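(* Let $((A,B,C),(Z^A,Z^B,Z^C))\in L_{\mathcal F}^\infty(\Omega;C([0,T^-];\mathbb R^3))\times L_{\mathcal F}^2(0,T^-;\mathbb R^{3\times m})$ be a solution to the BSDE system \[ \left\{ \begin{aligned} -dA_t&=\left\{\lambda_t-\eta^{-1} (A_t-\gamma B_t)^2\right\}dt-Z_t^A\,dW_t\\ -dB_t&=\left\{-\rho_t B_t+\eta^{-1}(\gamma C_t-B_t+1)(A_t-\gamma B_t)\right\}dt-Z_t^B\,dW_t\\ -dC_t&= \left\{-2\rho_t C_t-\eta^{-1}(\gamma C_t-B_t+1)^2\right\}dt-Z_t^C\,dW_t \end{aligned} \right. \] on $[0,T)$ that satisfies the singular terminal condition $(A_t,B_t,C_t)\to(\infty,1,0)$ in $L^\infty$ as $t\to T$. Then the value function $V_t(x,y)$ of the control problem defined in the context is of the linear-quadratic form \[ V_t(x,y)=\tfrac12A_tx^2+B_txy+\tfrac12C_ty^2,\qquad (t,x,y)\in[0,T)\times\mathbb R\times\mathbb R, \] and the optimal control is given by the feedback form \[ \xi^*_t(x,y)=\eta^{-1}(A_t-\gamma B_t)x-\eta^{-1}(\gamma C_t-B_t+1)y, \] i.e. for the initial state $(t,x,y)$ the control $\xi^*_s=\xi^*_s(X^*_s,Y^*_s)$, $s\in[t,T)$, with $(X^*,Y^* )$ the corresponding state process, is optimal. In particular, the BSDE system admits at most one solution in $L_{\mathcal F}^\infty(\Omega;C([0,T^-];\mathbb R^3))\times L_{\mathcal F}^2(0,T^-;\mathbb R^{3\times m})$ that satisfies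 the singular terminal condition.
   Context: Let $T\in(0,\infty)$ and let $(\Omega,\mathcal F,(\mathcal F_t)_{t\in[0,T]},\mathbb P)$ be a filtered probability space carrying an $m$-dimensional standard Brownian motion $W$; $(\mathcal F_t)$ is the filtration generated by $W$ completed by all null sets, and $\mathcal F=\mathcal F_T$. All equations and inequalities are understood $\mathbb P$-a.s. Spaces: $L^\infty_{\mathcal F}(0,T;E)$ is the set of progressively measurable, essentially bounded $E$-valued processes; $L^\infty_{\mathcal F}(\Omega;C([0,T];\mathbb R^d))$ is the set of progressively measurable, continuous, essentially bounded $\mathbb R^d$-valued processes; $L^2_{\mathcal F}(0,T;\mathbb R^d)$ is the set of progressively measurable $\mathbb R^d$-valued processes $Y$ with $\mathbb E[\int_0^T|Y_t|^2dt]<\infty$ (similarly on $[t,T]$). Writing $T^-$ instead of $T$ means that the statement holds for all $T'<T$ in place of $T^-$, e.g. $L^2_{\mathcal F}(0,T^-;\cdot)=\bigcap_{T'<T}L^2_{\mathcal F}(0,T';\cdot)$. Standing assumption: $\eta>0$ and $\gamma\in\mathbb R_+=[0,\infty)$ are constants, and $\rho,\lambda\in L^\infty_{\mathcal F}(0,T;\mathbb R_+)$. A solution of the system on $[0,T)$ means that the integrated equations hold between any two times $0\le t\le s<T$. The terminal condition means: for every $K>0$ there is a deterministic $T'<T$ such that $A_t\ge K$ for all $t\in[T',T)$ $\mathbb P$-a.s., and $\|B_t-1\|_{L^\infty}\to0$, $\|C_t\|_{L^\infty}\to0$ as $t\to T$. Control problem: for an initial state $(t,x,y)\in[0,T)\times\mathbb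 R\times\mathbb R$ and a control $\xi\in L^2_{\mathcal F}(t,T;\mathbb R)$, the state process $(X,Y)$ is given by \[ dX_s=-\xi_s\,ds,\quad X_t=x;\qquad dY_s=\{-\rho_sY_s+\gamma\xi_s\}\,ds,\quad Y_t=y,\qquad s\in[t,T]. \] The class $\mathcal A(t,x)$ of admissible controls consists of those $\xi\in L^2_{\mathcal F}(t,T;\mathbb R)$ with $X_T=0$ a.s. The value function is \[ V_t(x,y):=\operatorname*{ess\,inf}_{\xi\in\mathcal A(t,x)}\mathbb E\left[\left.\int_t^T\{\tfrac12\eta\xi_s^2+\xi_sY_s+\tfrac12\lambda_sX_s^2\}\,ds\,\right|\mathcal F_t\right]. \] An optimal control is an element of $\mathcal A(t,x)$ attaining this essential infimum. *)

theory Defs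
  imports "HOL-Probability.Probability"
begin

section \<open>Brownian motion and its augmented filtration\<close>

definition natural_filtration ::
    "'a measure \<Rightarrow> (real \<Rightarrow> 'a \<Rightarrow> 'b::topological_space) \<Rightarrow> real \<Rightarrow> 'a measure" where
  "natural_filtration M W t =
     sigma (space M) {W r -` S \<inter> space M | r S. r \<in> {0..t} \<and> S \<in> sets borel}"

text \<open>On a complete space the null sets of \<open>M\<close> comprise all subsets of negligible events, so this
  is the usual completion of the filtration generated by \<open>W\<close>.\<close>

definition augmented_filtration ::
    "'a measure \<Rightarrow> (real \<Rightarrow> 'a \<Rightarrow> 'b::topological_space) \<Rightarrow> real \<Rightarrow> 'a measure" where
  "augmented_filtration M W t =
     sigma (space M)
       ({W r -` S \<inter> space M | r S. r \<in> {0..t} \<and> S \<in> sets borel} \<union> null_sets M)"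

definition standard_brownian_motion ::
    "'a measure \<Rightarrow> real \<Rightarrow> (real \<Rightarrow> 'a \<Rightarrow> real ^ 'm) \<Rightarrow> bool" where
  "standard_brownian_motion M T W \<longleftrightarrow>
     (\<forall>t\<in>{0..T}. W t \<in> borel_measurable M) \<and>
     (AE \<omega> in M. W 0 \<omega> = 0) \<and>
     (AE \<omega> in M. continuous_on {0..T} (\<lambda>t. W t \<omega>)) \<and>
     (\<forall>s t. 0 \<le> s \<and> s < t \<and> t \<le> T \<longrightarrow>
        prob_space.indep_set M (sets (natural_filtration M W s))
          (sets (vimage_algebra (space M) (\<lambda>\<omega>. W t \<omega> - W s \<omega>) borel)) \<and>
        prob_space.indep_vars M (\<lambda>_. borel) (\<lambda>i \<omega>. (W t \<omega> - W s \<omega>) $ i) UNIV \<and>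
        (\<forall>i. distributed M lborel (\<lambda>\<omega>. (W t \<omega> - W s \<omega>) $ i) (normal_density 0 (sqrt (t - s)))))"

section \<open>Spaces of processes\<close>

definition progressive ::
    "(real \<Rightarrow> 'a measure) \<Rightarrow> real \<Rightarrow> real \<Rightarrow> (real \<Rightarrow> 'a \<Rightarrow> 'b::topological_space) \<Rightarrow> bool" where
  "progressive F a b X \<longleftrightarrow>
     (\<forall>u\<in>{a..b}. (\<lambda>(s, \<omega>). X s \<omega>) \<in> borel_measurable (restrict_space borel {a..u} \<Otimes>\<^sub>M F u))"

definition Linf_prog ::
    "'a measure \<Rightarrow> (real \<Rightarrow> 'a measure) \<Rightarrow> real \<Rightarrow> real \<Rightarrow> 'b set
      \<Rightarrow> (real \<Rightarrow> 'a \<Rightarrow> 'b::euclidean_space) \<Rightarrow> bool" where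
  "Linf_prog M F a b E X \<longleftrightarrow>
     progressive F a b X \<and>
     (\<exists>K. AE (s, \<omega>) in lborel \<Otimes>\<^sub>M M. s \<in> {a..b} \<longrightarrow> X s \<omega> \<in> E \<and> norm (X s \<omega>) \<le> K)"

definition Linf_cont ::
    "'a measure \<Rightarrow> (real \<Rightarrow> 'a measure) \<Rightarrow> real \<Rightarrow> real
      \<Rightarrow> (real \<Rightarrow> 'a \<Rightarrow> 'b::euclidean_space) \<Rightarrow> bool" where
  "Linf_cont M F a b X \<longleftrightarrow>
     progressive F a b X \<and>
     (AE \<omega> in M. continuous_on {a..b} (\<lambda>s. X s \<omega>)) \<and>
     (\<exists>K. AE \<omega> in M. \<forall>s\<in>{a..b}. norm (X s \<omega>) \<le> K)"

definition L2_prog ::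
    "'a measure \<Rightarrow> (real \<Rightarrow> 'a measure) \<Rightarrow> real \<Rightarrow> real
      \<Rightarrow> (real \<Rightarrow> 'a \<Rightarrow> 'b::euclidean_space) \<Rightarrow> bool" where
  "L2_prog M F a b X \<longleftrightarrow>
     progressive F a b X \<and>
     (\<integral>\<^sup>+ \<omega>. (\<integral>\<^sup>+ s\<in>{a..b}. ennreal ((norm (X s \<omega>))\<^sup>2) \<partial>lborel) \<partial>M) < \<infinity>"

section \<open>Ito integral\<close>

text \<open>A simple integrand is given by a partition \<open>\<tau> 0 \<le> \<dots> \<le> \<tau> n\<close> of \<open>[a, b]\<close> and bounded
  \<open>F (\<tau> i)\<close>-measurable vectors \<open>\<phi> i\<close>.  The Ito integral of a square-integrable progressive process
  is the \<open>L\<^sup>2\<close>-limit of the integrals of simple integrands converging to it in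
  \<open>L\<^sup>2(dt \<otimes> dP)\<close>; it is rendered as a relation since it is only determined almost surely.\<close>

definition simple_integrand ::
    "'a measure \<Rightarrow> (real \<Rightarrow> 'a measure) \<Rightarrow> real \<Rightarrow> real
      \<Rightarrow> nat \<Rightarrow> (nat \<Rightarrow> real) \<Rightarrow> (nat \<Rightarrow> 'a \<Rightarrow> real ^ 'm) \<Rightarrow> bool" where
  "simple_integrand M F a b n \<tau> \<phi> \<longleftrightarrow>
     \<tau> 0 = a \<and> \<tau> n = b \<and>
     (\<forall>i<n. \<tau> i \<le> \<tau> (Suc i) \<and> \<phi> i \<in> borel_measurable (F (\<tau> i)) \<and>
        (\<exists>K. \<forall>\<omega>\<in>space M. norm (\<phi> i \<omega>) \<le> K))"

definition simple_process ::
    "nat \<Rightarrow> (nat \<Rightarrow> real) \<Rightarrow> (nat \<Rightarrow> 'a \<Rightarrow> real ^ 'm) \<Rightarrow> real \<Rightarrow> 'a \<Rightarrow> real ^ 'm" where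
  "simple_process n \<tau> \<phi> s \<omega> = (\<Sum>i<n. indicat_real {\<tau> i<..\<tau> (Suc i)} s *\<^sub>R \<phi> i \<omega>)"

definition simple_integral ::
    "(real \<Rightarrow> 'a \<Rightarrow> real ^ 'm) \<Rightarrow> nat \<Rightarrow> (nat \<Rightarrow> real) \<Rightarrow> (nat \<Rightarrow> 'a \<Rightarrow> real ^ 'm) \<Rightarrow> 'a \<Rightarrow> real" where
  "simple_integral W n \<tau> \<phi> \<omega> = (\<Sum>i<n. \<phi> i \<omega> \<bullet> (W (\<tau> (Suc i)) \<omega> - W (\<tau> i) \<omega>))"

definition has_ito_integral ::
    "'a measure \<Rightarrow> (real \<Rightarrow> 'a measure) \<Rightarrow> (real \<Rightarrow> 'a \<Rightarrow> real ^ 'm) \<Rightarrow> real \<Rightarrow> real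
      \<Rightarrow> (real \<Rightarrow> 'a \<Rightarrow> real ^ 'm) \<Rightarrow> ('a \<Rightarrow> real) \<Rightarrow> bool" where
  "has_ito_integral M F W a b Z I \<longleftrightarrow>
     L2_prog M F a b Z \<and> I \<in> borel_measurable M \<and>
     (\<exists>N \<tau> \<phi>.
        (\<forall>k. simple_integrand M F a b (N k) (\<tau> k) (\<phi> k)) \<and>
        ((\<lambda>k. \<integral>\<^sup>+ \<omega>. (\<integral>\<^sup>+ s\<in>{a..b}.
            ennreal ((norm (simple_process (N k) (\<tau> k) (\<phi> k) s \<omega> - Z s \<omega>))\<^sup>2) \<partial>lborel) \<partial>M)
           \<longlonglongrightarrow> 0) \<and>
        ((\<lambda>k. \<integral>\<^sup>+ \<omega>. ennreal ((simple_integral W (N k) (\<tau> k) (\<phi> k) \<omega> - I \<omega>)\<^sup>2) \<partial>M) \<longlonglongrightarrow> 0))"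

section \<open>The BSDE system\<close>

text \<open>\<open>-dP = f dt - Z dW\<close> between the times \<open>t \<le> s\<close>, i.e.
  \<open>\<integral>\<^sub>t\<^sup>s Z dW = P\<^sub>s - P\<^sub>t + \<integral>\<^sub>t\<^sup>s f dr\<close> a.s.\<close>

definition bsde_between ::
    "'a measure \<Rightarrow> (real \<Rightarrow> 'a measure) \<Rightarrow> (real \<Rightarrow> 'a \<Rightarrow> real ^ 'm) \<Rightarrow> real \<Rightarrow> real
      \<Rightarrow> (real \<Rightarrow> 'a \<Rightarrow> real) \<Rightarrow> (real \<Rightarrow> 'a \<Rightarrow> real) \<Rightarrow> (real \<Rightarrow> 'a \<Rightarrow> real ^ 'm) \<Rightarrow> bool" where
  "bsde_between M F W t s P f Z \<longleftrightarrow>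
     (AE \<omega> in M. set_integrable lborel {t..s} (\<lambda>r. f r \<omega>)) \<and>
     has_ito_integral M F W t s Z (\<lambda>\<omega>. P s \<omega> - P t \<omega> + (LINT r:{t..s}|lborel. f r \<omega>))"

definition bsde_solution ::
    "'a measure \<Rightarrow> (real \<Rightarrow> 'a measure) \<Rightarrow> (real \<Rightarrow> 'a \<Rightarrow> real ^ 'm) \<Rightarrow> real \<Rightarrow> real \<Rightarrow> real
      \<Rightarrow> (real \<Rightarrow> 'a \<Rightarrow> real) \<Rightarrow> (real \<Rightarrow> 'a \<Rightarrow> real)
      \<Rightarrow> (real \<Rightarrow> 'a \<Rightarrow> real) \<Rightarrow> (real \<Rightarrow> 'a \<Rightarrow> real) \<Rightarrow> (real \<Rightarrow> 'a \<Rightarrow> real)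
      \<Rightarrow> (real \<Rightarrow> 'a \<Rightarrow> real ^ 'm) \<Rightarrow> (real \<Rightarrow> 'a \<Rightarrow> real ^ 'm) \<Rightarrow> (real \<Rightarrow> 'a \<Rightarrow> real ^ 'm) \<Rightarrow> bool" where
  "bsde_solution M F W T \<eta> \<gamma> \<rho> lam A B C ZA ZB ZC \<longleftrightarrow>
     (\<forall>T'\<in>{0..<T}.
        Linf_cont M F 0 T' (\<lambda>s \<omega>. (A s \<omega>, B s \<omega>, C s \<omega>)) \<and>
        L2_prog M F 0 T' (\<lambda>s \<omega>. (ZA s \<omega>, ZB s \<omega>, ZC s \<omega>))) \<and>
     (\<forall>t s. 0 \<le> t \<and> t \<le> s \<and> s < T \<longrightarrow>
        bsde_between M F W t s A
          (\<lambda>r \<omega>. lam r \<omega> - inverse \<eta> * (A r \<omega> - \<gamma> * B r \<omega>)\<^sup>2) ZA \<and>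
        bsde_between M F W t s B
          (\<lambda>r \<omega>. - \<rho> r \<omega> * B r \<omega>
             + inverse \<eta> * (\<gamma> * C r \<omega> - B r \<omega> + 1) * (A r \<omega> - \<gamma> * B r \<omega>)) ZB \<and>
        bsde_between M F W t s C
          (\<lambda>r \<omega>. - 2 * \<rho> r \<omega> * C r \<omega> - inverse \<eta> * (\<gamma> * C r \<omega> - B r \<omega> + 1)\<^sup>2) ZC)"

definition singular_terminal_condition ::
    "'a measure \<Rightarrow> real \<Rightarrow> (real \<Rightarrow> 'a \<Rightarrow> real) \<Rightarrow> (real \<Rightarrow> 'a \<Rightarrow> real) \<Rightarrow> (real \<Rightarrow> 'a \<Rightarrow> real) \<Rightarrow> bool"
  where
  "singular_terminal_condition M T A B C \<longleftrightarrow>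
     (\<forall>K>0. \<exists>T'\<in>{0..<T}. AE \<omega> in M. \<forall>t\<in>{T'..<T}. K \<le> A t \<omega>) \<and>
     ((\<lambda>t. esssup M (\<lambda>\<omega>. ereal \<bar>B t \<omega> - 1\<bar>)) \<longlongrightarrow> 0) (at_left T) \<and>
     ((\<lambda>t. esssup M (\<lambda>\<omega>. ereal \<bar>C t \<omega>\<bar>)) \<longlongrightarrow> 0) (at_left T)"

section \<open>The control problem\<close>

definition position_process ::
    "'a measure \<Rightarrow> (real \<Rightarrow> 'a measure) \<Rightarrow> real \<Rightarrow> real \<Rightarrow> real
      \<Rightarrow> (real \<Rightarrow> 'a \<Rightarrow> real) \<Rightarrow> (real \<Rightarrow> 'a \<Rightarrow> real) \<Rightarrow> bool" where
  "position_process M F t b x \<xi> X \<longleftrightarrow>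
     progressive F t b X \<and>
     (AE \<omega> in M. \<forall>s\<in>{t..b}.
        set_integrable lborel {t..s} (\<lambda>r. \<xi> r \<omega>) \<and>
        X s \<omega> = x - (LINT r:{t..s}|lborel. \<xi> r \<omega>))"

text \<open>The state equations with initial state \<open>(t, x, y)\<close>, on the time interval \<open>[t, b]\<close>.\<close>

definition state_process ::
    "'a measure \<Rightarrow> (real \<Rightarrow> 'a measure) \<Rightarrow> real \<Rightarrow> (real \<Rightarrow> 'a \<Rightarrow> real) \<Rightarrow> real \<Rightarrow> real \<Rightarrow> real \<Rightarrow> real
      \<Rightarrow> (real \<Rightarrow> 'a \<Rightarrow> real) \<Rightarrow> (real \<Rightarrow> 'a \<Rightarrow> real) \<Rightarrow> (real \<Rightarrow> 'a \<Rightarrow> real) \<Rightarrow> bool" where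
  "state_process M F \<gamma> \<rho> t b x y \<xi> X Y \<longleftrightarrow>
     position_process M F t b x \<xi> X \<and>
     progressive F t b Y \<and>
     (AE \<omega> in M. \<forall>s\<in>{t..b}.
        set_integrable lborel {t..s} (\<lambda>r. - \<rho> r \<omega> * Y r \<omega> + \<gamma> * \<xi> r \<omega>) \<and>
        Y s \<omega> = y + (LINT r:{t..s}|lborel. - \<rho> r \<omega> * Y r \<omega> + \<gamma> * \<xi> r \<omega>))"

definition admissible ::
    "'a measure \<Rightarrow> (real \<Rightarrow> 'a measure) \<Rightarrow> real \<Rightarrow> real \<Rightarrow> real \<Rightarrow> (real \<Rightarrow> 'a \<Rightarrow> real) \<Rightarrow> bool" where
  "admissible M F T t x \<xi> \<longleftrightarrow>
     L2_prog M F t T \<xi> \<and>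
     (\<exists>X. position_process M F t T x \<xi> X \<and> (AE \<omega> in M. X T \<omega> = 0))"

definition conditional_cost ::
    "'a measure \<Rightarrow> (real \<Rightarrow> 'a measure) \<Rightarrow> real \<Rightarrow> real \<Rightarrow> (real \<Rightarrow> 'a \<Rightarrow> real) \<Rightarrow> real
      \<Rightarrow> (real \<Rightarrow> 'a \<Rightarrow> real) \<Rightarrow> (real \<Rightarrow> 'a \<Rightarrow> real) \<Rightarrow> (real \<Rightarrow> 'a \<Rightarrow> real) \<Rightarrow> 'a \<Rightarrow> real" where
  "conditional_cost M F T \<eta> lam t \<xi> X Y =
     real_cond_exp M (F t) (\<lambda>\<omega>. LINT s:{t..T}|lborel.
       1/2 * \<eta> * (\<xi> s \<omega>)\<^sup>2 + \<xi> s \<omega> * Y s \<omega> + 1/2 * lam s \<omega> * (X s \<omega>)\<^sup>2)"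

definition is_ess_inf :: "'a measure \<Rightarrow> ('a \<Rightarrow> ereal) set \<Rightarrow> ('a \<Rightarrow> ereal) \<Rightarrow> bool" where
  "is_ess_inf M S v \<longleftrightarrow>
     v \<in> borel_measurable M \<and>
     (\<forall>f\<in>S. AE \<omega> in M. v \<omega> \<le> f \<omega>) \<and>
     (\<forall>w\<in>borel_measurable M. (\<forall>f\<in>S. AE \<omega> in M. w \<omega> \<le> f \<omega>) \<longrightarrow> (AE \<omega> in M. w \<omega> \<le> v \<omega>))"

text \<open>An essential infimum is only determined up to null sets; this picks a version.\<close>

definition ess_inf :: "'a measure \<Rightarrow> ('a \<Rightarrow> ereal) set \<Rightarrow> 'a \<Rightarrow> ereal" where
  "ess_inf M S = (SOME v. is_ess_inf M S v)"

lemma ess_inf_AE_eq: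
  assumes "is_ess_inf M S v"
  shows "AE \<omega> in M. ess_inf M S \<omega> = v \<omega>"
proof -
  have u: "is_ess_inf M S (ess_inf M S)"
    unfolding ess_inf_def using assms by (rule someI[of "is_ess_inf M S"])
  have "AE \<omega> in M. ess_inf M S \<omega> \<le> v \<omega>" "AE \<omega> in M. v \<omega> \<le> ess_inf M S \<omega>"
    using u assms unfolding is_ess_inf_def by blast+
  then show ?thesis by eventually_elim (rule antisym)
qed

definition value_function ::
    "'a measure \<Rightarrow> (real \<Rightarrow> 'a measure) \<Rightarrow> real \<Rightarrow> real \<Rightarrow> real \<Rightarrow> (real \<Rightarrow> 'a \<Rightarrow> real)
      \<Rightarrow> (real \<Rightarrow> 'a \<Rightarrow> real) \<Rightarrow> real \<Rightarrow> real \<Rightarrow> real \<Rightarrow> 'a \<Rightarrow> ereal" where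
  "value_function M F T \<eta> \<gamma> \<rho> lam t x y =
     ess_inf M {(\<lambda>\<omega>. ereal (conditional_cost M F T \<eta> lam t \<xi> X Y \<omega>)) | \<xi> X Y.
       admissible M F T t x \<xi> \<and> state_process M F \<gamma> \<rho> t T x y \<xi> X Y}"

definition optimal_control ::
    "'a measure \<Rightarrow> (real \<Rightarrow> 'a measure) \<Rightarrow> real \<Rightarrow> real \<Rightarrow> real \<Rightarrow> (real \<Rightarrow> 'a \<Rightarrow> real)
      \<Rightarrow> (real \<Rightarrow> 'a \<Rightarrow> real) \<Rightarrow> real \<Rightarrow> real \<Rightarrow> real \<Rightarrow> (real \<Rightarrow> 'a \<Rightarrow> real) \<Rightarrow> bool" where
  "optimal_control M F T \<eta> \<gamma> \<rho> lam t x y \<xi> \<longleftrightarrow>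
     admissible M F T t x \<xi> \<and>
     (\<exists>X Y. state_process M F \<gamma> \<rho> t T x y \<xi> X Y \<and>
        (AE \<omega> in M. ereal (conditional_cost M F T \<eta> lam t \<xi> X Y \<omega>)
           = value_function M F T \<eta> \<gamma> \<rho> lam t x y \<omega>))"

definition feedback ::
    "real \<Rightarrow> real \<Rightarrow> (real \<Rightarrow> 'a \<Rightarrow> real) \<Rightarrow> (real \<Rightarrow> 'a \<Rightarrow> real) \<Rightarrow> (real \<Rightarrow> 'a \<Rightarrow> real)
      \<Rightarrow> real \<Rightarrow> 'a \<Rightarrow> real \<Rightarrow> real \<Rightarrow> real" where
  "feedback \<eta> \<gamma> A B C s \<omega> x y =
     inverse \<eta> * (A s \<omega> - \<gamma> * B s \<omega>) * x - inverse \<eta> * (\<gamma> * C s \<omega> - B s \<omega> + 1) * y"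

text \<open>\<open>\<xi>\<close> is the feedback control started at \<open>(t, x, y)\<close>, with state process \<open>(X, Y)\<close> on \<open>[t, T)\<close>.
  Neither square integrability of \<open>\<xi>\<close> up to \<open>T\<close> nor \<open>X\<^sub>T = 0\<close> is part of the definition.  The value
  of \<open>\<xi>\<close> at the single time \<open>T\<close> is irrelevant and only subject to measurability.\<close>

definition closed_loop ::
    "'a measure \<Rightarrow> (real \<Rightarrow> 'a measure) \<Rightarrow> real \<Rightarrow> real \<Rightarrow> real \<Rightarrow> (real \<Rightarrow> 'a \<Rightarrow> real)
      \<Rightarrow> (real \<Rightarrow> 'a \<Rightarrow> real) \<Rightarrow> (real \<Rightarrow> 'a \<Rightarrow> real) \<Rightarrow> (real \<Rightarrow> 'a \<Rightarrow> real)
      \<Rightarrow> real \<Rightarrow> real \<Rightarrow> real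
      \<Rightarrow> (real \<Rightarrow> 'a \<Rightarrow> real) \<Rightarrow> (real \<Rightarrow> 'a \<Rightarrow> real) \<Rightarrow> (real \<Rightarrow> 'a \<Rightarrow> real) \<Rightarrow> bool" where
  "closed_loop M F T \<eta> \<gamma> \<rho> A B C t x y \<xi> X Y \<longleftrightarrow>
     progressive F t T \<xi> \<and>
     (\<forall>T'\<in>{t..<T}. state_process M F \<gamma> \<rho> t T' x y \<xi> X Y) \<and>
     (AE \<omega> in M. \<forall>s\<in>{t..<T}. \<xi> s \<omega> = feedback \<eta> \<gamma> A B C s \<omega> (X s \<omega>) (Y s \<omega>))"

end

theory Submission
  imports Defs
begin

text \<open>Write \<open>V\<^sub>s = 1/2 A\<^sub>s X\<^sub>s\<^sup>2 + B\<^sub>s X\<^sub>s Y\<^sub>s + 1/2 C\<^sub>s Y\<^sub>s\<^sup>2\<close> for the quadratic form along a state process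
  \<open>(X, Y)\<close> with control \<open>\<xi>\<close>, and \<open>\<xi>\<^sup>*\<close> for the feedback rule. The Riccati drifts of \<open>A, B, C\<close> are made
  such that the drift of \<open>V\<close> plus the running cost is a perfect square (\<open>completing_the_square\<close>).
  Hence for \<open>t \<le> b < T\<close> and every event \<open>H\<close> in \<open>F t\<close> (\<open>energy_identity\<close>)

  \<open>E[1\<^sub>H V\<^sub>b] + E[1\<^sub>H \<integral>\<^sub>t\<^sup>b cost ds] = E[1\<^sub>H V\<^sub>t] + E[1\<^sub>H \<integral>\<^sub>t\<^sup>b 1/2 \<eta> (\<xi> - \<xi>\<^sup>*)\<^sup>2 ds]\<close>.

  The underlying product rule is elementary. Each of \<open>A, B, C\<close> is a bounded process with a
  conditional drift, since Ito integrals have vanishing conditional expectation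
  (\<open>ito_integral_cond_exp_zero\<close>), and it is multiplied by a process with absolutely continuous paths,
  namely \<open>X\<^sup>2\<close>, \<open>X Y\<close> or \<open>Y\<^sup>2\<close>; for such a product Fubini's theorem gives the product rule in
  expectation (\<open>drift_product_rule\<close>).

  The singularity at \<open>T\<close> is dealt with as follows. Testing the equation for \<open>A\<close> against
  \<open>((b - r) / (b - s))\<^sup>2\<close> and completing a square, with \<open>b\<close> tending to \<open>T\<close>, gives \<open>A\<^sub>s \<le> K / (T - s)\<close>
  (\<open>coefficient_bounds\<close>). An admissible control has \<open>X\<^sub>s = \<integral>\<^sub>s\<^sup>T \<xi> dr\<close>, so that \<open>A\<^sub>s X\<^sub>s\<^sup>2 \<le> K \<integral>\<^sub>s\<^sup>T \<xi>\<^sup>2 dr\<close> by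
  Cauchy-Schwarz, and \<open>V\<^sub>b\<close> tends to \<open>0\<close> as \<open>b\<close> tends to \<open>T\<close>. In the limit the energy identity says that
  the conditional cost of \<open>\<xi>\<close> is at least \<open>V\<^sub>t\<close>, with equality if \<open>\<xi> = \<xi>\<^sup>*\<close> (\<open>verification\<close>).

  For the feedback control, square integrability up to \<open>T\<close> and \<open>X\<^sub>T = 0\<close> are consequences of the energy
  identity without its square. On a short final interval the cost and \<open>V\<^sub>b\<close> together dominate a
  multiple of \<open>\<integral> \<xi>\<^sup>2\<close>, which bounds its expectation (\<open>closed_loop_square_integrable\<close>); then the
  expectations of \<open>V\<^sub>b\<close> stay bounded while \<open>A\<close> tends to infinity, which forces \<open>X\<^sub>T = 0\<close>
  (\<open>closed_loop_liquidates\<close>). The closed loop itself is a linear equation with coefficients that are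
  bounded away from \<open>T\<close>, and is solved by Picard iteration for each \<open>\<omega>\<close> (\<open>closed_loop_exists\<close>).

  Finally, two solutions of the system have the same value function, and a quadratic form is
  determined by its values at \<open>(1, 0)\<close>, \<open>(0, 1)\<close> and \<open>(1, 1)\<close>; the Ito isometry then identifies the
  integrands \<open>Z\<close>.\<close>

section \<open>Integrals of functions of time\<close>

lemma set_lebesgue_integral_exp:
  fixes K t s :: real
  assumes "K > 0" "t \<le> s"
  shows "set_integrable lborel {t..s} (\<lambda>r. exp (K * (r - t)))"
    and "(LINT r:{t..s}|lborel. exp (K * (r - t))) = (exp (K * (s - t)) - 1) / K"
proof -
  have c: "continuous_on {t..s} (\<lambda>r. exp (K * (r - t)))" by (intro continuous_intros)
  show i: "set_integrable lborel {t..s} (\<lambda>r. exp (K * (r - t)))"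
    by (rule borel_integrable_atLeastAtMost'[OF c])
  have "((\<lambda>r. exp (K * (r - t))) has_integral exp (K * (s - t)) / K - exp (K * (t - t)) / K) {t..s}"
    using assms
    by (intro fundamental_theorem_of_calculus)
      (auto intro!: derivative_eq_intros simp: has_real_derivative_iff_has_vector_derivative[symmetric])
  then show "(LINT r:{t..s}|lborel. exp (K * (r - t))) = (exp (K * (s - t)) - 1) / K"
    using set_borel_integral_eq_integral(2)[OF i] by (simp add: integral_unique diff_divide_distrib)
qed

lemma integrable_indicator_Icc:
  fixes a b :: real
  shows "integrable lborel (indicat_real {a..b})"
  using borel_integrable_atLeastAtMost'[of a b "\<lambda>_. 1 :: real"] by (simp add: set_integrable_def)

lemma LINT_at_point:
  fixes f :: "real \<Rightarrow> 'b::euclidean_space"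
  shows "(LINT r:{a}|lborel. f r) = 0"
  unfolding set_lebesgue_integral_def
proof (rule integral_eq_zero_AE)
  show "AE r in lborel. indicat_real {a} r *\<^sub>R f r = 0"
    using AE_lborel_singleton[of a] by eventually_elim (auto simp: indicator_def)
qed

lemma LINT_split:
  fixes f :: "real \<Rightarrow> real"
  assumes f: "set_integrable lborel {a..b} f" and r: "r \<in> {a..b}"
  shows "(LINT u:{a..b}|lborel. f u) = (LINT u:{a..r}|lborel. f u) + (LINT u:{r..b}|lborel. f u)"
proof -
  have "(LINT u:{a..r} \<union> {r..b}|lborel. f u) = (LINT u:{a..r}|lborel. f u) + (LINT u:{r..b}|lborel. f u)"
  proof (rule set_integral_Un_AE)
    show "AE x in lborel. \<not> (x \<in> {a..r} \<and> x \<in> {r..b})" using AE_lborel_singleton[of r] by eventually_elim auto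
    show "set_integrable lborel {a..r} f" "set_integrable lborel {r..b} f"
      by (rule set_integrable_subset[OF f]; use r in auto)+
  qed auto
  moreover have "{a..r} \<union> {r..b} = {a..b}" using r by auto
  ultimately show ?thesis by simp
qed

lemma LINT_mono_interval:
  fixes f :: "real \<Rightarrow> real"
  assumes f: "set_integrable lborel {a..b} f" and c: "c \<in> {a..b}" and nn: "\<And>r. 0 \<le> f r"
  shows "(LINT r:{a..c}|lborel. f r) \<le> (LINT r:{a..b}|lborel. f r)"
proof -
  have "0 \<le> (LINT r:{p..q}|lborel. f r)" for p q
    unfolding set_lebesgue_integral_def using nn by (intro Bochner_Integration.integral_nonneg) simp
  then show "(LINT r:{a..c}|lborel. f r) \<le> (LINT r:{a..b}|lborel. f r)"
    using LINT_split[OF f c] by simp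
qed

lemma LINT_bounded_linear:
  fixes f :: "real \<Rightarrow> 'b::euclidean_space" and h :: "'b \<Rightarrow> 'c::euclidean_space"
  assumes h: "bounded_linear h" and f: "set_integrable lborel S f"
  shows "set_integrable lborel S (\<lambda>r. h (f r))" "(LINT r:S|lborel. h (f r)) = h (LINT r:S|lborel. f r)"
  using integrable_bounded_linear[OF h f[unfolded set_integrable_def]] integral_bounded_linear[OF h f[unfolded set_integrable_def]]
  unfolding set_integrable_def set_lebesgue_integral_def
  by (simp_all add: linear_simps(5)[OF h])

lemma continuous_on_indefinite_LINT:
  fixes f :: "real \<Rightarrow> 'b::euclidean_space"
  assumes "set_integrable lborel {t..b} f"
  shows "continuous_on {t..b} (\<lambda>s. LINT r:{t..s}|lborel. f r)"
proof -
  have "continuous_on {t..b} (\<lambda>s. integral {t..s} f)"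
    by (rule indefinite_integral_continuous_1[OF set_borel_integral_eq_integral(1)[OF assms]])
  moreover have "(LINT r:{t..s}|lborel. f r) = integral {t..s} f" if "s \<in> {t..b}" for s
    by (rule set_borel_integral_eq_integral(2), rule set_integrable_subset[OF assms]) (use that in auto)
  ultimately show ?thesis by (metis (mono_tags, lifting) continuous_on_cong)
qed

lemma set_integrable_mult_bounded:
  fixes u Y :: "real \<Rightarrow> real"
  assumes u: "set_integrable lborel S u" and Y: "set_borel_measurable borel S Y"
    and bnd: "AE r in lborel. r \<in> S \<longrightarrow> \<bar>Y r\<bar> \<le> K"
  shows "set_integrable lborel S (\<lambda>r. u r * Y r)"
proof -
  have "set_integrable lborel S (\<lambda>r. K * u r)" using u by simp
  then show ?thesis
  proof (rule set_integrable_bound)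
    have "(\<lambda>r. (indicator S r *\<^sub>R u r) * (indicator S r *\<^sub>R Y r)) \<in> borel_measurable lborel"
      using u Y unfolding set_integrable_def set_borel_measurable_def by measurable
    also have "(\<lambda>r. (indicator S r *\<^sub>R u r) * (indicator S r *\<^sub>R Y r)) = (\<lambda>r. indicator S r *\<^sub>R (u r * Y r))"
      by (auto split: split_indicator)
    finally show "set_borel_measurable lborel S (\<lambda>r. u r * Y r)" by (simp add: set_borel_measurable_def)
    show "AE r in lborel. r \<in> S \<longrightarrow> norm (u r * Y r) \<le> norm (K * u r)"
      using bnd
    proof eventually_elim
      case (elim r)
      then show ?case using mult_mono[of "\<bar>Y r\<bar>" "\<bar>K\<bar>" "\<bar>u r\<bar>" "\<bar>u r\<bar>"] by (auto simp: abs_mult mult.commute)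
    qed
  qed
qed

lemma set_integrable_mult_continuous:
  fixes u Y :: "real \<Rightarrow> real"
  assumes u: "set_integrable lborel {t..s} u" and Y: "continuous_on {t..s} Y"
  shows "set_integrable lborel {t..s} (\<lambda>r. u r * Y r)"
proof -
  have "bounded (Y ` {t..s})" by (rule compact_imp_bounded[OF compact_continuous_image[OF Y]]) simp
  then obtain K where "\<forall>r\<in>{t..s}. \<bar>Y r\<bar> \<le> K" by (auto simp: bounded_iff)
  then show ?thesis
    by (intro set_integrable_mult_bounded[OF u set_measurable_continuous_on[OF _ Y], of K]) auto
qed

text \<open>The diagonal cuts the square \<open>{t..s} \<times> {t..s}\<close> into two triangles that meet in a null set. By
  Fubini's theorem the two iterated integrals are the integrals of \<open>u a * v b\<close> over these triangles.\<close>

lemma integral_square_split_diagonal: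
  fixes u v :: "real \<Rightarrow> real"
  assumes u: "set_integrable lborel {t..s} u" and v: "set_integrable lborel {t..s} v"
  shows "(LINT a:{t..s}|lborel. u a * (LINT b:{t..a}|lborel. v b))
       + (LINT a:{t..s}|lborel. v a * (LINT b:{t..a}|lborel. u b))
       = (LINT a:{t..s}|lborel. u a) * (LINT a:{t..s}|lborel. v a)"
proof -
  define u' v' where "u' a = indicator {t..s} a * u a" and "v' a = indicator {t..s} a * v a" for a
  have iu: "integrable lborel u'" and iv: "integrable lborel v'"
    using u v unfolding u'_def v'_def set_integrable_def by simp_all
  note [measurable] = borel_measurable_integrable[OF iu] borel_measurable_integrable[OF iv]
  have iK: "integrable (lborel \<Otimes>\<^sub>M lborel) (\<lambda>(a, b). u' a * v' b)"
    by (rule lborel_pair.Fubini_integrable) (use iu iv in \<open>auto simp: abs_mult\<close>)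
  have "closed {x :: real \<times> real. snd x \<le> fst x}" "closed {x :: real \<times> real. fst x \<le> snd x}"
    by (intro closed_Collect_le continuous_intros)+
  then have m: "{(a, b). b \<le> a} \<in> sets (lborel \<Otimes>\<^sub>M (lborel :: real measure))"
    "{(a, b). a \<le> b} \<in> sets (lborel \<Otimes>\<^sub>M (lborel :: real measure))"
    unfolding lborel_prod split_beta' by (simp_all only: sets_lborel borel_closed)
  have iL: "integrable (lborel \<Otimes>\<^sub>M lborel) (\<lambda>(a, b). indicator {(a, b). b \<le> a} (a, b) * (u' a * v' b))"
    using integrable_mult_indicator[OF m(1) iK] by (simp add: split_beta')
  have iU: "integrable (lborel \<Otimes>\<^sub>M lborel) (\<lambda>(a, b). indicator {(a, b). a \<le> b} (a, b) * (u' a * v' b))"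
    using integrable_mult_indicator[OF m(2) iK] by (simp add: split_beta')
  have L: "(LINT a:{t..s}|lborel. u a * (LINT b:{t..a}|lborel. v b))
     = (\<integral>a. (\<integral>b. indicator {(a, b). b \<le> a} (a, b) * (u' a * v' b) \<partial>lborel) \<partial>lborel)"
    unfolding set_lebesgue_integral_def
  proof (intro Bochner_Integration.integral_cong refl)
    fix a :: real
    have "indicator {(a, b). b \<le> a} (a, b) * (u' a * v' b)
       = (indicator {t..s} a * u a) * (indicator {t..a} b *\<^sub>R v b)" for b
      by (auto simp: u'_def v'_def split: split_indicator)
    then show "indicat_real {t..s} a *\<^sub>R (u a * (LINT b|lborel. indicat_real {t..a} b *\<^sub>R v b)) =
         (LINT b|lborel. indicat_real {(a, b). b \<le> a} (a, b) * (u' a * v' b))"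
      by (simp add: mult.assoc)
  qed
  have U: "(LINT a:{t..s}|lborel. v a * (LINT b:{t..a}|lborel. u b))
     = (\<integral>b. (\<integral>a. indicator {(a, b). a \<le> b} (a, b) * (u' a * v' b) \<partial>lborel) \<partial>lborel)"
    unfolding set_lebesgue_integral_def
  proof (intro Bochner_Integration.integral_cong refl)
    fix b :: real
    have "indicator {(a, b). a \<le> b} (a, b) * (u' a * v' b)
       = (indicator {t..s} b * v b) * (indicator {t..b} a *\<^sub>R u a)" for a
      by (auto simp: u'_def v'_def split: split_indicator)
    then show "indicat_real {t..s} b *\<^sub>R (v b * (LINT a|lborel. indicat_real {t..b} a *\<^sub>R u a)) =
         (LINT a|lborel. indicat_real {(a, b). a \<le> b} (a, b) * (u' a * v' b))"
      by (simp add: mult.assoc)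
  qed
  have "(\<integral>b. (\<integral>a. indicator {(a, b). a \<le> b} (a, b) * (u' a * v' b) \<partial>lborel) \<partial>lborel)
     = (\<integral>a. (\<integral>b. indicator {(a, b). a \<le> b} (a, b) * (u' a * v' b) \<partial>lborel) \<partial>lborel)"
    by (rule lborel_pair.Fubini_integral[OF iU])
  moreover have "(\<integral>a. (\<integral>b. indicator {(a, b). b \<le> a} (a, b) * (u' a * v' b) \<partial>lborel) \<partial>lborel)
     + (\<integral>a. (\<integral>b. indicator {(a, b). a \<le> b} (a, b) * (u' a * v' b) \<partial>lborel) \<partial>lborel)
     = (\<integral>a. (\<integral>b. u' a * v' b \<partial>lborel) \<partial>lborel)"
  proof (subst Bochner_Integration.integral_add[symmetric])
    show "integrable lborel (\<lambda>a. (\<integral>b. indicator {(a, b). b \<le> a} (a, b) * (u' a * v' b) \<partial>lborel))"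
      by (rule lborel_pair.integrable_fst[OF iL])
    show "integrable lborel (\<lambda>a. (\<integral>b. indicator {(a, b). a \<le> b} (a, b) * (u' a * v' b) \<partial>lborel))"
      by (rule lborel_pair.integrable_fst[OF iU])
    show "(\<integral>a. (\<integral>b. indicator {(a, b). b \<le> a} (a, b) * (u' a * v' b) \<partial>lborel)
       + (\<integral>b. indicator {(a, b). a \<le> b} (a, b) * (u' a * v' b) \<partial>lborel) \<partial>lborel)
       = (\<integral>a. (\<integral>b. u' a * v' b \<partial>lborel) \<partial>lborel)"
    proof (rule Bochner_Integration.integral_cong[OF refl])
      fix a :: real
      have i: "integrable lborel (\<lambda>b. u' a * v' b)" using iv by simp
      have "integrable lborel (\<lambda>b. indicator {(a, b). b \<le> a} (a, b) * (u' a * v' b))"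
        "integrable lborel (\<lambda>b. indicator {(a, b). a \<le> b} (a, b) * (u' a * v' b))"
        using integrable_mult_indicator[OF _ i, of "{..a}"] integrable_mult_indicator[OF _ i, of "{a..}"]
        by (auto simp: indicator_def of_bool_def)
      then have "(\<integral>b. indicator {(a, b). b \<le> a} (a, b) * (u' a * v' b) \<partial>lborel)
          + (\<integral>b. indicator {(a, b). a \<le> b} (a, b) * (u' a * v' b) \<partial>lborel)
          = (\<integral>b. indicator {(a, b). b \<le> a} (a, b) * (u' a * v' b)
                + indicator {(a, b). a \<le> b} (a, b) * (u' a * v' b) \<partial>lborel)"
        by simp
      also have "\<dots> = (\<integral>b. u' a * v' b \<partial>lborel)"
      proof (rule integral_cong_AE)
        show "AE b in lborel. indicator {(a, b). b \<le> a} (a, b) * (u' a * v' b)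
                + indicator {(a, b). a \<le> b} (a, b) * (u' a * v' b) = u' a * v' b"
          using AE_lborel_singleton[of a] by eventually_elim (auto split: split_indicator)
      qed measurable
      finally show "(\<integral>b. indicator {(a, b). b \<le> a} (a, b) * (u' a * v' b) \<partial>lborel)
          + (\<integral>b. indicator {(a, b). a \<le> b} (a, b) * (u' a * v' b) \<partial>lborel) = (\<integral>b. u' a * v' b \<partial>lborel)" .
    qed
  qed
  ultimately show ?thesis unfolding L U
    by (simp add: u'_def v'_def set_lebesgue_integral_def)
qed

text \<open>Integration by parts for absolutely continuous functions. After expanding the product of the two
  indefinite integrals, the part that is quadratic in the velocities is a sum over two triangles.\<close>

lemma product_of_indefinite_integrals:
  fixes X Y u v :: "real \<Rightarrow> real"
  assumes u: "set_integrable lborel {t..s} u" and v: "set_integrable lborel {t..s} v"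
    and X: "\<forall>r\<in>{t..s}. X r = x + (LINT q:{t..r}|lborel. u q)"
    and Y: "\<forall>r\<in>{t..s}. Y r = y + (LINT q:{t..r}|lborel. v q)"
    and ts: "t \<le> s"
  shows "set_integrable lborel {t..s} (\<lambda>r. u r * Y r + v r * X r)"
    and "X s * Y s = x * y + (LINT r:{t..s}|lborel. u r * Y r + v r * X r)"
proof -
  let ?U = "\<lambda>r. (LINT q:{t..r}|lborel. u q)" and ?V = "\<lambda>r. (LINT q:{t..r}|lborel. v q)"
  note cU = continuous_on_indefinite_LINT[OF u] and cV = continuous_on_indefinite_LINT[OF v]
  note iU = set_integrable_mult_continuous[OF v cU] and iV = set_integrable_mult_continuous[OF u cV]
  have eq: "u r * Y r + v r * X r = (y * u r + u r * ?V r) + (x * v r + v r * ?U r)" if "r \<in> {t..s}" for r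
    using X Y that by (simp add: algebra_simps)
  have i: "set_integrable lborel {t..s} (\<lambda>r. (y * u r + u r * ?V r) + (x * v r + v r * ?U r))"
    using u v iU iV by (intro set_integral_add) auto
  then show "set_integrable lborel {t..s} (\<lambda>r. u r * Y r + v r * X r)"
    using eq by (subst set_integrable_cong[OF refl refl]) auto
  have "(LINT r:{t..s}|lborel. u r * Y r + v r * X r)
     = (LINT r:{t..s}|lborel. (y * u r + u r * ?V r) + (x * v r + v r * ?U r))"
    using eq by (intro set_lebesgue_integral_cong) auto
  also have "\<dots> = y * ?U s + x * ?V s + ?U s * ?V s"
    using u v iU iV integral_square_split_diagonal[OF u v] by (simp add: set_integral_add)
  finally show "X s * Y s = x * y + (LINT r:{t..s}|lborel. u r * Y r + v r * X r)"
    using X Y ts by (simp add: algebra_simps)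
qed

lemma abs_mult_le_squares: "\<bar>p * q\<bar> \<le> p\<^sup>2 + q\<^sup>2" for p q :: real
proof -
  have "2 * (\<bar>p\<bar> * \<bar>q\<bar>) \<le> p\<^sup>2 + q\<^sup>2" using sum_squares_bound[of "\<bar>p\<bar>" "\<bar>q\<bar>"] by simp
  moreover have "0 \<le> \<bar>p\<bar> * \<bar>q\<bar>" by simp
  ultimately show ?thesis unfolding abs_mult by linarith
qed

text \<open>Cauchy-Schwarz against the constant function, obtained by integrating the square of \<open>u\<close> minus its
  mean.\<close>

lemma square_of_integral_le:
  fixes u :: "real \<Rightarrow> real"
  assumes u: "set_integrable lborel {a..b} u" and u2: "set_integrable lborel {a..b} (\<lambda>r. (u r)\<^sup>2)" and ab: "a \<le> b"
  shows "(LINT r:{a..b}|lborel. u r)\<^sup>2 \<le> (b - a) * (LINT r:{a..b}|lborel. (u r)\<^sup>2)"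
proof (cases "a = b")
  case True
  then show ?thesis by (simp add: LINT_at_point)
next
  case False
  then have ab': "b - a > 0" using ab by simp
  define m where "m = (LINT r:{a..b}|lborel. u r) / (b - a)"
  have c: "set_integrable lborel {a..b} (\<lambda>r. m\<^sup>2)" "(LINT r:{a..b}|lborel. m\<^sup>2) = m\<^sup>2 * (b - a)"
    using integrable_indicator_Icc[of a b] ab by (simp_all add: set_integrable_def set_lebesgue_integral_def)
  have eq: "(u r - m)\<^sup>2 = (u r)\<^sup>2 - 2 * m * u r + m\<^sup>2" for r by (simp add: power2_diff)
  have "0 \<le> (LINT r:{a..b}|lborel. (u r - m)\<^sup>2)"
    unfolding set_lebesgue_integral_def by (rule Bochner_Integration.integral_nonneg) simp
  also have "\<dots> = (LINT r:{a..b}|lborel. (u r)\<^sup>2) - 2 * m * (LINT r:{a..b}|lborel. u r) + m\<^sup>2 * (b - a)"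
    unfolding eq using u u2 c by (simp add: set_integral_add set_integral_diff)
  also have "\<dots> = (LINT r:{a..b}|lborel. (u r)\<^sup>2) - (LINT r:{a..b}|lborel. u r)\<^sup>2 / (b - a)"
  proof -
    have S: "(LINT r:{a..b}|lborel. u r) = m * (b - a)" using ab' by (simp add: m_def)
    show ?thesis unfolding S using ab' by (simp add: power2_eq_square)
  qed
  finally show ?thesis using ab' by (simp add: field_simps)
qed

lemma sequence_from_below:
  fixes a b :: real
  assumes "a < b"
  obtains c :: "nat \<Rightarrow> real" where "\<And>n. c n \<in> {a..<b}" "c \<longlonglongrightarrow> b"
proof
  define c where "c n = b - (b - a) * inverse (real (Suc n))" for n
  have "c \<longlonglongrightarrow> b - (b - a) * 0"
    unfolding c_def by (intro tendsto_intros LIMSEQ_inverse_real_of_nat)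
  then show "c \<longlonglongrightarrow> b" by simp
  show "c n \<in> {a..<b}" for n
  proof -
    have "inverse (real (Suc n)) \<le> 1" "0 < inverse (real (Suc n))" by (simp_all add: inverse_le_1_iff)
    then have "(b - a) * inverse (real (Suc n)) \<le> (b - a) * 1" "0 < (b - a) * inverse (real (Suc n))"
      using assms by (intro mult_left_mono mult_pos_pos; simp)+
    then show ?thesis by (auto simp: c_def)
  qed
qed

text \<open>This turns a bound that holds almost surely at each fixed time into one that holds almost surely
  at all times, because only countably many null sets have to be collected.\<close>

lemma continuous_le_from_rationals:
  fixes f :: "real \<Rightarrow> real"
  assumes f: "continuous_on {a..c} f" and s: "s \<in> {a..<c}" and le: "\<And>q. q \<in> \<rat> \<Longrightarrow> s < q \<Longrightarrow> q < c \<Longrightarrow> f q \<le> K"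
  shows "f s \<le> K"
proof (rule ccontr)
  assume "\<not> f s \<le> K"
  then have e: "f s - K > 0" by simp
  obtain d where d: "d > 0" "\<And>r. r \<in> {a..c} \<Longrightarrow> dist r s < d \<Longrightarrow> dist (f r) (f s) < f s - K"
  proof -
    have "s \<in> {a..c}" using s by auto
    with f e have "\<exists>d>0. \<forall>r\<in>{a..c}. dist r s < d \<longrightarrow> dist (f r) (f s) < f s - K"
      unfolding continuous_on_iff by blast
    then show thesis using that by blast
  qed
  obtain q where q: "q \<in> \<rat>" "s < q" "q < min c (s + d)"
    using Rats_dense_in_real[of s "min c (s + d)"] s d(1) by auto
  have "dist (f q) (f s) < f s - K" by (rule d(2)) (use q s in \<open>auto simp: dist_real_def\<close>)
  then have "f q > K" by (simp add: dist_real_def abs_if split: if_splits)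
  moreover have "f q \<le> K" by (rule le) (use q in auto)
  ultimately show False by simp
qed

section \<open>Gronwall's inequality and Picard iteration\<close>

text \<open>Take the point \<open>p\<close> where \<open>\<phi> r / exp (2 * K * (r - t))\<close> is largest. With this weight the integral
  contributes at most half of \<open>\<phi> p\<close> and can be absorbed, which explains the factor \<open>2\<close> and the doubled
  rate.\<close>

lemma gronwall_bound:
  fixes \<phi> :: "real \<Rightarrow> real"
  assumes c: "continuous_on {t..b} \<phi>" and nn: "\<And>s. s \<in> {t..b} \<Longrightarrow> 0 \<le> \<phi> s" and K: "K > 0" and R: "R \<ge> 0"
    and le: "\<And>s. s \<in> {t..b} \<Longrightarrow> \<phi> s \<le> R + K * (LINT r:{t..s}|lborel. \<phi> r)"
    and s: "s \<in> {t..b}"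
  shows "\<phi> s \<le> 2 * R * exp (2 * K * (b - t))"
proof -
  define e where "e r = exp (2 * K * (r - t))" for r
  have epos: "e r > 0" for r by (simp add: e_def)
  have ne: "{t..b} \<noteq> {}" using s by auto
  have "continuous_on {t..b} (\<lambda>r. \<phi> r / e r)" unfolding e_def by (intro continuous_intros c) auto
  then obtain p where p: "p \<in> {t..b}" and max: "\<forall>r\<in>{t..b}. \<phi> r / e r \<le> \<phi> p / e p"
    using continuous_attains_sup[OF compact_Icc ne] by blast
  define m where "m = \<phi> p / e p"
  have m0: "m \<ge> 0" using nn[OF p] epos[of p] by (simp add: m_def)
  have le_m: "\<phi> r \<le> m * e r" if "r \<in> {t..b}" for r
    using bspec[OF max that] epos[of r] by (simp only: m_def pos_divide_le_eq)
  have "(LINT r:{t..p}|lborel. \<phi> r) \<le> (LINT r:{t..p}|lborel. m * e r)"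
  proof (rule set_integral_mono)
    show "set_integrable lborel {t..p} \<phi>"
      by (rule borel_integrable_atLeastAtMost', rule continuous_on_subset[OF c]) (use p in auto)
    show "set_integrable lborel {t..p} (\<lambda>r. m * e r)"
      using set_lebesgue_integral_exp(1)[of "2*K" t p] K p by (auto simp: e_def)
  qed (use le_m p in auto)
  also have "\<dots> = m * ((e p - 1) / (2 * K))"
    using set_lebesgue_integral_exp(2)[of "2*K" t p] K p by (auto simp: e_def)
  finally have "K * (LINT r:{t..p}|lborel. \<phi> r) \<le> K * (m * ((e p - 1) / (2 * K)))"
    using K by (intro mult_left_mono) auto
  also have "\<dots> = m * (e p - 1) / 2" using K by (simp add: field_simps)
  finally have "\<phi> p \<le> R + m * (e p - 1) / 2" using le[OF p] by simp
  moreover have "\<phi> p = m * e p" using epos[of p] by (simp add: m_def)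
  ultimately have "m * e p \<le> R + (m * e p - m) / 2" by (simp add: algebra_simps)
  moreover have "z \<le> 2 * R" if "z \<le> R + (z - m) / 2" for z :: real using that m0 by (simp add: field_simps)
  ultimately have "m * e p \<le> 2 * R" by blast
  moreover have "m * 1 \<le> m * e p" using m0 K p by (intro mult_left_mono) (auto simp: e_def)
  ultimately have m: "m \<le> 2 * R" by simp
  have "\<phi> s \<le> m * e s" by (rule le_m[OF s])
  also have "\<dots> \<le> (2 * R) * e b" using m m0 K s R by (intro mult_mono) (auto simp: e_def)
  finally show ?thesis by (simp add: e_def mult.assoc)
qed

text \<open>In the norm with weight \<open>exp (K * (r - t))\<close>, integration gains a factor \<open>1 / K\<close> whatever the length
  of the interval. This is what lets Picard iteration converge on the whole interval at once.\<close>

lemma exponentially_weighted_integral_bound: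
  fixes h :: "real \<Rightarrow> 'b::euclidean_space"
  assumes K: "K > 0" and c: "c \<ge> 0" and meas: "set_borel_measurable lborel {t..b} h"
    and le: "\<And>r. r \<in> {t..b} \<Longrightarrow> norm (h r) \<le> c * exp (K * (r - t))" and s: "s \<in> {t..b}"
  shows "set_integrable lborel {t..s} h"
    and "norm (LINT r:{t..s}|lborel. h r) \<le> c / K * exp (K * (s - t))"
proof -
  have i: "set_integrable lborel {t..s} (\<lambda>r. c * exp (K * (r - t)))"
    using set_lebesgue_integral_exp(1)[of K t s] K s by auto
  show ih: "set_integrable lborel {t..s} h"
  proof (rule set_integrable_bound[OF i])
    show "set_borel_measurable lborel {t..s} h"
      by (rule set_borel_measurable_subset[OF meas]) (use s in auto)
    show "AE x in lborel. x \<in> {t..s} \<longrightarrow> norm (h x) \<le> norm (c * exp (K * (x - t)))"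
      using le s c by (intro AE_I2) (auto simp: abs_mult)
  qed
  have "norm (LINT r:{t..s}|lborel. h r) \<le> (LINT r:{t..s}|lborel. norm (h r))"
    by (rule set_integral_norm_bound[OF ih])
  also have "\<dots> \<le> (LINT r:{t..s}|lborel. c * exp (K * (r - t)))"
    by (rule set_integral_mono[OF set_integrable_norm[OF ih] i]) (use le s in auto)
  also have "\<dots> = c * ((exp (K * (s - t)) - 1) / K)"
    using set_lebesgue_integral_exp(2)[of K t s] K s by auto
  also have "\<dots> \<le> c / K * exp (K * (s - t))" using K c by (simp add: field_simps)
  finally show "norm (LINT r:{t..s}|lborel. h r) \<le> c / K * exp (K * (s - t))" .
qed

text \<open>Explicit iterates, rather than a fixed point in a function space, since the solution inherits
  progressive measurability from them.\<close>

primrec picard :: "real \<Rightarrow> 'b::euclidean_space \<Rightarrow> (real \<Rightarrow> 'b \<Rightarrow> 'b) \<Rightarrow> nat \<Rightarrow> real \<Rightarrow> 'b" where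
  "picard t u0 g 0 = (\<lambda>s. u0)"
| "picard t u0 g (Suc n) = (\<lambda>s. u0 + (LINT r:{t..s}|lborel. g r (picard t u0 g n r)))"

text \<open>Differences of consecutive iterates halve in the norm with weight \<open>exp (2 * K * (r - t))\<close>. The
  iterates therefore converge and have a common integrable bound, and dominated convergence passes
  to the limit in the integral equation. Measurability in time is required along the iterates only.\<close>

lemma picard_solves:
  fixes g :: "real \<Rightarrow> 'b::euclidean_space \<Rightarrow> 'b"
  assumes K: "K > 0"
    and lip: "\<And>r u v. r \<in> {t..b} \<Longrightarrow> norm (g r u - g r v) \<le> K * norm (u - v)"
    and g0: "\<And>r. r \<in> {t..b} \<Longrightarrow> g r 0 = 0"
    and meas: "\<And>n. set_borel_measurable lborel {t..b} (\<lambda>r. g r (picard t u0 g n r))"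
    and s: "s \<in> {t..b}"
  defines "U \<equiv> \<lambda>r. lim (\<lambda>n. picard t u0 g n r)"
  shows "(\<lambda>n. picard t u0 g n s) \<longlonglongrightarrow> U s"
    and "set_integrable lborel {t..s} (\<lambda>r. g r (U r))"
    and "U s = u0 + (LINT r:{t..s}|lborel. g r (U r))"
proof -
  let ?p = "picard t u0 g"
  define e where "e r = exp (2 * K * (r - t))" for r
  have e1: "1 \<le> e r" if "r \<in> {t..b}" for r using K that by (simp add: e_def)
  have eb: "e r \<le> e b" if "r \<in> {t..b}" for r using K that by (simp add: e_def)
  have gle: "norm (g r u) \<le> K * norm u" if "r \<in> {t..b}" for r u
    using lip[OF that, of u 0] g0[OF that] by simp
  have step: "\<forall>r\<in>{t..b}. norm (?p (Suc n) r - ?p n r) \<le> norm u0 * (1/2)^(Suc n) * e r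
      \<and> norm (?p n r) \<le> norm u0 * (2 - (1/2)^n) * e r" for n
  proof (induction n)
    case 0
    have "norm (?p (Suc 0) r - ?p 0 r) \<le> norm u0 * (1/2)^(Suc 0) * e r" if r: "r \<in> {t..b}" for r
    proof -
      have "norm (g q u0) \<le> K * norm u0 * exp (2 * K * (q - t))" if "q \<in> {t..b}" for q
        using gle[OF that, of u0] mult_left_mono[OF e1[OF that], of "K * norm u0"] K
        unfolding e_def by (metis mult.right_neutral mult_nonneg_nonneg norm_ge_zero less_imp_le order_trans)
      from exponentially_weighted_integral_bound(2)[OF _ _ _ this r]
      show ?thesis using K meas[of 0] by (simp add: e_def)
    qed
    moreover have "norm (?p 0 r) \<le> norm u0 * (2 - (1/2)^0) * e r" if r: "r \<in> {t..b}" for r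
      using e1[OF r] by (simp add: mult_le_cancel_left1)
    ultimately show ?case by blast
  next
    case (Suc n)
    have b1: "norm (?p (Suc n) r) \<le> norm u0 * (2 - (1/2)^Suc n) * e r" if r: "r \<in> {t..b}" for r
    proof -
      have "norm (?p (Suc n) r) \<le> norm (?p n r) + norm (?p (Suc n) r - ?p n r)"
        by (metis norm_triangle_sub)
      also have "\<dots> \<le> norm u0 * (2 - (1/2)^n) * e r + norm u0 * (1/2)^(Suc n) * e r"
        using Suc r by (intro add_mono) auto
      also have "\<dots> = norm u0 * (2 - (1/2)^Suc n) * e r" by (simp add: field_simps)
      finally show ?thesis .
    qed
    have int: "set_integrable lborel {t..r} (\<lambda>q. g q (?p m q))"
      if r: "r \<in> {t..b}" and m: "\<forall>q\<in>{t..b}. norm (?p m q) \<le> norm u0 * (2 - (1/2)^m) * e q" for r m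
    proof (rule exponentially_weighted_integral_bound(1)[OF _ _ meas _ r])
      fix q assume q: "q \<in> {t..b}"
      have "norm (g q (?p m q)) \<le> K * norm (?p m q)" by (rule gle[OF q])
      also have "\<dots> \<le> K * (norm u0 * (2 - (1/2)^m) * e q)"
        using m q K by (intro mult_left_mono) auto
      finally show "norm (g q (?p m q)) \<le> (K * norm u0 * (2 - (1/2)^m)) * exp ((2 * K) * (q - t))"
        by (simp add: e_def mult.assoc)
    qed (use K in \<open>auto simp: power_le_one intro!: mult_nonneg_nonneg intro: order_trans[of _ 1]\<close>)
    have "norm (?p (Suc (Suc n)) r - ?p (Suc n) r) \<le> norm u0 * (1/2)^(Suc (Suc n)) * e r"
      if r: "r \<in> {t..b}" for r
    proof -
      have i1: "set_integrable lborel {t..r} (\<lambda>q. g q (?p (Suc n) q))" by (rule int[OF r]) (use b1 in blast)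
      have i0: "set_integrable lborel {t..r} (\<lambda>q. g q (?p n q))" by (rule int[OF r]) (use Suc in blast)
      have "?p (Suc (Suc n)) r - ?p (Suc n) r = (LINT q:{t..r}|lborel. g q (?p (Suc n) q) - g q (?p n q))"
        unfolding set_integral_diff(2)[OF i1 i0] by simp
      also have "norm \<dots> \<le> (K * (norm u0 * (1/2)^(Suc n))) / (2*K) * exp ((2 * K) * (r - t))"
      proof (rule exponentially_weighted_integral_bound(2)[OF _ _ _ _ r])
        have "set_borel_measurable lborel {t..b} (\<lambda>q. g q (?p (Suc n) q) - g q (?p n q))"
          using borel_measurable_diff[OF meas[of "Suc n", unfolded set_borel_measurable_def] meas[of n, unfolded set_borel_measurable_def]]
          by (simp add: set_borel_measurable_def scaleR_diff_right del: picard.simps)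
        then show "set_borel_measurable lborel {t..b} (\<lambda>q. g q (?p (Suc n) q) - g q (?p n q))" .
        fix q assume q: "q \<in> {t..b}"
        have "norm (g q (?p (Suc n) q) - g q (?p n q)) \<le> K * norm (?p (Suc n) q - ?p n q)"
          by (rule lip[OF q])
        also have "\<dots> \<le> K * (norm u0 * (1/2)^(Suc n) * e q)"
          using Suc q K by (intro mult_left_mono) auto
        finally show "norm (g q (?p (Suc n) q) - g q (?p n q))
            \<le> (K * (norm u0 * (1/2)^(Suc n))) * exp ((2 * K) * (q - t))"
          by (simp add: e_def mult.assoc)
      qed (use K in auto)
      also have "\<dots> = norm u0 * (1/2)^(Suc (Suc n)) * e r" using K by (simp add: e_def)
      finally show ?thesis .
    qed
    then show ?case using b1 by blast
  qed
  have bnd: "norm (?p n r) \<le> 2 * norm u0 * e r" if "r \<in> {t..b}" for n r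
  proof -
    have "norm (?p n r) \<le> norm u0 * (2 - (1/2)^n) * e r" using step that by blast
    also have "\<dots> \<le> norm u0 * 2 * e r" by (intro mult_mono) (use e1[OF that] power_le_one[of "1/2::real" n] in \<open>auto simp del: power_one_over\<close>)
    finally show ?thesis by simp
  qed
  have conv: "(\<lambda>n. ?p n r) \<longlonglongrightarrow> U r" if r: "r \<in> {t..b}" for r
  proof -
    have "summable (\<lambda>n. ?p (Suc n) r - ?p n r)"
    proof (rule summable_comparison_test')
      show "summable (\<lambda>n. norm u0 * e r * (1/2)^(Suc n))"
        by (intro summable_mult) (simp add: summable_Suc_iff summable_geometric del: power_Suc)
      show "norm (?p (Suc n) r - ?p n r) \<le> norm u0 * e r * (1/2)^(Suc n)" for n
        using bspec[OF step[of n] r] by (simp only: mult.assoc mult.commute[of "e r"])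
    qed
    then have "convergent (\<lambda>n. \<Sum>i<n. ?p (Suc i) r - ?p i r)" by (simp add: summable_iff_convergent del: picard.simps)
    then have "convergent (\<lambda>n. (\<Sum>i<n. ?p (Suc i) r - ?p i r) + ?p 0 r)"
      by (intro convergent_add) (auto simp: convergent_const)
    moreover have "(\<Sum>i<n. ?p (Suc i) r - ?p i r) + ?p 0 r = ?p n r" for n
      by (subst sum_lessThan_telescope) simp
    ultimately show ?thesis unfolding U_def by (simp add: convergent_LIMSEQ_iff del: picard.simps)
  qed
  show "(\<lambda>n. picard t u0 g n s) \<longlonglongrightarrow> U s" by (rule conv[OF s])
  have gconv: "(\<lambda>n. g r (?p n r)) \<longlonglongrightarrow> g r (U r)" if r: "r \<in> {t..b}" for r
  proof (rule Lim_null_comparison[THEN LIM_zero_cancel])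
    show "\<forall>\<^sub>F n in sequentially. norm (g r (?p n r) - g r (U r)) \<le> K * norm (?p n r - U r)"
      using lip[OF r] by simp
    show "(\<lambda>n. K * norm (?p n r - U r)) \<longlonglongrightarrow> 0"
      using conv[OF r] by (intro tendsto_mult_right_zero tendsto_norm_zero LIM_zero)
  qed
  \<comment> \<open>All iterates stay below \<open>2 * norm u0 * e r\<close>, hence this bound for their images under \<open>g r\<close>.\<close>
  define w where "w r = indicator {t..s} r * (2 * K * norm u0 * e r)" for r
  have w: "integrable lborel w"
  proof -
    have "set_integrable lborel {t..s} (\<lambda>r. 2 * K * norm u0 * e r)"
      using set_lebesgue_integral_exp(1)[of "2*K" t s] K s by (auto simp: e_def)
    then show ?thesis by (simp add: w_def[abs_def] set_integrable_def)
  qed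
  have ms: "set_borel_measurable lborel {t..s} (\<lambda>r. g r (?p n r))" for n
    by (rule set_borel_measurable_subset[OF meas]) (use s in auto)
  have lim: "AE r in lborel. (\<lambda>n. indicator {t..s} r *\<^sub>R g r (?p n r)) \<longlonglongrightarrow> indicator {t..s} r *\<^sub>R g r (U r)"
    using s by (intro AE_I2) (auto intro!: gconv tendsto_scaleR split: split_indicator)
  have dom: "AE r in lborel. norm (indicator {t..s} r *\<^sub>R g r (?p n r)) \<le> w r" for n
  proof (intro AE_I2)
    fix r show "norm (indicator {t..s} r *\<^sub>R g r (?p n r)) \<le> w r"
    proof (cases "r \<in> {t..s}")
      case True
      then have r: "r \<in> {t..b}" using s by auto
      show ?thesis using order_trans[OF gle[OF r] mult_left_mono[OF bnd[OF r, of n], of K]] True K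
        by (auto simp: w_def mult.assoc mult.left_commute)
    qed (auto simp: w_def)
  qed
  have ml: "(\<lambda>r. indicator {t..s} r *\<^sub>R g r (U r)) \<in> borel_measurable lborel"
    by (rule borel_measurable_LIMSEQ_metric[of "\<lambda>n r. indicator {t..s} r *\<^sub>R g r (?p n r)"])
       (use ms s in \<open>auto simp: set_borel_measurable_def intro!: gconv tendsto_scaleR split: split_indicator\<close>)
  note dct = integrable_dominated_convergence[OF ml ms[unfolded set_borel_measurable_def] w lim dom]
    integral_dominated_convergence[OF ml ms[unfolded set_borel_measurable_def] w lim dom]
  show "set_integrable lborel {t..s} (\<lambda>r. g r (U r))"
    using dct(1) by (simp add: set_integrable_def)
  have "(\<lambda>n. u0 + (LINT r:{t..s}|lborel. g r (?p n r))) \<longlonglongrightarrow> u0 + (LINT r:{t..s}|lborel. g r (U r))"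
    using dct(2) by (intro tendsto_intros) (simp add: set_lebesgue_integral_def)
  then have "(\<lambda>n. ?p (Suc n) s) \<longlonglongrightarrow> u0 + (LINT r:{t..s}|lborel. g r (U r))" by simp
  moreover have "(\<lambda>n. ?p (Suc n) s) \<longlonglongrightarrow> U s" using conv[OF s] by (rule LIMSEQ_Suc)
  ultimately show "U s = u0 + (LINT r:{t..s}|lborel. g r (U r))" by (metis LIMSEQ_unique)
qed

text \<open>The position is controlled by \<open>\<integral> \<bar>\<xi>\<bar>\<close>, and the second component by Gronwall's inequality. The rate
  is \<open>K + 1\<close> because \<open>gronwall_bound\<close> asks for a positive one.\<close>

lemma linear_state_bound:
  fixes X Y \<xi> \<rho> :: "real \<Rightarrow> real"
  assumes \<xi>: "set_integrable lborel {t..b} \<xi>"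
    and X: "\<forall>s\<in>{t..b}. X s = x - (LINT r:{t..s}|lborel. \<xi> r)"
    and iY: "set_integrable lborel {t..b} (\<lambda>r. - \<rho> r * Y r + \<gamma> * \<xi> r)"
    and Y: "\<forall>s\<in>{t..b}. Y s = y + (LINT r:{t..s}|lborel. - \<rho> r * Y r + \<gamma> * \<xi> r)"
    and \<rho>: "AE r in lborel. r \<in> {t..b} \<longrightarrow> \<bar>\<rho> r\<bar> \<le> K" and K: "K \<ge> 0" and \<gamma>: "\<gamma> \<ge> 0" and s: "s \<in> {t..b}"
  shows "\<bar>X s\<bar> \<le> \<bar>x\<bar> + (LINT r:{t..b}|lborel. \<bar>\<xi> r\<bar>)"
    and "\<bar>Y s\<bar> \<le> 2 * (\<bar>y\<bar> + \<gamma> * (LINT r:{t..b}|lborel. \<bar>\<xi> r\<bar>)) * exp (2 * (K + 1) * (b - t))"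
proof -
  let ?J = "LINT r:{t..b}|lborel. \<bar>\<xi> r\<bar>"
  have sub: "set_integrable lborel {t..q} h" if "set_integrable lborel {t..b} h" "q \<in> {t..b}" for h :: "real \<Rightarrow> real" and q
    by (rule set_integrable_subset[OF that(1)]) (use that(2) in auto)
  have J: "\<bar>LINT r:{t..q}|lborel. \<xi> r\<bar> \<le> ?J" "(LINT r:{t..q}|lborel. \<bar>\<xi> r\<bar>) \<le> ?J" if q: "q \<in> {t..b}" for q
  proof -
    note a = set_integrable_abs[OF \<xi>]
    show le: "(LINT r:{t..q}|lborel. \<bar>\<xi> r\<bar>) \<le> ?J"
      unfolding set_lebesgue_integral_def
      by (rule integral_mono) (use a sub[OF a q] q in \<open>auto simp: set_integrable_def split: split_indicator\<close>)
    show "\<bar>LINT r:{t..q}|lborel. \<xi> r\<bar> \<le> ?J"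
      using set_integral_norm_bound[OF sub[OF \<xi> q]] le by simp
  qed
  show "\<bar>X s\<bar> \<le> \<bar>x\<bar> + ?J" using J(1)[OF s] X s by auto
  have "continuous_on {t..b} (\<lambda>s. y + (LINT r:{t..s}|lborel. - \<rho> r * Y r + \<gamma> * \<xi> r))"
    by (intro continuous_intros continuous_on_indefinite_LINT iY)
  then have cY: "continuous_on {t..b} Y" by (rule continuous_on_eq) (use Y in auto)
  have J0: "0 \<le> ?J" unfolding set_lebesgue_integral_def by (rule Bochner_Integration.integral_nonneg) simp
  show "\<bar>Y s\<bar> \<le> 2 * (\<bar>y\<bar> + \<gamma> * ?J) * exp (2 * (K + 1) * (b - t))"
  proof (rule gronwall_bound[where \<phi>="\<lambda>s. \<bar>Y s\<bar>"])
    show "continuous_on {t..b} (\<lambda>s. \<bar>Y s\<bar>)" by (intro continuous_intros cY)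
    fix q assume q: "q \<in> {t..b}"
    have iaY: "set_integrable lborel {t..q} (\<lambda>r. \<bar>Y r\<bar>)"
      by (rule borel_integrable_atLeastAtMost', intro continuous_intros, rule continuous_on_subset[OF cY]) (use q in auto)
    note iq = sub[OF iY q] and iax = set_integrable_abs[OF sub[OF \<xi> q]]
    have "\<bar>LINT r:{t..q}|lborel. - \<rho> r * Y r + \<gamma> * \<xi> r\<bar> \<le> (LINT r:{t..q}|lborel. \<bar>- \<rho> r * Y r + \<gamma> * \<xi> r\<bar>)"
      using set_integral_norm_bound[OF iq] by simp
    also have "\<dots> \<le> (LINT r:{t..q}|lborel. (K + 1) * \<bar>Y r\<bar> + \<gamma> * \<bar>\<xi> r\<bar>)"
    proof (rule set_integral_mono_AE)
      show "set_integrable lborel {t..q} (\<lambda>r. \<bar>- \<rho> r * Y r + \<gamma> * \<xi> r\<bar>)" by (rule set_integrable_abs[OF iq])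
      show "set_integrable lborel {t..q} (\<lambda>r. (K + 1) * \<bar>Y r\<bar> + \<gamma> * \<bar>\<xi> r\<bar>)"
        using iaY iax by (intro set_integral_add) auto
      show "AE r\<in>{t..q} in lborel. \<bar>- \<rho> r * Y r + \<gamma> * \<xi> r\<bar> \<le> (K + 1) * \<bar>Y r\<bar> + \<gamma> * \<bar>\<xi> r\<bar>"
        using \<rho>
      proof eventually_elim
        case (elim r)
        show ?case
        proof
          assume "r \<in> {t..q}"
          then have "\<bar>\<rho> r\<bar> \<le> K + 1" using elim q K by auto
          then have "\<bar>\<rho> r\<bar> * \<bar>Y r\<bar> \<le> (K + 1) * \<bar>Y r\<bar>" by (rule mult_right_mono) simp
          moreover have "\<bar>- \<rho> r * Y r + \<gamma> * \<xi> r\<bar> \<le> \<bar>- \<rho> r * Y r\<bar> + \<bar>\<gamma> * \<xi> r\<bar>" by (rule abs_triangle_ineq)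
          moreover have "\<bar>- \<rho> r * Y r\<bar> = \<bar>\<rho> r\<bar> * \<bar>Y r\<bar>" "\<bar>\<gamma> * \<xi> r\<bar> = \<gamma> * \<bar>\<xi> r\<bar>"
            using \<gamma> by (auto simp: abs_mult)
          ultimately show "\<bar>- \<rho> r * Y r + \<gamma> * \<xi> r\<bar> \<le> (K + 1) * \<bar>Y r\<bar> + \<gamma> * \<bar>\<xi> r\<bar>" by linarith
        qed
      qed
    qed
    also have "\<dots> = (K + 1) * (LINT r:{t..q}|lborel. \<bar>Y r\<bar>) + \<gamma> * (LINT r:{t..q}|lborel. \<bar>\<xi> r\<bar>)"
      using iaY iax by (simp add: set_integral_add)
    also have "\<gamma> * (LINT r:{t..q}|lborel. \<bar>\<xi> r\<bar>) \<le> \<gamma> * ?J" by (rule mult_left_mono[OF J(2)[OF q] \<gamma>])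
    finally show "\<bar>Y q\<bar> \<le> (\<bar>y\<bar> + \<gamma> * ?J) + (K + 1) * (LINT r:{t..q}|lborel. \<bar>Y r\<bar>)"
      using Y q by auto
  qed (use K J0 \<gamma> s in auto)
qed

section \<open>Progressively measurable processes\<close>

lemma progressive_subinterval:
  assumes "progressive F a b X" "a \<le> a'" "b' \<le> b"
  shows "progressive F a' b' X"
  unfolding progressive_def
proof
  fix u assume u: "u \<in> {a'..b'}"
  have "(\<lambda>p. p) \<in> measurable (restrict_space borel {a'..u} \<Otimes>\<^sub>M F u) (restrict_space borel {a..u} \<Otimes>\<^sub>M F u)"
  proof -
    have "(\<lambda>x. x) \<in> measurable (restrict_space borel {a'..u}) (restrict_space borel {a..u})"
      by (rule measurable_restrict_space3) (use assms in auto)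
    then have "(\<lambda>p. (fst p, snd p)) \<in> measurable (restrict_space borel {a'..u} \<Otimes>\<^sub>M F u) (restrict_space borel {a..u} \<Otimes>\<^sub>M F u)"
      by (intro measurable_Pair measurable_compose[OF measurable_fst] measurable_snd) auto
    then show ?thesis by simp
  qed
  then show "(\<lambda>(s, \<omega>). X s \<omega>) \<in> borel_measurable (restrict_space borel {a'..u} \<Otimes>\<^sub>M F u)"
    by (rule measurable_compose) (use assms u in \<open>auto simp: progressive_def\<close>)
qed

lemma progressive_compose:
  assumes "progressive F a b X" "h \<in> borel_measurable borel"
  shows "progressive F a b (\<lambda>s \<omega>. h (X s \<omega>))"
  using assms measurable_compose[OF _ assms(2)] unfolding progressive_def split_beta' by blast

lemma progressive_compose2:
  fixes X :: "real \<Rightarrow> 'a \<Rightarrow> 'b::second_countable_topology" and Y :: "real \<Rightarrow> 'a \<Rightarrow> 'c::second_countable_topology"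
  assumes "progressive F a b X" "progressive F a b Y" "(\<lambda>(x, y). h x y) \<in> borel_measurable borel"
  shows "progressive F a b (\<lambda>s \<omega>. h (X s \<omega>) (Y s \<omega>))"
proof -
  have "(\<lambda>p. (\<lambda>(x, y). h x y) (X (fst p) (snd p), Y (fst p) (snd p))) \<in> borel_measurable (restrict_space borel {a..u} \<Otimes>\<^sub>M F u)"
    if "u \<in> {a..b}" for u
    by (rule measurable_compose[OF _ assms(3)], rule borel_measurable_Pair)
      (use assms(1,2) that in \<open>auto simp: progressive_def split_beta'\<close>)
  then show ?thesis unfolding progressive_def split_beta' by simp
qed

lemma progressive_add:
  fixes X Y :: "real \<Rightarrow> 'a \<Rightarrow> 'b::{second_countable_topology, real_normed_vector}"
  assumes "progressive F a b X" "progressive F a b Y"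
  shows "progressive F a b (\<lambda>s \<omega>. X s \<omega> + Y s \<omega>)"
  using assms unfolding progressive_def split_beta' by (auto intro!: borel_measurable_add)

lemma progressive_diff:
  fixes X Y :: "real \<Rightarrow> 'a \<Rightarrow> 'b::{second_countable_topology, real_normed_vector}"
  assumes "progressive F a b X" "progressive F a b Y"
  shows "progressive F a b (\<lambda>s \<omega>. X s \<omega> - Y s \<omega>)"
  using assms unfolding progressive_def split_beta' by (auto intro!: borel_measurable_diff)

lemma progressive_mult:
  fixes X Y :: "real \<Rightarrow> 'a \<Rightarrow> real"
  assumes "progressive F a b X" "progressive F a b Y"
  shows "progressive F a b (\<lambda>s \<omega>. X s \<omega> * Y s \<omega>)"
  using assms unfolding progressive_def split_beta' by (auto intro!: borel_measurable_times)

lemma progressive_power: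
  fixes X :: "real \<Rightarrow> 'a \<Rightarrow> real"
  assumes "progressive F a b X"
  shows "progressive F a b (\<lambda>s \<omega>. X s \<omega> ^ n)"
  using assms unfolding progressive_def split_beta' by (auto intro!: borel_measurable_power)

lemma progressive_uminus:
  fixes X :: "real \<Rightarrow> 'a \<Rightarrow> real"
  assumes "progressive F a b X"
  shows "progressive F a b (\<lambda>s \<omega>. - X s \<omega>)"
  using assms unfolding progressive_def split_beta' by (auto intro!: borel_measurable_uminus)

lemma progressive_deterministic:
  assumes "h \<in> borel_measurable borel"
  shows "progressive F a b (\<lambda>s \<omega>. h s)"
proof -
  have "h \<in> borel_measurable (restrict_space borel {a..u})" for u
    by (rule measurable_restrict_space1[OF assms])
  then show ?thesis unfolding progressive_def split_beta' by (auto intro: measurable_compose[OF measurable_fst])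
qed

lemma progressive_const: "progressive F a b (\<lambda>s \<omega>. c)"
  by (rule progressive_deterministic) simp

lemmas progressive_intros = progressive_add progressive_diff progressive_mult progressive_power
  progressive_uminus progressive_const

text \<open>Freezing the time argument outside \<open>{a..u}\<close> yields a map that is jointly measurable on the whole
  time axis without leaving \<open>F u\<close>. Integrals over time can then be taken with respect to \<open>lborel\<close>,
  where Fubini's theorem is available.\<close>

lemma progressive_clamped:
  assumes X: "progressive F a b X" and u: "u \<in> {a..b}"
  shows "(\<lambda>p. X (max a (min u (fst p))) (snd p)) \<in> borel_measurable (borel \<Otimes>\<^sub>M F u)"
proof -
  have "(\<lambda>r. max a (min u r)) \<in> measurable borel (restrict_space borel {a..u})"
    by (rule measurable_restrict_space2) (use u in auto)
  then have "(\<lambda>p. (max a (min u (fst p)), snd p)) \<in> measurable (borel \<Otimes>\<^sub>M F u) (restrict_space borel {a..u} \<Otimes>\<^sub>M F u)"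
    by (intro measurable_Pair measurable_compose[OF measurable_fst] measurable_snd) auto
  from measurable_compose[OF this bspec[OF X[unfolded progressive_def] u]] show ?thesis by simp
qed

lemma progressive_at_time:
  assumes X: "progressive F a b X" and u: "u \<in> {a..b}"
  shows "X u \<in> borel_measurable (F u)"
proof -
  have "(\<lambda>\<omega>. (u, \<omega>)) \<in> measurable (F u) (borel \<Otimes>\<^sub>M F u)" by simp
  from measurable_compose[OF this progressive_clamped[OF X u]] u show ?thesis by simp
qed

text \<open>After clamping, the integrand is measurable in time, \<open>\<omega>\<close> and the integration variable jointly, so
  that the parameter integral is measurable.\<close>

lemma progressive_integral:
  fixes h :: "real \<Rightarrow> 'a \<Rightarrow> 'b::euclidean_space"
  assumes h: "progressive F a b h"
  shows "progressive F a b (\<lambda>s \<omega>. LINT r:{a..s}|lborel. h r \<omega>)"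
  unfolding progressive_def
proof
  fix u assume u: "u \<in> {a..b}"
  let ?N = "restrict_space borel {a..u} \<Otimes>\<^sub>M F u"
  have [measurable]: "(\<lambda>x. x) \<in> borel_measurable (restrict_space borel {a..u})"
    by (rule measurable_restrict_space1) simp
  have m1: "(\<lambda>z. (snd z, snd (fst z))) \<in> measurable (?N \<Otimes>\<^sub>M lborel) (borel \<Otimes>\<^sub>M F u)"
    by measurable
  have [measurable]: "(\<lambda>z. h (max a (min u (snd z))) (snd (fst z))) \<in> borel_measurable (?N \<Otimes>\<^sub>M lborel)"
    using measurable_compose[OF m1 progressive_clamped[OF h u]] by simp
  have [measurable]: "(\<lambda>z. fst (fst z)) \<in> borel_measurable (?N \<Otimes>\<^sub>M lborel)"
    by (rule measurable_compose[OF measurable_fst measurable_compose[OF measurable_fst]]) measurable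
  have "(\<lambda>(p, r). if a \<le> r \<and> r \<le> fst p then h (max a (min u r)) (snd p) else 0) \<in> borel_measurable (?N \<Otimes>\<^sub>M lborel)"
    unfolding split_beta' by measurable
  then have "(\<lambda>p. \<integral>r. (if a \<le> r \<and> r \<le> fst p then h (max a (min u r)) (snd p) else 0) \<partial>lborel) \<in> borel_measurable ?N"
    by (rule lborel.borel_measurable_lebesgue_integral)
  also have "?this \<longleftrightarrow> (\<lambda>(s, \<omega>). LINT r:{a..s}|lborel. h r \<omega>) \<in> borel_measurable ?N"
  proof (rule measurable_cong)
    fix p assume "p \<in> space ?N"
    then have "fst p \<le> u" by (auto simp: space_pair_measure space_restrict_space)
    then have "(if a \<le> r \<and> r \<le> fst p then h (max a (min u r)) (snd p) else 0)
        = indicator {a..fst p} r *\<^sub>R h r (snd p)" for r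
      by (auto simp: indicator_def)
    then show "(\<integral>r. (if a \<le> r \<and> r \<le> fst p then h (max a (min u r)) (snd p) else 0) \<partial>lborel)
       = (case p of (s, \<omega>) \<Rightarrow> LINT r:{a..s}|lborel. h r \<omega>)"
      by (simp add: set_lebesgue_integral_def split_beta')
  qed
  finally show "(\<lambda>(s, \<omega>). LINT r:{a..s}|lborel. h r \<omega>) \<in> borel_measurable ?N" .
qed

section \<open>The augmented Brownian filtration\<close>

locale brownian_filtration = prob_space M for M :: "'a measure" +
  fixes F :: "real \<Rightarrow> 'a measure" and W :: "real \<Rightarrow> 'a \<Rightarrow> real ^ 'm" and T :: real
  assumes T_pos: "T > 0"
    and brownian: "standard_brownian_motion M T W"
    and F_eq: "F = augmented_filtration M W"
    and sets_M: "sets M = sets (F T)"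
begin

definition generators :: "real \<Rightarrow> 'a set set" where
  "generators t = {W r -` S \<inter> space M | r S. r \<in> {0..t} \<and> S \<in> sets borel}"

lemma sets_F: "sets (F t) = sigma_sets (space M) (generators t \<union> null_sets M)"
  unfolding F_eq augmented_filtration_def generators_def[symmetric]
  by (rule sets_measure_of) (auto simp: generators_def dest: null_setsD2 sets.sets_into_space)

lemma space_F [simp]: "space (F t) = space M"
  unfolding F_eq augmented_filtration_def
  by (rule space_measure_of) (auto dest: null_setsD2 sets.sets_into_space)

lemma F_mono:
  assumes "s \<le> t"
  shows "sets (F s) \<subseteq> sets (F t)"
proof -
  have "generators s \<subseteq> generators t"
  proof
    fix A assume "A \<in> generators s"
    then obtain r S where "A = W r -` S \<inter> space M" "r \<in> {0..s}" "S \<in> sets borel"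
      unfolding generators_def by blast
    moreover from this have "r \<in> {0..t}" using assms by auto
    ultimately show "A \<in> generators t" unfolding generators_def by blast
  qed
  then show ?thesis unfolding sets_F by (intro sigma_sets_mono') blast
qed

lemma F_subset_M: "t \<le> T \<Longrightarrow> sets (F t) \<subseteq> sets M"
  using F_mono sets_M by auto

lemma subalgebra_F: "t \<le> T \<Longrightarrow> subalgebra M (F t)"
  using F_subset_M by (auto simp: subalgebra_def)

lemma cond_exp_F: "t \<le> T \<Longrightarrow> sigma_finite_subalgebra M (F t)"
  using finite_measure_subalgebra_is_sigma_finite[of M "F t"] subalgebra_F[of t]
  by (simp add: finite_measure_subalgebra_def finite_measure_subalgebra_axioms_def finite_measure_axioms)

lemma borel_measurable_F_M: "f \<in> borel_measurable (F t) \<Longrightarrow> t \<le> T \<Longrightarrow> f \<in> borel_measurable M"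
  by (rule measurable_from_subalg[OF subalgebra_F])

lemma borel_measurable_F_mono: "f \<in> borel_measurable (F s) \<Longrightarrow> s \<le> t \<Longrightarrow> f \<in> borel_measurable (F t)"
  by (rule measurable_from_subalg[of _ "F s"]) (use F_mono in \<open>auto simp: subalgebra_def\<close>)

lemma progressive_random:
  assumes "\<phi> \<in> borel_measurable (F a)"
  shows "progressive F a b (\<lambda>s. \<phi>)"
  unfolding progressive_def
proof
  fix u assume "u \<in> {a..b}"
  then have "\<phi> \<in> borel_measurable (F u)" using borel_measurable_F_mono[OF assms] by simp
  then show "(\<lambda>(s, \<omega>). \<phi> \<omega>) \<in> borel_measurable (restrict_space borel {a..u} \<Otimes>\<^sub>M F u)"
    unfolding split_beta' by (rule measurable_compose[OF measurable_snd])
qed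

lemma progressive_time_M:
  assumes "progressive F a b X" "u \<in> {a..b}" "b \<le> T"
  shows "X u \<in> borel_measurable M"
proof (rule borel_measurable_F_M)
  show "X u \<in> borel_measurable (F u)" by (rule progressive_at_time[OF assms(1,2)])
  show "u \<le> T" using assms by simp
qed

lemma progressive_jointly_measurable:
  fixes X :: "real \<Rightarrow> 'a \<Rightarrow> 'b::euclidean_space"
  assumes X: "progressive F a b X" and b: "b \<le> T"
  shows "(\<lambda>(s, \<omega>). indicator {a..b} s *\<^sub>R X s \<omega>) \<in> borel_measurable (lborel \<Otimes>\<^sub>M M)"
proof (cases "a \<le> b")
  case True
  have "(\<lambda>p. p) \<in> measurable (lborel \<Otimes>\<^sub>M M) ((borel :: real measure) \<Otimes>\<^sub>M F b)"
  proof -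
    have 1: "(\<lambda>x. x) \<in> measurable lborel (borel :: real measure)" by simp
    have 2: "(\<lambda>x. x) \<in> measurable M (F b)"
      by (rule measurable_from_subalg[OF subalgebra_F[OF b]]) simp
    have "(\<lambda>p. (fst p, snd p)) \<in> measurable (lborel \<Otimes>\<^sub>M M) ((borel :: real measure) \<Otimes>\<^sub>M F b)"
      by (rule measurable_Pair[OF measurable_compose[OF measurable_fst 1] measurable_compose[OF measurable_snd 2]])
    then show ?thesis by simp
  qed
  from measurable_compose[OF this progressive_clamped[OF X, of b]] True
  have [measurable]: "(\<lambda>p. X (max a (min b (fst p))) (snd p)) \<in> borel_measurable (lborel \<Otimes>\<^sub>M M)"
    by simp
  have "(\<lambda>p. indicator {a..b} (fst p) *\<^sub>R X (max a (min b (fst p))) (snd p)) \<in> borel_measurable (lborel \<Otimes>\<^sub>M M)"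
    by measurable
  also have "(\<lambda>p. indicator {a..b} (fst p) *\<^sub>R X (max a (min b (fst p))) (snd p))
     = (\<lambda>(s, \<omega>). indicator {a..b} s *\<^sub>R X s \<omega>)"
    by (auto simp: fun_eq_iff indicator_def)
  finally show ?thesis .
qed (auto simp: indicator_def)

lemma progressive_section_measurable:
  fixes h :: "real \<Rightarrow> 'a \<Rightarrow> 'b::euclidean_space"
  assumes h: "progressive F a b h" and b: "b \<le> T" and \<omega>: "\<omega> \<in> space M"
  shows "set_borel_measurable lborel {a..b} (\<lambda>r. h r \<omega>)"
proof -
  have "(\<lambda>s. (s, \<omega>)) \<in> measurable lborel (lborel \<Otimes>\<^sub>M M)" using \<omega> by simp
  from measurable_compose[OF this progressive_jointly_measurable[OF h b]]
  show ?thesis by (simp add: set_borel_measurable_def)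
qed

text \<open>At the terminal time \<open>b\<close> measurability is recovered from the processes that are frozen at times
  \<open>c n < b\<close>. The value \<open>0\<close> at \<open>b\<close> is a default.\<close>

lemma progressive_before_terminal:
  fixes X :: "real \<Rightarrow> 'a \<Rightarrow> 'b::euclidean_space"
  assumes X: "\<And>b'. b' \<in> {a..<b} \<Longrightarrow> progressive F a b' X"
  shows "progressive F a b (\<lambda>s \<omega>. if s < b then X s \<omega> else 0)"
  unfolding progressive_def
proof
  fix u assume u: "u \<in> {a..b}"
  show "(\<lambda>(s, \<omega>). if s < b then X s \<omega> else 0) \<in> borel_measurable (restrict_space borel {a..u} \<Otimes>\<^sub>M F u)"
  proof (cases "u < b")
    case True
    then have "(\<lambda>(s, \<omega>). X s \<omega>) \<in> borel_measurable (restrict_space borel {a..u} \<Otimes>\<^sub>M F u)"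
      using X[of u] u by (auto simp: progressive_def)
    also have "?this \<longleftrightarrow> ?thesis"
      using True by (intro measurable_cong) (auto simp: space_pair_measure space_restrict_space)
    finally show ?thesis .
  next
    case False
    then have ub: "u = b" using u by simp
    show ?thesis
    proof (cases "a < b")
      case ab: True
      obtain c :: "nat \<Rightarrow> real" where c: "\<And>n. c n \<in> {a..<b}" and clim: "c \<longlonglongrightarrow> b"
        using sequence_from_below[OF ab] by blast
      have m: "(\<lambda>p. X (max a (min (c n) (fst p))) (snd p)) \<in> borel_measurable (restrict_space borel {a..u} \<Otimes>\<^sub>M F u)" for n
      proof -
        have 1: "(\<lambda>x. x) \<in> measurable (restrict_space borel {a..u}) borel"
          by (rule measurable_restrict_space1) simp
        have 2: "(\<lambda>x. x) \<in> measurable (F u) (F (c n))"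
          by (rule measurable_from_subalg[of _ "F (c n)"]) (use F_mono[of "c n" u] c[of n] ub in \<open>auto simp: subalgebra_def\<close>)
        have "(\<lambda>p. (fst p, snd p)) \<in> measurable (restrict_space borel {a..u} \<Otimes>\<^sub>M F u) (borel \<Otimes>\<^sub>M F (c n))"
          by (rule measurable_Pair[OF measurable_compose[OF measurable_fst 1] measurable_compose[OF measurable_snd 2]])
        from measurable_compose[OF this progressive_clamped[OF X[OF c[of n]], of "c n"]] c[of n] show ?thesis by simp
      qed
      show ?thesis
      proof (rule borel_measurable_LIMSEQ_metric)
        fix n
        have [measurable]: "(\<lambda>p. fst p) \<in> borel_measurable (restrict_space borel {a..u} \<Otimes>\<^sub>M F u)"
          by (rule measurable_compose[OF measurable_fst measurable_restrict_space1]) simp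
        show "(\<lambda>p. if fst p \<le> c n then X (max a (min (c n) (fst p))) (snd p) else 0)
            \<in> borel_measurable (restrict_space borel {a..u} \<Otimes>\<^sub>M F u)"
          using m[of n] by (intro measurable_If) auto
      next
        fix p assume "p \<in> space (restrict_space borel {a..u} \<Otimes>\<^sub>M F u)"
        then have p: "a \<le> fst p" "fst p \<le> b" using ub by (auto simp: space_pair_measure space_restrict_space)
        show "(\<lambda>n. if fst p \<le> c n then X (max a (min (c n) (fst p))) (snd p) else 0)
           \<longlonglongrightarrow> (case p of (s, \<omega>) \<Rightarrow> if s < b then X s \<omega> else 0)"
        proof (cases "fst p < b")
          case True
          have "\<forall>\<^sub>F n in sequentially. fst p < c n" using order_tendstoD(1)[OF clim True] .
          then have "\<forall>\<^sub>F n in sequentially. (if fst p \<le> c n then X (max a (min (c n) (fst p))) (snd p) else 0) = X (fst p) (snd p)"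
            by eventually_elim (use p in auto)
          then show ?thesis using True by (auto simp: split_beta' intro: tendsto_eventually)
        next
          case False
          then have "\<not> fst p \<le> c n" for n using c[of n] by auto
          then show ?thesis using False by (simp add: split_beta')
        qed
      qed
    next
      case nab: False
      then have "a = b" using u by auto
      have "(\<lambda>p. 0 :: 'b) \<in> borel_measurable (restrict_space borel {a..u} \<Otimes>\<^sub>M F u)" by simp
      also have "?this \<longleftrightarrow> ?thesis"
        using nab u ub by (intro measurable_cong) (auto simp: space_pair_measure space_restrict_space)
      finally show ?thesis .
    qed
  qed
qed

text \<open>Two random variables that are measurable at time \<open>s\<close> are compared by integrating over the event on
  which the inequality fails.\<close>

lemma AE_le_of_integral_le:
  fixes f g :: "'a \<Rightarrow> real"
  assumes s: "s \<le> T" and f: "integrable M f" "f \<in> borel_measurable (F s)" and g: "integrable M g" "g \<in> borel_measurable (F s)"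
    and le: "\<And>H. H \<in> sets (F s) \<Longrightarrow> expectation (\<lambda>\<omega>. indicat_real H \<omega> * f \<omega>) \<le> expectation (\<lambda>\<omega>. indicat_real H \<omega> * g \<omega>)"
  shows "AE \<omega> in M. f \<omega> \<le> g \<omega>"
proof -
  define H where "H = {\<omega> \<in> space (F s). g \<omega> < f \<omega>}"
  have H: "H \<in> sets (F s)" using borel_measurable_less[OF g(2) f(2)] by (simp add: H_def)
  then have HM: "H \<in> sets M" using F_subset_M[OF s] by auto
  have i: "integrable M (\<lambda>\<omega>. indicat_real H \<omega> * f \<omega>)" "integrable M (\<lambda>\<omega>. indicat_real H \<omega> * g \<omega>)"
    using integrable_mult_indicator[OF HM f(1)] integrable_mult_indicator[OF HM g(1)] by simp_all
  let ?d = "\<lambda>\<omega>. indicat_real H \<omega> * f \<omega> - indicat_real H \<omega> * g \<omega>"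
  have nn: "0 \<le> ?d \<omega>" for \<omega> by (auto simp: H_def indicator_def)
  have "expectation ?d \<le> 0" using le[OF H] i by simp
  moreover have "0 \<le> expectation ?d" by (rule Bochner_Integration.integral_nonneg[OF nn])
  ultimately have "expectation ?d = 0" by simp
  then have "AE \<omega> in M. ?d \<omega> = 0"
    using integral_nonneg_eq_0_iff_AE[of M ?d] i nn by auto
  with AE_space show ?thesis
    by eventually_elim (auto simp: H_def indicator_def split: if_splits)
qed

section \<open>Integrability in time and probability\<close>

sublocale time: pair_sigma_finite lborel M ..

lemma AE_swap_time:
  assumes "AE (s, \<omega>) in lborel \<Otimes>\<^sub>M M. Q s \<omega>"
  shows "AE \<omega> in M. AE s in lborel. Q s \<omega>"
proof -
  obtain N where N: "{p \<in> space (lborel \<Otimes>\<^sub>M M). \<not> (case p of (s, \<omega>) \<Rightarrow> Q s \<omega>)} \<subseteq> N"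
     "emeasure (lborel \<Otimes>\<^sub>M M) N = 0" "N \<in> sets (lborel \<Otimes>\<^sub>M M)"
    using assms by (rule AE_E)
  then have "AE p in lborel \<Otimes>\<^sub>M M. p \<notin> N" by (intro AE_not_in) auto
  then have "AE s in lborel. AE \<omega> in M. (s, \<omega>) \<notin> N" by (rule time.AE_pair)
  also have "?this \<longleftrightarrow> (AE \<omega> in M. AE s in lborel. (s, \<omega>) \<notin> N)"
  proof (rule time.AE_commute)
    have "{p \<in> space (lborel \<Otimes>\<^sub>M M). (fst p, snd p) \<notin> N} = space (lborel \<Otimes>\<^sub>M M) - N" by auto
    then show "{p \<in> space (lborel \<Otimes>\<^sub>M M). (fst p, snd p) \<notin> N} \<in> sets (lborel \<Otimes>\<^sub>M M)" using N(3) by (metis sets.compl_sets)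
  qed
  finally have "AE \<omega> in M. AE s in lborel. (s, \<omega>) \<notin> N" .
  with AE_space show ?thesis
  proof eventually_elim
    case (elim \<omega>)
    from elim(2) show ?case
      by eventually_elim (use N(1) elim(1) in \<open>auto simp: space_pair_measure\<close>)
  qed
qed

lemma AE_lift_time:
  assumes "AE \<omega> in M. Q \<omega>"
  shows "AE (s, \<omega>) in lborel \<Otimes>\<^sub>M M. Q \<omega>"
proof -
  obtain N where N: "{\<omega> \<in> space M. \<not> Q \<omega>} \<subseteq> N" "emeasure M N = 0" "N \<in> sets M"
    using assms by (rule AE_E)
  have "AE p in lborel \<Otimes>\<^sub>M M. snd p \<notin> N"
  proof (rule time.AE_pair_measure)
    have "{p \<in> space (lborel \<Otimes>\<^sub>M M). snd p \<notin> N} = space lborel \<times> (space M - N)"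
      by (auto simp: space_pair_measure)
    then show "{p \<in> space (lborel \<Otimes>\<^sub>M M). snd p \<notin> N} \<in> sets (lborel \<Otimes>\<^sub>M M)"
      using N(3) by (metis pair_measureI sets.compl_sets sets.top)
    show "AE s in lborel. AE \<omega> in M. snd (s, \<omega>) \<notin> N" using AE_not_in[of N M] N by auto
  qed
  with AE_space show ?thesis
    by eventually_elim (use N(1) in \<open>auto simp: space_pair_measure\<close>)
qed

definition time_integrable :: "real \<Rightarrow> real \<Rightarrow> (real \<Rightarrow> 'a \<Rightarrow> real) \<Rightarrow> bool" where
  "time_integrable a b h \<longleftrightarrow> integrable (lborel \<Otimes>\<^sub>M M) (\<lambda>(s, \<omega>). indicator {a..b} s * h s \<omega>)"

lemma time_integrableD:
  assumes "time_integrable a b h"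
  shows "AE \<omega> in M. set_integrable lborel {a..b} (\<lambda>s. h s \<omega>)"
    and "integrable M (\<lambda>\<omega>. LINT s:{a..b}|lborel. h s \<omega>)"
    and "AE s in lborel. s \<in> {a..b} \<longrightarrow> integrable M (h s)"
    and "(\<integral>\<omega>. (LINT s:{a..b}|lborel. h s \<omega>) \<partial>M) = (LINT s:{a..b}|lborel. (\<integral>\<omega>. h s \<omega> \<partial>M))"
proof -
  note i = assms[unfolded time_integrable_def]
  show "AE \<omega> in M. set_integrable lborel {a..b} (\<lambda>s. h s \<omega>)"
    using time.AE_integrable_snd[OF i] by (simp add: set_integrable_def)
  show "integrable M (\<lambda>\<omega>. LINT s:{a..b}|lborel. h s \<omega>)"
    using time.integrable_snd[OF i] by (simp add: set_lebesgue_integral_def)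
  show "AE s in lborel. s \<in> {a..b} \<longrightarrow> integrable M (h s)"
    using time.AE_integrable_fst[OF i] by eventually_elim (auto simp: indicator_def)
  show "(\<integral>\<omega>. (LINT s:{a..b}|lborel. h s \<omega>) \<partial>M) = (LINT s:{a..b}|lborel. (\<integral>\<omega>. h s \<omega> \<partial>M))"
    using time.Fubini_integral[OF i] by (simp add: set_lebesgue_integral_def)
qed

lemma time_integrable_cong:
  assumes "\<And>s \<omega>. s \<in> {a..b} \<Longrightarrow> \<omega> \<in> space M \<Longrightarrow> f s \<omega> = g s \<omega>"
  shows "time_integrable a b f \<longleftrightarrow> time_integrable a b g"
  unfolding time_integrable_def
  by (rule Bochner_Integration.integrable_cong[OF refl]) (use assms in \<open>auto simp: space_pair_measure indicator_def\<close>)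

lemma time_integrable_subinterval:
  assumes f: "time_integrable a b f" and ab: "a \<le> a'" "b' \<le> b"
  shows "time_integrable a' b' f"
proof -
  have m: "{a'..b'} \<times> space M \<in> sets (lborel \<Otimes>\<^sub>M M)" by (intro pair_measureI) auto
  have "integrable (lborel \<Otimes>\<^sub>M M) (\<lambda>p. indicat_real ({a'..b'} \<times> space M) p *\<^sub>R (case p of (s, \<omega>) \<Rightarrow> indicator {a..b} s * f s \<omega>))"
    by (rule integrable_mult_indicator[OF m f[unfolded time_integrable_def]])
  then show ?thesis unfolding time_integrable_def
    by (rule Bochner_Integration.integrable_cong[THEN iffD1, OF refl, rotated])
      (use ab in \<open>auto simp: space_pair_measure indicator_def\<close>)
qed

lemma time_integrable_add: "time_integrable a b f \<Longrightarrow> time_integrable a b g \<Longrightarrow> time_integrable a b (\<lambda>s \<omega>. f s \<omega> + g s \<omega>)"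
  unfolding time_integrable_def using Bochner_Integration.integrable_add[of "lborel \<Otimes>\<^sub>M M" "\<lambda>(s, \<omega>). indicator {a..b} s * f s \<omega>" "\<lambda>(s, \<omega>). indicator {a..b} s * g s \<omega>"]
  by (simp add: split_beta' distrib_left)

lemma time_integrable_diff: "time_integrable a b f \<Longrightarrow> time_integrable a b g \<Longrightarrow> time_integrable a b (\<lambda>s \<omega>. f s \<omega> - g s \<omega>)"
  unfolding time_integrable_def using Bochner_Integration.integrable_diff[of "lborel \<Otimes>\<^sub>M M" "\<lambda>(s, \<omega>). indicator {a..b} s * f s \<omega>" "\<lambda>(s, \<omega>). indicator {a..b} s * g s \<omega>"]
  by (simp add: split_beta' right_diff_distrib)

lemma time_integrable_cmult: "time_integrable a b f \<Longrightarrow> time_integrable a b (\<lambda>s \<omega>. c * f s \<omega>)"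
  unfolding time_integrable_def using integrable_mult_right[of c "lborel \<Otimes>\<^sub>M M" "\<lambda>(s, \<omega>). indicator {a..b} s * f s \<omega>"]
  by (simp add: split_beta' mult.left_commute)

lemma time_integrable_abs: "time_integrable a b f \<Longrightarrow> time_integrable a b (\<lambda>s \<omega>. \<bar>f s \<omega>\<bar>)"
  unfolding time_integrable_def using integrable_abs[of "lborel \<Otimes>\<^sub>M M" "\<lambda>(s, \<omega>). indicator {a..b} s * f s \<omega>"]
  by (simp add: split_beta' abs_mult)

lemma time_integrable_bound_measurable:
  assumes g: "time_integrable a b g"
    and f: "(\<lambda>(s, \<omega>). indicator {a..b} s * f s \<omega>) \<in> borel_measurable (lborel \<Otimes>\<^sub>M M)"
    and le: "AE (s, \<omega>) in lborel \<Otimes>\<^sub>M M. s \<in> {a..b} \<longrightarrow> \<bar>f s \<omega>\<bar> \<le> g s \<omega>"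
  shows "time_integrable a b f"
  unfolding time_integrable_def
proof (rule Bochner_Integration.integrable_bound[OF g[unfolded time_integrable_def] f])
  show "AE p in lborel \<Otimes>\<^sub>M M. norm (case p of (s, \<omega>) \<Rightarrow> indicator {a..b} s * f s \<omega>)
       \<le> norm (case p of (s, \<omega>) \<Rightarrow> indicator {a..b} s * g s \<omega>)"
    using le
  proof eventually_elim
    case (elim p)
    then show ?case by (cases p; cases "fst p \<in> {a..b}") (auto simp: abs_mult)
  qed
qed

lemma time_integrable_bound:
  assumes g: "time_integrable a b g" and f: "progressive F a b f" and b: "b \<le> T"
    and le: "AE (s, \<omega>) in lborel \<Otimes>\<^sub>M M. s \<in> {a..b} \<longrightarrow> \<bar>f s \<omega>\<bar> \<le> g s \<omega>"
  shows "time_integrable a b f"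
  using progressive_jointly_measurable[OF f b] by (intro time_integrable_bound_measurable[OF g _ le]) simp

lemma time_integrable_const: "time_integrable a b (\<lambda>s \<omega>. c)"
proof -
  have i: "integrable lborel (\<lambda>s. indicator {a..b} s * c)"
    using integrable_indicator_Icc by simp
  have "integrable (lborel \<Otimes>\<^sub>M M) (\<lambda>(s, \<omega>). indicator {a..b} s * c)"
    by (rule time.Fubini_integrable) (use i in \<open>auto simp: abs_mult prob_space\<close>)
  then show ?thesis by (simp add: time_integrable_def)
qed

lemma time_integrable_random:
  assumes "integrable M \<phi>"
  shows "time_integrable a b (\<lambda>s. \<phi>)"
proof -
  have [measurable]: "\<phi> \<in> borel_measurable M" using assms by simp
  have "integrable (lborel \<Otimes>\<^sub>M M) (\<lambda>(s, \<omega>). indicator {a..b} s * \<phi> \<omega>)"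
    by (rule time.Fubini_integrable) (use assms integrable_indicator_Icc in \<open>auto simp: abs_mult\<close>)
  then show ?thesis by (simp add: time_integrable_def)
qed

lemma expectation_LINT:
  assumes "time_integrable a b h"
  shows "expectation (\<lambda>\<omega>. LINT s:{a..b}|lborel. h s \<omega>) = (\<integral>p. (case p of (s, \<omega>) \<Rightarrow> indicator {a..b} s * h s \<omega>) \<partial>(lborel \<Otimes>\<^sub>M M))"
  using time.integral_snd[OF assms[unfolded time_integrable_def]] unfolding set_lebesgue_integral_def real_scaleR_def .

lemma expectation_LINT_add:
  assumes "time_integrable a b f" "time_integrable a b g"
  shows "expectation (\<lambda>\<omega>. LINT s:{a..b}|lborel. f s \<omega> + g s \<omega>)
    = expectation (\<lambda>\<omega>. LINT s:{a..b}|lborel. f s \<omega>) + expectation (\<lambda>\<omega>. LINT s:{a..b}|lborel. g s \<omega>)"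
proof -
  have "(\<lambda>(s, \<omega>). indicat_real {a..b} s * (f s \<omega> + g s \<omega>))
     = (\<lambda>p. (case p of (s, \<omega>) \<Rightarrow> indicat_real {a..b} s * f s \<omega>) + (case p of (s, \<omega>) \<Rightarrow> indicat_real {a..b} s * g s \<omega>))"
    by (rule ext) (simp add: split_beta distrib_left)
  then show ?thesis
    unfolding expectation_LINT[OF assms(1)] expectation_LINT[OF assms(2)] expectation_LINT[OF time_integrable_add[OF assms]]
    using Bochner_Integration.integral_add[OF assms[unfolded time_integrable_def]] by (simp only:)
qed

lemma expectation_LINT_cmult:
  fixes c :: real
  shows "expectation (\<lambda>\<omega>. LINT s:{a..b}|lborel. c * f s \<omega>) = c * expectation (\<lambda>\<omega>. LINT s:{a..b}|lborel. f s \<omega>)"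
  unfolding set_integral_mult_right by (rule integral_mult_right_zero)

lemma time_integrable_of_square:
  assumes f: "progressive F a b f" "time_integrable a b (\<lambda>s \<omega>. (f s \<omega>)\<^sup>2)" and b: "b \<le> T"
  shows "time_integrable a b f"
proof (rule time_integrable_bound[OF time_integrable_add[OF time_integrable_const[of a b 1] f(2)] f(1) b])
  have "\<bar>z\<bar> \<le> 1 + z\<^sup>2" for z :: real using abs_mult_le_squares[of 1 z] by simp
  then show "AE (s, \<omega>) in lborel \<Otimes>\<^sub>M M. s \<in> {a..b} \<longrightarrow> \<bar>f s \<omega>\<bar> \<le> 1 + (f s \<omega>)\<^sup>2" by (intro AE_I2) auto
qed

text \<open>Fatou's lemma along \<open>{a..c n}\<close> with \<open>c n\<close> tending to \<open>b\<close> from below.\<close>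

lemma time_integrable_up_to:
  assumes f: "progressive F a b f" and ab: "a < b" "b \<le> T"
    and nn: "\<And>s \<omega>. 0 \<le> f s \<omega>"
    and i: "\<And>c. c \<in> {a..<b} \<Longrightarrow> time_integrable a c f"
    and le: "\<And>c. c \<in> {a..<b} \<Longrightarrow> expectation (\<lambda>\<omega>. LINT s:{a..c}|lborel. f s \<omega>) \<le> R"
  shows "time_integrable a b f"
proof -
  let ?P = "lborel \<Otimes>\<^sub>M M"
  obtain c :: "nat \<Rightarrow> real" where c: "\<And>n. c n \<in> {a..<b}" "c \<longlonglongrightarrow> b"
    using sequence_from_below[OF ab(1)] by blast
  define u where "u n p = indicat_real {a..c n} (fst p) * f (fst p) (snd p)" for n p
  have iu: "integrable ?P (u n)" for n
    using i[OF c(1)[of n]] by (simp add: time_integrable_def u_def[abs_def] split_beta')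
  have "(\<integral>\<^sup>+ p. ennreal (u n p) \<partial>?P) \<le> ennreal R" for n
  proof -
    have "(\<integral>\<^sup>+ p. ennreal (u n p) \<partial>?P) = ennreal (\<integral>p. u n p \<partial>?P)"
      by (rule nn_integral_eq_integral[OF iu]) (use nn in \<open>auto simp: u_def\<close>)
    also have "(\<integral>p. u n p \<partial>?P) = expectation (\<lambda>\<omega>. LINT s:{a..c n}|lborel. f s \<omega>)"
      unfolding expectation_LINT[OF i[OF c(1)[of n]]] by (simp add: u_def split_beta')
    finally show ?thesis using le[OF c(1)[of n]] by (simp add: ennreal_leI)
  qed
  then have lim: "liminf (\<lambda>n. \<integral>\<^sup>+ p. ennreal (u n p) \<partial>?P) \<le> ennreal R"
    by (intro Liminf_le) auto
  have m: "(\<lambda>(s, \<omega>). indicator {a..b} s * f s \<omega>) \<in> borel_measurable ?P"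
    using progressive_jointly_measurable[OF f ab(2)] by simp
  have neq: "AE p in ?P. fst p \<noteq> b"
  proof (rule time.AE_pair_measure)
    have "{p \<in> space ?P. fst p \<noteq> b} = (space lborel - {b}) \<times> space M" by (auto simp: space_pair_measure)
    then show "{p \<in> space ?P. fst p \<noteq> b} \<in> sets ?P" by (auto intro!: pair_measureI)
    show "AE s in lborel. AE \<omega> in M. fst (s, \<omega>) \<noteq> b" using AE_lborel_singleton[of b] by eventually_elim simp
  qed
  have "(\<integral>\<^sup>+ p. ennreal (norm (case p of (s, \<omega>) \<Rightarrow> indicator {a..b} s * f s \<omega>)) \<partial>?P)
     \<le> (\<integral>\<^sup>+ p. liminf (\<lambda>n. ennreal (u n p)) \<partial>?P)"
  proof (rule nn_integral_mono_AE)
    show "AE p in ?P. ennreal (norm (case p of (s, \<omega>) \<Rightarrow> indicator {a..b} s * f s \<omega>)) \<le> liminf (\<lambda>n. ennreal (u n p))"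
      using neq
    proof eventually_elim
      case (elim p)
      obtain s \<omega> where p: "p = (s, \<omega>)" by (cases p)
      have "(\<lambda>n. u n p) \<longlonglongrightarrow> indicator {a..b} s * f s \<omega>"
      proof (cases "s < b")
        case True
        then have "\<forall>\<^sub>F n in sequentially. s < c n" by (rule order_tendstoD(1)[OF c(2)])
        then have "\<forall>\<^sub>F n in sequentially. u n p = indicator {a..b} s * f s \<omega>"
          by eventually_elim (use True in \<open>auto simp: u_def p indicator_def\<close>)
        then show ?thesis by (rule tendsto_eventually)
      next
        case False
        then have "s > b" using elim p by simp
        moreover have "c n < b" for n using c(1)[of n] by simp
        ultimately have "u n p = indicator {a..b} s * f s \<omega>" for n
          by (auto simp: u_def p indicator_def) (meson less_le_trans less_asym not_le)
        then show ?thesis by simp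
      qed
      then have "(\<lambda>n. ennreal (u n p)) \<longlonglongrightarrow> ennreal (indicator {a..b} s * f s \<omega>)" by (rule tendsto_ennrealI)
      then have "liminf (\<lambda>n. ennreal (u n p)) = ennreal (indicator {a..b} s * f s \<omega>)" by (intro lim_imp_Liminf) auto
      then show ?case using nn by (simp add: p)
    qed
  qed
  also have "\<dots> \<le> liminf (\<lambda>n. \<integral>\<^sup>+ p. ennreal (u n p) \<partial>?P)"
    by (rule nn_integral_liminf) (use iu in auto)
  also have "\<dots> \<le> ennreal R" by (rule lim)
  also have "\<dots> < \<infinity>" by simp
  finally show ?thesis unfolding time_integrable_def by (intro integrableI_bounded m)
qed

text \<open>By Tonelli's theorem the iterated integral in \<^const>\<open>L2_prog\<close> is an integral over the product space.\<close>

lemma L2_prog_iff: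
  fixes X :: "real \<Rightarrow> 'a \<Rightarrow> 'b::euclidean_space"
  assumes b: "b \<le> T"
  shows "L2_prog M F a b X \<longleftrightarrow> progressive F a b X \<and> time_integrable a b (\<lambda>s \<omega>. (norm (X s \<omega>))\<^sup>2)"
proof (cases "progressive F a b X")
  case True
  have p: "progressive F a b (\<lambda>s \<omega>. (norm (X s \<omega>))\<^sup>2)"
    by (rule progressive_compose[OF True]) simp
  have m: "(\<lambda>(s, \<omega>). indicator {a..b} s * (norm (X s \<omega>))\<^sup>2) \<in> borel_measurable (lborel \<Otimes>\<^sub>M M)"
    using progressive_jointly_measurable[OF p b] by simp
  have "(\<integral>\<^sup>+ \<omega>. (\<integral>\<^sup>+ s\<in>{a..b}. ennreal ((norm (X s \<omega>))\<^sup>2) \<partial>lborel) \<partial>M)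
     = (\<integral>\<^sup>+ \<omega>. (\<integral>\<^sup>+ s. (\<lambda>(s, \<omega>). ennreal (indicator {a..b} s * (norm (X s \<omega>))\<^sup>2)) (s, \<omega>) \<partial>lborel) \<partial>M)"
    by (auto intro!: nn_integral_cong split: split_indicator)
  also have "\<dots> = (\<integral>\<^sup>+ p. (case p of (s, \<omega>) \<Rightarrow> ennreal (indicator {a..b} s * (norm (X s \<omega>))\<^sup>2)) \<partial>(lborel \<Otimes>\<^sub>M M))"
    by (rule time.nn_integral_snd) (use m in \<open>simp add: split_beta'\<close>)
  also have "\<dots> = (\<integral>\<^sup>+ p. ennreal (norm (case p of (s, \<omega>) \<Rightarrow> indicator {a..b} s * (norm (X s \<omega>))\<^sup>2)) \<partial>(lborel \<Otimes>\<^sub>M M))"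
    by (auto intro!: nn_integral_cong)
  finally show ?thesis
    using True m by (simp add: L2_prog_def time_integrable_def integrable_iff_bounded)
qed (simp add: L2_prog_def)

lemma L2_progD:
  fixes \<xi> :: "real \<Rightarrow> 'a \<Rightarrow> real"
  assumes "b \<le> T" "L2_prog M F t b \<xi>"
  shows "progressive F t b \<xi>" "time_integrable t b (\<lambda>s \<omega>. (\<xi> s \<omega>)\<^sup>2)"
  using assms L2_prog_iff[OF assms(1), of t \<xi>] by auto

lemma L2_prog_subinterval:
  fixes \<xi> :: "real \<Rightarrow> 'a \<Rightarrow> real"
  assumes \<xi>: "L2_prog M F a b \<xi>" and ab: "a \<le> a'" "b' \<le> b" "b \<le> T"
  shows "L2_prog M F a' b' \<xi>"
proof -
  have "b' \<le> T" using ab by simp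
  then show ?thesis
    using \<xi> L2_prog_iff[OF ab(3), of a \<xi>] L2_prog_iff[of b' a' \<xi>] progressive_subinterval[OF _ ab(1,2), of F \<xi>]
      time_integrable_subinterval[OF _ ab(1,2), of "\<lambda>s \<omega>. (norm (\<xi> s \<omega>))\<^sup>2"] by blast
qed

section \<open>Ito integrals: martingale property and isometry\<close>

text \<open>The events that agree with an event of the natural filtration up to a null set form a
  sigma-algebra, which contains the generators and all null sets. The independence of increments,
  which is assumed for the natural filtration, thereby carries over to the augmented one.\<close>

lemma augmented_event_approx:
  assumes "H \<in> sets (F s)"
  shows "\<exists>H'\<in>sigma_sets (space M) (generators s). AE \<omega> in M. \<omega> \<in> H \<longleftrightarrow> \<omega> \<in> H'"
  using assms unfolding sets_F
proof (induction rule: sigma_sets.induct)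
  case (Basic H)
  then show ?case
  proof
    assume "H \<in> generators s" then show ?thesis by (intro bexI[of _ H]) (auto intro: sigma_sets.Basic)
  next
    assume "H \<in> null_sets M"
    then have "AE \<omega> in M. \<omega> \<notin> H" by (rule AE_not_in)
    then show ?thesis by (intro bexI[of _ "{}"]) (auto intro: sigma_sets.Empty)
  qed
next
  case Empty
  then show ?case by (intro bexI[of _ "{}"]) (auto intro: sigma_sets.Empty)
next
  case (Compl H)
  then obtain H' where H': "H' \<in> sigma_sets (space M) (generators s)" "AE \<omega> in M. \<omega> \<in> H \<longleftrightarrow> \<omega> \<in> H'" by blast
  show ?case
    by (rule bexI[OF _ sigma_sets.Compl[OF H'(1)]]) (use H'(2) in auto)
next
  case (Union H)
  then obtain H' where H': "\<And>n. H' n \<in> sigma_sets (space M) (generators s)"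
    "\<And>n::nat. AE \<omega> in M. \<omega> \<in> H n \<longleftrightarrow> \<omega> \<in> H' n" by metis
  have "AE \<omega> in M. \<forall>n. \<omega> \<in> H n \<longleftrightarrow> \<omega> \<in> H' n" using H'(2) by (simp add: AE_all_countable)
  then have "AE \<omega> in M. \<omega> \<in> (\<Union>n. H n) \<longleftrightarrow> \<omega> \<in> (\<Union>n. H' n)" by eventually_elim auto
  then show ?case by (rule bexI[OF _ sigma_sets.Union[OF H'(1)]])
qed

lemma sets_natural: "sets (natural_filtration M W s) = sigma_sets (space M) (generators s)"
  unfolding natural_filtration_def generators_def[symmetric]
  by (rule sets_measure_of) (auto simp: generators_def)

lemma increment_indep_augmented:
  assumes st: "0 \<le> s" "s < t" "t \<le> T"
  shows "indep_set (sets (F s)) (sets (vimage_algebra (space M) (\<lambda>\<omega>. W t \<omega> - W s \<omega>) borel))"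
proof -
  let ?B = "sets (vimage_algebra (space M) (\<lambda>\<omega>. W t \<omega> - W s \<omega>) borel)"
  have ind: "indep_set (sets (natural_filtration M W s)) ?B"
    using brownian st unfolding standard_brownian_motion_def by blast
  show ?thesis unfolding indep_sets2_eq
  proof (intro conjI ballI)
    show "sets (F s) \<subseteq> events" using F_subset_M st by auto
    show B: "?B \<subseteq> events" using ind unfolding indep_sets2_eq by blast
    fix H G assume H: "H \<in> sets (F s)" and G: "G \<in> ?B"
    obtain H' where H': "H' \<in> sets (natural_filtration M W s)" and ae: "AE \<omega> in M. \<omega> \<in> H \<longleftrightarrow> \<omega> \<in> H'"
      using augmented_event_approx[OF H] unfolding sets_natural by blast
    have ev: "H \<in> events" "H' \<in> events" "G \<in> events"
      using H H' G B F_subset_M[of s] st ind unfolding indep_sets2_eq by auto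
    have "prob (H \<inter> G) = prob (H' \<inter> G)" using ae ev by (intro measure_eq_AE) auto
    also have "\<dots> = prob H' * prob G" using ind H' G unfolding indep_sets2_eq by blast
    also have "prob H' = prob H" using ae ev by (intro measure_eq_AE) auto
    finally show "prob (H \<inter> G) = prob H * prob G" .
  qed
qed

lemma increment_indep_var:
  assumes st: "0 \<le> s" "s < t" "t \<le> T" and \<phi>: "\<phi> \<in> borel_measurable (F s)" and g: "g \<in> borel_measurable borel"
  shows "indep_var borel \<phi> borel (\<lambda>\<omega>. g (W t \<omega> - W s \<omega>) :: real)"
  unfolding indep_var_eq
proof (intro conjI)
  have W: "W r \<in> borel_measurable M" if "r \<in> {0..T}" for r
    using brownian that unfolding standard_brownian_motion_def by blast
  then have D: "(\<lambda>\<omega>. W t \<omega> - W s \<omega>) \<in> borel_measurable M" using st by (intro borel_measurable_diff W) auto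
  show "\<phi> \<in> borel_measurable M" using borel_measurable_F_M[OF \<phi>] st by simp
  show "(\<lambda>\<omega>. g (W t \<omega> - W s \<omega>)) \<in> borel_measurable M" by (rule measurable_compose[OF D g])
  have 1: "sigma_sets (space M) {\<phi> -` A \<inter> space M |A. A \<in> sets borel} \<subseteq> sets (F s)"
    using sets.sigma_sets_subset[of "{\<phi> -` A \<inter> space M |A. A \<in> sets borel}" "F s"] measurable_sets[OF \<phi>] by auto
  have 2: "sigma_sets (space M) {(\<lambda>\<omega>. g (W t \<omega> - W s \<omega>)) -` A \<inter> space M |A. A \<in> sets borel}
       \<subseteq> sets (vimage_algebra (space M) (\<lambda>\<omega>. W t \<omega> - W s \<omega>) borel)"
  proof -
    have "(\<lambda>\<omega>. g (W t \<omega> - W s \<omega>)) -` A \<inter> space M \<in> sets (vimage_algebra (space M) (\<lambda>\<omega>. W t \<omega> - W s \<omega>) borel)"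
      if "A \<in> sets borel" for A
    proof -
      have "g -` A \<inter> space borel \<in> sets borel" by (rule measurable_sets[OF g that])
      then have "(\<lambda>\<omega>. W t \<omega> - W s \<omega>) -` (g -` A \<inter> space borel) \<inter> space M
          \<in> sets (vimage_algebra (space M) (\<lambda>\<omega>. W t \<omega> - W s \<omega>) borel)"
        by (rule in_vimage_algebra)
      also have "(\<lambda>\<omega>. W t \<omega> - W s \<omega>) -` (g -` A \<inter> space borel) \<inter> space M = (\<lambda>\<omega>. g (W t \<omega> - W s \<omega>)) -` A \<inter> space M"
        by auto
      finally show ?thesis .
    qed
    then show ?thesis
      using sets.sigma_sets_subset[of "{(\<lambda>\<omega>. g (W t \<omega> - W s \<omega>)) -` A \<inter> space M |A. A \<in> sets borel}"
         "vimage_algebra (space M) (\<lambda>\<omega>. W t \<omega> - W s \<omega>) borel"] by auto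
  qed
  show "indep_set (sigma_sets (space M) {\<phi> -` A \<inter> space M |A. A \<in> sets borel})
      (sigma_sets (space M) {(\<lambda>\<omega>. g (W t \<omega> - W s \<omega>)) -` A \<inter> space M |A. A \<in> sets borel})"
    using increment_indep_augmented[OF st] 1 2 unfolding indep_sets2_eq by blast
qed

lemma increment_moments:
  assumes st: "0 \<le> s" "s < t" "t \<le> T"
  shows "integrable M (\<lambda>\<omega>. (W t \<omega> - W s \<omega>) $ i)" "expectation (\<lambda>\<omega>. (W t \<omega> - W s \<omega>) $ i) = 0"
    and "integrable M (\<lambda>\<omega>. (W t \<omega> - W s \<omega>) $ i * (W t \<omega> - W s \<omega>) $ j)"
    and "expectation (\<lambda>\<omega>. (W t \<omega> - W s \<omega>) $ i * (W t \<omega> - W s \<omega>) $ j) = (if i = j then t - s else 0)"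
proof -
  define D where "D i \<omega> = (W t \<omega> - W s \<omega>) $ i" for i \<omega>
  have d: "distributed M lborel (D i) (normal_density 0 (sqrt (t - s)))" for i
    using brownian st unfolding standard_brownian_motion_def D_def by blast
  have sp: "0 < sqrt (t - s)" using st by simp
  have i1: "integrable M (D i)" for i
    using distributed_integrable[OF d, of "\<lambda>x. x" i] integrable_normal_moment[OF sp, of 0 1] by simp
  have e1: "expectation (D i) = 0" for i
    using distributed_integral[OF d, of "\<lambda>x. x" i] integral_normal_moment_odd[OF sp, of 0 0] by simp
  have i2: "integrable M (\<lambda>\<omega>. (D i \<omega>)\<^sup>2)" for i
    using distributed_integrable[OF d, of "\<lambda>x. x\<^sup>2" i] integrable_normal_moment[OF sp, of 0 2] by simp
  have e2: "expectation (\<lambda>\<omega>. (D i \<omega>)\<^sup>2) = t - s" for i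
    using distributed_integral[OF d, of "\<lambda>x. x\<^sup>2" i] integral_normal_moment_even[OF sp, of 0 1] st
    by (simp add: fact_numeral)
  show "integrable M (\<lambda>\<omega>. (W t \<omega> - W s \<omega>) $ i)" "expectation (\<lambda>\<omega>. (W t \<omega> - W s \<omega>) $ i) = 0"
    using i1[of i] e1[of i] unfolding D_def[abs_def] by simp_all
  have "integrable M (\<lambda>\<omega>. D i \<omega> * D j \<omega>) \<and> expectation (\<lambda>\<omega>. D i \<omega> * D j \<omega>) = (if i = j then t - s else 0)"
  proof (cases "i = j")
    case True
    then show ?thesis using i2[of j] e2[of j] by (simp add: power2_eq_square)
  next
    case False
    have "indep_vars (\<lambda>_. borel) (\<lambda>i \<omega>. (W t \<omega> - W s \<omega>) $ i) UNIV"
      using brownian st unfolding standard_brownian_motion_def by blast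
    then have "indep_vars (\<lambda>_. borel) D UNIV" by (simp only: D_def[abs_def])
    then have iv: "indep_vars (\<lambda>_. borel) D {i, j}" by (rule indep_vars_subset) simp
    show ?thesis
      using indep_vars_lebesgue_integral[OF _ iv i1] indep_vars_integrable[OF _ iv i1] False e1 by simp
  qed
  then show "integrable M (\<lambda>\<omega>. (W t \<omega> - W s \<omega>) $ i * (W t \<omega> - W s \<omega>) $ j)"
    "expectation (\<lambda>\<omega>. (W t \<omega> - W s \<omega>) $ i * (W t \<omega> - W s \<omega>) $ j) = (if i = j then t - s else 0)"
    unfolding D_def by simp_all
qed

lemma adapted_W:
  assumes "0 \<le> r" "r \<le> s" "r \<le> T"
  shows "W r \<in> borel_measurable (F s)"
proof (rule measurableI)
  fix A :: "(real ^ 'm) set" assume "A \<in> sets borel"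
  then have "W r -` A \<inter> space M \<in> generators s" unfolding generators_def using assms by auto
  then show "W r -` A \<inter> space (F s) \<in> sets (F s)" unfolding sets_F by (auto intro: sigma_sets.Basic)
qed simp

definition increment_term :: "('a \<Rightarrow> real ^ 'm) \<Rightarrow> real \<Rightarrow> real \<Rightarrow> 'a \<Rightarrow> real" where
  "increment_term \<phi> a b \<omega> = \<phi> \<omega> \<bullet> (W b \<omega> - W a \<omega>)"

definition bounded_at :: "real \<Rightarrow> ('a \<Rightarrow> real ^ 'm) \<Rightarrow> bool" where
  "bounded_at a \<phi> \<longleftrightarrow> \<phi> \<in> borel_measurable (F a) \<and> (\<exists>K. \<forall>\<omega>\<in>space M. norm (\<phi> \<omega>) \<le> K)"

lemma bounded_at_mono: "bounded_at a \<phi> \<Longrightarrow> a \<le> b \<Longrightarrow> bounded_at b \<phi>"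
  unfolding bounded_at_def using borel_measurable_F_mono by blast

lemma bounded_at_integrable:
  assumes "bounded_at a \<phi>" "bounded_at b \<psi>" "a \<le> T" "b \<le> T"
  shows "integrable M \<phi>" "integrable M (\<lambda>\<omega>. \<phi> \<omega> \<bullet> \<psi> \<omega>)"
proof -
  obtain K where K: "\<And>\<omega>. \<omega> \<in> space M \<Longrightarrow> norm (\<phi> \<omega>) \<le> K" and m: "\<phi> \<in> borel_measurable M"
    using assms borel_measurable_F_M unfolding bounded_at_def by metis
  obtain L where L: "\<And>\<omega>. \<omega> \<in> space M \<Longrightarrow> norm (\<psi> \<omega>) \<le> L" and m': "\<psi> \<in> borel_measurable M"
    using assms borel_measurable_F_M unfolding bounded_at_def by metis
  show "integrable M \<phi>" using K m by (intro integrable_const_bound[of _ K]) auto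
  have "norm (\<phi> \<omega> \<bullet> \<psi> \<omega>) \<le> K * L" if "\<omega> \<in> space M" for \<omega>
    using Cauchy_Schwarz_ineq2[of "\<phi> \<omega>" "\<psi> \<omega>"] mult_mono[OF K[OF that] L[OF that]] K[OF that]
    by (auto intro: order_trans simp: order_trans[OF norm_ge_zero])
  then show "integrable M (\<lambda>\<omega>. \<phi> \<omega> \<bullet> \<psi> \<omega>)" using m m' by (intro integrable_const_bound[of _ "K * L"]) auto
qed

text \<open>Stated for integrable integrands, because in \<open>increment_term_orthogonal\<close> the integrand is a bounded
  variable multiplied by an earlier increment.\<close>

lemma increment_term_mean_zero:
  assumes ab: "0 \<le> a" "a \<le> b" "b \<le> T" and \<psi>: "\<psi> \<in> borel_measurable (F a)" "integrable M \<psi>"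
  shows "integrable M (increment_term \<psi> a b)" "expectation (increment_term \<psi> a b) = 0"
proof -
  have "integrable M (increment_term \<psi> a b) \<and> expectation (increment_term \<psi> a b) = 0"
  proof (cases "a = b")
    case True
    then show ?thesis by (simp add: increment_term_def[abs_def])
  next
    case False
    then have ab': "a < b" using ab by simp
    have *: "integrable M (\<lambda>\<omega>. \<psi> \<omega> $ i * (W b \<omega> - W a \<omega>) $ i)
        \<and> expectation (\<lambda>\<omega>. \<psi> \<omega> $ i * (W b \<omega> - W a \<omega>) $ i) = 0" for i
    proof -
      have "(\<lambda>\<omega>. \<psi> \<omega> $ i) \<in> borel_measurable (F a)" by (rule measurable_compose[OF \<psi>(1)]) simp
      then have iv: "indep_var borel (\<lambda>\<omega>. \<psi> \<omega> $ i) borel (\<lambda>\<omega>. (W b \<omega> - W a \<omega>) $ i)"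
        using increment_indep_var[OF ab(1) ab' ab(3), of _ "\<lambda>x. x $ i"] by simp
      have i: "integrable M (\<lambda>\<omega>. \<psi> \<omega> $ i)" by (rule integrable_bounded_linear[OF bounded_linear_vec_nth \<psi>(2)])
      show ?thesis
        using indep_var_integrable[OF iv i increment_moments(1)[OF ab(1) ab' ab(3)]]
          indep_var_lebesgue_integral[OF iv i increment_moments(1)[OF ab(1) ab' ab(3)]]
          increment_moments(2)[OF ab(1) ab' ab(3), of i] by simp
    qed
    then show ?thesis
      by (simp add: increment_term_def[abs_def] inner_vec_def Bochner_Integration.integral_sum Bochner_Integration.integrable_sum)
  qed
  then show "integrable M (increment_term \<psi> a b)" "expectation (increment_term \<psi> a b) = 0" by auto
qed

text \<open>The product is a double sum over components. In each summand the integrand components are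
  independent of the increment components, and the product of the latter has mean \<open>b - a\<close> on the
  diagonal and \<open>0\<close> off it.\<close>

lemma increment_term_second_moment:
  assumes ab: "0 \<le> a" "a \<le> b" "b \<le> T" and \<phi>: "bounded_at a \<phi>" and \<psi>: "bounded_at a \<psi>"
  shows "integrable M (\<lambda>\<omega>. increment_term \<phi> a b \<omega> * increment_term \<psi> a b \<omega>)"
    and "expectation (\<lambda>\<omega>. increment_term \<phi> a b \<omega> * increment_term \<psi> a b \<omega>)
       = (b - a) * expectation (\<lambda>\<omega>. \<phi> \<omega> \<bullet> \<psi> \<omega>)"
proof -
  have "integrable M (\<lambda>\<omega>. increment_term \<phi> a b \<omega> * increment_term \<psi> a b \<omega>)
    \<and> expectation (\<lambda>\<omega>. increment_term \<phi> a b \<omega> * increment_term \<psi> a b \<omega>)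
       = (b - a) * expectation (\<lambda>\<omega>. \<phi> \<omega> \<bullet> \<psi> \<omega>)"
  proof (cases "a = b")
    case True
    then show ?thesis by (simp add: increment_term_def[abs_def])
  next
    case False
    then have ab': "a < b" using ab by simp
    note abs = ab(1) ab' ab(3)
    obtain K where K: "\<And>\<omega>. \<omega> \<in> space M \<Longrightarrow> norm (\<phi> \<omega>) \<le> K" and m: "\<phi> \<in> borel_measurable (F a)"
      using \<phi> unfolding bounded_at_def by metis
    obtain L where L: "\<And>\<omega>. \<omega> \<in> space M \<Longrightarrow> norm (\<psi> \<omega>) \<le> L" and m': "\<psi> \<in> borel_measurable (F a)"
      using \<psi> unfolding bounded_at_def by metis
    let ?D = "\<lambda>i \<omega>. (W b \<omega> - W a \<omega>) $ i"
    have mij: "(\<lambda>\<omega>. \<phi> \<omega> $ i * \<psi> \<omega> $ j) \<in> borel_measurable (F a)" for i j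
      using m m' by (intro borel_measurable_times measurable_compose[OF m] measurable_compose[OF m']) auto
    have iij: "integrable M (\<lambda>\<omega>. \<phi> \<omega> $ i * \<psi> \<omega> $ j)" for i j
    proof (rule integrable_const_bound[of _ "K * L"])
      show "AE \<omega> in M. norm (\<phi> \<omega> $ i * \<psi> \<omega> $ j) \<le> K * L"
      proof (rule AE_I2)
        fix \<omega> assume \<omega>: "\<omega> \<in> space M"
        have "\<bar>\<phi> \<omega> $ i\<bar> \<le> K" "\<bar>\<psi> \<omega> $ j\<bar> \<le> L"
          using K[OF \<omega>] L[OF \<omega>] component_le_norm_cart[of "\<phi> \<omega>" i] component_le_norm_cart[of "\<psi> \<omega>" j] by auto
        then show "norm (\<phi> \<omega> $ i * \<psi> \<omega> $ j) \<le> K * L" by (auto simp: abs_mult intro!: mult_mono)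
      qed
      show "(\<lambda>\<omega>. \<phi> \<omega> $ i * \<psi> \<omega> $ j) \<in> borel_measurable M"
        by (rule borel_measurable_F_M[OF mij]) (use ab in auto)
    qed
    have *: "integrable M (\<lambda>\<omega>. (\<phi> \<omega> $ i * \<psi> \<omega> $ j) * (?D i \<omega> * ?D j \<omega>))
        \<and> expectation (\<lambda>\<omega>. (\<phi> \<omega> $ i * \<psi> \<omega> $ j) * (?D i \<omega> * ?D j \<omega>))
          = expectation (\<lambda>\<omega>. \<phi> \<omega> $ i * \<psi> \<omega> $ j) * (if i = j then b - a else 0)" for i j
    proof -
      have iv: "indep_var borel (\<lambda>\<omega>. \<phi> \<omega> $ i * \<psi> \<omega> $ j) borel (\<lambda>\<omega>. ?D i \<omega> * ?D j \<omega>)"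
        using increment_indep_var[OF abs mij, of "\<lambda>x. x $ i * x $ j"] by simp
      show ?thesis
        using indep_var_integrable[OF iv iij increment_moments(3)[OF abs]]
          indep_var_lebesgue_integral[OF iv iij increment_moments(3)[OF abs]]
          increment_moments(4)[OF abs, of i j] by simp
    qed
    have eq: "increment_term \<phi> a b \<omega> * increment_term \<psi> a b \<omega>
        = (\<Sum>i\<in>UNIV. \<Sum>j\<in>UNIV. (\<phi> \<omega> $ i * \<psi> \<omega> $ j) * (?D i \<omega> * ?D j \<omega>))" for \<omega>
      unfolding increment_term_def inner_vec_def sum_product by (simp add: ac_simps)
    have "expectation (\<lambda>\<omega>. increment_term \<phi> a b \<omega> * increment_term \<psi> a b \<omega>)
       = (\<Sum>i\<in>UNIV. \<Sum>j\<in>UNIV. expectation (\<lambda>\<omega>. (\<phi> \<omega> $ i * \<psi> \<omega> $ j) * (?D i \<omega> * ?D j \<omega>)))"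
      unfolding eq using * by (subst Bochner_Integration.integral_sum, fastforce, subst Bochner_Integration.integral_sum) auto
    also have "\<dots> = (\<Sum>i\<in>UNIV. \<Sum>j\<in>UNIV. expectation (\<lambda>\<omega>. \<phi> \<omega> $ i * \<psi> \<omega> $ j) * (if i = j then b - a else 0))"
      using * by simp
    also have "\<dots> = (\<Sum>i\<in>UNIV. expectation (\<lambda>\<omega>. \<phi> \<omega> $ i * \<psi> \<omega> $ i)) * (b - a)"
      by (simp add: sum_distrib_right if_distrib[of "\<lambda>z. _ * z"] cong: if_cong)
    also have "(\<Sum>i\<in>UNIV. expectation (\<lambda>\<omega>. \<phi> \<omega> $ i * \<psi> \<omega> $ i)) = expectation (\<lambda>\<omega>. \<phi> \<omega> \<bullet> \<psi> \<omega>)"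
      unfolding inner_vec_def using iij by simp
    finally show ?thesis unfolding eq using *
      by (auto intro!: Bochner_Integration.integrable_sum simp: mult.commute)
  qed
  then show "integrable M (\<lambda>\<omega>. increment_term \<phi> a b \<omega> * increment_term \<psi> a b \<omega>)"
    "expectation (\<lambda>\<omega>. increment_term \<phi> a b \<omega> * increment_term \<psi> a b \<omega>)
       = (b - a) * expectation (\<lambda>\<omega>. \<phi> \<omega> \<bullet> \<psi> \<omega>)" by auto
qed

lemma increment_term_adapted:
  assumes "0 \<le> a" "a \<le> b" "b \<le> T" "bounded_at a \<phi>"
  shows "increment_term \<phi> a b \<in> borel_measurable (F b)"
  unfolding increment_term_def[abs_def]
  using assms by (intro borel_measurable_inner borel_measurable_diff adapted_W)
    (auto simp: bounded_at_def intro: borel_measurable_F_mono)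

text \<open>Everything but the later increment is known at time \<open>c\<close>, so the product is an increment term with
  the integrand \<open>increment_term \<phi> a b \<omega> *\<^sub>R \<psi> \<omega>\<close>.\<close>

lemma increment_term_orthogonal:
  assumes ab: "0 \<le> a" "a \<le> b" "b \<le> c" "c \<le> d" "d \<le> T" and \<phi>: "bounded_at a \<phi>" and \<psi>: "bounded_at c \<psi>"
  shows "integrable M (\<lambda>\<omega>. increment_term \<phi> a b \<omega> * increment_term \<psi> c d \<omega>)"
    and "expectation (\<lambda>\<omega>. increment_term \<phi> a b \<omega> * increment_term \<psi> c d \<omega>) = 0"
proof -
  have m\<phi>: "increment_term \<phi> a b \<in> borel_measurable (F c)"
    by (rule borel_measurable_F_mono[OF increment_term_adapted]) (use ab \<phi> in auto)
  have i: "integrable M (increment_term \<phi> a b)"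
    using increment_term_mean_zero(1)[of a b \<phi>] ab \<phi> bounded_at_integrable(1)[OF \<phi> \<phi>]
    by (auto simp: bounded_at_def)
  obtain L where L: "\<And>\<omega>. \<omega> \<in> space M \<Longrightarrow> norm (\<psi> \<omega>) \<le> L" and m': "\<psi> \<in> borel_measurable (F c)"
    using \<psi> unfolding bounded_at_def by metis
  let ?\<theta> = "\<lambda>\<omega>. increment_term \<phi> a b \<omega> *\<^sub>R \<psi> \<omega>"
  have m: "?\<theta> \<in> borel_measurable (F c)" by (intro borel_measurable_scaleR m\<phi> m')
  have "integrable M ?\<theta>"
  proof (rule Bochner_Integration.integrable_bound)
    show "integrable M (\<lambda>\<omega>. L * increment_term \<phi> a b \<omega>)" using i by simp
    show "?\<theta> \<in> borel_measurable M" by (rule borel_measurable_F_M[OF m]) (use ab in auto)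
    show "AE \<omega> in M. norm (?\<theta> \<omega>) \<le> norm (L * increment_term \<phi> a b \<omega>)"
    proof (rule AE_I2)
      fix \<omega> assume "\<omega> \<in> space M"
      then have "norm (\<psi> \<omega>) \<le> \<bar>L\<bar>" using L by fastforce
      then show "norm (?\<theta> \<omega>) \<le> norm (L * increment_term \<phi> a b \<omega>)"
        by (simp add: abs_mult mult.commute mult_right_mono)
    qed
  qed
  from increment_term_mean_zero[OF _ ab(4,5) m this] ab
  show "integrable M (\<lambda>\<omega>. increment_term \<phi> a b \<omega> * increment_term \<psi> c d \<omega>)"
    "expectation (\<lambda>\<omega>. increment_term \<phi> a b \<omega> * increment_term \<psi> c d \<omega>) = 0"
    by (simp_all add: increment_term_def[abs_def])
qed

lemma increment_term_split: "increment_term \<phi> a c \<omega> = increment_term \<phi> a b \<omega> + increment_term \<phi> b c \<omega>"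
  by (simp add: increment_term_def inner_diff_right)

text \<open>The length of the intersection of the intervals from \<open>a\<close> to \<open>b\<close> and from \<open>c\<close> to \<open>d\<close>.\<close>

definition overlap :: "real \<Rightarrow> real \<Rightarrow> real \<Rightarrow> real \<Rightarrow> real" where
  "overlap a b c d = max 0 (min b d - max a c)"

text \<open>Cut both increments at \<open>c\<close> and at the end \<open>m\<close> of the common part. Terms over disjoint intervals are
  orthogonal, so only the common part from \<open>c\<close> to \<open>m\<close> contributes; after \<open>m\<close> one of the two increments
  is zero.\<close>

lemma increment_term_isometry_ordered:
  assumes ab: "0 \<le> a" "a \<le> b" "b \<le> T" and cd: "0 \<le> c" "c \<le> d" "d \<le> T" and ac: "a \<le> c"
    and \<phi>: "bounded_at a \<phi>" and \<psi>: "bounded_at c \<psi>"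
  shows "integrable M (\<lambda>\<omega>. increment_term \<phi> a b \<omega> * increment_term \<psi> c d \<omega>) \<and>
     expectation (\<lambda>\<omega>. increment_term \<phi> a b \<omega> * increment_term \<psi> c d \<omega>)
       = overlap a b c d * expectation (\<lambda>\<omega>. \<phi> \<omega> \<bullet> \<psi> \<omega>)"
proof (cases "b \<le> c")
  case True
  then show ?thesis
    using increment_term_orthogonal[OF ab(1,2) _ cd(2,3) \<phi> \<psi>] by (simp add: overlap_def)
next
  case False
  define m where "m = min b d"
  have m: "c \<le> m" "m \<le> b" "m \<le> d" "m = b \<or> m = d" "m \<le> T" using False cd ab by (auto simp: m_def)
  have \<phi>c: "bounded_at c \<phi>" "bounded_at m \<phi>" "bounded_at m \<psi>"
    using \<phi> \<psi> ac m by (auto intro: bounded_at_mono)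
  let ?I = increment_term
  have eq: "?I \<phi> a b \<omega> * ?I \<psi> c d \<omega> = ?I \<phi> a c \<omega> * ?I \<psi> c d \<omega> + (?I \<phi> c m \<omega> * ?I \<psi> c m \<omega>
     + (?I \<phi> c m \<omega> * ?I \<psi> m d \<omega> + ?I \<psi> c m \<omega> * ?I \<phi> m b \<omega>))" for \<omega>
  proof -
    have "?I \<phi> m b \<omega> * ?I \<psi> m d \<omega> = 0" using m(4) by (auto simp: increment_term_def)
    then show ?thesis
      unfolding increment_term_split[of \<phi> a b \<omega> c] increment_term_split[of \<phi> c b \<omega> m]
        increment_term_split[of \<psi> c d \<omega> m] by (simp add: algebra_simps)
  qed
  have 1: "integrable M (\<lambda>\<omega>. ?I \<phi> a c \<omega> * ?I \<psi> c d \<omega>)" "expectation (\<lambda>\<omega>. ?I \<phi> a c \<omega> * ?I \<psi> c d \<omega>) = 0"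
    using increment_term_orthogonal[OF ab(1) ac _ cd(2,3) \<phi> \<psi>] by auto
  have 2: "integrable M (\<lambda>\<omega>. ?I \<phi> c m \<omega> * ?I \<psi> c m \<omega>)"
      "expectation (\<lambda>\<omega>. ?I \<phi> c m \<omega> * ?I \<psi> c m \<omega>) = (m - c) * expectation (\<lambda>\<omega>. \<phi> \<omega> \<bullet> \<psi> \<omega>)"
    using increment_term_second_moment[OF cd(1) m(1,5) \<phi>c(1) \<psi>] by auto
  have 3: "integrable M (\<lambda>\<omega>. ?I \<phi> c m \<omega> * ?I \<psi> m d \<omega>)" "expectation (\<lambda>\<omega>. ?I \<phi> c m \<omega> * ?I \<psi> m d \<omega>) = 0"
    using increment_term_orthogonal[OF cd(1) m(1) _ m(3) cd(3) \<phi>c(1) \<phi>c(3)] by auto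
  have 4: "integrable M (\<lambda>\<omega>. ?I \<psi> c m \<omega> * ?I \<phi> m b \<omega>)" "expectation (\<lambda>\<omega>. ?I \<psi> c m \<omega> * ?I \<phi> m b \<omega>) = 0"
    using increment_term_orthogonal[OF cd(1) m(1) _ m(2) ab(3) \<psi> \<phi>c(2)] by auto
  have "overlap a b c d = m - c" using m ac by (simp add: overlap_def m_def)
  then show ?thesis unfolding eq using 1 2 3 4 by simp
qed

lemma overlap_commute: "overlap a b c d = overlap c d a b"
  by (simp add: overlap_def min.commute max.commute)

lemma increment_term_isometry:
  assumes ab: "0 \<le> a" "a \<le> b" "b \<le> T" and cd: "0 \<le> c" "c \<le> d" "d \<le> T"
    and \<phi>: "bounded_at a \<phi>" and \<psi>: "bounded_at c \<psi>"
  shows "integrable M (\<lambda>\<omega>. increment_term \<phi> a b \<omega> * increment_term \<psi> c d \<omega>)"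
    and "expectation (\<lambda>\<omega>. increment_term \<phi> a b \<omega> * increment_term \<psi> c d \<omega>)
       = overlap a b c d * expectation (\<lambda>\<omega>. \<phi> \<omega> \<bullet> \<psi> \<omega>)"
  using increment_term_isometry_ordered[OF ab cd _ \<phi> \<psi>] increment_term_isometry_ordered[OF cd ab _ \<psi> \<phi>]
    linear[of a c] by (auto simp: mult.commute inner_commute overlap_commute)

lemma overlap_integral:
  assumes "a \<le> b" "c \<le> d"
  shows "integrable lborel (\<lambda>s. indicat_real {a<..b} s * indicat_real {c<..d} s)"
    and "(\<integral>s. indicat_real {a<..b} s * indicat_real {c<..d} s \<partial>lborel) = overlap a b c d"
proof -
  have "{a<..b} \<inter> {c<..d} = {max a c<..min b d}" by auto
  then have eq: "indicat_real {a<..b} s * indicat_real {c<..d} s = indicat_real {max a c<..min b d} s" for s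
    by (simp add: indicator_inter_arith[symmetric])
  show "integrable lborel (\<lambda>s. indicat_real {a<..b} s * indicat_real {c<..d} s)"
    unfolding eq by (cases "max a c \<le> min b d") auto
  show "(\<integral>s. indicat_real {a<..b} s * indicat_real {c<..d} s \<partial>lborel) = overlap a b c d"
    unfolding eq overlap_def by (cases "max a c \<le> min b d") auto
qed

text \<open>The Ito isometry for finite sums of increments over arbitrary, possibly overlapping, intervals.
  Overlaps are allowed in order to treat the difference of two simple integrals over different
  partitions without a common refinement.\<close>

lemma simple_family_isometry:
  fixes J :: "'j set"
  assumes J: "finite J"
    and ab: "\<And>j. j \<in> J \<Longrightarrow> 0 \<le> \<alpha> j \<and> \<alpha> j \<le> \<beta> j \<and> \<beta> j \<le> T" and \<phi>: "\<And>j. j \<in> J \<Longrightarrow> bounded_at (\<alpha> j) (\<phi> j)"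
  shows "(\<integral>\<^sup>+ \<omega>. ennreal ((\<Sum>j\<in>J. increment_term (\<phi> j) (\<alpha> j) (\<beta> j) \<omega>)\<^sup>2) \<partial>M)
    = (\<integral>\<^sup>+ p. ennreal ((norm (\<Sum>j\<in>J. indicat_real {\<alpha> j<..\<beta> j} (fst p) *\<^sub>R \<phi> j (snd p)))\<^sup>2) \<partial>(lborel \<Otimes>\<^sub>M M))"
proof -
  let ?I = "\<lambda>j. increment_term (\<phi> j) (\<alpha> j) (\<beta> j)"
  let ?S = "\<lambda>s \<omega>. (\<Sum>j\<in>J. indicat_real {\<alpha> j<..\<beta> j} s *\<^sub>R \<phi> j \<omega>)"
  have e1: "(\<Sum>j\<in>J. ?I j \<omega>)\<^sup>2 = (\<Sum>i\<in>J. \<Sum>j\<in>J. ?I i \<omega> * ?I j \<omega>)" for \<omega>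
    by (simp add: power2_eq_square sum_product)
  have ii: "integrable M (\<lambda>\<omega>. ?I i \<omega> * ?I j \<omega>)"
    "expectation (\<lambda>\<omega>. ?I i \<omega> * ?I j \<omega>) = overlap (\<alpha> i) (\<beta> i) (\<alpha> j) (\<beta> j) * expectation (\<lambda>\<omega>. \<phi> i \<omega> \<bullet> \<phi> j \<omega>)"
    if "i \<in> J" "j \<in> J" for i j
    using increment_term_isometry[of "\<alpha> i" "\<beta> i" "\<alpha> j" "\<beta> j" "\<phi> i" "\<phi> j"] ab that \<phi> by auto
  have int1: "integrable M (\<lambda>\<omega>. (\<Sum>j\<in>J. ?I j \<omega>)\<^sup>2)"
    unfolding e1 by (intro Bochner_Integration.integrable_sum ii)
  have ex1: "expectation (\<lambda>\<omega>. (\<Sum>j\<in>J. ?I j \<omega>)\<^sup>2)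
     = (\<Sum>i\<in>J. \<Sum>j\<in>J. overlap (\<alpha> i) (\<beta> i) (\<alpha> j) (\<beta> j) * expectation (\<lambda>\<omega>. \<phi> i \<omega> \<bullet> \<phi> j \<omega>))"
    unfolding e1 by (simp add: Bochner_Integration.integral_sum Bochner_Integration.integrable_sum ii)
  let ?G = "\<lambda>i j s \<omega>. (indicat_real {\<alpha> i<..\<beta> i} s * indicat_real {\<alpha> j<..\<beta> j} s) * (\<phi> i \<omega> \<bullet> \<phi> j \<omega>)"
  have e2: "(norm (?S s \<omega>))\<^sup>2 = (\<Sum>i\<in>J. \<Sum>j\<in>J. ?G i j s \<omega>)" for s \<omega>
    unfolding power2_norm_eq_inner inner_sum_left
    by (simp add: inner_sum_right sum_distrib_left mult.assoc mult.left_commute)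
  have gg: "integrable (lborel \<Otimes>\<^sub>M M) (\<lambda>p. ?G i j (fst p) (snd p))"
    "(\<integral>p. ?G i j (fst p) (snd p) \<partial>(lborel \<Otimes>\<^sub>M M)) = overlap (\<alpha> i) (\<beta> i) (\<alpha> j) (\<beta> j) * expectation (\<lambda>\<omega>. \<phi> i \<omega> \<bullet> \<phi> j \<omega>)"
    if ij: "i \<in> J" "j \<in> J" for i j
  proof -
    note o = overlap_integral[of "\<alpha> i" "\<beta> i" "\<alpha> j" "\<beta> j"]
    have i\<phi>: "integrable M (\<lambda>\<omega>. \<phi> i \<omega> \<bullet> \<phi> j \<omega>)"
      by (rule bounded_at_integrable(2)[OF \<phi>[OF ij(1)] \<phi>[OF ij(2)]]) (use ab ij in force)+
    note [measurable] = borel_measurable_integrable[OF i\<phi>]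
    have i: "integrable (lborel \<Otimes>\<^sub>M M) (\<lambda>(s, \<omega>). ?G i j s \<omega>)"
      by (rule time.Fubini_integrable) (use i\<phi> o ab ij in \<open>auto simp: abs_mult\<close>)
    then show "integrable (lborel \<Otimes>\<^sub>M M) (\<lambda>p. ?G i j (fst p) (snd p))" by (simp add: split_beta')
    show "(\<integral>p. ?G i j (fst p) (snd p) \<partial>(lborel \<Otimes>\<^sub>M M)) = overlap (\<alpha> i) (\<beta> i) (\<alpha> j) (\<beta> j) * expectation (\<lambda>\<omega>. \<phi> i \<omega> \<bullet> \<phi> j \<omega>)"
      using time.integral_fst[OF i] o(2) ab ij by (simp add: split_beta')
  qed
  have int2: "integrable (lborel \<Otimes>\<^sub>M M) (\<lambda>p. (norm (?S (fst p) (snd p)))\<^sup>2)"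
    unfolding e2 by (intro Bochner_Integration.integrable_sum gg)
  have ex2: "(\<integral>p. (norm (?S (fst p) (snd p)))\<^sup>2 \<partial>(lborel \<Otimes>\<^sub>M M))
     = (\<Sum>i\<in>J. \<Sum>j\<in>J. overlap (\<alpha> i) (\<beta> i) (\<alpha> j) (\<beta> j) * expectation (\<lambda>\<omega>. \<phi> i \<omega> \<bullet> \<phi> j \<omega>))"
    unfolding e2 using gg by (simp add: Bochner_Integration.integral_sum Bochner_Integration.integrable_sum)
  show ?thesis
    using nn_integral_eq_integral[OF int1] nn_integral_eq_integral[OF int2] ex1 ex2 by simp
qed

lemma simple_integrand_facts:
  assumes s: "simple_integrand M F a b n \<tau> \<phi>"
  shows "i \<le> n \<Longrightarrow> a \<le> \<tau> i \<and> \<tau> i \<le> b" and "i < n \<Longrightarrow> \<tau> i \<le> \<tau> (Suc i)" and "i < n \<Longrightarrow> bounded_at (\<tau> i) (\<phi> i)"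
proof -
  have step: "\<And>i. i < n \<Longrightarrow> \<tau> i \<le> \<tau> (Suc i)" using s by (auto simp: simple_integrand_def)
  have le: "\<tau> i \<le> \<tau> j" if "i \<le> j" "j \<le> n" for i j
    using that
  proof (induction j rule: dec_induct)
    case (step k)
    then show ?case using \<open>\<And>i. i < n \<Longrightarrow> \<tau> i \<le> \<tau> (Suc i)\<close>[of k] by auto
  qed simp
  show "i \<le> n \<Longrightarrow> a \<le> \<tau> i \<and> \<tau> i \<le> b" using le[of 0 i] le[of i n] s by (auto simp: simple_integrand_def)
  show "i < n \<Longrightarrow> \<tau> i \<le> \<tau> (Suc i)" by (rule step)
  show "i < n \<Longrightarrow> bounded_at (\<tau> i) (\<phi> i)" using s by (auto simp: simple_integrand_def bounded_at_def)
qed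

lemma simple_integral_eq: "simple_integral W n \<tau> \<phi> \<omega> = (\<Sum>i<n. increment_term (\<phi> i) (\<tau> i) (\<tau> (Suc i)) \<omega>)"
  by (simp add: simple_integral_def increment_term_def)

lemma increment_term_restrict:
  "indicat_real H \<omega> * increment_term \<phi> a b \<omega> = increment_term (\<lambda>\<omega>. indicat_real H \<omega> *\<^sub>R \<phi> \<omega>) a b \<omega>"
  by (simp add: increment_term_def)

lemma simple_integral_mean_zero:
  assumes ab: "0 \<le> a" "b \<le> T" and s: "simple_integrand M F a b n \<tau> \<phi>" and H: "H \<in> sets (F a)"
  shows "integrable M (simple_integral W n \<tau> \<phi>)" "(\<integral>\<omega>. indicat_real H \<omega> * simple_integral W n \<tau> \<phi> \<omega> \<partial>M) = 0"
proof -
  note f = simple_integrand_facts[OF s]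
  have t: "0 \<le> \<tau> i" "\<tau> i \<le> \<tau> (Suc i)" "\<tau> (Suc i) \<le> T" "a \<le> \<tau> i" if "i < n" for i
    using f(1)[of i] f(1)[of "Suc i"] f(2)[of i] that ab by auto
  have 1: "integrable M (increment_term (\<phi> i) (\<tau> i) (\<tau> (Suc i)))" if "i < n" for i
  proof (rule increment_term_mean_zero(1)[OF t(1-3)[OF that]])
    show "\<phi> i \<in> borel_measurable (F (\<tau> i))" using f(3)[OF that] by (simp add: bounded_at_def)
    show "integrable M (\<phi> i)" by (rule bounded_at_integrable(1)[OF f(3)[OF that] f(3)[OF that]]) (use t[OF that] in auto)
  qed
  then show "integrable M (simple_integral W n \<tau> \<phi>)"
    unfolding simple_integral_eq[abs_def] by (intro Bochner_Integration.integrable_sum) auto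
  have 2: "integrable M (\<lambda>\<omega>. indicat_real H \<omega> * increment_term (\<phi> i) (\<tau> i) (\<tau> (Suc i)) \<omega>)
     \<and> (\<integral>\<omega>. indicat_real H \<omega> * increment_term (\<phi> i) (\<tau> i) (\<tau> (Suc i)) \<omega> \<partial>M) = 0" if "i < n" for i
  proof -
    let ?\<psi> = "\<lambda>\<omega>. indicat_real H \<omega> *\<^sub>R \<phi> i \<omega>"
    have "H \<in> sets (F (\<tau> i))" using F_mono[OF t(4)[OF that]] H by auto
    then have "bounded_at (\<tau> i) ?\<psi>" using f(3)[OF that] unfolding bounded_at_def
      by (auto intro!: borel_measurable_scaleR borel_measurable_indicator simp: indicator_def intro: order_trans[OF norm_ge_zero])
    moreover from bounded_at_integrable(1)[OF this this] have "integrable M ?\<psi>" using t[OF that] by auto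
    ultimately show ?thesis
      using increment_term_mean_zero[OF t(1-3)[OF that], of ?\<psi>]
      by (simp add: increment_term_restrict bounded_at_def)
  qed
  then show "(\<integral>\<omega>. indicat_real H \<omega> * simple_integral W n \<tau> \<phi> \<omega> \<partial>M) = 0"
    unfolding simple_integral_eq sum_distrib_left
    by (subst Bochner_Integration.integral_sum) auto
qed

lemma integrable_of_square:
  assumes m: "f \<in> borel_measurable M" and fin: "(\<integral>\<^sup>+ \<omega>. ennreal ((f \<omega>)\<^sup>2) \<partial>M) < \<infinity>"
  shows "integrable M (\<lambda>\<omega>. (f \<omega>)\<^sup>2)" "integrable M f"
proof -
  show i: "integrable M (\<lambda>\<omega>. (f \<omega>)\<^sup>2)" using m fin by (intro integrableI_bounded) auto
  show "integrable M f"
  proof (rule Bochner_Integration.integrable_bound[OF _ m])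
    show "integrable M (\<lambda>\<omega>. 1 + (f \<omega>)\<^sup>2)" using i by simp
    have "\<bar>z\<bar> \<le> 1 + z\<^sup>2" for z :: real
      using abs_mult_le_squares[of 1 z] by simp
    then show "AE \<omega> in M. norm (f \<omega>) \<le> norm (1 + (f \<omega>)\<^sup>2)" by (intro AE_I2) (simp add: abs_of_nonneg)
  qed
qed

text \<open>Simple integrals have mean zero over every event of \<open>F a\<close>, and this survives \<open>L\<^sup>2\<close>-limits.\<close>

lemma ito_integral_cond_exp_zero:
  assumes ab: "0 \<le> a" "a \<le> b" "b \<le> T" and ito: "has_ito_integral M F W a b Z I"
  shows "integrable M I" "AE \<omega> in M. real_cond_exp M (F a) I \<omega> = 0"
proof -
  obtain N \<tau> \<phi> where s: "\<And>k. simple_integrand M F a b (N k) (\<tau> k) (\<phi> k)"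
    and lim: "(\<lambda>k. \<integral>\<^sup>+ \<omega>. ennreal ((simple_integral W (N k) (\<tau> k) (\<phi> k) \<omega> - I \<omega>)\<^sup>2) \<partial>M) \<longlonglongrightarrow> 0"
    and I: "I \<in> borel_measurable M"
    using ito unfolding has_ito_integral_def by blast
  let ?J = "\<lambda>k. simple_integral W (N k) (\<tau> k) (\<phi> k)"
  have iJ: "integrable M (?J k)" for k by (rule simple_integral_mean_zero(1)[OF ab(1,3) s sets.top])
  have mD: "(\<lambda>\<omega>. ?J k \<omega> - I \<omega>) \<in> borel_measurable M" for k using iJ I by (intro borel_measurable_diff) auto
  have ex: "\<exists>k. (\<integral>\<^sup>+ \<omega>. ennreal ((?J k \<omega> - I \<omega>)\<^sup>2) \<partial>M) < ennreal e" if "e > 0" for e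
    using order_tendstoD(2)[OF lim, of "ennreal e"] that by (auto simp: eventually_sequentially ennreal_less_zero_iff)
  obtain k1 where "(\<integral>\<^sup>+ \<omega>. ennreal ((?J k1 \<omega> - I \<omega>)\<^sup>2) \<partial>M) < ennreal 1" using ex[of 1] by auto
  then have "integrable M (\<lambda>\<omega>. ?J k1 \<omega> - I \<omega>)"
    by (intro integrable_of_square mD) (auto intro: less_trans simp: ennreal_less_top less_top[symmetric])
  from Bochner_Integration.integrable_diff[OF iJ[of k1] this] show iI: "integrable M I" by simp
  have "(\<integral>\<omega>\<in>H. I \<omega> \<partial>M) = (\<integral>\<omega>\<in>H. 0 \<partial>M)" if H: "H \<in> sets (F a)" for H
  proof -
    have HM: "H \<in> sets M" using H F_subset_M[of a] ab by auto
    have "\<bar>\<integral>\<omega>\<in>H. I \<omega> \<partial>M\<bar> \<le> e" if e: "e > 0" for e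
    proof -
      obtain k where k: "(\<integral>\<^sup>+ \<omega>. ennreal ((?J k \<omega> - I \<omega>)\<^sup>2) \<partial>M) < ennreal ((e/2)\<^sup>2)"
        using ex[of "(e/2)\<^sup>2"] e by auto
      then have sq: "integrable M (\<lambda>\<omega>. (?J k \<omega> - I \<omega>)\<^sup>2)"
        by (intro integrable_of_square mD) (auto intro: less_trans simp: ennreal_less_top less_top[symmetric])
      have "expectation (\<lambda>\<omega>. (?J k \<omega> - I \<omega>)\<^sup>2) \<le> (e/2)\<^sup>2"
        using k unfolding nn_integral_eq_integral[OF sq AE_I2, simplified] by (simp add: ennreal_less_iff)
      then have l2: "expectation (\<lambda>\<omega>. (?J k \<omega> - I \<omega>)\<^sup>2) / (2 * (e/2)) \<le> e / 4" using e
        by (simp add: field_simps power2_eq_square)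
      have iH: "integrable M (\<lambda>\<omega>. indicat_real H \<omega> * I \<omega>)" "integrable M (\<lambda>\<omega>. indicat_real H \<omega> * ?J k \<omega>)"
        using integrable_mult_indicator[OF HM iI] integrable_mult_indicator[OF HM iJ[of k]] by simp_all
      have "(\<integral>\<omega>\<in>H. I \<omega> \<partial>M) = (\<integral>\<omega>. indicat_real H \<omega> * I \<omega> - indicat_real H \<omega> * ?J k \<omega> \<partial>M)"
        using iH simple_integral_mean_zero(2)[OF ab(1,3) s H, of k] by (simp add: set_lebesgue_integral_def)
      also have "\<bar>\<dots>\<bar> \<le> (\<integral>\<omega>. \<bar>indicat_real H \<omega> * I \<omega> - indicat_real H \<omega> * ?J k \<omega>\<bar> \<partial>M)"
        by (rule integral_abs_bound)
      also have "\<dots> \<le> (\<integral>\<omega>. e / 4 + (?J k \<omega> - I \<omega>)\<^sup>2 / (2 * (e/2)) \<partial>M)"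
      proof (rule integral_mono)
        show "integrable M (\<lambda>\<omega>. \<bar>indicat_real H \<omega> * I \<omega> - indicat_real H \<omega> * ?J k \<omega>\<bar>)" using iH by simp
        show "integrable M (\<lambda>\<omega>. e / 4 + (?J k \<omega> - I \<omega>)\<^sup>2 / (2 * (e/2)))" using sq by simp
        fix \<omega>
        have "\<bar>indicat_real H \<omega> * I \<omega> - indicat_real H \<omega> * ?J k \<omega>\<bar> \<le> \<bar>?J k \<omega> - I \<omega>\<bar>"
          by (auto simp: indicator_def)
        \<comment> \<open>Young's inequality, weighted so that an \<open>L\<^sup>2\<close>-error of \<open>e / 2\<close> yields an \<open>L\<^sup>1\<close>-error of
          \<open>e / 2\<close>.\<close>
        also have "\<bar>z\<bar> \<le> e / 4 + z\<^sup>2 / (2 * (e/2))" for z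
          using zero_le_power2[of "\<bar>z\<bar> - e/2"] e by (simp add: power2_diff field_simps power2_eq_square)
        finally show "\<bar>indicat_real H \<omega> * I \<omega> - indicat_real H \<omega> * ?J k \<omega>\<bar> \<le> e / 4 + (?J k \<omega> - I \<omega>)\<^sup>2 / (2 * (e/2))" .
      qed
      also have "\<dots> = e / 4 + expectation (\<lambda>\<omega>. (?J k \<omega> - I \<omega>)\<^sup>2) / (2 * (e/2))" using sq by (simp add: prob_space)
      also have "\<dots> \<le> e / 4 + e / 4" by (rule add_left_mono[OF l2])
      also have "\<dots> \<le> e" using e by simp
      finally show ?thesis .
    qed
    then have "\<bar>\<integral>\<omega>\<in>H. I \<omega> \<partial>M\<bar> \<le> 0" by (rule field_le_epsilon[of _ 0, simplified])
    then show ?thesis by simp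
  qed
  then show "AE \<omega> in M. real_cond_exp M (F a) I \<omega> = 0"
    by (intro sigma_finite_subalgebra.real_cond_exp_charact[OF cond_exp_F] iI) (use ab in auto)
qed

text \<open>The triangle inequality for squared \<open>L\<^sup>2\<close>-distances, with the factor \<open>2\<close> that squaring costs.\<close>

lemma nn_integral_square_triangle:
  fixes f g h :: "'x \<Rightarrow> 'b::euclidean_space"
  assumes [measurable]: "f \<in> borel_measurable N" "g \<in> borel_measurable N" "h \<in> borel_measurable N"
  shows "(\<integral>\<^sup>+ x. ennreal ((norm (f x - h x))\<^sup>2) \<partial>N)
     \<le> 2 * (\<integral>\<^sup>+ x. ennreal ((norm (f x - g x))\<^sup>2) \<partial>N) + 2 * (\<integral>\<^sup>+ x. ennreal ((norm (g x - h x))\<^sup>2) \<partial>N)"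
proof -
  have "(norm (f x - h x))\<^sup>2 \<le> 2 * (norm (f x - g x))\<^sup>2 + 2 * (norm (g x - h x))\<^sup>2" for x
  proof -
    have "norm (f x - h x) \<le> norm (f x - g x) + norm (g x - h x)" using norm_triangle_ineq[of "f x - g x" "g x - h x"] by simp
    then have "(norm (f x - h x))\<^sup>2 \<le> (norm (f x - g x) + norm (g x - h x))\<^sup>2" by (rule power_mono) simp
    also have "\<dots> \<le> 2 * (norm (f x - g x))\<^sup>2 + 2 * (norm (g x - h x))\<^sup>2" using zero_le_power2[of "norm (f x - g x) - norm (g x - h x)"] by (simp add: power2_sum power2_diff)
    finally show ?thesis .
  qed
  then have "(\<integral>\<^sup>+ x. ennreal ((norm (f x - h x))\<^sup>2) \<partial>N)
     \<le> (\<integral>\<^sup>+ x. 2 * ennreal ((norm (f x - g x))\<^sup>2) + 2 * ennreal ((norm (g x - h x))\<^sup>2) \<partial>N)"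
    by (intro nn_integral_mono) (simp add: ennreal_mult''[symmetric] ennreal_plus[symmetric] ennreal_leI del: ennreal_plus
          flip: ennreal_numeral)
  also have "\<dots> = 2 * (\<integral>\<^sup>+ x. ennreal ((norm (f x - g x))\<^sup>2) \<partial>N) + 2 * (\<integral>\<^sup>+ x. ennreal ((norm (g x - h x))\<^sup>2) \<partial>N)"
    by (subst nn_integral_add) (auto simp: nn_integral_cmult)
  finally show ?thesis .
qed

lemma iterated_square_integral:
  fixes X :: "real \<Rightarrow> 'a \<Rightarrow> real ^ 'm"
  assumes "(\<lambda>p. indicator {a..b} (fst p) *\<^sub>R X (fst p) (snd p)) \<in> borel_measurable (lborel \<Otimes>\<^sub>M M)"
  shows "(\<integral>\<^sup>+ \<omega>. (\<integral>\<^sup>+ s\<in>{a..b}. ennreal ((norm (X s \<omega>))\<^sup>2) \<partial>lborel) \<partial>M)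
     = (\<integral>\<^sup>+ p. ennreal ((norm (indicator {a..b} (fst p) *\<^sub>R X (fst p) (snd p)))\<^sup>2) \<partial>(lborel \<Otimes>\<^sub>M M))"
proof -
  have "(\<integral>\<^sup>+ \<omega>. (\<integral>\<^sup>+ s\<in>{a..b}. ennreal ((norm (X s \<omega>))\<^sup>2) \<partial>lborel) \<partial>M)
     = (\<integral>\<^sup>+ \<omega>. (\<integral>\<^sup>+ s. (\<lambda>p. ennreal ((norm (indicator {a..b} (fst p) *\<^sub>R X (fst p) (snd p)))\<^sup>2)) (s, \<omega>) \<partial>lborel) \<partial>M)"
    by (auto intro!: nn_integral_cong split: split_indicator)
  also have "\<dots> = (\<integral>\<^sup>+ p. ennreal ((norm (indicator {a..b} (fst p) *\<^sub>R X (fst p) (snd p)))\<^sup>2) \<partial>(lborel \<Otimes>\<^sub>M M))"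
    by (rule time.nn_integral_snd) (use assms in measurable)
  finally show ?thesis .
qed

text \<open>Choose simple integrals approximating \<open>I\<close> and \<open>I'\<close>. They come close to each other, so by the
  isometry the simple integrands do too, and these approximate \<open>Z\<close> and \<open>Z'\<close>.\<close>

lemma ito_integrand_unique:
  assumes ab: "0 \<le> a" "a \<le> b" "b \<le> T"
    and ito: "has_ito_integral M F W a b Z I" "has_ito_integral M F W a b Z' I'"
    and eq: "AE \<omega> in M. I \<omega> = I' \<omega>"
  shows "AE (s, \<omega>) in lborel \<Otimes>\<^sub>M M. s \<in> {a..b} \<longrightarrow> Z s \<omega> = Z' s \<omega>"
proof -
  let ?e = "\<lambda>X :: real \<Rightarrow> 'a \<Rightarrow> real ^ 'm. \<integral>\<^sup>+ \<omega>. (\<integral>\<^sup>+ s\<in>{a..b}. ennreal ((norm (X s \<omega>))\<^sup>2) \<partial>lborel) \<partial>M"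
  obtain N \<tau> \<phi> where s: "\<And>k. simple_integrand M F a b (N k) (\<tau> k) (\<phi> k)"
    and limS: "(\<lambda>k. ?e (\<lambda>s \<omega>. simple_process (N k) (\<tau> k) (\<phi> k) s \<omega> - Z s \<omega>)) \<longlonglongrightarrow> 0"
    and limI: "(\<lambda>k. \<integral>\<^sup>+ \<omega>. ennreal ((simple_integral W (N k) (\<tau> k) (\<phi> k) \<omega> - I \<omega>)\<^sup>2) \<partial>M) \<longlonglongrightarrow> 0"
    and Z: "progressive F a b Z" and I: "I \<in> borel_measurable M"
    using ito(1) unfolding has_ito_integral_def L2_prog_def by blast
  obtain N' \<tau>' \<phi>' where s': "\<And>k. simple_integrand M F a b (N' k) (\<tau>' k) (\<phi>' k)"
    and limS': "(\<lambda>k. ?e (\<lambda>s \<omega>. simple_process (N' k) (\<tau>' k) (\<phi>' k) s \<omega> - Z' s \<omega>)) \<longlonglongrightarrow> 0"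
    and limI': "(\<lambda>k. \<integral>\<^sup>+ \<omega>. ennreal ((simple_integral W (N' k) (\<tau>' k) (\<phi>' k) \<omega> - I' \<omega>)\<^sup>2) \<partial>M) \<longlonglongrightarrow> 0"
    and Z': "progressive F a b Z'" and I': "I' \<in> borel_measurable M"
    using ito(2) unfolding has_ito_integral_def L2_prog_def by blast
  define S where "S k p = simple_process (N k) (\<tau> k) (\<phi> k) (fst p) (snd p)" for k and p :: "real \<times> 'a"
  define S' where "S' k p = simple_process (N' k) (\<tau>' k) (\<phi>' k) (fst p) (snd p)" for k and p :: "real \<times> 'a"
  define J where "J k = simple_integral W (N k) (\<tau> k) (\<phi> k)" for k
  define J' where "J' k = simple_integral W (N' k) (\<tau>' k) (\<phi>' k)" for k
  define Y where "Y p = indicator {a..b} (fst p) *\<^sub>R Z (fst p) (snd p)" for p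
  define Y' where "Y' p = indicator {a..b} (fst p) *\<^sub>R Z' (fst p) (snd p)" for p
  let ?P = "lborel \<Otimes>\<^sub>M M"
  have [measurable]: "Y \<in> borel_measurable ?P" "Y' \<in> borel_measurable ?P"
    using progressive_jointly_measurable[OF Z ab(3)] progressive_jointly_measurable[OF Z' ab(3)]
    by (simp_all add: Y_def[abs_def] Y'_def[abs_def] split_beta')
  have simp_meas: "(\<lambda>p. simple_process n t f (fst p) (snd p)) \<in> borel_measurable ?P"
    and simp_supp: "indicator {a..b} s *\<^sub>R simple_process n t f s \<omega> = simple_process n t f s \<omega>"
    if "simple_integrand M F a b n t f" for n t and f :: "nat \<Rightarrow> 'a \<Rightarrow> real ^ 'm" and s \<omega>
  proof -
    note f = simple_integrand_facts[OF that]
    have fm: "f i \<in> borel_measurable M" if "i < n" for i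
    proof (rule borel_measurable_F_M)
      show "f i \<in> borel_measurable (F (t i))" using f(3)[OF that] by (simp add: bounded_at_def)
      show "t i \<le> T" using f(1)[of i] that ab by auto
    qed
    show "(\<lambda>p. simple_process n t f (fst p) (snd p)) \<in> borel_measurable ?P"
      unfolding simple_process_def
    proof (rule borel_measurable_sum)
      fix i assume "i \<in> {..<n}"
      then have [measurable]: "f i \<in> borel_measurable M" by (simp add: fm)
      show "(\<lambda>p. indicat_real {t i<..t (Suc i)} (fst p) *\<^sub>R f i (snd p)) \<in> borel_measurable ?P" by measurable
    qed
    show "indicator {a..b} s *\<^sub>R simple_process n t f s \<omega> = simple_process n t f s \<omega>"
      unfolding simple_process_def scaleR_sum_right
    proof (rule sum.cong[OF refl])
      fix i assume "i \<in> {..<n}"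
      then have "a \<le> t i" "t (Suc i) \<le> b" using f(1)[of i] f(1)[of "Suc i"] by auto
      then show "indicator {a..b} s *\<^sub>R (indicat_real {t i<..t (Suc i)} s *\<^sub>R f i \<omega>) = indicat_real {t i<..t (Suc i)} s *\<^sub>R f i \<omega>"
        by (auto split: split_indicator)
    qed
  qed
  have [measurable]: "S k \<in> borel_measurable ?P" "S' k \<in> borel_measurable ?P" for k
    using simp_meas[OF s] simp_meas[OF s'] by (simp_all add: S_def[abs_def] S'_def[abs_def])
  have [measurable]: "J k \<in> borel_measurable M" "J' k \<in> borel_measurable M" for k
    using simple_integral_mean_zero(1)[OF ab(1,3) s sets.top] simple_integral_mean_zero(1)[OF ab(1,3) s' sets.top]
    by (auto simp: J_def J'_def)
  note [measurable] = I I'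
  have conv: "?e (\<lambda>s \<omega>. simple_process n t f s \<omega> - X s \<omega>)
     = (\<integral>\<^sup>+ p. ennreal ((norm (simple_process n t f (fst p) (snd p) - indicator {a..b} (fst p) *\<^sub>R X (fst p) (snd p)))\<^sup>2) \<partial>?P)"
    if f: "simple_integrand M F a b n t f" and X: "(\<lambda>p. indicator {a..b} (fst p) *\<^sub>R X (fst p) (snd p)) \<in> borel_measurable ?P"
    for n t and f :: "nat \<Rightarrow> 'a \<Rightarrow> real ^ 'm" and X
  proof -
    have "indicator {a..b} (fst p) *\<^sub>R (simple_process n t f (fst p) (snd p) - X (fst p) (snd p))
      = simple_process n t f (fst p) (snd p) - indicator {a..b} (fst p) *\<^sub>R X (fst p) (snd p)" for p
      by (simp add: scaleR_diff_right simp_supp[OF f])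
    then show ?thesis
      using iterated_square_integral[of a b "\<lambda>s \<omega>. simple_process n t f s \<omega> - X s \<omega>"] simp_meas[OF f] X by simp
  qed
  have "?e (\<lambda>s \<omega>. simple_process (N k) (\<tau> k) (\<phi> k) s \<omega> - Z s \<omega>)
      = (\<integral>\<^sup>+ p. ennreal ((norm (Y p - S k p))\<^sup>2) \<partial>?P)" for k
    using conv[of "N k" "\<tau> k" "\<phi> k" Z, OF s] \<open>Y \<in> borel_measurable ?P\<close>
    by (simp add: S_def Y_def[abs_def] norm_minus_commute)
  then have lS: "(\<lambda>k. \<integral>\<^sup>+ p. ennreal ((norm (Y p - S k p))\<^sup>2) \<partial>?P) \<longlonglongrightarrow> 0"
    using limS by simp
  have "?e (\<lambda>s \<omega>. simple_process (N' k) (\<tau>' k) (\<phi>' k) s \<omega> - Z' s \<omega>)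
      = (\<integral>\<^sup>+ p. ennreal ((norm (S' k p - Y' p))\<^sup>2) \<partial>?P)" for k
    using conv[of "N' k" "\<tau>' k" "\<phi>' k" Z', OF s'] \<open>Y' \<in> borel_measurable ?P\<close>
    by (simp add: S'_def Y'_def[abs_def])
  then have lS': "(\<lambda>k. \<integral>\<^sup>+ p. ennreal ((norm (S' k p - Y' p))\<^sup>2) \<partial>?P) \<longlonglongrightarrow> 0"
    using limS' by simp
  \<comment> \<open>Both simple integrals together form one family, indexed by a sum type, in which the second one
    has the opposite sign.\<close>
  have iso: "(\<integral>\<^sup>+ p. ennreal ((norm (S k p - S' k p))\<^sup>2) \<partial>?P) = (\<integral>\<^sup>+ \<omega>. ennreal ((norm (J k \<omega> - J' k \<omega>))\<^sup>2) \<partial>M)" for k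
  proof -
    let ?K = "{..<N k} <+> {..<N' k}"
    let ?\<alpha> = "case_sum (\<tau> k) (\<tau>' k)" and ?\<beta> = "case_sum (\<lambda>i. \<tau> k (Suc i)) (\<lambda>i. \<tau>' k (Suc i))"
    let ?\<phi> = "case_sum (\<phi> k) (\<lambda>i \<omega>. - \<phi>' k i \<omega>)"
    note f = simple_integrand_facts[OF s[of k]] and f' = simple_integrand_facts[OF s'[of k]]
    have neg: "bounded_at t (\<lambda>\<omega>. - h \<omega>)" if "bounded_at t h" for t h
      using that by (auto simp: bounded_at_def)
    have plus: "(\<Sum>j\<in>?K. g j) = (\<Sum>i<N k. g (Inl i)) + (\<Sum>i<N' k. g (Inr i))"
      for g :: "nat + nat \<Rightarrow> 'c::ab_group_add"
      by (simp add: sum.Plus comp_def)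
    have "(\<integral>\<^sup>+ \<omega>. ennreal ((\<Sum>j\<in>?K. increment_term (?\<phi> j) (?\<alpha> j) (?\<beta> j) \<omega>)\<^sup>2) \<partial>M)
      = (\<integral>\<^sup>+ p. ennreal ((norm (\<Sum>j\<in>?K. indicat_real {?\<alpha> j<..?\<beta> j} (fst p) *\<^sub>R ?\<phi> j (snd p)))\<^sup>2) \<partial>?P)"
    proof (rule simple_family_isometry)
      fix j assume "j \<in> ?K"
      then consider i where "j = Inl i" "i < N k" | i where "j = Inr i" "i < N' k" by auto
      then have "(0 \<le> ?\<alpha> j \<and> ?\<alpha> j \<le> ?\<beta> j \<and> ?\<beta> j \<le> T) \<and> bounded_at (?\<alpha> j) (?\<phi> j)"
      proof cases
        case (1 i)
        then show ?thesis using f(1)[of i] f(1)[of "Suc i"] f(2,3)[of i] ab by auto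
      next
        case (2 i)
        then show ?thesis using f'(1)[of i] f'(1)[of "Suc i"] f'(2)[of i] neg[OF f'(3)[of i]] ab by auto
      qed
      then show "0 \<le> ?\<alpha> j \<and> ?\<alpha> j \<le> ?\<beta> j \<and> ?\<beta> j \<le> T" "bounded_at (?\<alpha> j) (?\<phi> j)" by blast+
    qed simp
    moreover have "(\<Sum>j\<in>?K. increment_term (?\<phi> j) (?\<alpha> j) (?\<beta> j) \<omega>) = J k \<omega> - J' k \<omega>" for \<omega>
      unfolding plus sum.case J_def J'_def simple_integral_eq increment_term_def inner_minus_left sum_negf by simp
    moreover have "(\<Sum>j\<in>?K. indicat_real {?\<alpha> j<..?\<beta> j} (fst p) *\<^sub>R ?\<phi> j (snd p)) = S k p - S' k p" for p
      unfolding plus sum.case S_def S'_def simple_process_def scaleR_minus_right sum_negf by simp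
    ultimately show ?thesis by (simp only: real_norm_def power2_abs)
  qed
  let ?A = "\<lambda>k. \<integral>\<^sup>+ p. ennreal ((norm (Y p - S k p))\<^sup>2) \<partial>?P"
  let ?B = "\<lambda>k. \<integral>\<^sup>+ p. ennreal ((norm (S' k p - Y' p))\<^sup>2) \<partial>?P"
  let ?C = "\<lambda>k. \<integral>\<^sup>+ \<omega>. ennreal ((norm (J k \<omega> - I \<omega>))\<^sup>2) \<partial>M"
  let ?D = "\<lambda>k. \<integral>\<^sup>+ \<omega>. ennreal ((norm (I \<omega> - J' k \<omega>))\<^sup>2) \<partial>M"
  have lC: "?C \<longlonglongrightarrow> 0" using limI by (simp add: J_def)
  have "?D k = (\<integral>\<^sup>+ \<omega>. ennreal ((J' k \<omega> - I' \<omega>)\<^sup>2) \<partial>M)" for k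
    by (rule nn_integral_cong_AE) (use eq in \<open>eventually_elim, simp add: power2_commute\<close>)
  then have lD: "?D \<longlonglongrightarrow> 0" using limI' by (simp add: J'_def)
  have bound: "(\<integral>\<^sup>+ p. ennreal ((norm (Y p - Y' p))\<^sup>2) \<partial>?P) \<le> 2 * ?A k + 2 * (2 * (2 * ?C k + 2 * ?D k) + 2 * ?B k)" for k
  proof -
    have "(\<integral>\<^sup>+ p. ennreal ((norm (Y p - Y' p))\<^sup>2) \<partial>?P) \<le> 2 * ?A k + 2 * (\<integral>\<^sup>+ p. ennreal ((norm (S k p - Y' p))\<^sup>2) \<partial>?P)"
      by (rule nn_integral_square_triangle) measurable
    also have "(\<integral>\<^sup>+ p. ennreal ((norm (S k p - Y' p))\<^sup>2) \<partial>?P) \<le> 2 * (\<integral>\<^sup>+ p. ennreal ((norm (S k p - S' k p))\<^sup>2) \<partial>?P) + 2 * ?B k"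
      by (rule nn_integral_square_triangle) measurable
    also have "(\<integral>\<^sup>+ p. ennreal ((norm (S k p - S' k p))\<^sup>2) \<partial>?P) \<le> 2 * ?C k + 2 * ?D k"
      unfolding iso by (rule nn_integral_square_triangle) measurable
    finally show ?thesis by (simp add: add_mono mult_left_mono)
  qed
  have "(\<lambda>k. 2 * ?A k + 2 * (2 * (2 * ?C k + 2 * ?D k) + 2 * ?B k)) \<longlonglongrightarrow> 2 * 0 + 2 * (2 * (2 * 0 + 2 * 0) + 2 * 0)"
    by (intro tendsto_add ennreal_tendsto_cmult lS lS' lC lD) auto
  moreover have "2 * 0 + 2 * (2 * (2 * 0 + 2 * 0) + 2 * 0) = (0 :: ennreal)" by simp
  ultimately have "(\<lambda>k. 2 * ?A k + 2 * (2 * (2 * ?C k + 2 * ?D k) + 2 * ?B k)) \<longlonglongrightarrow> 0" by (simp only:)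
  then have "(\<integral>\<^sup>+ p. ennreal ((norm (Y p - Y' p))\<^sup>2) \<partial>?P) \<le> 0"
    by (rule LIMSEQ_le_const) (use bound in auto)
  then have "(\<integral>\<^sup>+ p. ennreal ((norm (Y p - Y' p))\<^sup>2) \<partial>?P) = 0" by simp
  then have "AE p in ?P. ennreal ((norm (Y p - Y' p))\<^sup>2) = 0" by (subst (asm) nn_integral_0_iff_AE) auto
  then show ?thesis
    by eventually_elim (auto simp: Y_def Y'_def ennreal_eq_0_iff)
qed

lemma ito_integrand_unique_before_terminal:
  assumes Z: "\<And>b. b \<in> {0..<T} \<Longrightarrow> \<exists>I I'. has_ito_integral M F W 0 b Z I \<and> has_ito_integral M F W 0 b Z' I' \<and> (AE \<omega> in M. I \<omega> = I' \<omega>)"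
  shows "AE (s, \<omega>) in lborel \<Otimes>\<^sub>M M. s \<in> {0..<T} \<longrightarrow> Z s \<omega> = Z' s \<omega>"
proof -
  obtain c :: "nat \<Rightarrow> real" where c: "\<And>n. c n \<in> {0..<T}" "c \<longlonglongrightarrow> T"
    using sequence_from_below[OF T_pos] by blast
  have "AE p in lborel \<Otimes>\<^sub>M M. case p of (s, \<omega>) \<Rightarrow> s \<in> {0..c n} \<longrightarrow> Z s \<omega> = Z' s \<omega>" for n
  proof -
    obtain I I' where "has_ito_integral M F W 0 (c n) Z I" "has_ito_integral M F W 0 (c n) Z' I'" "AE \<omega> in M. I \<omega> = I' \<omega>"
      using Z[OF c(1)] by blast
    then show ?thesis using c(1)[of n] by (intro ito_integrand_unique[of 0 "c n"]) auto
  qed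
  then have "AE p in lborel \<Otimes>\<^sub>M M. \<forall>n. case p of (s, \<omega>) \<Rightarrow> s \<in> {0..c n} \<longrightarrow> Z s \<omega> = Z' s \<omega>"
    unfolding AE_all_countable by blast
  then show ?thesis
  proof eventually_elim
    case (elim p)
    obtain s \<omega> where p: "p = (s, \<omega>)" by (cases p)
    have "Z s \<omega> = Z' s \<omega>" if s: "s \<in> {0..<T}"
    proof -
      have "\<forall>\<^sub>F n in sequentially. s < c n" using order_tendstoD(1)[OF c(2)] s by auto
      then obtain n where "s < c n" by (auto simp: eventually_sequentially)
      then have "s \<in> {0..c n}" using s by simp
      then show ?thesis using elim p by auto
    qed
    then show ?case by (simp add: p)
  qed
qed

section \<open>A product rule in expectation\<close>

text \<open>The part of \<open>-dP = f dt - Z dW\<close> that survives conditional expectations: \<open>P\<close> plus the integral of \<open>f\<close>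
  is a martingale. With this sign convention the drift of \<open>P\<close> in the usual sense is \<open>- f\<close>.\<close>

definition has_drift :: "real \<Rightarrow> real \<Rightarrow> (real \<Rightarrow> 'a \<Rightarrow> real) \<Rightarrow> (real \<Rightarrow> 'a \<Rightarrow> real) \<Rightarrow> bool" where
  "has_drift a b P f \<longleftrightarrow> progressive F a b P \<and> progressive F a b f \<and>
     (\<exists>K. AE \<omega> in M. \<forall>s\<in>{a..b}. \<bar>P s \<omega>\<bar> \<le> K) \<and>
     (\<exists>K. AE (s, \<omega>) in lborel \<Otimes>\<^sub>M M. s \<in> {a..b} \<longrightarrow> \<bar>f s \<omega>\<bar> \<le> K) \<and>
     (\<forall>r s. a \<le> r \<and> r \<le> s \<and> s \<le> b \<longrightarrow>
        (AE \<omega> in M. real_cond_exp M (F r) (\<lambda>\<omega>. P s \<omega> - P r \<omega> + (LINT u:{r..s}|lborel. f u \<omega>)) \<omega> = 0))"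

lemma has_driftI:
  assumes ab: "0 \<le> a" "b \<le> T" and P: "progressive F a b P" "progressive F a b f"
    and bP: "AE \<omega> in M. \<forall>s\<in>{a..b}. \<bar>P s \<omega>\<bar> \<le> K"
    and bf: "AE (s, \<omega>) in lborel \<Otimes>\<^sub>M M. s \<in> {a..b} \<longrightarrow> \<bar>f s \<omega>\<bar> \<le> L"
    and eq: "\<And>r s. a \<le> r \<Longrightarrow> r \<le> s \<Longrightarrow> s \<le> b \<Longrightarrow> bsde_between M F W r s P f Z"
  shows "has_drift a b P f"
  unfolding has_drift_def
proof (intro conjI allI impI)
  fix r s assume rs: "a \<le> r \<and> r \<le> s \<and> s \<le> b"
  then have "has_ito_integral M F W r s Z (\<lambda>\<omega>. P s \<omega> - P r \<omega> + (LINT r:{r..s}|lborel. f r \<omega>))"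
    using eq[of r s] unfolding bsde_between_def by blast
  then show "AE \<omega> in M. real_cond_exp M (F r) (\<lambda>\<omega>. P s \<omega> - P r \<omega> + (LINT u:{r..s}|lborel. f u \<omega>)) \<omega> = 0"
    by (rule ito_integral_cond_exp_zero(2)[rotated 3]) (use ab rs in auto)
qed (use P bP bf in blast)+

lemma integrable_mult_AE_bounded:
  fixes f g :: "'a \<Rightarrow> real"
  assumes f: "integrable M f" and g: "g \<in> borel_measurable M" and le: "AE \<omega> in M. \<bar>g \<omega>\<bar> \<le> K"
  shows "integrable M (\<lambda>\<omega>. g \<omega> * f \<omega>)"
proof (rule Bochner_Integration.integrable_bound)
  show "integrable M (\<lambda>\<omega>. K * f \<omega>)" using f by simp
  show "(\<lambda>\<omega>. g \<omega> * f \<omega>) \<in> borel_measurable M" using f g by auto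
  show "AE \<omega> in M. norm (g \<omega> * f \<omega>) \<le> norm (K * f \<omega>)"
    using le by eventually_elim (auto simp: abs_mult intro!: mult_right_mono)
qed

text \<open>In expectation, \<open>d(P G) = (P g - f G) dt\<close> if \<open>G\<close> has velocity \<open>g\<close>. Expand
  \<open>P b * G b = P b * G a + (\<integral> r. P b * g r)\<close>. For each \<open>r\<close> the martingale property, tested against the
  \<open>F r\<close>-measurable variable \<open>g r\<close>, replaces \<open>P b\<close> by \<open>P r\<close> minus the integral of \<open>f\<close> from \<open>r\<close> to \<open>b\<close>. What
  remains is a double integral over the triangle \<open>r \<le> u\<close>, which by \<open>integral_square_split_diagonal\<close> is
  the integral of \<open>f * (G - G a)\<close>.\<close>

lemma drift_product_rule:
  assumes ab: "a \<le> b" "b \<le> T" and P: "has_drift a b P f"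
    and g: "progressive F a b g" "time_integrable a b g"
    and G: "progressive F a b G" "AE \<omega> in M. \<forall>s\<in>{a..b}. G s \<omega> = G a \<omega> + (LINT r:{a..s}|lborel. g r \<omega>)"
    and Ga: "integrable M (G a)"
  shows "time_integrable a b (\<lambda>r \<omega>. P r \<omega> * g r \<omega> - f r \<omega> * G r \<omega>)" (is ?I)
    and "integrable M (\<lambda>\<omega>. P a \<omega> * G a \<omega>)" "integrable M (\<lambda>\<omega>. P b \<omega> * G b \<omega>)"
    and "expectation (\<lambda>\<omega>. P b \<omega> * G b \<omega>) - expectation (\<lambda>\<omega>. P a \<omega> * G a \<omega>)
      = expectation (\<lambda>\<omega>. LINT r:{a..b}|lborel. P r \<omega> * g r \<omega> - f r \<omega> * G r \<omega>)"
proof -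
  obtain K L where K: "AE \<omega> in M. \<forall>s\<in>{a..b}. \<bar>P s \<omega>\<bar> \<le> K"
    and L: "AE (s, \<omega>) in lborel \<Otimes>\<^sub>M M. s \<in> {a..b} \<longrightarrow> \<bar>f s \<omega>\<bar> \<le> L"
    and mart: "\<And>r s. a \<le> r \<Longrightarrow> r \<le> s \<Longrightarrow> s \<le> b \<Longrightarrow>
        AE \<omega> in M. real_cond_exp M (F r) (\<lambda>\<omega>. P s \<omega> - P r \<omega> + (LINT u:{r..s}|lborel. f u \<omega>)) \<omega> = 0"
    and pP: "progressive F a b P" and pf: "progressive F a b f"
    using P unfolding has_drift_def by blast
  have a: "a \<in> {a..b}" and b: "b \<in> {a..b}" using ab by auto
  define \<Phi> where "\<Phi> s \<omega> = (LINT u:{a..s}|lborel. f u \<omega>)" for s \<omega>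
  have p\<Phi>: "progressive F a b \<Phi>" unfolding \<Phi>_def[abs_def] by (rule progressive_integral[OF pf])
  have tf: "time_integrable a b f" by (rule time_integrable_bound[OF time_integrable_const pf ab(2) L])
  have if_AE: "AE \<omega> in M. set_integrable lborel {a..b} (\<lambda>r. f r \<omega>)" by (rule time_integrableD(1)[OF tf])
  have ig_AE: "AE \<omega> in M. set_integrable lborel {a..b} (\<lambda>r. g r \<omega>)" by (rule time_integrableD(1)[OF g(2)])
  have L_AE: "AE \<omega> in M. AE s in lborel. s \<in> {a..b} \<longrightarrow> \<bar>f s \<omega>\<bar> \<le> L" by (rule AE_swap_time[OF L])
  have \<Phi>split: "AE \<omega> in M. \<forall>r\<in>{a..b}. (LINT u:{r..b}|lborel. f u \<omega>) = \<Phi> b \<omega> - \<Phi> r \<omega>"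
    using if_AE
  proof eventually_elim
    case (elim \<omega>)
    show ?case
    proof
      fix r assume r: "r \<in> {a..b}"
      show "(LINT u:{r..b}|lborel. f u \<omega>) = \<Phi> b \<omega> - \<Phi> r \<omega>" using LINT_split[OF elim r] by (simp add: \<Phi>_def)
    qed
  qed
  have \<Phi>bound: "AE \<omega> in M. \<forall>r\<in>{a..b}. \<bar>\<Phi> r \<omega>\<bar> \<le> \<bar>L\<bar> * (b - a)"
    using if_AE L_AE
  proof eventually_elim
    case (elim \<omega>)
    show ?case
    proof
      fix r assume r: "r \<in> {a..b}"
      have i: "set_integrable lborel {a..r} (\<lambda>r. f r \<omega>)" by (rule set_integrable_subset[OF elim(1)]) (use r in auto)
      have c: "set_integrable lborel {a..r} (\<lambda>r. \<bar>L\<bar>)" "(LINT u:{a..r}|lborel. \<bar>L\<bar>) = \<bar>L\<bar> * (r - a)"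
        using integrable_indicator_Icc[of a r] r by (simp_all add: set_integrable_def set_lebesgue_integral_def)
      have "\<bar>\<Phi> r \<omega>\<bar> \<le> (LINT u:{a..r}|lborel. \<bar>f u \<omega>\<bar>)" using set_integral_norm_bound[OF i] by (simp add: \<Phi>_def)
      also have "\<dots> \<le> (LINT u:{a..r}|lborel. \<bar>L\<bar>)"
        by (rule set_integral_mono_AE[OF set_integrable_abs[OF i] c(1)]) (use elim(2) r in \<open>eventually_elim, auto\<close>)
      also have "\<dots> \<le> \<bar>L\<bar> * (b - a)" unfolding c(2) using r by (intro mult_left_mono) auto
      finally show "\<bar>\<Phi> r \<omega>\<bar> \<le> \<bar>L\<bar> * (b - a)" .
    qed
  qed
  define D where "D \<omega> = \<bar>G a \<omega>\<bar> + (LINT r:{a..b}|lborel. \<bar>g r \<omega>\<bar>)" for \<omega>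
  have iD: "integrable M D"
    unfolding D_def[abs_def] using Ga time_integrableD(2)[OF time_integrable_abs[OF g(2)]] by simp
  have GD: "AE \<omega> in M. \<forall>s\<in>{a..b}. \<bar>G s \<omega>\<bar> \<le> D \<omega>"
    using G(2) ig_AE
  proof eventually_elim
    case (elim \<omega>)
    show ?case
    proof
      fix s assume s: "s \<in> {a..b}"
      have i: "set_integrable lborel {a..s} (\<lambda>r. g r \<omega>)" by (rule set_integrable_subset[OF elim(2)]) (use s in auto)
      have "\<bar>LINT r:{a..s}|lborel. g r \<omega>\<bar> \<le> (LINT r:{a..s}|lborel. \<bar>g r \<omega>\<bar>)" using set_integral_norm_bound[OF i] by simp
      also have "\<dots> \<le> (LINT r:{a..b}|lborel. \<bar>g r \<omega>\<bar>)"
        unfolding set_lebesgue_integral_def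
        by (rule integral_mono) (use set_integrable_abs[OF i] set_integrable_abs[OF elim(2)] s in \<open>auto simp: set_integrable_def split: split_indicator\<close>)
      finally have "\<bar>LINT r:{a..s}|lborel. g r \<omega>\<bar> \<le> (LINT r:{a..b}|lborel. \<bar>g r \<omega>\<bar>)" .
      moreover have "G s \<omega> = G a \<omega> + (LINT r:{a..s}|lborel. g r \<omega>)" using elim(1) s by blast
      ultimately show "\<bar>G s \<omega>\<bar> \<le> D \<omega>" unfolding D_def by linarith
    qed
  qed
  have mP: "P r \<in> borel_measurable M" and mG: "G r \<in> borel_measurable M" and m\<Phi>: "\<Phi> r \<in> borel_measurable M"
    if "r \<in> {a..b}" for r
    by (fact progressive_time_M[OF pP that ab(2)] progressive_time_M[OF G(1) that ab(2)] progressive_time_M[OF p\<Phi> that ab(2)])+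
  have Pb: "AE \<omega> in M. \<bar>P r \<omega>\<bar> \<le> K" if "r \<in> {a..b}" for r using K by eventually_elim (use that in auto)
  have iG: "integrable M (G r)" if r: "r \<in> {a..b}" for r
  proof (rule Bochner_Integration.integrable_bound[OF iD mG[OF r]])
    show "AE \<omega> in M. norm (G r \<omega>) \<le> norm (D \<omega>)"
      using GD
    proof eventually_elim
      case (elim \<omega>)
      then have "\<bar>G r \<omega>\<bar> \<le> D \<omega>" using r by blast
      then show ?case by simp
    qed
  qed
  show iPGa: "integrable M (\<lambda>\<omega>. P a \<omega> * G a \<omega>)" and "integrable M (\<lambda>\<omega>. P b \<omega> * G b \<omega>)"
    by (rule integrable_mult_AE_bounded[OF iG mP Pb]; use a b in simp)+
  have iPbGa: "integrable M (\<lambda>\<omega>. P b \<omega> * G a \<omega>)" by (rule integrable_mult_AE_bounded[OF iG[OF a] mP[OF b] Pb[OF b]])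
  have \<Phi>b: "AE \<omega> in M. \<bar>\<Phi> b \<omega>\<bar> \<le> \<bar>L\<bar> * (b - a)" using \<Phi>bound by eventually_elim (use b in auto)
  have i\<Phi>G: "integrable M (\<lambda>\<omega>. \<Phi> b \<omega> * G a \<omega>)" by (rule integrable_mult_AE_bounded[OF iG[OF a] m\<Phi>[OF b] \<Phi>b])
  have tPg: "time_integrable a b (\<lambda>r \<omega>. P r \<omega> * g r \<omega>)"
  proof (rule time_integrable_bound[OF time_integrable_cmult[OF time_integrable_abs[OF g(2)], of K] _ ab(2)])
    show "progressive F a b (\<lambda>r \<omega>. P r \<omega> * g r \<omega>)" by (intro progressive_intros pP g)
    show "AE (r, \<omega>) in lborel \<Otimes>\<^sub>M M. r \<in> {a..b} \<longrightarrow> \<bar>P r \<omega> * g r \<omega>\<bar> \<le> K * \<bar>g r \<omega>\<bar>"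
      using AE_lift_time[OF K] by eventually_elim (auto simp: abs_mult intro!: mult_right_mono)
  qed
  have tfG: "time_integrable a b (\<lambda>r \<omega>. f r \<omega> * G r \<omega>)"
  proof (rule time_integrable_bound[OF time_integrable_cmult[OF time_integrable_random[OF iD], where c=L] _ ab(2)])
    show "progressive F a b (\<lambda>r \<omega>. f r \<omega> * G r \<omega>)" by (intro progressive_intros pf G)
    show "AE (r, \<omega>) in lborel \<Otimes>\<^sub>M M. r \<in> {a..b} \<longrightarrow> \<bar>f r \<omega> * G r \<omega>\<bar> \<le> L * D \<omega>"
      using L AE_lift_time[OF GD]
    proof eventually_elim
      case (elim p)
      obtain r \<omega> where p: "p = (r, \<omega>)" by (cases p)
      have "\<bar>f r \<omega>\<bar> * \<bar>G r \<omega>\<bar> \<le> L * D \<omega>" if "r \<in> {a..b}"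
      proof (rule mult_mono)
        show le: "\<bar>f r \<omega>\<bar> \<le> L" "\<bar>G r \<omega>\<bar> \<le> D \<omega>" using elim that unfolding p by auto
        show "0 \<le> L" using le(1) by linarith
      qed simp
      then show ?case by (simp add: p abs_mult)
    qed
  qed
  show ?I by (rule time_integrable_diff[OF tPg tfG])
  have mg: "(\<lambda>p. indicator {a..b} (fst p) * g (fst p) (snd p)) \<in> borel_measurable (lborel \<Otimes>\<^sub>M M)"
    using progressive_jointly_measurable[OF g(1) ab(2)] by (simp add: split_beta')
  have tPbg: "time_integrable a b (\<lambda>r \<omega>. P b \<omega> * g r \<omega>)"
  proof (rule time_integrable_bound_measurable[OF time_integrable_cmult[OF time_integrable_abs[OF g(2)], of K]])
    have [measurable]: "P b \<in> borel_measurable M" by (rule mP[OF b])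
    have "(\<lambda>p. P b (snd p) * (indicator {a..b} (fst p) * g (fst p) (snd p))) \<in> borel_measurable (lborel \<Otimes>\<^sub>M M)"
      using mg by measurable
    then show "(\<lambda>(r, \<omega>). indicator {a..b} r * (P b \<omega> * g r \<omega>)) \<in> borel_measurable (lborel \<Otimes>\<^sub>M M)"
      by (simp add: split_beta' mult.left_commute)
    show "AE (r, \<omega>) in lborel \<Otimes>\<^sub>M M. r \<in> {a..b} \<longrightarrow> \<bar>P b \<omega> * g r \<omega>\<bar> \<le> K * \<bar>g r \<omega>\<bar>"
      using AE_lift_time[OF K] by eventually_elim (use b in \<open>auto simp: abs_mult intro!: mult_right_mono\<close>)
  qed
  have t\<Phi>bg: "time_integrable a b (\<lambda>r \<omega>. g r \<omega> * (\<Phi> b \<omega> - \<Phi> r \<omega>))"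
  proof (rule time_integrable_bound_measurable[OF time_integrable_cmult[OF time_integrable_abs[OF g(2)], of "2 * (\<bar>L\<bar> * (b - a))"]])
    have [measurable]: "\<Phi> b \<in> borel_measurable M" by (rule m\<Phi>[OF b])
    have [measurable]: "(\<lambda>p. indicator {a..b} (fst p) * \<Phi> (fst p) (snd p)) \<in> borel_measurable (lborel \<Otimes>\<^sub>M M)"
      using progressive_jointly_measurable[OF p\<Phi> ab(2)] by (simp add: split_beta')
    have "(\<lambda>p. (indicator {a..b} (fst p) * g (fst p) (snd p)) * (\<Phi> b (snd p) - indicator {a..b} (fst p) * \<Phi> (fst p) (snd p))) \<in> borel_measurable (lborel \<Otimes>\<^sub>M M)"
      using mg by measurable
    also have "(\<lambda>p. (indicator {a..b} (fst p) * g (fst p) (snd p)) * (\<Phi> b (snd p) - indicator {a..b} (fst p) * \<Phi> (fst p) (snd p)))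
       = (\<lambda>(r, \<omega>). indicator {a..b} r * (g r \<omega> * (\<Phi> b \<omega> - \<Phi> r \<omega>)))"
      by (auto simp: fun_eq_iff indicator_def)
    finally show "(\<lambda>(r, \<omega>). indicator {a..b} r * (g r \<omega> * (\<Phi> b \<omega> - \<Phi> r \<omega>))) \<in> borel_measurable (lborel \<Otimes>\<^sub>M M)" .
    show "AE (r, \<omega>) in lborel \<Otimes>\<^sub>M M. r \<in> {a..b} \<longrightarrow> \<bar>g r \<omega> * (\<Phi> b \<omega> - \<Phi> r \<omega>)\<bar> \<le> 2 * (\<bar>L\<bar> * (b - a)) * \<bar>g r \<omega>\<bar>"
      using AE_lift_time[OF \<Phi>bound]
    proof eventually_elim
      case (elim p)
      obtain r \<omega> where p: "p = (r, \<omega>)" by (cases p)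
      have "\<bar>\<Phi> b \<omega> - \<Phi> r \<omega>\<bar> * \<bar>g r \<omega>\<bar> \<le> 2 * (\<bar>L\<bar> * (b - a)) * \<bar>g r \<omega>\<bar>" if "r \<in> {a..b}"
      proof (rule mult_right_mono)
        have "\<bar>\<Phi> b \<omega>\<bar> \<le> \<bar>L\<bar> * (b - a)" "\<bar>\<Phi> r \<omega>\<bar> \<le> \<bar>L\<bar> * (b - a)" using elim that b unfolding p by auto
        then show "\<bar>\<Phi> b \<omega> - \<Phi> r \<omega>\<bar> \<le> 2 * (\<bar>L\<bar> * (b - a))" by linarith
      qed simp
      then show ?case by (simp add: p abs_mult mult.commute)
    qed
  qed
  \<comment> \<open>The increment of the martingale is bounded, so that test variables need only be integrable; nothing
    more is known about \<open>g r\<close>.\<close>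
  have test: "expectation (\<lambda>\<omega>. h \<omega> * (P b \<omega> - P r \<omega> + (\<Phi> b \<omega> - \<Phi> r \<omega>))) = 0"
    if r: "r \<in> {a..b}" and h: "h \<in> borel_measurable (F r)" "integrable M h" for r h
  proof -
    let ?N = "\<lambda>\<omega>. P b \<omega> - P r \<omega> + (LINT u:{r..b}|lborel. f u \<omega>)"
    have m1: "(\<lambda>\<omega>. LINT u:{r..b}|lborel. f u \<omega>) \<in> borel_measurable M"
      by (rule progressive_time_M[OF progressive_integral[OF progressive_subinterval[OF pf, of r b]], of b]) (use r ab in auto)
    have mN: "?N \<in> borel_measurable M" by (intro borel_measurable_add borel_measurable_diff mP m1 b r)
    have "AE \<omega> in M. \<bar>?N \<omega>\<bar> \<le> 2 * K + 2 * (\<bar>L\<bar> * (b - a))"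
      using K \<Phi>split \<Phi>bound
    proof eventually_elim
      case (elim \<omega>)
      then have "\<bar>P b \<omega>\<bar> \<le> K" "\<bar>P r \<omega>\<bar> \<le> K" "\<bar>\<Phi> b \<omega>\<bar> \<le> \<bar>L\<bar> * (b - a)" "\<bar>\<Phi> r \<omega>\<bar> \<le> \<bar>L\<bar> * (b - a)"
        "(LINT u:{r..b}|lborel. f u \<omega>) = \<Phi> b \<omega> - \<Phi> r \<omega>"
        using r b by auto
      then show ?case by linarith
    qed
    from integrable_mult_AE_bounded[OF h(2) mN this]
    have i: "integrable M (\<lambda>\<omega>. h \<omega> * ?N \<omega>)" by (simp add: mult.commute)
    have "expectation (\<lambda>\<omega>. h \<omega> * ?N \<omega>) = expectation (\<lambda>\<omega>. h \<omega> * real_cond_exp M (F r) ?N \<omega>)"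
      by (rule sigma_finite_subalgebra.real_cond_exp_intg(2)[OF cond_exp_F i h(1) mN, symmetric]) (use r ab in auto)
    also have "\<dots> = 0"
      by (rule integral_eq_zero_AE) (use mart[of r b] r in auto)
    also have "expectation (\<lambda>\<omega>. h \<omega> * ?N \<omega>) = expectation (\<lambda>\<omega>. h \<omega> * (P b \<omega> - P r \<omega> + (\<Phi> b \<omega> - \<Phi> r \<omega>)))"
      by (rule integral_cong_AE)
        (use h mN mP[OF r] mP[OF b] m\<Phi>[OF r] m\<Phi>[OF b] \<Phi>split r in \<open>auto intro!: borel_measurable_times borel_measurable_add borel_measurable_diff\<close>)
    finally show ?thesis by simp
  qed
  have "expectation (\<lambda>\<omega>. G a \<omega> * (P b \<omega> - P a \<omega> + (\<Phi> b \<omega> - \<Phi> a \<omega>))) = 0"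
    by (rule test[OF a progressive_at_time[OF G(1) a] Ga])
  moreover have "G a \<omega> * (P b \<omega> - P a \<omega> + (\<Phi> b \<omega> - \<Phi> a \<omega>)) = P b \<omega> * G a \<omega> - P a \<omega> * G a \<omega> + \<Phi> b \<omega> * G a \<omega>" for \<omega>
    by (simp add: \<Phi>_def LINT_at_point algebra_simps)
  ultimately have start: "expectation (\<lambda>\<omega>. P b \<omega> * G a \<omega>) = expectation (\<lambda>\<omega>. P a \<omega> * G a \<omega>) - expectation (\<lambda>\<omega>. \<Phi> b \<omega> * G a \<omega>)"
    using iPbGa iPGa i\<Phi>G by simp
  have slice: "AE r in lborel. r \<in> {a..b} \<longrightarrow>
     expectation (\<lambda>\<omega>. P b \<omega> * g r \<omega>) = expectation (\<lambda>\<omega>. P r \<omega> * g r \<omega> - g r \<omega> * (\<Phi> b \<omega> - \<Phi> r \<omega>))"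
    using time_integrableD(3)[OF g(2)] time_integrableD(3)[OF tPbg] time_integrableD(3)[OF tPg] time_integrableD(3)[OF t\<Phi>bg]
  proof eventually_elim
    case (elim r)
    show ?case
    proof
      assume r: "r \<in> {a..b}"
      have i: "integrable M (\<lambda>\<omega>. P b \<omega> * g r \<omega>)" "integrable M (\<lambda>\<omega>. P r \<omega> * g r \<omega>)" "integrable M (\<lambda>\<omega>. g r \<omega> * (\<Phi> b \<omega> - \<Phi> r \<omega>))"
        using elim r by auto
      have "expectation (\<lambda>\<omega>. g r \<omega> * (P b \<omega> - P r \<omega> + (\<Phi> b \<omega> - \<Phi> r \<omega>))) = 0"
        by (rule test[OF r progressive_at_time[OF g(1) r]]) (use elim r in auto)
      also have "(\<lambda>\<omega>. g r \<omega> * (P b \<omega> - P r \<omega> + (\<Phi> b \<omega> - \<Phi> r \<omega>)))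
          = (\<lambda>\<omega>. P b \<omega> * g r \<omega> - (P r \<omega> * g r \<omega> - g r \<omega> * (\<Phi> b \<omega> - \<Phi> r \<omega>)))"
        by (simp add: fun_eq_iff algebra_simps)
      finally show "expectation (\<lambda>\<omega>. P b \<omega> * g r \<omega>) = expectation (\<lambda>\<omega>. P r \<omega> * g r \<omega> - g r \<omega> * (\<Phi> b \<omega> - \<Phi> r \<omega>))"
        using i by simp
    qed
  qed
  have tR: "time_integrable a b (\<lambda>r \<omega>. P r \<omega> * g r \<omega> - g r \<omega> * (\<Phi> b \<omega> - \<Phi> r \<omega>))" by (rule time_integrable_diff[OF tPg t\<Phi>bg])
  have "expectation (\<lambda>\<omega>. P b \<omega> * G b \<omega>) = expectation (\<lambda>\<omega>. P b \<omega> * G a \<omega> + (LINT r:{a..b}|lborel. P b \<omega> * g r \<omega>))"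
  proof (rule integral_cong_AE)
    show "(\<lambda>\<omega>. P b \<omega> * G b \<omega>) \<in> borel_measurable M" using mP[OF b] mG[OF b] by simp
    show "(\<lambda>\<omega>. P b \<omega> * G a \<omega> + (LINT r:{a..b}|lborel. P b \<omega> * g r \<omega>)) \<in> borel_measurable M"
      using iPbGa time_integrableD(2)[OF tPbg] by (intro borel_measurable_add borel_measurable_integrable)
    show "AE \<omega> in M. P b \<omega> * G b \<omega> = P b \<omega> * G a \<omega> + (LINT r:{a..b}|lborel. P b \<omega> * g r \<omega>)"
      using G(2)
    proof eventually_elim
      case (elim \<omega>)
      then have "G b \<omega> = G a \<omega> + (LINT r:{a..b}|lborel. g r \<omega>)" using b by blast
      then show ?case by (simp only: distrib_left set_integral_mult_right)
    qed
  qed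
  also have "\<dots> = expectation (\<lambda>\<omega>. P b \<omega> * G a \<omega>) + (LINT r:{a..b}|lborel. expectation (\<lambda>\<omega>. P b \<omega> * g r \<omega>))"
    using iPbGa time_integrableD(2,4)[OF tPbg] by simp
  also have "(LINT r:{a..b}|lborel. expectation (\<lambda>\<omega>. P b \<omega> * g r \<omega>))
     = (LINT r:{a..b}|lborel. expectation (\<lambda>\<omega>. P r \<omega> * g r \<omega> - g r \<omega> * (\<Phi> b \<omega> - \<Phi> r \<omega>)))"
    unfolding set_lebesgue_integral_def
  proof (rule integral_cong_AE)
    show "AE r in lborel. indicat_real {a..b} r *\<^sub>R expectation (\<lambda>\<omega>. P b \<omega> * g r \<omega>)
       = indicat_real {a..b} r *\<^sub>R expectation (\<lambda>\<omega>. P r \<omega> * g r \<omega> - g r \<omega> * (\<Phi> b \<omega> - \<Phi> r \<omega>))"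
      using slice by eventually_elim (auto simp: indicator_def)
    show "(\<lambda>r. indicat_real {a..b} r *\<^sub>R expectation (\<lambda>\<omega>. P b \<omega> * g r \<omega>)) \<in> borel_measurable lborel"
      "(\<lambda>r. indicat_real {a..b} r *\<^sub>R expectation (\<lambda>\<omega>. P r \<omega> * g r \<omega> - g r \<omega> * (\<Phi> b \<omega> - \<Phi> r \<omega>))) \<in> borel_measurable lborel"
      using borel_measurable_integrable[OF time.integrable_fst[OF tPbg[unfolded time_integrable_def]]]
        borel_measurable_integrable[OF time.integrable_fst[OF tR[unfolded time_integrable_def]]] by simp_all
  qed
  also have "\<dots> = expectation (\<lambda>\<omega>. LINT r:{a..b}|lborel. P r \<omega> * g r \<omega> - g r \<omega> * (\<Phi> b \<omega> - \<Phi> r \<omega>))"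
    by (rule time_integrableD(4)[OF tR, symmetric])
  also have "\<dots> = expectation (\<lambda>\<omega>. (LINT r:{a..b}|lborel. P r \<omega> * g r \<omega> - f r \<omega> * G r \<omega>) + \<Phi> b \<omega> * G a \<omega>)"
  proof (rule integral_cong_AE)
    show "(\<lambda>\<omega>. LINT r:{a..b}|lborel. P r \<omega> * g r \<omega> - g r \<omega> * (\<Phi> b \<omega> - \<Phi> r \<omega>)) \<in> borel_measurable M"
      by (rule borel_measurable_integrable[OF time_integrableD(2)[OF tR]])
    show "(\<lambda>\<omega>. (LINT r:{a..b}|lborel. P r \<omega> * g r \<omega> - f r \<omega> * G r \<omega>) + \<Phi> b \<omega> * G a \<omega>) \<in> borel_measurable M"
      using time_integrableD(2)[OF time_integrable_diff[OF tPg tfG]] i\<Phi>G by (intro borel_measurable_add borel_measurable_integrable)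
    show "AE \<omega> in M. (LINT r:{a..b}|lborel. P r \<omega> * g r \<omega> - g r \<omega> * (\<Phi> b \<omega> - \<Phi> r \<omega>))
        = (LINT r:{a..b}|lborel. P r \<omega> * g r \<omega> - f r \<omega> * G r \<omega>) + \<Phi> b \<omega> * G a \<omega>"
      using G(2) ig_AE if_AE time_integrableD(1)[OF tPg] time_integrableD(1)[OF tfG] time_integrableD(1)[OF t\<Phi>bg]
    proof eventually_elim
      case (elim \<omega>)
      let ?g = "\<lambda>r. g r \<omega>" and ?f = "\<lambda>r. f r \<omega>" and ?\<Gamma> = "\<lambda>r. LINT u:{a..r}|lborel. g u \<omega>"
      have i1: "set_integrable lborel {a..b} (\<lambda>r. ?g r * \<Phi> r \<omega>)"
        unfolding \<Phi>_def by (rule set_integrable_mult_continuous[OF elim(2) continuous_on_indefinite_LINT[OF elim(3)]])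
      have i2: "set_integrable lborel {a..b} (\<lambda>r. ?f r * ?\<Gamma> r)"
        by (rule set_integrable_mult_continuous[OF elim(3) continuous_on_indefinite_LINT[OF elim(2)]])
      have "(LINT r:{a..b}|lborel. ?g r * (\<Phi> b \<omega> - \<Phi> r \<omega>)) = ?\<Gamma> b * \<Phi> b \<omega> - (LINT r:{a..b}|lborel. ?g r * \<Phi> r \<omega>)"
        using elim(2) i1 by (simp add: right_diff_distrib set_integral_diff)
      also have "\<dots> = (LINT r:{a..b}|lborel. ?f r * ?\<Gamma> r)"
        using integral_square_split_diagonal[OF elim(2,3)] by (simp add: \<Phi>_def)
      also have "\<dots> = (LINT r:{a..b}|lborel. f r \<omega> * G r \<omega> - G a \<omega> * f r \<omega>)"
      proof (rule set_lebesgue_integral_cong, simp, intro allI impI)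
        fix r assume "r \<in> {a..b}"
        then have "G r \<omega> = G a \<omega> + ?\<Gamma> r" using elim(1) by blast
        then show "f r \<omega> * ?\<Gamma> r = f r \<omega> * G r \<omega> - G a \<omega> * f r \<omega>" by (simp add: algebra_simps)
      qed
      also have "\<dots> = (LINT r:{a..b}|lborel. f r \<omega> * G r \<omega>) - G a \<omega> * \<Phi> b \<omega>"
        using elim(3,5) by (simp add: set_integral_diff \<Phi>_def)
      finally show ?case using elim(4,5,6) by (simp add: set_integral_diff mult.commute)
    qed
  qed
  also have "\<dots> = expectation (\<lambda>\<omega>. LINT r:{a..b}|lborel. P r \<omega> * g r \<omega> - f r \<omega> * G r \<omega>) + expectation (\<lambda>\<omega>. \<Phi> b \<omega> * G a \<omega>)"
    using time_integrableD(2)[OF time_integrable_diff[OF tPg tfG]] i\<Phi>G by simp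
  finally show "expectation (\<lambda>\<omega>. P b \<omega> * G b \<omega>) - expectation (\<lambda>\<omega>. P a \<omega> * G a \<omega>)
      = expectation (\<lambda>\<omega>. LINT r:{a..b}|lborel. P r \<omega> * g r \<omega> - f r \<omega> * G r \<omega>)"
    using start by simp
qed

text \<open>The product rule for \<open>G = U V\<close> on an event \<open>H\<close> that is known at the initial time. With \<open>H\<close> ranging
  over \<open>F t\<close>, statements about expectations are as strong as statements about conditional
  expectations.\<close>

lemma drift_times_product:
  assumes tb: "0 \<le> t" "t \<le> b" "b \<le> T" and P: "has_drift t b P f" and H: "H \<in> sets (F t)"
    and U: "progressive F t b U" "progressive F t b V" "progressive F t b u" "progressive F t b v"
    and dU: "AE \<omega> in M. set_integrable lborel {t..b} (\<lambda>r. u r \<omega>) \<and> (\<forall>s\<in>{t..b}. U s \<omega> = x + (LINT r:{t..s}|lborel. u r \<omega>))"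
    and dV: "AE \<omega> in M. set_integrable lborel {t..b} (\<lambda>r. v r \<omega>) \<and> (\<forall>s\<in>{t..b}. V s \<omega> = y + (LINT r:{t..s}|lborel. v r \<omega>))"
    and D: "integrable M D" "AE \<omega> in M. \<forall>s\<in>{t..b}. (U s \<omega>)\<^sup>2 \<le> D \<omega> \<and> (V s \<omega>)\<^sup>2 \<le> D \<omega>"
    and sq: "time_integrable t b (\<lambda>s \<omega>. (u s \<omega>)\<^sup>2)" "time_integrable t b (\<lambda>s \<omega>. (v s \<omega>)\<^sup>2)"
  defines "h \<equiv> indicat_real H"
  shows "time_integrable t b (\<lambda>r \<omega>. h \<omega> * (P r \<omega> * (u r \<omega> * V r \<omega> + v r \<omega> * U r \<omega>) - f r \<omega> * (U r \<omega> * V r \<omega>)))"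
    and "integrable M (\<lambda>\<omega>. h \<omega> * (P t \<omega> * (U t \<omega> * V t \<omega>)))" "integrable M (\<lambda>\<omega>. h \<omega> * (P b \<omega> * (U b \<omega> * V b \<omega>)))"
    and "expectation (\<lambda>\<omega>. h \<omega> * (P b \<omega> * (U b \<omega> * V b \<omega>))) - expectation (\<lambda>\<omega>. h \<omega> * (P t \<omega> * (U t \<omega> * V t \<omega>)))
      = expectation (\<lambda>\<omega>. LINT r:{t..b}|lborel. h \<omega> * (P r \<omega> * (u r \<omega> * V r \<omega> + v r \<omega> * U r \<omega>) - f r \<omega> * (U r \<omega> * V r \<omega>)))"
proof -
  have h: "progressive F t b (\<lambda>s. h)" unfolding h_def by (rule progressive_random) (use H in simp)
  let ?g = "\<lambda>r \<omega>. h \<omega> * (u r \<omega> * V r \<omega> + v r \<omega> * U r \<omega>)"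
  let ?G = "\<lambda>r \<omega>. h \<omega> * (U r \<omega> * V r \<omega>)"
  have pg: "progressive F t b ?g" "progressive F t b ?G" by (intro progressive_intros h U)+
  note ab_le = abs_mult_le_squares
  have tg: "time_integrable t b ?g"
  proof (rule time_integrable_bound[OF time_integrable_add[OF time_integrable_add[OF sq] time_integrable_cmult[OF time_integrable_random[OF D(1)], where c=2]] pg(1) tb(3)])
    show "AE (r, \<omega>) in lborel \<Otimes>\<^sub>M M. r \<in> {t..b} \<longrightarrow> \<bar>?g r \<omega>\<bar> \<le> (u r \<omega>)\<^sup>2 + (v r \<omega>)\<^sup>2 + 2 * D \<omega>"
      using AE_lift_time[OF D(2)]
    proof eventually_elim
      case (elim p)
      obtain r \<omega> where p: "p = (r, \<omega>)" by (cases p)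
      have "\<bar>?g r \<omega>\<bar> \<le> (u r \<omega>)\<^sup>2 + (v r \<omega>)\<^sup>2 + 2 * D \<omega>" if "r \<in> {t..b}"
      proof -
        have "(U r \<omega>)\<^sup>2 \<le> D \<omega>" "(V r \<omega>)\<^sup>2 \<le> D \<omega>" using elim that unfolding p by auto
        then have "\<bar>u r \<omega> * V r \<omega> + v r \<omega> * U r \<omega>\<bar> \<le> (u r \<omega>)\<^sup>2 + (v r \<omega>)\<^sup>2 + 2 * D \<omega>"
          using ab_le[of "u r \<omega>" "V r \<omega>"] ab_le[of "v r \<omega>" "U r \<omega>"] by linarith
        moreover have "\<bar>?g r \<omega>\<bar> \<le> \<bar>u r \<omega> * V r \<omega> + v r \<omega> * U r \<omega>\<bar>" by (auto simp: h_def indicator_def)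
        ultimately show ?thesis by linarith
      qed
      then show ?case by (simp add: p)
    qed
  qed
  have G: "AE \<omega> in M. \<forall>s\<in>{t..b}. ?G s \<omega> = ?G t \<omega> + (LINT r:{t..s}|lborel. ?g r \<omega>)"
    using dU dV
  proof eventually_elim
    case (elim \<omega>)
    have P: "U s \<omega> * V s \<omega> = x * y + (LINT r:{t..s}|lborel. u r \<omega> * V r \<omega> + v r \<omega> * U r \<omega>)" if s: "s \<in> {t..b}" for s
    proof (rule product_of_indefinite_integrals(2))
      show "set_integrable lborel {t..s} (\<lambda>r. u r \<omega>)" "set_integrable lborel {t..s} (\<lambda>r. v r \<omega>)"
        using elim s by (auto intro: set_integrable_subset)
      show "\<forall>r\<in>{t..s}. U r \<omega> = x + (LINT q:{t..r}|lborel. u q \<omega>)" "\<forall>r\<in>{t..s}. V r \<omega> = y + (LINT q:{t..r}|lborel. v q \<omega>)"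
        using elim s by auto
    qed (use s in auto)
    have t: "U t \<omega> * V t \<omega> = x * y" using P[of t] tb by (simp add: LINT_at_point)
    show ?case
    proof
      fix s assume s: "s \<in> {t..b}"
      have "?G s \<omega> = h \<omega> * (x * y) + h \<omega> * (LINT r:{t..s}|lborel. u r \<omega> * V r \<omega> + v r \<omega> * U r \<omega>)"
        unfolding P[OF s] by (rule distrib_left)
      also have "\<dots> = ?G t \<omega> + (LINT r:{t..s}|lborel. ?g r \<omega>)" unfolding t by simp
      finally show "?G s \<omega> = ?G t \<omega> + (LINT r:{t..s}|lborel. ?g r \<omega>)" .
    qed
  qed
  have Gt: "integrable M (?G t)"
  proof (rule Bochner_Integration.integrable_bound)
    show "integrable M (\<lambda>\<omega>. 2 * D \<omega>)" using D(1) by simp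
    show "?G t \<in> borel_measurable M" by (rule progressive_time_M[OF pg(2) _ tb(3)]) (use tb in auto)
    show "AE \<omega> in M. norm (?G t \<omega>) \<le> norm (2 * D \<omega>)"
      using D(2)
    proof eventually_elim
      case (elim \<omega>)
      have "(U t \<omega>)\<^sup>2 \<le> D \<omega>" "(V t \<omega>)\<^sup>2 \<le> D \<omega>" using elim tb by auto
      then have "\<bar>U t \<omega> * V t \<omega>\<bar> \<le> \<bar>2 * D \<omega>\<bar>" using ab_le[of "U t \<omega>" "V t \<omega>"] by linarith
      moreover have "\<bar>?G t \<omega>\<bar> \<le> \<bar>U t \<omega> * V t \<omega>\<bar>" by (auto simp: h_def indicator_def)
      ultimately show ?case by simp
    qed
  qed
  note pr = drift_product_rule[OF tb(2,3) P pg(1) tg pg(2) G Gt]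
  have e: "P r \<omega> * ?g r \<omega> - f r \<omega> * ?G r \<omega>
     = h \<omega> * (P r \<omega> * (u r \<omega> * V r \<omega> + v r \<omega> * U r \<omega>) - f r \<omega> * (U r \<omega> * V r \<omega>))"
     and e': "P r \<omega> * ?G r \<omega> = h \<omega> * (P r \<omega> * (U r \<omega> * V r \<omega>))" for r \<omega>
    by (simp_all add: algebra_simps)
  show "time_integrable t b (\<lambda>r \<omega>. h \<omega> * (P r \<omega> * (u r \<omega> * V r \<omega> + v r \<omega> * U r \<omega>) - f r \<omega> * (U r \<omega> * V r \<omega>)))"
    "integrable M (\<lambda>\<omega>. h \<omega> * (P t \<omega> * (U t \<omega> * V t \<omega>)))" "integrable M (\<lambda>\<omega>. h \<omega> * (P b \<omega> * (U b \<omega> * V b \<omega>)))"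
    "expectation (\<lambda>\<omega>. h \<omega> * (P b \<omega> * (U b \<omega> * V b \<omega>))) - expectation (\<lambda>\<omega>. h \<omega> * (P t \<omega> * (U t \<omega> * V t \<omega>)))
      = expectation (\<lambda>\<omega>. LINT r:{t..b}|lborel. h \<omega> * (P r \<omega> * (u r \<omega> * V r \<omega> + v r \<omega> * U r \<omega>) - f r \<omega> * (U r \<omega> * V r \<omega>)))"
    using pr unfolding e e' by blast+
qed

end

section \<open>The controlled state process\<close>

locale control_problem = brownian_filtration M F W T
  for M :: "'a measure" and F :: "real \<Rightarrow> 'a measure" and W :: "real \<Rightarrow> 'a \<Rightarrow> real ^ 'm" and T :: real +
  fixes \<eta> \<gamma> :: real and \<rho> lam :: "real \<Rightarrow> 'a \<Rightarrow> real"
  assumes eta: "\<eta> > 0" and gamma: "\<gamma> \<ge> 0"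
    and rho: "Linf_prog M F 0 T {0..} \<rho>" and lam: "Linf_prog M F 0 T {0..} lam"
begin

lemma rho_bound: "\<exists>K\<ge>0. AE (s, \<omega>) in lborel \<Otimes>\<^sub>M M. s \<in> {0..T} \<longrightarrow> \<bar>\<rho> s \<omega>\<bar> \<le> K"
proof -
  obtain K where K: "AE (s, \<omega>) in lborel \<Otimes>\<^sub>M M. s \<in> {0..T} \<longrightarrow> \<rho> s \<omega> \<in> {0..} \<and> norm (\<rho> s \<omega>) \<le> K"
    using rho unfolding Linf_prog_def by blast
  have "AE (s, \<omega>) in lborel \<Otimes>\<^sub>M M. s \<in> {0..T} \<longrightarrow> \<bar>\<rho> s \<omega>\<bar> \<le> \<bar>K\<bar>"
    using K by eventually_elim auto
  then show ?thesis by (intro exI[of _ "\<bar>K\<bar>"]) simp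
qed

lemma lam_bound:
  "\<exists>K\<ge>0. AE (s, \<omega>) in lborel \<Otimes>\<^sub>M M. s \<in> {0..T} \<longrightarrow> 0 \<le> lam s \<omega> \<and> \<bar>lam s \<omega>\<bar> \<le> K"
proof -
  obtain K where K: "AE (s, \<omega>) in lborel \<Otimes>\<^sub>M M. s \<in> {0..T} \<longrightarrow> lam s \<omega> \<in> {0..} \<and> norm (lam s \<omega>) \<le> K"
    using lam unfolding Linf_prog_def by blast
  have "AE (s, \<omega>) in lborel \<Otimes>\<^sub>M M. s \<in> {0..T} \<longrightarrow> 0 \<le> lam s \<omega> \<and> \<bar>lam s \<omega>\<bar> \<le> \<bar>K\<bar>"
    using K by eventually_elim auto
  then show ?thesis by (intro exI[of _ "\<bar>K\<bar>"]) simp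
qed

lemma rho_progressive: "0 \<le> t \<Longrightarrow> b \<le> T \<Longrightarrow> progressive F t b \<rho>"
  using rho unfolding Linf_prog_def by (blast intro: progressive_subinterval)

lemma lam_progressive: "0 \<le> t \<Longrightarrow> b \<le> T \<Longrightarrow> progressive F t b lam"
  using lam unfolding Linf_prog_def by (blast intro: progressive_subinterval)

definition rho_max :: real where
  "rho_max = (SOME K. K \<ge> 0 \<and> (AE (s, \<omega>) in lborel \<Otimes>\<^sub>M M. s \<in> {0..T} \<longrightarrow> \<bar>\<rho> s \<omega>\<bar> \<le> K))"

lemma rho_max: "rho_max \<ge> 0" "AE (s, \<omega>) in lborel \<Otimes>\<^sub>M M. s \<in> {0..T} \<longrightarrow> \<bar>\<rho> s \<omega>\<bar> \<le> rho_max"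
proof -
  have "rho_max \<ge> 0 \<and> (AE (s, \<omega>) in lborel \<Otimes>\<^sub>M M. s \<in> {0..T} \<longrightarrow> \<bar>\<rho> s \<omega>\<bar> \<le> rho_max)"
    unfolding rho_max_def using rho_bound by (rule someI_ex)
  then show "rho_max \<ge> 0" "AE (s, \<omega>) in lborel \<Otimes>\<^sub>M M. s \<in> {0..T} \<longrightarrow> \<bar>\<rho> s \<omega>\<bar> \<le> rho_max" by auto
qed

text \<open>The Gronwall constant of the state equation over the full horizon; it depends neither on the
  control nor on the initial time.\<close>

definition state_gain :: real where
  "state_gain = 2 * (1 + \<gamma>) * exp (2 * (rho_max + 1) * T)"

lemma state_gain_ge_1: "state_gain \<ge> 1"
proof -
  have "1 \<le> exp (2 * (rho_max + 1) * T)" using T_pos rho_max(1) by simp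
  then have "1 * 1 \<le> (2 * (1 + \<gamma>)) * exp (2 * (rho_max + 1) * T)" using gamma by (intro mult_mono) auto
  then show ?thesis by (simp add: state_gain_def)
qed

lemma state_process_bound:
  assumes tb: "0 \<le> t" "t \<le> b" "b \<le> T" and st: "state_process M F \<gamma> \<rho> t b x y \<xi> X Y"
  shows "AE \<omega> in M. \<forall>s\<in>{t..b}. \<bar>X s \<omega>\<bar> \<le> state_gain * (\<bar>x\<bar> + \<bar>y\<bar> + (LINT r:{t..b}|lborel. \<bar>\<xi> r \<omega>\<bar>))
     \<and> \<bar>Y s \<omega>\<bar> \<le> state_gain * (\<bar>x\<bar> + \<bar>y\<bar> + (LINT r:{t..b}|lborel. \<bar>\<xi> r \<omega>\<bar>))"
proof -
  define K where "K = rho_max"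
  have K: "K \<ge> 0" "AE \<omega> in M. AE s in lborel. s \<in> {0..T} \<longrightarrow> \<bar>\<rho> s \<omega>\<bar> \<le> K"
    using rho_max AE_swap_time[OF rho_max(2)] by (auto simp: K_def)
  have g: "state_gain = 2 * (1 + \<gamma>) * exp (2 * (K + 1) * T)" by (simp add: state_gain_def K_def)
  have X: "AE \<omega> in M. \<forall>s\<in>{t..b}. set_integrable lborel {t..s} (\<lambda>r. \<xi> r \<omega>) \<and> X s \<omega> = x - (LINT r:{t..s}|lborel. \<xi> r \<omega>)"
    and Y: "AE \<omega> in M. \<forall>s\<in>{t..b}. set_integrable lborel {t..s} (\<lambda>r. - \<rho> r \<omega> * Y r \<omega> + \<gamma> * \<xi> r \<omega>) \<and>
        Y s \<omega> = y + (LINT r:{t..s}|lborel. - \<rho> r \<omega> * Y r \<omega> + \<gamma> * \<xi> r \<omega>)"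
    using st unfolding state_process_def position_process_def by auto
  show ?thesis using X Y K(2)
  proof eventually_elim
    case (elim \<omega>)
    let ?J = "LINT r:{t..b}|lborel. \<bar>\<xi> r \<omega>\<bar>"
    have J0: "0 \<le> ?J" unfolding set_lebesgue_integral_def by (rule Bochner_Integration.integral_nonneg) simp
    have b: "b \<in> {t..b}" using tb by simp
    have \<rho>: "AE s in lborel. s \<in> {t..b} \<longrightarrow> \<bar>\<rho> s \<omega>\<bar> \<le> K" using elim(3) by eventually_elim (use tb in auto)
    have i1: "set_integrable lborel {t..b} (\<lambda>r. \<xi> r \<omega>)" and i2: "set_integrable lborel {t..b} (\<lambda>r. - \<rho> r \<omega> * Y r \<omega> + \<gamma> * \<xi> r \<omega>)"
      using elim(1,2) b by blast+
    have eX: "\<forall>s\<in>{t..b}. X s \<omega> = x - (LINT r:{t..s}|lborel. \<xi> r \<omega>)"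
      and eY: "\<forall>s\<in>{t..b}. Y s \<omega> = y + (LINT r:{t..s}|lborel. - \<rho> r \<omega> * Y r \<omega> + \<gamma> * \<xi> r \<omega>)"
      using elim(1,2) by blast+
    have E: "exp (2 * (K + 1) * (b - t)) \<le> exp (2 * (K + 1) * T)"
      using K(1) tb by (auto intro!: mult_left_mono)
    show ?case
    proof
      fix s assume s: "s \<in> {t..b}"
      note B = linear_state_bound[OF i1 eX i2 eY \<rho> K(1) gamma s]
      have "\<bar>X s \<omega>\<bar> \<le> 1 * (\<bar>x\<bar> + \<bar>y\<bar> + ?J)" using B(1) by simp
      also have "\<dots> \<le> state_gain * (\<bar>x\<bar> + \<bar>y\<bar> + ?J)" by (rule mult_right_mono[OF state_gain_ge_1]) (use J0 in auto)
      finally have 1: "\<bar>X s \<omega>\<bar> \<le> state_gain * (\<bar>x\<bar> + \<bar>y\<bar> + ?J)" .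
      have "\<bar>Y s \<omega>\<bar> \<le> 2 * (\<bar>y\<bar> + \<gamma> * ?J) * exp (2 * (K + 1) * (b - t))" by (rule B(2))
      also have "\<dots> \<le> 2 * ((1 + \<gamma>) * (\<bar>x\<bar> + \<bar>y\<bar> + ?J)) * exp (2 * (K + 1) * T)"
      proof (intro mult_mono E order_refl)
        have "(1 + \<gamma>) * (\<bar>x\<bar> + \<bar>y\<bar> + ?J) = \<bar>y\<bar> + \<gamma> * ?J + (\<bar>x\<bar> + ?J + \<gamma> * (\<bar>x\<bar> + \<bar>y\<bar>))" by (simp add: algebra_simps)
        moreover have "0 \<le> \<bar>x\<bar> + ?J + \<gamma> * (\<bar>x\<bar> + \<bar>y\<bar>)" using J0 gamma by auto
        ultimately show "\<bar>y\<bar> + \<gamma> * ?J \<le> (1 + \<gamma>) * (\<bar>x\<bar> + \<bar>y\<bar> + ?J)" by linarith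
      qed (use J0 gamma in auto)
      also have "\<dots> = state_gain * (\<bar>x\<bar> + \<bar>y\<bar> + ?J)" unfolding g by (simp only: ac_simps)
      finally have "\<bar>Y s \<omega>\<bar> \<le> state_gain * (\<bar>x\<bar> + \<bar>y\<bar> + ?J)" .
      with 1 show "\<bar>X s \<omega>\<bar> \<le> state_gain * (\<bar>x\<bar> + \<bar>y\<bar> + ?J) \<and> \<bar>Y s \<omega>\<bar> \<le> state_gain * (\<bar>x\<bar> + \<bar>y\<bar> + ?J)" ..
    qed
  qed
qed

text \<open>An integrable bound for \<open>X\<^sup>2\<close> and \<open>Y\<^sup>2\<close> at all times in \<open>{t..b}\<close> simultaneously, used as the
  dominating function in limits.\<close>

definition dominant :: "real \<Rightarrow> real \<Rightarrow> real \<Rightarrow> real \<Rightarrow> (real \<Rightarrow> 'a \<Rightarrow> real) \<Rightarrow> 'a \<Rightarrow> real" where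
  "dominant t b x y \<xi> \<omega> = 2 * state_gain\<^sup>2 * ((\<bar>x\<bar> + \<bar>y\<bar>)\<^sup>2 + (b - t) * (LINT r:{t..b}|lborel. (\<xi> r \<omega>)\<^sup>2))"

lemma dominant_integrable:
  assumes "b \<le> T" "L2_prog M F t b \<xi>"
  shows "integrable M (dominant t b x y \<xi>)"
  unfolding dominant_def[abs_def]
  using time_integrableD(2)[OF L2_progD(2)[OF assms]] by simp

lemma state_process_dominated:
  assumes tb: "0 \<le> t" "t \<le> b" "b \<le> T" and st: "state_process M F \<gamma> \<rho> t b x y \<xi> X Y" and \<xi>: "L2_prog M F t b \<xi>"
  shows "AE \<omega> in M. \<forall>s\<in>{t..b}. (X s \<omega>)\<^sup>2 \<le> dominant t b x y \<xi> \<omega> \<and> (Y s \<omega>)\<^sup>2 \<le> dominant t b x y \<xi> \<omega>"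
  using state_process_bound[OF tb st] time_integrableD(1)[OF L2_progD(2)[OF tb(3) \<xi>]]
    conjunct2[OF conjunct1[OF st[unfolded state_process_def], unfolded position_process_def]]
proof eventually_elim
  case (elim \<omega>)
  let ?J = "LINT r:{t..b}|lborel. \<bar>\<xi> r \<omega>\<bar>"
  have i: "set_integrable lborel {t..b} (\<lambda>r. \<xi> r \<omega>)" using elim(3) tb by auto
  have J: "?J\<^sup>2 \<le> (b - t) * (LINT r:{t..b}|lborel. (\<xi> r \<omega>)\<^sup>2)"
    using square_of_integral_le[OF set_integrable_abs[OF i] _ tb(2)] elim(2) by simp
  have sq: "z\<^sup>2 \<le> dominant t b x y \<xi> \<omega>" if "\<bar>z\<bar> \<le> state_gain * (\<bar>x\<bar> + \<bar>y\<bar> + ?J)" for z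
  proof -
    have "z\<^sup>2 \<le> (state_gain * (\<bar>x\<bar> + \<bar>y\<bar> + ?J))\<^sup>2" using power_mono[OF that, of 2] by simp
    also have "\<dots> = state_gain\<^sup>2 * ((\<bar>x\<bar> + \<bar>y\<bar>) + ?J)\<^sup>2" by (simp add: power_mult_distrib)
    also have "\<dots> \<le> state_gain\<^sup>2 * (2 * ((\<bar>x\<bar> + \<bar>y\<bar>)\<^sup>2 + ?J\<^sup>2))"
      using zero_le_power2[of "(\<bar>x\<bar> + \<bar>y\<bar>) - ?J"] by (intro mult_left_mono) (auto simp: power2_diff power2_sum)
    also have "\<dots> \<le> state_gain\<^sup>2 * (2 * ((\<bar>x\<bar> + \<bar>y\<bar>)\<^sup>2 + (b - t) * (LINT r:{t..b}|lborel. (\<xi> r \<omega>)\<^sup>2)))"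
      using J by (intro mult_left_mono) auto
    also have "\<dots> = dominant t b x y \<xi> \<omega>" unfolding dominant_def by (simp only: ac_simps)
    finally show ?thesis .
  qed
  show ?case using elim(1) sq by blast
qed

lemma state_process_restrict:
  assumes st: "state_process M F \<gamma> \<rho> t b x y \<xi> X Y" and b: "b' \<le> b"
  shows "state_process M F \<gamma> \<rho> t b' x y \<xi> X Y"
proof -
  have X: "AE \<omega> in M. \<forall>s\<in>{t..b}. set_integrable lborel {t..s} (\<lambda>r. \<xi> r \<omega>) \<and> X s \<omega> = x - (LINT r:{t..s}|lborel. \<xi> r \<omega>)"
    and Y: "AE \<omega> in M. \<forall>s\<in>{t..b}. set_integrable lborel {t..s} (\<lambda>r. - \<rho> r \<omega> * Y r \<omega> + \<gamma> * \<xi> r \<omega>) \<and>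
        Y s \<omega> = y + (LINT r:{t..s}|lborel. - \<rho> r \<omega> * Y r \<omega> + \<gamma> * \<xi> r \<omega>)"
    and p: "progressive F t b X" "progressive F t b Y"
    using st unfolding state_process_def position_process_def by auto
  show ?thesis unfolding state_process_def position_process_def
  proof (intro conjI)
    show "progressive F t b' X" "progressive F t b' Y" using p b by (auto intro: progressive_subinterval)
    show "AE \<omega> in M. \<forall>s\<in>{t..b'}. set_integrable lborel {t..s} (\<lambda>r. \<xi> r \<omega>) \<and> X s \<omega> = x - (LINT r:{t..s}|lborel. \<xi> r \<omega>)"
    proof (rule eventually_mono[OF X], intro ballI)
      fix \<omega> s assume "\<forall>s\<in>{t..b}. set_integrable lborel {t..s} (\<lambda>r. \<xi> r \<omega>) \<and> X s \<omega> = x - (LINT r:{t..s}|lborel. \<xi> r \<omega>)" "s \<in> {t..b'}"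
      moreover have "s \<in> {t..b}" using \<open>s \<in> {t..b'}\<close> b by auto
      ultimately show "set_integrable lborel {t..s} (\<lambda>r. \<xi> r \<omega>) \<and> X s \<omega> = x - (LINT r:{t..s}|lborel. \<xi> r \<omega>)" by blast
    qed
    show "AE \<omega> in M. \<forall>s\<in>{t..b'}. set_integrable lborel {t..s} (\<lambda>r. - \<rho> r \<omega> * Y r \<omega> + \<gamma> * \<xi> r \<omega>) \<and>
        Y s \<omega> = y + (LINT r:{t..s}|lborel. - \<rho> r \<omega> * Y r \<omega> + \<gamma> * \<xi> r \<omega>)"
    proof (rule eventually_mono[OF Y], intro ballI)
      fix \<omega> s assume "\<forall>s\<in>{t..b}. set_integrable lborel {t..s} (\<lambda>r. - \<rho> r \<omega> * Y r \<omega> + \<gamma> * \<xi> r \<omega>) \<and>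
        Y s \<omega> = y + (LINT r:{t..s}|lborel. - \<rho> r \<omega> * Y r \<omega> + \<gamma> * \<xi> r \<omega>)" "s \<in> {t..b'}"
      moreover have "s \<in> {t..b}" using \<open>s \<in> {t..b'}\<close> b by auto
      ultimately show "set_integrable lborel {t..s} (\<lambda>r. - \<rho> r \<omega> * Y r \<omega> + \<gamma> * \<xi> r \<omega>) \<and>
        Y s \<omega> = y + (LINT r:{t..s}|lborel. - \<rho> r \<omega> * Y r \<omega> + \<gamma> * \<xi> r \<omega>)" by blast
    qed
  qed
qed

text \<open>The state equations in the form \<open>U = x + \<integral> u\<close> with square-integrable velocities that
  \<open>drift_times_product\<close> expects.\<close>

lemma state_velocity:
  assumes tb: "0 \<le> t" "t \<le> b" "b \<le> T" and st: "state_process M F \<gamma> \<rho> t b x y \<xi> X Y" and \<xi>: "L2_prog M F t b \<xi>"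
  shows "progressive F t b X" "progressive F t b Y" "progressive F t b (\<lambda>r \<omega>. - \<xi> r \<omega>)"
    "progressive F t b (\<lambda>r \<omega>. - \<rho> r \<omega> * Y r \<omega> + \<gamma> * \<xi> r \<omega>)"
    and "AE \<omega> in M. set_integrable lborel {t..b} (\<lambda>r. - \<xi> r \<omega>) \<and> (\<forall>s\<in>{t..b}. X s \<omega> = x + (LINT r:{t..s}|lborel. - \<xi> r \<omega>))"
    and "AE \<omega> in M. set_integrable lborel {t..b} (\<lambda>r. - \<rho> r \<omega> * Y r \<omega> + \<gamma> * \<xi> r \<omega>) \<and>
      (\<forall>s\<in>{t..b}. Y s \<omega> = y + (LINT r:{t..s}|lborel. - \<rho> r \<omega> * Y r \<omega> + \<gamma> * \<xi> r \<omega>))"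
    and "time_integrable t b (\<lambda>s \<omega>. (- \<xi> s \<omega>)\<^sup>2)"
    and "time_integrable t b (\<lambda>s \<omega>. (- \<rho> s \<omega> * Y s \<omega> + \<gamma> * \<xi> s \<omega>)\<^sup>2)"
proof -
  show pX: "progressive F t b X" and pY: "progressive F t b Y"
    using st unfolding state_process_def position_process_def by auto
  note p\<xi> = L2_progD(1)[OF tb(3) \<xi>] and t\<xi> = L2_progD(2)[OF tb(3) \<xi>]
  show "progressive F t b (\<lambda>r \<omega>. - \<xi> r \<omega>)" by (intro progressive_intros p\<xi>)
  show pv: "progressive F t b (\<lambda>r \<omega>. - \<rho> r \<omega> * Y r \<omega> + \<gamma> * \<xi> r \<omega>)"
    by (intro progressive_intros p\<xi> pY rho_progressive tb)
  have X: "AE \<omega> in M. \<forall>s\<in>{t..b}. set_integrable lborel {t..s} (\<lambda>r. \<xi> r \<omega>) \<and> X s \<omega> = x - (LINT r:{t..s}|lborel. \<xi> r \<omega>)"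
    and Y: "AE \<omega> in M. \<forall>s\<in>{t..b}. set_integrable lborel {t..s} (\<lambda>r. - \<rho> r \<omega> * Y r \<omega> + \<gamma> * \<xi> r \<omega>) \<and>
        Y s \<omega> = y + (LINT r:{t..s}|lborel. - \<rho> r \<omega> * Y r \<omega> + \<gamma> * \<xi> r \<omega>)"
    using st unfolding state_process_def position_process_def by auto
  show "AE \<omega> in M. set_integrable lborel {t..b} (\<lambda>r. - \<xi> r \<omega>) \<and> (\<forall>s\<in>{t..b}. X s \<omega> = x + (LINT r:{t..s}|lborel. - \<xi> r \<omega>))"
    using X
  proof eventually_elim
    case (elim \<omega>)
    then have "set_integrable lborel {t..b} (\<lambda>r. \<xi> r \<omega>)" using tb by auto
    moreover from this have "set_integrable lborel {t..b} (\<lambda>r. (-1) * \<xi> r \<omega>)" by (intro set_integrable_mult_right) auto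
    moreover have "(LINT r:{t..s}|lborel. - \<xi> r \<omega>) = - (LINT r:{t..s}|lborel. \<xi> r \<omega>)" if "s \<in> {t..b}" for s
      using elim that by (intro set_integral_uminus) auto
    ultimately show ?case using elim by auto
  qed
  show "AE \<omega> in M. set_integrable lborel {t..b} (\<lambda>r. - \<rho> r \<omega> * Y r \<omega> + \<gamma> * \<xi> r \<omega>) \<and>
      (\<forall>s\<in>{t..b}. Y s \<omega> = y + (LINT r:{t..s}|lborel. - \<rho> r \<omega> * Y r \<omega> + \<gamma> * \<xi> r \<omega>))"
    using Y by eventually_elim (use tb in auto)
  show "time_integrable t b (\<lambda>s \<omega>. (- \<xi> s \<omega>)\<^sup>2)" using t\<xi> by simp
  show "time_integrable t b (\<lambda>s \<omega>. (- \<rho> s \<omega> * Y s \<omega> + \<gamma> * \<xi> s \<omega>)\<^sup>2)"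
  proof (rule time_integrable_bound[OF time_integrable_add[OF time_integrable_cmult[OF time_integrable_random[OF dominant_integrable[OF tb(3) \<xi>]], where c="2 * rho_max\<^sup>2"]
      time_integrable_cmult[OF t\<xi>, where c="2 * \<gamma>\<^sup>2"]] _ tb(3)])
    show "progressive F t b (\<lambda>s \<omega>. (- \<rho> s \<omega> * Y s \<omega> + \<gamma> * \<xi> s \<omega>)\<^sup>2)" by (intro progressive_power pv)
    show "AE (s, \<omega>) in lborel \<Otimes>\<^sub>M M. s \<in> {t..b} \<longrightarrow> \<bar>(- \<rho> s \<omega> * Y s \<omega> + \<gamma> * \<xi> s \<omega>)\<^sup>2\<bar>
       \<le> 2 * rho_max\<^sup>2 * dominant t b x y \<xi> \<omega> + 2 * \<gamma>\<^sup>2 * (\<xi> s \<omega>)\<^sup>2"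
      using rho_max(2) AE_lift_time[OF state_process_dominated[OF tb st \<xi>]]
    proof eventually_elim
      case (elim p)
      obtain s \<omega> where p: "p = (s, \<omega>)" by (cases p)
      have "(- \<rho> s \<omega> * Y s \<omega> + \<gamma> * \<xi> s \<omega>)\<^sup>2 \<le> 2 * rho_max\<^sup>2 * dominant t b x y \<xi> \<omega> + 2 * \<gamma>\<^sup>2 * (\<xi> s \<omega>)\<^sup>2" if s: "s \<in> {t..b}"
      proof -
        have 1: "(Y s \<omega>)\<^sup>2 \<le> dominant t b x y \<xi> \<omega>" "\<bar>\<rho> s \<omega>\<bar> \<le> rho_max" using elim s tb unfolding p by auto
        have 2: "(\<rho> s \<omega>)\<^sup>2 \<le> rho_max\<^sup>2" using power_mono[OF 1(2), of 2] by simp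
        have "(- \<rho> s \<omega> * Y s \<omega> + \<gamma> * \<xi> s \<omega>)\<^sup>2 \<le> 2 * (\<rho> s \<omega> * Y s \<omega>)\<^sup>2 + 2 * (\<gamma> * \<xi> s \<omega>)\<^sup>2"
          using zero_le_power2[of "\<rho> s \<omega> * Y s \<omega> + \<gamma> * \<xi> s \<omega>"] by (simp add: power2_sum power2_diff algebra_simps)
        also have "(\<rho> s \<omega> * Y s \<omega>)\<^sup>2 \<le> rho_max\<^sup>2 * dominant t b x y \<xi> \<omega>"
          unfolding power_mult_distrib by (rule mult_mono[OF 2 1(1)]) auto
        finally show ?thesis by (simp add: power_mult_distrib)
      qed
      then show ?case by (simp add: p)
    qed
  qed
qed

definition running_cost :: "(real \<Rightarrow> 'a \<Rightarrow> real) \<Rightarrow> (real \<Rightarrow> 'a \<Rightarrow> real) \<Rightarrow> (real \<Rightarrow> 'a \<Rightarrow> real) \<Rightarrow> real \<Rightarrow> 'a \<Rightarrow> real" where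
  "running_cost \<xi> X Y s \<omega> = 1/2 * \<eta> * (\<xi> s \<omega>)\<^sup>2 + \<xi> s \<omega> * Y s \<omega> + 1/2 * lam s \<omega> * (X s \<omega>)\<^sup>2"

lemma running_cost_bound:
  assumes tb: "0 \<le> t" "t \<le> b" "b \<le> T" and st: "state_process M F \<gamma> \<rho> t b x y \<xi> X Y" and \<xi>: "L2_prog M F t b \<xi>"
  shows "time_integrable t b (running_cost \<xi> X Y)" "progressive F t b (running_cost \<xi> X Y)"
proof -
  obtain Kl where Kl: "Kl \<ge> 0" "AE (s, \<omega>) in lborel \<Otimes>\<^sub>M M. s \<in> {0..T} \<longrightarrow> 0 \<le> lam s \<omega> \<and> \<bar>lam s \<omega>\<bar> \<le> Kl"
    using lam_bound by blast
  let ?D = "dominant t b x y \<xi>"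
  have pX: "progressive F t b X" "progressive F t b Y"
    using st by (auto simp: state_process_def position_process_def)
  show p: "progressive F t b (running_cost \<xi> X Y)"
    unfolding running_cost_def[abs_def]
    by (intro progressive_intros L2_progD(1)[OF tb(3) \<xi>] pX lam_progressive tb)
  show "time_integrable t b (running_cost \<xi> X Y)"
  proof (rule time_integrable_bound[OF time_integrable_add[OF time_integrable_cmult[OF L2_progD(2)[OF tb(3) \<xi>], where c="\<eta> + 1"]
      time_integrable_cmult[OF time_integrable_random[OF dominant_integrable[OF tb(3) \<xi>]], where c="1 + Kl"]] p tb(3)])
    show "AE (s, \<omega>) in lborel \<Otimes>\<^sub>M M. s \<in> {t..b} \<longrightarrow> \<bar>running_cost \<xi> X Y s \<omega>\<bar> \<le> (\<eta> + 1) * (\<xi> s \<omega>)\<^sup>2 + (1 + Kl) * ?D \<omega>"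
      using AE_lift_time[OF state_process_dominated[OF tb st \<xi>]] Kl(2)
    proof eventually_elim
      case (elim p)
      obtain s \<omega> where p: "p = (s, \<omega>)" by (cases p)
      have "\<bar>running_cost \<xi> X Y s \<omega>\<bar> \<le> (\<eta> + 1) * (\<xi> s \<omega>)\<^sup>2 + (1 + Kl) * ?D \<omega>" if s: "s \<in> {t..b}"
      proof -
        have d: "(X s \<omega>)\<^sup>2 \<le> ?D \<omega>" "(Y s \<omega>)\<^sup>2 \<le> ?D \<omega>" using elim s unfolding p by auto
        have l: "\<bar>lam s \<omega>\<bar> \<le> Kl" using elim s tb unfolding p by auto
        have 1: "\<bar>\<xi> s \<omega> * Y s \<omega>\<bar> \<le> (\<xi> s \<omega>)\<^sup>2 + ?D \<omega>"
          using abs_mult_le_squares[of "\<xi> s \<omega>" "Y s \<omega>"] d(2) by linarith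
        have 2: "\<bar>lam s \<omega> * (X s \<omega>)\<^sup>2\<bar> \<le> Kl * ?D \<omega>"
          unfolding abs_mult by (rule mult_mono[OF l]) (use d Kl(1) in auto)
        have 3: "\<bar>1/2 * \<eta> * (\<xi> s \<omega>)\<^sup>2\<bar> \<le> \<eta> * (\<xi> s \<omega>)\<^sup>2" using eta by (simp add: abs_mult)
        have "(\<eta> + 1) * (\<xi> s \<omega>)\<^sup>2 + (1 + Kl) * ?D \<omega> = \<eta> * (\<xi> s \<omega>)\<^sup>2 + ((\<xi> s \<omega>)\<^sup>2 + ?D \<omega>) + Kl * ?D \<omega>"
          by (simp add: algebra_simps)
        then show ?thesis using 1 2 3 unfolding running_cost_def by linarith
      qed
      then show ?case by (simp add: p)
    qed
  qed
qed

lemma feedback_linear_growth: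
  fixes A B C :: "real \<Rightarrow> 'a \<Rightarrow> real"
  assumes "\<bar>A s \<omega>\<bar> \<le> K" "\<bar>B s \<omega>\<bar> \<le> K" "\<bar>C s \<omega>\<bar> \<le> K"
  shows "\<bar>feedback \<eta> \<gamma> A B C s \<omega> x y\<bar> \<le> inverse \<eta> * (1 + 2 * K + 2 * \<gamma> * K) * (\<bar>x\<bar> + \<bar>y\<bar>)"
proof -
  have i: "inverse \<eta> > 0" using eta by simp
  have K0: "0 \<le> K" using assms(1) by linarith
  have g: "\<bar>\<gamma> * B s \<omega>\<bar> \<le> \<gamma> * K" "\<bar>\<gamma> * C s \<omega>\<bar> \<le> \<gamma> * K" using assms gamma by (auto simp: abs_mult intro!: mult_left_mono)
  have gK: "0 \<le> \<gamma> * K" using gamma K0 by simp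
  let ?m = "1 + 2 * K + 2 * \<gamma> * K"
  have 1: "\<bar>A s \<omega> - \<gamma> * B s \<omega>\<bar> \<le> ?m" using abs_triangle_ineq4[of "A s \<omega>" "\<gamma> * B s \<omega>"] assms(1) g(1) gK K0 by linarith
  have 2: "\<bar>\<gamma> * C s \<omega> - B s \<omega> + 1\<bar> \<le> ?m"
    using abs_triangle_ineq[of "\<gamma> * C s \<omega> - B s \<omega>" 1] abs_triangle_ineq4[of "\<gamma> * C s \<omega>" "B s \<omega>"] assms(2) g(2) gK K0 by linarith
  have "\<bar>(A s \<omega> - \<gamma> * B s \<omega>) * x - (\<gamma> * C s \<omega> - B s \<omega> + 1) * y\<bar> \<le> \<bar>(A s \<omega> - \<gamma> * B s \<omega>) * x\<bar> + \<bar>(\<gamma> * C s \<omega> - B s \<omega> + 1) * y\<bar>"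
    by (rule abs_triangle_ineq4)
  also have "\<dots> \<le> ?m * \<bar>x\<bar> + ?m * \<bar>y\<bar>" unfolding abs_mult by (intro add_mono mult_right_mono 1 2) auto
  finally have "inverse \<eta> * \<bar>(A s \<omega> - \<gamma> * B s \<omega>) * x - (\<gamma> * C s \<omega> - B s \<omega> + 1) * y\<bar> \<le> inverse \<eta> * (?m * \<bar>x\<bar> + ?m * \<bar>y\<bar>)"
    using i by (intro mult_left_mono) auto
  moreover have "feedback \<eta> \<gamma> A B C s \<omega> x y = inverse \<eta> * ((A s \<omega> - \<gamma> * B s \<omega>) * x - (\<gamma> * C s \<omega> - B s \<omega> + 1) * y)"
    by (simp add: feedback_def algebra_simps)
  moreover have "\<bar>inverse \<eta> * z\<bar> = inverse \<eta> * \<bar>z\<bar>" for z using i by (simp add: abs_mult)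
  moreover have "p * (q * u + q * v) = p * q * (u + v)" for p q u v :: real by (simp add: algebra_simps)
  ultimately show ?thesis by (simp only:)
qed

end

section \<open>The energy identity\<close>

text \<open>The left side is the drift of the quadratic form when \<open>dx = - \<xi> ds\<close>, \<open>dy = (- \<rho> y + \<gamma> \<xi>) ds\<close> and
  \<open>a, b, c\<close> follow the Riccati system. With \<open>p\<close> denoting \<open>\<eta>\<close> times the feedback value, the terms that
  are linear in \<open>\<xi>\<close> add up to \<open>- \<xi> p - \<xi> y\<close> and the quadratic terms of the Riccati drifts to
  \<open>p\<^sup>2 / (2 \<eta>)\<close>; those with \<open>\<rho>\<close> cancel.\<close>

lemma completing_the_square:
  fixes \<eta> \<gamma> \<rho> l a b c x y \<xi> :: real
  assumes \<eta>: "\<eta> > 0"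
  defines "i \<equiv> inverse \<eta>"
  shows "1/2 * (a * (- \<xi> * x + - \<xi> * x) - (l - i * (a - \<gamma> * b)\<^sup>2) * (x * x))
    + (b * (- \<xi> * y + (- \<rho> * y + \<gamma> * \<xi>) * x) - (- \<rho> * b + i * (\<gamma> * c - b + 1) * (a - \<gamma> * b)) * (x * y))
    + 1/2 * (c * ((- \<rho> * y + \<gamma> * \<xi>) * y + (- \<rho> * y + \<gamma> * \<xi>) * y) - (- 2 * \<rho> * c - i * (\<gamma> * c - b + 1)\<^sup>2) * (y * y))
    = 1/2 * \<eta> * (\<xi> - (i * (a - \<gamma> * b) * x - i * (\<gamma> * c - b + 1) * y))\<^sup>2 - (1/2 * \<eta> * \<xi>\<^sup>2 + \<xi> * y + 1/2 * l * x\<^sup>2)"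
proof -
  define p where "p = (a - \<gamma> * b) * x - (\<gamma> * c - b + 1) * y"
  have e: "i * (a - \<gamma> * b) * x - i * (\<gamma> * c - b + 1) * y = i * p" by (simp add: p_def algebra_simps)
  have ei: "\<eta> * i = 1" using \<eta> by (simp add: i_def)
  have "1/2 * \<eta> * (\<xi> - i * p)\<^sup>2 = 1/2 * \<eta> * \<xi>\<^sup>2 - (\<eta> * i) * (\<xi> * p) + 1/2 * (\<eta> * i) * (i * p\<^sup>2)"
    by (simp add: power2_eq_square algebra_simps)
  then have s: "1/2 * \<eta> * (\<xi> - i * p)\<^sup>2 = 1/2 * \<eta> * \<xi>\<^sup>2 - \<xi> * p + 1/2 * (i * p\<^sup>2)" by (simp add: ei)
  show ?thesis unfolding e unfolding s unfolding p_def by (simp add: power2_eq_square algebra_simps)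
qed

locale riccati_solution = control_problem M F W T \<eta> \<gamma> \<rho> lam
  for M :: "'a measure" and F :: "real \<Rightarrow> 'a measure" and W :: "real \<Rightarrow> 'a \<Rightarrow> real ^ 'm" and T \<eta> \<gamma> :: real
    and \<rho> lam :: "real \<Rightarrow> 'a \<Rightarrow> real" +
  fixes A B C :: "real \<Rightarrow> 'a \<Rightarrow> real" and ZA ZB ZC :: "real \<Rightarrow> 'a \<Rightarrow> real ^ 'm"
  assumes solution: "bsde_solution M F W T \<eta> \<gamma> \<rho> lam A B C ZA ZB ZC"
    and terminal: "singular_terminal_condition M T A B C"
begin

definition drift_A :: "real \<Rightarrow> 'a \<Rightarrow> real" where
  "drift_A r \<omega> = lam r \<omega> - inverse \<eta> * (A r \<omega> - \<gamma> * B r \<omega>)\<^sup>2"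

definition drift_B :: "real \<Rightarrow> 'a \<Rightarrow> real" where
  "drift_B r \<omega> = - \<rho> r \<omega> * B r \<omega> + inverse \<eta> * (\<gamma> * C r \<omega> - B r \<omega> + 1) * (A r \<omega> - \<gamma> * B r \<omega>)"

definition drift_C :: "real \<Rightarrow> 'a \<Rightarrow> real" where
  "drift_C r \<omega> = - 2 * \<rho> r \<omega> * C r \<omega> - inverse \<eta> * (\<gamma> * C r \<omega> - B r \<omega> + 1)\<^sup>2"

lemma coefficients_progressive:
  assumes "0 \<le> t" "b < T"
  shows "progressive F t b A" "progressive F t b B" "progressive F t b C"
proof -
  have "progressive F t b A \<and> progressive F t b B \<and> progressive F t b C"
  proof (cases "t \<le> b")
    case True
    then have "progressive F 0 b (\<lambda>s \<omega>. (A s \<omega>, B s \<omega>, C s \<omega>))"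
      using solution assms unfolding bsde_solution_def Linf_cont_def by auto
    then have p: "progressive F t b (\<lambda>s \<omega>. (A s \<omega>, B s \<omega>, C s \<omega>))"
      by (rule progressive_subinterval) (use assms in auto)
    show ?thesis
      using progressive_compose[OF p, of fst] progressive_compose[OF p, of "\<lambda>z. fst (snd z)"] progressive_compose[OF p, of "\<lambda>z. snd (snd z)"]
      by (simp add: borel_measurable_continuous_onI continuous_intros)
  qed (simp add: progressive_def)
  then show "progressive F t b A" "progressive F t b B" "progressive F t b C" by auto
qed

lemma coefficients_bounded:
  assumes "b < T"
  shows "\<exists>K\<ge>0. AE \<omega> in M. \<forall>s\<in>{0..b}. \<bar>A s \<omega>\<bar> \<le> K \<and> \<bar>B s \<omega>\<bar> \<le> K \<and> \<bar>C s \<omega>\<bar> \<le> K"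
proof (cases "0 \<le> b")
  case True
  then obtain K where K: "AE \<omega> in M. \<forall>s\<in>{0..b}. norm (A s \<omega>, B s \<omega>, C s \<omega>) \<le> K"
    using solution assms unfolding bsde_solution_def Linf_cont_def by fastforce
  have "AE \<omega> in M. \<forall>s\<in>{0..b}. \<bar>A s \<omega>\<bar> \<le> \<bar>K\<bar> \<and> \<bar>B s \<omega>\<bar> \<le> \<bar>K\<bar> \<and> \<bar>C s \<omega>\<bar> \<le> \<bar>K\<bar>"
    using K
  proof eventually_elim
    case (elim \<omega>)
    show ?case
    proof
      fix s assume "s \<in> {0..b}"
      then have "norm (A s \<omega>, B s \<omega>, C s \<omega>) \<le> \<bar>K\<bar>" using elim by force
      moreover have "\<bar>A s \<omega>\<bar> \<le> norm (A s \<omega>, B s \<omega>, C s \<omega>)" "norm (B s \<omega>, C s \<omega>) \<le> norm (A s \<omega>, B s \<omega>, C s \<omega>)"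
        using norm_fst_le[of "A s \<omega>" "(B s \<omega>, C s \<omega>)"] norm_snd_le[of "(B s \<omega>, C s \<omega>)" "A s \<omega>"] by auto
      moreover have "\<bar>B s \<omega>\<bar> \<le> norm (B s \<omega>, C s \<omega>)" "\<bar>C s \<omega>\<bar> \<le> norm (B s \<omega>, C s \<omega>)"
        using norm_fst_le[of "B s \<omega>" "C s \<omega>"] norm_snd_le[of "C s \<omega>" "B s \<omega>"] by auto
      ultimately show "\<bar>A s \<omega>\<bar> \<le> \<bar>K\<bar> \<and> \<bar>B s \<omega>\<bar> \<le> \<bar>K\<bar> \<and> \<bar>C s \<omega>\<bar> \<le> \<bar>K\<bar>" by linarith
    qed
  qed
  then show ?thesis by (intro exI[of _ "\<bar>K\<bar>"]) simp
next
  case False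
  then show ?thesis by (intro exI[of _ 0]) auto
qed

text \<open>Before \<open>T\<close> the coefficients are bounded, so their drifts, which are quadratic in them with bounded
  \<open>\<rho>\<close> and \<open>lam\<close>, are bounded as well.\<close>

lemma drifts:
  assumes "0 \<le> t" "b < T"
  shows "has_drift t b A drift_A" "has_drift t b B drift_B" "has_drift t b C drift_C"
proof -
  obtain K where K: "K \<ge> 0" "AE \<omega> in M. \<forall>s\<in>{0..b}. \<bar>A s \<omega>\<bar> \<le> K \<and> \<bar>B s \<omega>\<bar> \<le> K \<and> \<bar>C s \<omega>\<bar> \<le> K"
    using coefficients_bounded[OF assms(2)] by blast
  obtain L where L: "L \<ge> 0" "AE (s, \<omega>) in lborel \<Otimes>\<^sub>M M. s \<in> {0..T} \<longrightarrow> 0 \<le> lam s \<omega> \<and> \<bar>lam s \<omega>\<bar> \<le> L"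
    using lam_bound by blast
  define R where "R = rho_max"
  have R: "R \<ge> 0" "AE (s, \<omega>) in lborel \<Otimes>\<^sub>M M. s \<in> {0..T} \<longrightarrow> \<bar>\<rho> s \<omega>\<bar> \<le> R"
    using rho_max by (auto simp: R_def)
  define a where "a = K + \<gamma> * K"
  define c where "c = \<gamma> * K + K + 1"
  have ac: "a \<ge> 0" "c \<ge> 0" using K(1) gamma by (auto simp: a_def c_def)
  have i: "inverse \<eta> > 0" using eta by simp
  have bnd: "AE (s, \<omega>) in lborel \<Otimes>\<^sub>M M. s \<in> {t..b} \<longrightarrow> \<bar>drift_A s \<omega>\<bar> \<le> L + inverse \<eta> * a\<^sup>2
      \<and> \<bar>drift_B s \<omega>\<bar> \<le> R * K + inverse \<eta> * c * a \<and> \<bar>drift_C s \<omega>\<bar> \<le> 2 * R * K + inverse \<eta> * c\<^sup>2"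
    using AE_lift_time[OF K(2)] L(2) R(2)
  proof eventually_elim
    case (elim p)
    obtain s \<omega> where p: "p = (s, \<omega>)" by (cases p)
    have "\<bar>drift_A s \<omega>\<bar> \<le> L + inverse \<eta> * a\<^sup>2
      \<and> \<bar>drift_B s \<omega>\<bar> \<le> R * K + inverse \<eta> * c * a \<and> \<bar>drift_C s \<omega>\<bar> \<le> 2 * R * K + inverse \<eta> * c\<^sup>2" if s: "s \<in> {t..b}"
    proof -
      have k: "\<bar>A s \<omega>\<bar> \<le> K" "\<bar>B s \<omega>\<bar> \<le> K" "\<bar>C s \<omega>\<bar> \<le> K" "\<bar>lam s \<omega>\<bar> \<le> L" "\<bar>\<rho> s \<omega>\<bar> \<le> R"
        using elim s assms unfolding p by auto
      have "\<bar>\<gamma> * B s \<omega>\<bar> \<le> \<gamma> * K" "\<bar>\<gamma> * C s \<omega>\<bar> \<le> \<gamma> * K" using k gamma by (auto simp: abs_mult intro!: mult_left_mono)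
      note BC = this
      have 1: "\<bar>A s \<omega> - \<gamma> * B s \<omega>\<bar> \<le> a"
        unfolding a_def using abs_triangle_ineq4[of "A s \<omega>" "\<gamma> * B s \<omega>"] k(1) BC(1) by (meson add_mono order_trans)
      have "\<bar>\<gamma> * C s \<omega> - B s \<omega>\<bar> \<le> \<gamma> * K + K"
        using abs_triangle_ineq4[of "\<gamma> * C s \<omega>" "B s \<omega>"] k(2) BC(2) by (meson add_mono order_trans)
      then have 1: "\<bar>A s \<omega> - \<gamma> * B s \<omega>\<bar> \<le> a" "\<bar>\<gamma> * C s \<omega> - B s \<omega> + 1\<bar> \<le> c"
        using 1 abs_triangle_ineq[of "\<gamma> * C s \<omega> - B s \<omega>" 1] by (auto simp: c_def)
      have 2: "(A s \<omega> - \<gamma> * B s \<omega>)\<^sup>2 \<le> a\<^sup>2" "(\<gamma> * C s \<omega> - B s \<omega> + 1)\<^sup>2 \<le> c\<^sup>2"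
        using 1 power_mono[of "\<bar>A s \<omega> - \<gamma> * B s \<omega>\<bar>" a 2] power_mono[of "\<bar>\<gamma> * C s \<omega> - B s \<omega> + 1\<bar>" c 2] by auto
      have 3: "\<bar>inverse \<eta> * (A s \<omega> - \<gamma> * B s \<omega>)\<^sup>2\<bar> \<le> inverse \<eta> * a\<^sup>2" "\<bar>inverse \<eta> * (\<gamma> * C s \<omega> - B s \<omega> + 1)\<^sup>2\<bar> \<le> inverse \<eta> * c\<^sup>2"
        using 2 i by (auto simp: abs_mult intro!: mult_left_mono)
      have 4: "\<bar>inverse \<eta> * (\<gamma> * C s \<omega> - B s \<omega> + 1) * (A s \<omega> - \<gamma> * B s \<omega>)\<bar> \<le> inverse \<eta> * c * a"
        unfolding abs_mult using 1 i ac by (intro mult_mono) auto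
      have 5: "\<bar>- \<rho> s \<omega> * B s \<omega>\<bar> \<le> R * K" "\<bar>- 2 * \<rho> s \<omega> * C s \<omega>\<bar> \<le> 2 * R * K"
        unfolding abs_mult using k R(1) K(1) by (auto intro!: mult_mono)
      have "\<bar>drift_A s \<omega>\<bar> \<le> L + inverse \<eta> * a\<^sup>2"
        unfolding drift_A_def by (rule order_trans[OF abs_triangle_ineq4 add_mono[OF k(4) 3(1)]])
      moreover have "\<bar>drift_B s \<omega>\<bar> \<le> R * K + inverse \<eta> * c * a"
        unfolding drift_B_def by (rule order_trans[OF abs_triangle_ineq add_mono[OF 5(1) 4]])
      moreover have "\<bar>drift_C s \<omega>\<bar> \<le> 2 * R * K + inverse \<eta> * c\<^sup>2"
        unfolding drift_C_def by (rule order_trans[OF abs_triangle_ineq4 add_mono[OF 5(2) 3(2)]])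
      ultimately show ?thesis by blast
    qed
    then show ?case by (simp add: p)
  qed
  have pr: "progressive F t b \<rho>" "progressive F t b lam"
    using rho_progressive lam_progressive assms by auto
  note pc = coefficients_progressive[OF assms]
  have pd: "progressive F t b drift_A" "progressive F t b drift_B" "progressive F t b drift_C"
    unfolding drift_A_def[abs_def] drift_B_def[abs_def] drift_C_def[abs_def]
    by (intro progressive_intros pc pr)+
  have eqs: "bsde_between M F W r s A drift_A ZA" "bsde_between M F W r s B drift_B ZB" "bsde_between M F W r s C drift_C ZC"
    if "t \<le> r" "r \<le> s" "s \<le> b" for r s
    using solution that assms unfolding bsde_solution_def drift_A_def[abs_def] drift_B_def[abs_def] drift_C_def[abs_def] by auto
  have bA: "AE \<omega> in M. \<forall>s\<in>{t..b}. \<bar>A s \<omega>\<bar> \<le> K" and bB: "AE \<omega> in M. \<forall>s\<in>{t..b}. \<bar>B s \<omega>\<bar> \<le> K"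
    and bC: "AE \<omega> in M. \<forall>s\<in>{t..b}. \<bar>C s \<omega>\<bar> \<le> K"
    using K(2) by (eventually_elim, use assms in auto)+
  have dA: "AE (s, \<omega>) in lborel \<Otimes>\<^sub>M M. s \<in> {t..b} \<longrightarrow> \<bar>drift_A s \<omega>\<bar> \<le> L + inverse \<eta> * a\<^sup>2"
    and dB: "AE (s, \<omega>) in lborel \<Otimes>\<^sub>M M. s \<in> {t..b} \<longrightarrow> \<bar>drift_B s \<omega>\<bar> \<le> R * K + inverse \<eta> * c * a"
    and dC: "AE (s, \<omega>) in lborel \<Otimes>\<^sub>M M. s \<in> {t..b} \<longrightarrow> \<bar>drift_C s \<omega>\<bar> \<le> 2 * R * K + inverse \<eta> * c\<^sup>2"
    using bnd by (eventually_elim, fastforce)+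
  have bT: "b \<le> T" using assms by simp
  show "has_drift t b A drift_A" by (rule has_driftI[OF assms(1) bT pc(1) pd(1) bA dA eqs(1)])
  show "has_drift t b B drift_B" by (rule has_driftI[OF assms(1) bT pc(2) pd(2) bB dB eqs(2)])
  show "has_drift t b C drift_C" by (rule has_driftI[OF assms(1) bT pc(3) pd(3) bC dC eqs(3)])
qed

definition value_form :: "(real \<Rightarrow> 'a \<Rightarrow> real) \<Rightarrow> (real \<Rightarrow> 'a \<Rightarrow> real) \<Rightarrow> real \<Rightarrow> 'a \<Rightarrow> real" where
  "value_form X Y s \<omega> = 1/2 * A s \<omega> * (X s \<omega>)\<^sup>2 + B s \<omega> * X s \<omega> * Y s \<omega> + 1/2 * C s \<omega> * (Y s \<omega>)\<^sup>2"

text \<open>The rate at which a control loses against the feedback rule.\<close>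

definition excess :: "(real \<Rightarrow> 'a \<Rightarrow> real) \<Rightarrow> (real \<Rightarrow> 'a \<Rightarrow> real) \<Rightarrow> (real \<Rightarrow> 'a \<Rightarrow> real) \<Rightarrow> real \<Rightarrow> 'a \<Rightarrow> real" where
  "excess \<xi> X Y s \<omega> = 1/2 * \<eta> * (\<xi> s \<omega> - feedback \<eta> \<gamma> A B C s \<omega> (X s \<omega>) (Y s \<omega>))\<^sup>2"

text \<open>The sum of the product rules for \<open>A X\<^sup>2\<close>, \<open>B X Y\<close> and \<open>C Y\<^sup>2\<close>.\<close>

lemma energy_identity_raw:
  assumes tb: "0 \<le> t" "t \<le> b" "b < T" and st: "state_process M F \<gamma> \<rho> t b x y \<xi> X Y" and \<xi>: "L2_prog M F t b \<xi>"
    and H: "H \<in> sets (F t)"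
  defines "h \<equiv> indicat_real H"
  shows "time_integrable t b (\<lambda>r \<omega>. h \<omega> * (excess \<xi> X Y r \<omega> - running_cost \<xi> X Y r \<omega>))"
    and "integrable M (\<lambda>\<omega>. h \<omega> * value_form X Y t \<omega>)" "integrable M (\<lambda>\<omega>. h \<omega> * value_form X Y b \<omega>)"
    and "expectation (\<lambda>\<omega>. h \<omega> * value_form X Y b \<omega>) - expectation (\<lambda>\<omega>. h \<omega> * value_form X Y t \<omega>)
      = expectation (\<lambda>\<omega>. LINT r:{t..b}|lborel. h \<omega> * (excess \<xi> X Y r \<omega> - running_cost \<xi> X Y r \<omega>))"
proof -
  have bT: "b \<le> T" using tb by simp
  note tb' = tb(1,2) bT
  note dr = drifts[OF tb(1,3)]
  note sv = state_velocity[OF tb' st \<xi>]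
  let ?D = "dominant t b x y \<xi>"
  note iD = dominant_integrable[OF bT \<xi>, of x y]
  have dom: "AE \<omega> in M. \<forall>s\<in>{t..b}. (X s \<omega>)\<^sup>2 \<le> ?D \<omega> \<and> (X s \<omega>)\<^sup>2 \<le> ?D \<omega>"
    "AE \<omega> in M. \<forall>s\<in>{t..b}. (X s \<omega>)\<^sup>2 \<le> ?D \<omega> \<and> (Y s \<omega>)\<^sup>2 \<le> ?D \<omega>"
    "AE \<omega> in M. \<forall>s\<in>{t..b}. (Y s \<omega>)\<^sup>2 \<le> ?D \<omega> \<and> (Y s \<omega>)\<^sup>2 \<le> ?D \<omega>"
    using state_process_dominated[OF tb' st \<xi>] by (eventually_elim, blast)+
  note pA = drift_times_product[OF tb' dr(1) H sv(1) sv(1) sv(3) sv(3) sv(5) sv(5) iD dom(1) sv(7) sv(7), folded h_def]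
  note pB = drift_times_product[OF tb' dr(2) H sv(1) sv(2) sv(3) sv(4) sv(5) sv(6) iD dom(2) sv(7) sv(8), folded h_def]
  note pC = drift_times_product[OF tb' dr(3) H sv(2) sv(2) sv(4) sv(4) sv(6) sv(6) iD dom(3) sv(8) sv(8), folded h_def]
  let ?a = "\<lambda>r \<omega>. h \<omega> * (A r \<omega> * (- \<xi> r \<omega> * X r \<omega> + - \<xi> r \<omega> * X r \<omega>) - drift_A r \<omega> * (X r \<omega> * X r \<omega>))"
  let ?b = "\<lambda>r \<omega>. h \<omega> * (B r \<omega> * (- \<xi> r \<omega> * Y r \<omega> + (- \<rho> r \<omega> * Y r \<omega> + \<gamma> * \<xi> r \<omega>) * X r \<omega>) - drift_B r \<omega> * (X r \<omega> * Y r \<omega>))"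
  let ?c = "\<lambda>r \<omega>. h \<omega> * (C r \<omega> * ((- \<rho> r \<omega> * Y r \<omega> + \<gamma> * \<xi> r \<omega>) * Y r \<omega> + (- \<rho> r \<omega> * Y r \<omega> + \<gamma> * \<xi> r \<omega>) * Y r \<omega>) - drift_C r \<omega> * (Y r \<omega> * Y r \<omega>))"
  have eq: "1/2 * ?a r \<omega> + ?b r \<omega> + 1/2 * ?c r \<omega> = h \<omega> * (excess \<xi> X Y r \<omega> - running_cost \<xi> X Y r \<omega>)" for r \<omega>
  proof -
    note cs = completing_the_square[OF eta, of "A r \<omega>" "\<xi> r \<omega>" "X r \<omega>" "lam r \<omega>" \<gamma> "B r \<omega>" "Y r \<omega>" "\<rho> r \<omega>" "C r \<omega>"]
    show ?thesis
      unfolding excess_def running_cost_def feedback_def cs[symmetric] drift_A_def drift_B_def drift_C_def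
      by (simp only: distrib_left mult.left_commute[of _ "h \<omega>"])
  qed
  have ta: "time_integrable t b (\<lambda>r \<omega>. 1/2 * ?a r \<omega>)" and tc: "time_integrable t b (\<lambda>r \<omega>. 1/2 * ?c r \<omega>)"
    by (rule time_integrable_cmult, fact pA(1), rule time_integrable_cmult, fact pC(1))
  note tab = time_integrable_add[OF ta pB(1)]
  show "time_integrable t b (\<lambda>r \<omega>. h \<omega> * (excess \<xi> X Y r \<omega> - running_cost \<xi> X Y r \<omega>))"
    using time_integrable_add[OF tab tc] unfolding eq .
  have vf: "h \<omega> * value_form X Y s \<omega> = 1/2 * (h \<omega> * (A s \<omega> * (X s \<omega> * X s \<omega>))) + h \<omega> * (B s \<omega> * (X s \<omega> * Y s \<omega>))
     + 1/2 * (h \<omega> * (C s \<omega> * (Y s \<omega> * Y s \<omega>)))" for s \<omega>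
    by (simp add: value_form_def power2_eq_square algebra_simps)
  show "integrable M (\<lambda>\<omega>. h \<omega> * value_form X Y t \<omega>)" "integrable M (\<lambda>\<omega>. h \<omega> * value_form X Y b \<omega>)"
    unfolding vf using pA(2,3) pB(2,3) pC(2,3) by (intro Bochner_Integration.integrable_add integrable_mult_right; blast)+
  have "expectation (\<lambda>\<omega>. LINT r:{t..b}|lborel. h \<omega> * (excess \<xi> X Y r \<omega> - running_cost \<xi> X Y r \<omega>))
     = 1/2 * expectation (\<lambda>\<omega>. LINT r:{t..b}|lborel. ?a r \<omega>) + expectation (\<lambda>\<omega>. LINT r:{t..b}|lborel. ?b r \<omega>)
       + 1/2 * expectation (\<lambda>\<omega>. LINT r:{t..b}|lborel. ?c r \<omega>)"
    unfolding eq[symmetric] expectation_LINT_add[OF tab tc] expectation_LINT_add[OF ta pB(1)] expectation_LINT_cmult ..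
  also have "\<dots> = expectation (\<lambda>\<omega>. h \<omega> * value_form X Y b \<omega>) - expectation (\<lambda>\<omega>. h \<omega> * value_form X Y t \<omega>)"
  proof -
    have "expectation (\<lambda>\<omega>. h \<omega> * value_form X Y b \<omega>) = 1/2 * expectation (\<lambda>\<omega>. h \<omega> * (A b \<omega> * (X b \<omega> * X b \<omega>)))
        + expectation (\<lambda>\<omega>. h \<omega> * (B b \<omega> * (X b \<omega> * Y b \<omega>))) + 1/2 * expectation (\<lambda>\<omega>. h \<omega> * (C b \<omega> * (Y b \<omega> * Y b \<omega>)))"
      unfolding vf using pA(3) pB(3) pC(3)
      by (simp only: Bochner_Integration.integral_add Bochner_Integration.integrable_add integrable_mult_right integral_mult_right_zero)
    moreover have "expectation (\<lambda>\<omega>. h \<omega> * value_form X Y t \<omega>) = 1/2 * expectation (\<lambda>\<omega>. h \<omega> * (A t \<omega> * (X t \<omega> * X t \<omega>)))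
        + expectation (\<lambda>\<omega>. h \<omega> * (B t \<omega> * (X t \<omega> * Y t \<omega>))) + 1/2 * expectation (\<lambda>\<omega>. h \<omega> * (C t \<omega> * (Y t \<omega> * Y t \<omega>)))"
      unfolding vf using pA(2) pB(2) pC(2)
      by (simp only: Bochner_Integration.integral_add Bochner_Integration.integrable_add integrable_mult_right integral_mult_right_zero)
    ultimately show ?thesis using pA(4) pB(4) pC(4) by linarith
  qed
  finally show "expectation (\<lambda>\<omega>. h \<omega> * value_form X Y b \<omega>) - expectation (\<lambda>\<omega>. h \<omega> * value_form X Y t \<omega>)
      = expectation (\<lambda>\<omega>. LINT r:{t..b}|lborel. h \<omega> * (excess \<xi> X Y r \<omega> - running_cost \<xi> X Y r \<omega>))" ..
qed

text \<open>The verification argument in one equation: the last integral is nonnegative and measures how far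
  the control is from the feedback rule.\<close>

lemma energy_identity:
  assumes tb: "0 \<le> t" "t \<le> b" "b < T" and st: "state_process M F \<gamma> \<rho> t b x y \<xi> X Y" and \<xi>: "L2_prog M F t b \<xi>"
  shows "time_integrable t b (excess \<xi> X Y)"
    and "integrable M (value_form X Y t)" "integrable M (value_form X Y b)"
    and "H \<in> sets (F t) \<Longrightarrow>
      expectation (\<lambda>\<omega>. indicat_real H \<omega> * value_form X Y b \<omega>)
        + expectation (\<lambda>\<omega>. indicat_real H \<omega> * (LINT r:{t..b}|lborel. running_cost \<xi> X Y r \<omega>))
      = expectation (\<lambda>\<omega>. indicat_real H \<omega> * value_form X Y t \<omega>)
        + expectation (\<lambda>\<omega>. indicat_real H \<omega> * (LINT r:{t..b}|lborel. excess \<xi> X Y r \<omega>))"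
proof -
  have bT: "b \<le> T" using tb by simp
  have S: "space M \<in> sets (F t)" using sets.top[of "F t"] by simp
  note raw = energy_identity_raw[OF tb st \<xi> S]
  have one: "indicat_real (space M) \<omega> = 1" if "\<omega> \<in> space M" for \<omega> using that by simp
  note rc = running_cost_bound(1)[OF tb(1,2) bT st \<xi>]
  have "time_integrable t b (\<lambda>r \<omega>. excess \<xi> X Y r \<omega> - running_cost \<xi> X Y r \<omega>)"
    using raw(1) by (rule time_integrable_cong[THEN iffD1, rotated]) (simp add: one)
  from time_integrable_add[OF this rc] show te: "time_integrable t b (excess \<xi> X Y)" by simp
  show "integrable M (value_form X Y t)" "integrable M (value_form X Y b)"
    by (rule Bochner_Integration.integrable_cong[THEN iffD1, OF refl _ raw(2)], simp add: one)
      (rule Bochner_Integration.integrable_cong[THEN iffD1, OF refl _ raw(3)], simp add: one)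
  assume H: "H \<in> sets (F t)"
  then have HM: "H \<in> sets M" using F_subset_M[of t] tb by auto
  let ?h = "indicat_real H"
  note rawH = energy_identity_raw[OF tb st \<xi> H]
  have ic: "integrable M (\<lambda>\<omega>. ?h \<omega> * (LINT r:{t..b}|lborel. running_cost \<xi> X Y r \<omega>))"
    and ie: "integrable M (\<lambda>\<omega>. ?h \<omega> * (LINT r:{t..b}|lborel. excess \<xi> X Y r \<omega>))"
    using integrable_mult_indicator[OF HM time_integrableD(2)[OF rc]] integrable_mult_indicator[OF HM time_integrableD(2)[OF te]] by simp_all
  have "expectation (\<lambda>\<omega>. LINT r:{t..b}|lborel. ?h \<omega> * (excess \<xi> X Y r \<omega> - running_cost \<xi> X Y r \<omega>))
     = expectation (\<lambda>\<omega>. ?h \<omega> * (LINT r:{t..b}|lborel. excess \<xi> X Y r \<omega>) - ?h \<omega> * (LINT r:{t..b}|lborel. running_cost \<xi> X Y r \<omega>))"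
  proof (rule integral_cong_AE)
    show "(\<lambda>\<omega>. LINT r:{t..b}|lborel. ?h \<omega> * (excess \<xi> X Y r \<omega> - running_cost \<xi> X Y r \<omega>)) \<in> borel_measurable M"
      using time_integrableD(2)[OF rawH(1)] by blast
    show "(\<lambda>\<omega>. ?h \<omega> * (LINT r:{t..b}|lborel. excess \<xi> X Y r \<omega>) - ?h \<omega> * (LINT r:{t..b}|lborel. running_cost \<xi> X Y r \<omega>)) \<in> borel_measurable M"
      using ic ie by (intro borel_measurable_diff) auto
    show "AE \<omega> in M. (LINT r:{t..b}|lborel. ?h \<omega> * (excess \<xi> X Y r \<omega> - running_cost \<xi> X Y r \<omega>))
       = ?h \<omega> * (LINT r:{t..b}|lborel. excess \<xi> X Y r \<omega>) - ?h \<omega> * (LINT r:{t..b}|lborel. running_cost \<xi> X Y r \<omega>)"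
      using time_integrableD(1)[OF rc] time_integrableD(1)[OF te]
      by eventually_elim (simp add: set_integral_diff right_diff_distrib)
  qed
  then show "expectation (\<lambda>\<omega>. ?h \<omega> * value_form X Y b \<omega>)
        + expectation (\<lambda>\<omega>. ?h \<omega> * (LINT r:{t..b}|lborel. running_cost \<xi> X Y r \<omega>))
      = expectation (\<lambda>\<omega>. ?h \<omega> * value_form X Y t \<omega>)
        + expectation (\<lambda>\<omega>. ?h \<omega> * (LINT r:{t..b}|lborel. excess \<xi> X Y r \<omega>))"
    using rawH(4) ic ie by simp
qed

section \<open>The coefficients near the terminal time\<close>

lemma coefficients_continuous:
  "AE \<omega> in M. \<forall>b\<in>{0..<T}. continuous_on {0..b} (\<lambda>s. A s \<omega>) \<and> continuous_on {0..b} (\<lambda>s. B s \<omega>) \<and> continuous_on {0..b} (\<lambda>s. C s \<omega>)"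
proof -
  obtain c :: "nat \<Rightarrow> real" where c: "\<And>n. c n \<in> {0..<T}" "c \<longlonglongrightarrow> T"
    using sequence_from_below[OF T_pos] by blast
  have "AE \<omega> in M. continuous_on {0..c n} (\<lambda>s. (A s \<omega>, B s \<omega>, C s \<omega>))" for n
    using solution c(1)[of n] unfolding bsde_solution_def Linf_cont_def by blast
  then have "AE \<omega> in M. \<forall>n. continuous_on {0..c n} (\<lambda>s. (A s \<omega>, B s \<omega>, C s \<omega>))" by (simp add: AE_all_countable)
  then show ?thesis
  proof eventually_elim
    case (elim \<omega>)
    show ?case
    proof
      fix b assume b: "b \<in> {0..<T}"
      then have "\<forall>\<^sub>F n in sequentially. b < c n" using order_tendstoD(1)[OF c(2)] by auto
      then obtain n where n: "b < c n" by (auto simp: eventually_sequentially)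
      have k: "continuous_on {0..b} (\<lambda>s. (A s \<omega>, B s \<omega>, C s \<omega>))"
        by (rule continuous_on_subset[OF elim[rule_format, of n]]) (use n in auto)
      show "continuous_on {0..b} (\<lambda>s. A s \<omega>) \<and> continuous_on {0..b} (\<lambda>s. B s \<omega>) \<and> continuous_on {0..b} (\<lambda>s. C s \<omega>)"
        using continuous_on_fst[OF k] continuous_on_fst[OF continuous_on_snd[OF k]] continuous_on_snd[OF continuous_on_snd[OF k]]
        by simp
    qed
  qed
qed

lemma BC_eventually_bounded:
  assumes "e > 0"
  shows "\<exists>b\<in>{0..<T}. \<forall>s\<in>{b<..<T}. AE \<omega> in M. \<bar>B s \<omega> - 1\<bar> \<le> e \<and> \<bar>C s \<omega>\<bar> \<le> e"
proof -
  have lim: "((\<lambda>t. esssup M (\<lambda>\<omega>. ereal \<bar>B t \<omega> - 1\<bar>)) \<longlongrightarrow> 0) (at_left T)" "((\<lambda>t. esssup M (\<lambda>\<omega>. ereal \<bar>C t \<omega>\<bar>)) \<longlongrightarrow> 0) (at_left T)"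
    using terminal unfolding singular_terminal_condition_def by auto
  have e0: "0 < ereal e" using assms by simp
  have "\<forall>\<^sub>F s in at_left T. esssup M (\<lambda>\<omega>. ereal \<bar>B s \<omega> - 1\<bar>) < ereal e \<and> esssup M (\<lambda>\<omega>. ereal \<bar>C s \<omega>\<bar>) < ereal e"
    using order_tendstoD(2)[OF lim(1) e0] order_tendstoD(2)[OF lim(2) e0] by (rule eventually_conj)
  then obtain b where b: "b < T" "\<And>s. b < s \<Longrightarrow> s < T \<Longrightarrow> esssup M (\<lambda>\<omega>. ereal \<bar>B s \<omega> - 1\<bar>) < ereal e \<and> esssup M (\<lambda>\<omega>. ereal \<bar>C s \<omega>\<bar>) < ereal e"
    unfolding eventually_at_left_field by blast
  show ?thesis
  proof (rule bexI[of _ "max 0 b"], rule ballI)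
    fix s assume s: "s \<in> {max 0 b<..<T}"
    have l: "esssup M (\<lambda>\<omega>. ereal \<bar>B s \<omega> - 1\<bar>) < ereal e" "esssup M (\<lambda>\<omega>. ereal \<bar>C s \<omega>\<bar>) < ereal e"
      using b(2)[of s] s by auto
    show "AE \<omega> in M. \<bar>B s \<omega> - 1\<bar> \<le> e \<and> \<bar>C s \<omega>\<bar> \<le> e"
      using esssup_AE[where M=M and f="\<lambda>\<omega>. ereal \<bar>B s \<omega> - 1\<bar>"] esssup_AE[where M=M and f="\<lambda>\<omega>. ereal \<bar>C s \<omega>\<bar>"]
    proof eventually_elim
      case (elim \<omega>)
      have "ereal \<bar>B s \<omega> - 1\<bar> < ereal e" by (rule le_less_trans[OF elim(1) l(1)])
      moreover have "ereal \<bar>C s \<omega>\<bar> < ereal e" by (rule le_less_trans[OF elim(2) l(2)])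
      ultimately show ?case by simp
    qed
  qed (use b T_pos in auto)
qed

text \<open>Close to \<open>T\<close> the bound comes from the terminal condition, at fixed times first, and before that
  from the boundedness of the solution.\<close>

lemma BC_bounded: "\<exists>K\<ge>1. AE \<omega> in M. \<forall>s\<in>{0..<T}. \<bar>B s \<omega>\<bar> \<le> K \<and> \<bar>C s \<omega>\<bar> \<le> K"
proof -
  obtain b where b: "b \<in> {0..<T}" "\<And>s. s \<in> {b<..<T} \<Longrightarrow> AE \<omega> in M. \<bar>B s \<omega> - 1\<bar> \<le> 1 \<and> \<bar>C s \<omega>\<bar> \<le> 1"
    using BC_eventually_bounded[of 1] by auto
  obtain L where L: "L \<ge> 0" "AE \<omega> in M. \<forall>s\<in>{0..b}. \<bar>A s \<omega>\<bar> \<le> L \<and> \<bar>B s \<omega>\<bar> \<le> L \<and> \<bar>C s \<omega>\<bar> \<le> L"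
    using coefficients_bounded[of b] b by auto
  have "AE \<omega> in M. \<forall>q\<in>\<rat> \<inter> {b<..<T}. \<bar>B q \<omega> - 1\<bar> \<le> 1 \<and> \<bar>C q \<omega>\<bar> \<le> 1"
    by (rule AE_ball_countable') (use b(2) countable_rat in auto)
  then have "AE \<omega> in M. \<forall>s\<in>{0..<T}. \<bar>B s \<omega>\<bar> \<le> L + 2 \<and> \<bar>C s \<omega>\<bar> \<le> L + 2"
    using L(2) coefficients_continuous
  proof eventually_elim
    case (elim \<omega>)
    show ?case
    proof
      fix s assume s: "s \<in> {0..<T}"
      show "\<bar>B s \<omega>\<bar> \<le> L + 2 \<and> \<bar>C s \<omega>\<bar> \<le> L + 2"
      proof (cases "s \<le> b")
        case True
        then have "\<bar>B s \<omega>\<bar> \<le> L" "\<bar>C s \<omega>\<bar> \<le> L" using elim(2) s by auto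
        then show ?thesis by simp
      next
        case False
        define c where "c = (s + T) / 2"
        have c: "c \<in> {0..<T}" "s \<in> {0..<c}" using s by (auto simp: c_def)
        have k: "continuous_on {0..c} (\<lambda>s. B s \<omega>)" "continuous_on {0..c} (\<lambda>s. C s \<omega>)" using elim(3) c by auto
        have "\<bar>B s \<omega>\<bar> \<le> 2"
        proof (rule continuous_le_from_rationals[OF continuous_on_rabs[OF k(1)] c(2)])
          fix q :: real assume "q \<in> \<rat>" "s < q" "q < c"
          then have "\<bar>B q \<omega> - 1\<bar> \<le> 1" using elim(1) False c by auto
          then show "\<bar>B q \<omega>\<bar> \<le> 2" by linarith
        qed
        moreover have "\<bar>C s \<omega>\<bar> \<le> 1"
          by (rule continuous_le_from_rationals[OF continuous_on_rabs[OF k(2)] c(2)]) (use elim(1) False c in auto)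
        ultimately show ?thesis using L(1) by simp
      qed
    qed
  qed
  then show ?thesis using L(1) by (intro exI[of _ "L + 2"]) auto
qed

text \<open>The quadratic drift limits the size of a Riccati solution by the remaining time. Apply the product
  rule to \<open>A\<close> and the deterministic function \<open>\<theta>\<^sup>2\<close>, which decreases from \<open>1\<close> at \<open>s\<close> to \<open>0\<close> at \<open>b\<close>. In terms
  of \<open>z = (A - \<gamma> B) \<theta>\<close> the resulting integrand is \<open>2 z / d - z\<^sup>2 / \<eta>\<close>, which never exceeds \<open>\<eta> / d\<^sup>2\<close>, up
  to bounded terms.\<close>

lemma A_upper_bound_fixed:
  assumes s: "0 \<le> s" "s < b" "b < T" and K: "K \<ge> 0" "AE \<omega> in M. \<forall>s\<in>{0..<T}. \<bar>B s \<omega>\<bar> \<le> K"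
    and L: "AE (s, \<omega>) in lborel \<Otimes>\<^sub>M M. s \<in> {0..T} \<longrightarrow> 0 \<le> lam s \<omega> \<and> \<bar>lam s \<omega>\<bar> \<le> L" "L \<ge> 0"
  shows "AE \<omega> in M. A s \<omega> \<le> \<eta> / (b - s) + 2 * \<gamma> * K + L * T"
proof -
  define d where "d = b - s"
  have d: "d > 0" "d \<le> T" using s by (auto simp: d_def)
  define \<theta> where "\<theta> r = (b - r) / d" for r
  let ?c = "\<eta> / d + 2 * \<gamma> * K + L * T"
  have bT: "b \<le> T" "s \<le> b" using s by auto
  have mA: "A s \<in> borel_measurable (F s)"
    by (rule progressive_at_time[OF coefficients_progressive(1)[OF s(1,3)]]) (use s in auto)
  obtain K' where K': "AE \<omega> in M. \<forall>s\<in>{0..b}. \<bar>A s \<omega>\<bar> \<le> K' \<and> \<bar>B s \<omega>\<bar> \<le> K' \<and> \<bar>C s \<omega>\<bar> \<le> K'"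
    using coefficients_bounded[OF s(3)] by blast
  have iA: "integrable M (A s)"
  proof (rule integrable_const_bound[of _ K'])
    show "AE \<omega> in M. norm (A s \<omega>) \<le> K'" using K' by eventually_elim (use s in auto)
    show "A s \<in> borel_measurable M" by (rule borel_measurable_F_M[OF mA]) (use s in auto)
  qed
  have "AE \<omega> in M. A s \<omega> \<le> ?c"
  proof (rule AE_le_of_integral_le[of s "A s" "\<lambda>_. ?c"])
    fix H assume H: "H \<in> sets (F s)"
    let ?h = "indicat_real H"
    have HM: "H \<in> sets M" using F_subset_M[of s] H s by auto
    have th: "(\<lambda>r. \<theta> r) \<in> borel_measurable borel" unfolding \<theta>_def by simp
    have ph: "progressive F s b (\<lambda>r. ?h)" by (rule progressive_random) (use H in simp)
    have p\<theta>: "progressive F s b (\<lambda>r \<omega>. \<theta> r)" by (rule progressive_deterministic[OF th])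
    let ?g = "\<lambda>r \<omega>. ?h \<omega> * (- 2 / d * \<theta> r)" and ?G = "\<lambda>r \<omega>. ?h \<omega> * (\<theta> r)\<^sup>2"
    have pg: "progressive F s b ?g" "progressive F s b ?G" by (intro progressive_intros ph p\<theta>)+
    have \<theta>1: "0 \<le> \<theta> r" "\<theta> r \<le> 1" if "r \<in> {s..b}" for r using that d by (auto simp: \<theta>_def d_def)
    have tg: "time_integrable s b ?g"
    proof (rule time_integrable_bound[OF time_integrable_const[of s b "2 / d"] pg(1) bT(1)])
      have "\<bar>?g r \<omega>\<bar> \<le> 2 / d" if "r \<in> {s..b}" for r \<omega>
        using \<theta>1[OF that] d by (auto simp: abs_mult indicator_def divide_simps)
      then show "AE (r, \<omega>) in lborel \<Otimes>\<^sub>M M. r \<in> {s..b} \<longrightarrow> \<bar>?g r \<omega>\<bar> \<le> 2 / d" by (intro AE_I2) auto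
    qed
    have ftc: "(LINT r:{s..q}|lborel. - 2 / d * \<theta> r) = (\<theta> q)\<^sup>2 - 1" if q: "q \<in> {s..b}" for q
    proof -
      have c: "continuous_on {s..q} (\<lambda>r. - 2 / d * \<theta> r)" unfolding \<theta>_def using d by (intro continuous_intros) auto
      have "((\<lambda>r. - 2 / d * \<theta> r) has_integral (\<theta> q)\<^sup>2 - (\<theta> s)\<^sup>2) {s..q}"
      proof (rule fundamental_theorem_of_calculus)
        fix r assume "r \<in> {s..q}"
        have "((\<lambda>r. (\<theta> r)\<^sup>2) has_real_derivative - 2 / d * \<theta> r) (at r within {s..q})"
          unfolding \<theta>_def by (rule derivative_eq_intros refl | use d in \<open>simp add: field_simps\<close>)+
        then show "((\<lambda>r. (\<theta> r)\<^sup>2) has_vector_derivative - 2 / d * \<theta> r) (at r within {s..q})"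
          by (simp add: has_real_derivative_iff_has_vector_derivative)
      qed (use q in auto)
      moreover have "\<theta> s = 1" using d by (simp add: \<theta>_def d_def)
      ultimately have "integral {s..q} (\<lambda>r. - 2 / d * \<theta> r) = (\<theta> q)\<^sup>2 - 1" by (simp only: integral_unique) simp
      with set_borel_integral_eq_integral(2)[OF borel_integrable_atLeastAtMost'[OF c]] show ?thesis by (simp only:)
    qed
    have \<theta>s: "\<theta> s = 1" "\<theta> b = 0" using d by (auto simp: \<theta>_def d_def)
    have G: "AE \<omega> in M. \<forall>q\<in>{s..b}. ?G q \<omega> = ?G s \<omega> + (LINT r:{s..q}|lborel. ?g r \<omega>)"
    proof (intro AE_I2 ballI)
      fix \<omega> q assume q: "q \<in> {s..b}"
      have "(LINT r:{s..q}|lborel. ?g r \<omega>) = ?h \<omega> * ((\<theta> q)\<^sup>2 - 1)" by (subst set_integral_mult_right) (simp only: ftc[OF q])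
      then show "?G q \<omega> = ?G s \<omega> + (LINT r:{s..q}|lborel. ?g r \<omega>)" by (simp add: \<theta>s algebra_simps)
    qed
    have ih: "integrable M ?h" using HM by (simp add: integrable_indicator_iff emeasure_eq_measure)
    then have Gs: "integrable M (?G s)" by (simp add: \<theta>s)
    note pr = drift_product_rule[OF bT(2,1) drifts(1)[OF s(1,3)] pg(1) tg pg(2) G Gs]
    have e: "expectation (\<lambda>\<omega>. ?h \<omega> * A s \<omega>) = - expectation (\<lambda>\<omega>. LINT r:{s..b}|lborel. A r \<omega> * ?g r \<omega> - drift_A r \<omega> * ?G r \<omega>)"
      using pr(4) by (simp add: \<theta>s mult.commute)
    have tn: "time_integrable s b (\<lambda>r \<omega>. - (A r \<omega> * ?g r \<omega> - drift_A r \<omega> * ?G r \<omega>))"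
      using time_integrable_cmult[OF pr(1), of "-1"] by simp
    have tc: "time_integrable s b (\<lambda>r \<omega>. ?h \<omega> * (?c / d))"
      by (rule time_integrable_random[OF integrable_mult_left[OF ih]])
    have pw: "AE (r, \<omega>) in lborel \<Otimes>\<^sub>M M. r \<in> {s..b} \<longrightarrow> - (A r \<omega> * ?g r \<omega> - drift_A r \<omega> * ?G r \<omega>) \<le> ?h \<omega> * (?c / d)"
      using L(1) AE_lift_time[OF K(2)]
    proof eventually_elim
      case (elim p)
      obtain r \<omega> where p: "p = (r, \<omega>)" by (cases p)
      have "- (A r \<omega> * ?g r \<omega> - drift_A r \<omega> * ?G r \<omega>) \<le> ?h \<omega> * (?c / d)" if r: "r \<in> {s..b}"
      proof -
        have l: "lam r \<omega> \<le> L" "0 \<le> lam r \<omega>" and B: "\<bar>B r \<omega>\<bar> \<le> K" using elim r s unfolding p by auto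
        define z where "z = (A r \<omega> - \<gamma> * B r \<omega>) * \<theta> r"
        have eq: "2 / d * \<theta> r * A r \<omega> + drift_A r \<omega> * (\<theta> r)\<^sup>2
           = (2 / d * z - inverse \<eta> * z\<^sup>2) + 2 / d * \<gamma> * (B r \<omega> * \<theta> r) + lam r \<omega> * (\<theta> r)\<^sup>2"
          by (simp add: drift_A_def z_def power2_eq_square algebra_simps)
        have "\<eta> / d\<^sup>2 - (2 / d * z - inverse \<eta> * z\<^sup>2) = inverse \<eta> * (z - \<eta> / d)\<^sup>2"
          using eta d by (simp add: power2_eq_square field_simps)
        moreover have "0 \<le> inverse \<eta> * (z - \<eta> / d)\<^sup>2" using eta by simp
        ultimately have 1: "2 / d * z - inverse \<eta> * z\<^sup>2 \<le> \<eta> / d\<^sup>2" by linarith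
        have "B r \<omega> * \<theta> r \<le> K * 1" using B \<theta>1[OF r] K(1) by (intro mult_mono) auto
        then have 2: "2 / d * \<gamma> * (B r \<omega> * \<theta> r) \<le> 2 / d * \<gamma> * K" using d gamma by (intro mult_left_mono) auto
        have "lam r \<omega> * (\<theta> r)\<^sup>2 \<le> L * 1" using l \<theta>1[OF r] L(2) by (intro mult_mono power_le_one) auto
        also have "L * 1 \<le> L * (T / d)" using d L(2) by (intro mult_left_mono) (auto simp: field_simps)
        finally have 3: "lam r \<omega> * (\<theta> r)\<^sup>2 \<le> L * (T / d)" .
        have "?c / d = \<eta> / d\<^sup>2 + 2 / d * \<gamma> * K + L * (T / d)" using d by (simp add: power2_eq_square field_simps)
        then have "2 / d * \<theta> r * A r \<omega> + drift_A r \<omega> * (\<theta> r)\<^sup>2 \<le> ?c / d" using 1 2 3 unfolding eq by linarith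
        then have "?h \<omega> * (2 / d * \<theta> r * A r \<omega> + drift_A r \<omega> * (\<theta> r)\<^sup>2) \<le> ?h \<omega> * (?c / d)" by (intro mult_left_mono) auto
        also have "?h \<omega> * (2 / d * \<theta> r * A r \<omega> + drift_A r \<omega> * (\<theta> r)\<^sup>2) = - (A r \<omega> * ?g r \<omega> - drift_A r \<omega> * ?G r \<omega>)"
          by (simp add: algebra_simps)
        finally show ?thesis .
      qed
      then show ?case by (simp add: p)
    qed
    have "expectation (\<lambda>\<omega>. ?h \<omega> * A s \<omega>) = expectation (\<lambda>\<omega>. LINT r:{s..b}|lborel. - (A r \<omega> * ?g r \<omega> - drift_A r \<omega> * ?G r \<omega>))"
      using e expectation_LINT_cmult[of s b "-1" "\<lambda>r \<omega>. A r \<omega> * ?g r \<omega> - drift_A r \<omega> * ?G r \<omega>"] by simp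
    also have "\<dots> \<le> expectation (\<lambda>\<omega>. LINT r:{s..b}|lborel. ?h \<omega> * (?c / d))"
      unfolding expectation_LINT[OF tn] expectation_LINT[OF tc]
    proof (rule integral_mono_AE[OF tn[unfolded time_integrable_def] tc[unfolded time_integrable_def]])
      show "AE p in lborel \<Otimes>\<^sub>M M. (case p of (r, \<omega>) \<Rightarrow> indicat_real {s..b} r * - (A r \<omega> * ?g r \<omega> - drift_A r \<omega> * ?G r \<omega>))
          \<le> (case p of (r, \<omega>) \<Rightarrow> indicat_real {s..b} r * (?h \<omega> * (?c / d)))"
        using pw
      proof eventually_elim
        case (elim p)
        then show ?case by (cases p; cases "fst p \<in> {s..b}") auto
      qed
    qed
    also have "\<dots> = expectation (\<lambda>\<omega>. ?h \<omega> * ?c)"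
    proof (rule Bochner_Integration.integral_cong[OF refl])
      fix \<omega>
      have "(LINT r:{s..b}|lborel. ?h \<omega> * (?c / d)) = (?h \<omega> * (?c / d)) * d"
        using d bT by (simp add: set_lebesgue_integral_def d_def)
      then show "(LINT r:{s..b}|lborel. ?h \<omega> * (?c / d)) = ?h \<omega> * ?c" using d by simp
    qed
    finally show "expectation (\<lambda>\<omega>. ?h \<omega> * A s \<omega>) \<le> expectation (\<lambda>\<omega>. ?h \<omega> * ?c)" .
  qed (use s iA mA in auto)
  then show ?thesis by (simp add: d_def)
qed

text \<open>Letting \<open>b\<close> tend to \<open>T\<close> in \<open>A_upper_bound_fixed\<close> shows that \<open>A\<close> blows up at most like \<open>1 / (T - s)\<close>;
  from below, \<open>A\<close> is at least \<open>1\<close> near \<open>T\<close> and bounded before.\<close>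

lemma coefficient_bounds:
  "\<exists>K\<ge>1. AE \<omega> in M. \<forall>s\<in>{0..<T}. \<bar>A s \<omega>\<bar> \<le> K / (T - s) \<and> \<bar>B s \<omega>\<bar> \<le> K \<and> \<bar>C s \<omega>\<bar> \<le> K"
proof -
  obtain K where K: "K \<ge> 1" "AE \<omega> in M. \<forall>s\<in>{0..<T}. \<bar>B s \<omega>\<bar> \<le> K \<and> \<bar>C s \<omega>\<bar> \<le> K" using BC_bounded by blast
  obtain L where L: "L \<ge> 0" "AE (s, \<omega>) in lborel \<Otimes>\<^sub>M M. s \<in> {0..T} \<longrightarrow> 0 \<le> lam s \<omega> \<and> \<bar>lam s \<omega>\<bar> \<le> L"
    using lam_bound by blast
  obtain b where b: "b \<in> {0..<T}" "AE \<omega> in M. \<forall>t\<in>{b..<T}. 1 \<le> A t \<omega>"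
    using terminal unfolding singular_terminal_condition_def by (meson zero_less_one)
  obtain K' where K': "K' \<ge> 0" "AE \<omega> in M. \<forall>s\<in>{0..b}. \<bar>A s \<omega>\<bar> \<le> K' \<and> \<bar>B s \<omega>\<bar> \<le> K' \<and> \<bar>C s \<omega>\<bar> \<le> K'"
    using coefficients_bounded[of b] b by auto
  define c where "c = 2 * \<gamma> * K + L * T"
  define R where "R = K + K' * T + \<eta> + c * T"
  have c0: "c \<ge> 0" using gamma K(1) L(1) T_pos by (simp add: c_def)
  have R: "R \<ge> 1" "K \<le> R" "K' * T \<le> R" "\<eta> + c * T \<le> R" using K(1) K'(1) T_pos eta c0 by (auto simp: R_def intro!: add_nonneg_nonneg add_increasing2)
  have BK: "AE \<omega> in M. \<forall>s\<in>{0..<T}. \<bar>B s \<omega>\<bar> \<le> K" using K(2) by eventually_elim auto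
  have up: "AE \<omega> in M. A s \<omega> * (T - s) \<le> \<eta> + c * T" if s: "s \<in> {0..<T}" for s
  proof -
    \<comment> \<open>The sequence starts halfway between \<open>s\<close> and \<open>T\<close>, which keeps it away from \<open>s\<close>.\<close>
    obtain u :: "nat \<Rightarrow> real" where u: "\<And>n. u n \<in> {(s + T) / 2..<T}" "u \<longlonglongrightarrow> T"
      using sequence_from_below[of "(s + T) / 2" T] s by auto
    have us: "s < u n" "u n < T" for n using u(1)[of n] s by (auto simp: field_simps)
    have "AE \<omega> in M. A s \<omega> \<le> \<eta> / (u n - s) + 2 * \<gamma> * K + L * T" for n
      by (rule A_upper_bound_fixed[OF _ us[of n] _ BK L(2,1)]) (use s K(1) in auto)
    then have "AE \<omega> in M. \<forall>n. A s \<omega> \<le> \<eta> / (u n - s) + c" by (simp add: AE_all_countable c_def add.assoc)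
    then show ?thesis
    proof eventually_elim
      case (elim \<omega>)
      have "(\<lambda>n. \<eta> / (u n - s) + c) \<longlonglongrightarrow> \<eta> / (T - s) + c" by (intro tendsto_intros u(2)) (use s in auto)
      then have "A s \<omega> \<le> \<eta> / (T - s) + c" by (rule LIMSEQ_le_const) (use elim in auto)
      then have "A s \<omega> * (T - s) \<le> (\<eta> / (T - s) + c) * (T - s)" using s by (intro mult_right_mono) auto
      also have "\<dots> = \<eta> + c * (T - s)" using s by (simp add: field_simps)
      also have "\<dots> \<le> \<eta> + c * T" using c0 s by (intro add_left_mono mult_left_mono) auto
      finally show ?case .
    qed
  qed
  have "AE \<omega> in M. \<forall>q\<in>\<rat> \<inter> {0..<T}. A q \<omega> * (T - q) \<le> \<eta> + c * T"
    by (rule AE_ball_countable') (use up countable_rat in auto)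
  then have "AE \<omega> in M. \<forall>s\<in>{0..<T}. \<bar>A s \<omega>\<bar> \<le> R / (T - s) \<and> \<bar>B s \<omega>\<bar> \<le> R \<and> \<bar>C s \<omega>\<bar> \<le> R"
    using K(2) b(2) K'(2) coefficients_continuous
  proof eventually_elim
    case (elim \<omega>)
    show ?case
    proof
      fix s assume s: "s \<in> {0..<T}"
      define d where "d = (s + T) / 2"
      have d: "d \<in> {0..<T}" "s \<in> {0..<d}" using s by (auto simp: d_def)
      have "continuous_on {0..d} (\<lambda>s. A s \<omega> * (T - s))" using elim(5) d by (intro continuous_intros) auto
      then have 1: "A s \<omega> * (T - s) \<le> \<eta> + c * T"
        by (rule continuous_le_from_rationals[OF _ d(2)]) (use elim(1) d s in auto)
      have 2: "- (A s \<omega>) * (T - s) \<le> R"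
      proof (cases "s \<le> b")
        case True
        then have "\<bar>A s \<omega>\<bar> \<le> K'" using elim(4) s by auto
        then have "- (A s \<omega>) \<le> K'" by linarith
        then have "- (A s \<omega>) * (T - s) \<le> K' * (T - s)" using s by (intro mult_right_mono) auto
        also have "\<dots> \<le> K' * T" using K'(1) s by (intro mult_left_mono) auto
        finally show ?thesis using R by simp
      next
        case False
        then have "1 \<le> A s \<omega>" using elim(3) s by auto
        then have "- (A s \<omega>) * (T - s) \<le> 0" using s by (intro mult_nonpos_nonneg) auto
        then show ?thesis using R by simp
      qed
      have "\<bar>A s \<omega>\<bar> * (T - s) = \<bar>A s \<omega> * (T - s)\<bar>" using s by (simp add: abs_mult)
      also have "\<dots> \<le> R" using 1 2 R(4) by (intro abs_leI) auto
      finally have "\<bar>A s \<omega>\<bar> \<le> R / (T - s)" using s by (simp add: pos_le_divide_eq)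
      moreover have "\<bar>B s \<omega>\<bar> \<le> R" "\<bar>C s \<omega>\<bar> \<le> R" using elim(2) s R(2) by force+
      ultimately show "\<bar>A s \<omega>\<bar> \<le> R / (T - s) \<and> \<bar>B s \<omega>\<bar> \<le> R \<and> \<bar>C s \<omega>\<bar> \<le> R" by blast
    qed
  qed
  then show ?thesis using R(1) by blast
qed

text \<open>Convergence of essential suprema becomes almost sure convergence along a sequence of times, where
  only countably many null sets occur.\<close>

lemma C_vanishes_along:
  assumes c: "\<And>n. c n \<in> {0..<T}" "c \<longlonglongrightarrow> T"
  shows "AE \<omega> in M. (\<lambda>n. C (c n) \<omega>) \<longlonglongrightarrow> 0"
proof -
  have *: "AE \<omega> in M. \<exists>N. \<forall>n\<ge>N. \<bar>C (c n) \<omega>\<bar> \<le> inverse (real (Suc k))" for k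
  proof -
    obtain b where b: "b \<in> {0..<T}" "\<And>s. s \<in> {b<..<T} \<Longrightarrow> AE \<omega> in M. \<bar>B s \<omega> - 1\<bar> \<le> inverse (real (Suc k)) \<and> \<bar>C s \<omega>\<bar> \<le> inverse (real (Suc k))"
      using BC_eventually_bounded[of "inverse (real (Suc k))"] by auto
    obtain N where N: "\<And>n. n \<ge> N \<Longrightarrow> b < c n"
      using order_tendstoD(1)[OF c(2), of b] b(1) by (auto simp: eventually_sequentially)
    have "AE \<omega> in M. n \<ge> N \<longrightarrow> \<bar>C (c n) \<omega>\<bar> \<le> inverse (real (Suc k))" for n
    proof (cases "n \<ge> N")
      case True
      then have "c n \<in> {b<..<T}" using N c(1)[of n] by auto
      from b(2)[OF this] show ?thesis by eventually_elim auto
    qed simp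
    then have "AE \<omega> in M. \<forall>n. n \<ge> N \<longrightarrow> \<bar>C (c n) \<omega>\<bar> \<le> inverse (real (Suc k))" by (simp add: AE_all_countable)
    then show ?thesis by eventually_elim blast
  qed
  then have "AE \<omega> in M. \<forall>k. \<exists>N. \<forall>n\<ge>N. \<bar>C (c n) \<omega>\<bar> \<le> inverse (real (Suc k))" unfolding AE_all_countable by blast
  then show ?thesis
  proof eventually_elim
    case (elim \<omega>)
    show ?case
    proof (rule LIMSEQ_I)
      fix e :: real assume "e > 0"
      then obtain k where k: "inverse (real (Suc k)) < e" using reals_Archimedean by blast
      obtain N where "\<forall>n\<ge>N. \<bar>C (c n) \<omega>\<bar> \<le> inverse (real (Suc k))" using elim by blast
      then show "\<exists>no. \<forall>n\<ge>no. norm (C (c n) \<omega> - 0) < e" using k by (intro exI[of _ N]) force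
    qed
  qed
qed

section \<open>Lower bound for the cost of admissible controls\<close>

text \<open>The limit \<open>b = T\<close> of the energy identity. Admissibility enters through \<open>X s = \<integral>\<^sub>s\<^sup>T \<xi> dr\<close>: by
  Cauchy-Schwarz and \<open>coefficient_bounds\<close>, \<open>A s * (X s)\<^sup>2\<close> is at most \<open>K\<close> times the integral of \<open>\<xi>\<^sup>2\<close>
  from \<open>s\<close> to \<open>T\<close>. So the quadratic form vanishes at \<open>T\<close>, with an integrable bound along the way.\<close>

theorem verification:
  assumes t: "t \<in> {0..<T}" and adm: "admissible M F T t x \<xi>" and st: "state_process M F \<gamma> \<rho> t T x y \<xi> X Y"
  shows "integrable M (\<lambda>\<omega>. LINT r:{t..T}|lborel. running_cost \<xi> X Y r \<omega>)"
    and "H \<in> sets (F t) \<Longrightarrow> expectation (\<lambda>\<omega>. indicat_real H \<omega> * value_form X Y t \<omega>)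
       \<le> expectation (\<lambda>\<omega>. indicat_real H \<omega> * (LINT r:{t..T}|lborel. running_cost \<xi> X Y r \<omega>))"
    and "H \<in> sets (F t) \<Longrightarrow> (AE \<omega> in M. \<forall>r\<in>{t..<T}. excess \<xi> X Y r \<omega> = 0) \<Longrightarrow>
       expectation (\<lambda>\<omega>. indicat_real H \<omega> * value_form X Y t \<omega>)
       = expectation (\<lambda>\<omega>. indicat_real H \<omega> * (LINT r:{t..T}|lborel. running_cost \<xi> X Y r \<omega>))"
proof -
  have tT: "0 \<le> t" "t \<le> T" "t < T" using t by auto
  have \<xi>: "L2_prog M F t T \<xi>" using adm unfolding admissible_def by blast
  note rc = running_cost_bound(1)[OF tT(1,2) order_refl st \<xi>]
  show "integrable M (\<lambda>\<omega>. LINT r:{t..T}|lborel. running_cost \<xi> X Y r \<omega>)" by (rule time_integrableD(2)[OF rc])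
  obtain X0 where X0: "position_process M F t T x \<xi> X0" "AE \<omega> in M. X0 T \<omega> = 0"
    using adm unfolding admissible_def by blast
  have X: "AE \<omega> in M. \<forall>s\<in>{t..T}. set_integrable lborel {t..s} (\<lambda>r. \<xi> r \<omega>) \<and> X s \<omega> = x - (LINT r:{t..s}|lborel. \<xi> r \<omega>)"
    using st unfolding state_process_def position_process_def by auto
  \<comment> \<open>The liquidation constraint, read off from the position process that admissibility provides; it
    turns \<open>X\<close> into the integral of \<open>\<xi>\<close> over the remaining time.\<close>
  have XT: "AE \<omega> in M. x = (LINT r:{t..T}|lborel. \<xi> r \<omega>)"
    using X0(2) X0(1)[unfolded position_process_def, THEN conjunct2] by eventually_elim (use tT in force)
  obtain c :: "nat \<Rightarrow> real" where c: "\<And>n. c n \<in> {t..<T}" "c \<longlonglongrightarrow> T"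
    using sequence_from_below[OF tT(3)] by blast
  have c0: "c n \<in> {0..<T}" "t \<le> c n" "c n < T" "c n \<le> T" for n using c(1)[of n] tT by auto
  obtain K where K: "K \<ge> 1" "AE \<omega> in M. \<forall>s\<in>{0..<T}. \<bar>A s \<omega>\<bar> \<le> K / (T - s) \<and> \<bar>B s \<omega>\<bar> \<le> K \<and> \<bar>C s \<omega>\<bar> \<le> K"
    using coefficient_bounds by blast
  let ?D = "dominant t T x y \<xi>"
  have stn: "state_process M F \<gamma> \<rho> t (c n) x y \<xi> X Y" for n by (rule state_process_restrict[OF st c0(4)])
  have \<xi>n: "L2_prog M F t (c n) \<xi>" for n by (rule L2_prog_subinterval[OF \<xi> order_refl c0(4) order_refl])
  note sv = state_velocity[OF tT(1,2) order_refl st \<xi>]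
  let ?Q = "\<lambda>\<omega>. LINT r:{t..T}|lborel. (\<xi> r \<omega>)\<^sup>2"
  have Abound: "AE \<omega> in M. \<forall>n. \<bar>1/2 * A (c n) \<omega> * (X (c n) \<omega>)\<^sup>2\<bar> \<le> K * (LINT r:{c n..T}|lborel. (\<xi> r \<omega>)\<^sup>2)
      \<and> K * (LINT r:{c n..T}|lborel. (\<xi> r \<omega>)\<^sup>2) \<le> K * ?Q \<omega>"
    using X XT K(2) time_integrableD(1)[OF L2_progD(2)[OF order_refl \<xi>]]
  proof eventually_elim
    case (elim \<omega>)
    show ?case
    proof
      fix n
      have cn: "c n \<in> {t..T}" using c0[of n] by auto
      have i: "set_integrable lborel {t..T} (\<lambda>r. \<xi> r \<omega>)" using elim(1) tT by auto
      have i1: "set_integrable lborel {c n..T} (\<lambda>r. \<xi> r \<omega>)" "set_integrable lborel {c n..T} (\<lambda>r. (\<xi> r \<omega>)\<^sup>2)"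
        by (rule set_integrable_subset[OF i], use c0 in auto, rule set_integrable_subset[OF elim(4)], use c0 in auto)
      have "X (c n) \<omega> = (LINT r:{c n..T}|lborel. \<xi> r \<omega>)"
        using LINT_split[OF i cn] elim(1,2) cn by auto
      then have sq: "(X (c n) \<omega>)\<^sup>2 \<le> (T - c n) * (LINT r:{c n..T}|lborel. (\<xi> r \<omega>)\<^sup>2)"
        using square_of_integral_le[OF i1 c0(4)] by simp
      have a: "\<bar>A (c n) \<omega>\<bar> \<le> K / (T - c n)" using elim(3) c0[of n] by blast
      have pos: "0 \<le> (LINT r:{q..q'}|lborel. (\<xi> r \<omega>)\<^sup>2)" for q q'
        unfolding set_lebesgue_integral_def by (rule Bochner_Integration.integral_nonneg) simp
      have "\<bar>1/2 * A (c n) \<omega> * (X (c n) \<omega>)\<^sup>2\<bar> = 1/2 * (\<bar>A (c n) \<omega>\<bar> * (X (c n) \<omega>)\<^sup>2)" by (simp add: abs_mult)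
      also have "\<dots> \<le> 1 * (\<bar>A (c n) \<omega>\<bar> * (X (c n) \<omega>)\<^sup>2)" by (rule mult_right_mono) auto
      also have "\<bar>A (c n) \<omega>\<bar> * (X (c n) \<omega>)\<^sup>2 \<le> K / (T - c n) * ((T - c n) * (LINT r:{c n..T}|lborel. (\<xi> r \<omega>)\<^sup>2))"
        by (rule mult_mono[OF a sq]) (use K(1) c0[of n] in auto)
      also have "\<dots> = K * (LINT r:{c n..T}|lborel. (\<xi> r \<omega>)\<^sup>2)" using c0(3)[of n] by simp
      finally have 1: "\<bar>1/2 * A (c n) \<omega> * (X (c n) \<omega>)\<^sup>2\<bar> \<le> K * (LINT r:{c n..T}|lborel. (\<xi> r \<omega>)\<^sup>2)" by simp
      have "(LINT r:{c n..T}|lborel. (\<xi> r \<omega>)\<^sup>2) \<le> ?Q \<omega>" using LINT_split[OF elim(4) cn] pos[of t "c n"] by simp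
      then have "K * (LINT r:{c n..T}|lborel. (\<xi> r \<omega>)\<^sup>2) \<le> K * ?Q \<omega>" using K(1) by (intro mult_left_mono) auto
      with 1 show "\<bar>1/2 * A (c n) \<omega> * (X (c n) \<omega>)\<^sup>2\<bar> \<le> K * (LINT r:{c n..T}|lborel. (\<xi> r \<omega>)\<^sup>2)
          \<and> K * (LINT r:{c n..T}|lborel. (\<xi> r \<omega>)\<^sup>2) \<le> K * ?Q \<omega>" ..
    qed
  qed
  have along: "(\<lambda>n. LINT r:{t..c n}|lborel. f r) \<longlonglongrightarrow> (LINT r:{t..T}|lborel. f r)"
    if "set_integrable lborel {t..T} f" for f :: "real \<Rightarrow> real"
    by (rule continuous_on_tendsto_compose[OF continuous_on_indefinite_LINT[OF that] c(2)])
       (use tT c0 in auto)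
  have Vlim: "AE \<omega> in M. (\<lambda>n. value_form X Y (c n) \<omega>) \<longlonglongrightarrow> 0"
    using Abound X XT K(2) time_integrableD(1)[OF L2_progD(2)[OF order_refl \<xi>]] sv(6) C_vanishes_along[OF c0(1) c(2)]
  proof eventually_elim
    case (elim \<omega>)
    have i: "set_integrable lborel {t..T} (\<lambda>r. \<xi> r \<omega>)" using elim(2) tT by auto
    have cn: "c n \<in> {t..T}" for n using c0[of n] by auto
    have Xc: "X (c n) \<omega> = x - (LINT r:{t..c n}|lborel. \<xi> r \<omega>)" for n using elim(2) cn by blast
    have lX: "(\<lambda>n. X (c n) \<omega>) \<longlonglongrightarrow> 0"
      using tendsto_diff[OF tendsto_const[of x] along[OF i]] elim(3) unfolding Xc by simp
    have Yc: "Y (c n) \<omega> = y + (LINT r:{t..c n}|lborel. - \<rho> r \<omega> * Y r \<omega> + \<gamma> * \<xi> r \<omega>)" for n using elim(6) cn by blast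
    have lY: "(\<lambda>n. Y (c n) \<omega>) \<longlonglongrightarrow> y + (LINT r:{t..T}|lborel. - \<rho> r \<omega> * Y r \<omega> + \<gamma> * \<xi> r \<omega>)" (is "_ \<longlonglongrightarrow> ?YT")
      unfolding Yc by (intro tendsto_intros along) (use elim(6) in blast)
    have "(\<lambda>n. K * (?Q \<omega> - (LINT r:{t..c n}|lborel. (\<xi> r \<omega>)\<^sup>2))) \<longlonglongrightarrow> K * (?Q \<omega> - ?Q \<omega>)"
      by (intro tendsto_intros along elim(5))
    moreover have "?Q \<omega> - (LINT r:{t..c n}|lborel. (\<xi> r \<omega>)\<^sup>2) = (LINT r:{c n..T}|lborel. (\<xi> r \<omega>)\<^sup>2)" for n
      using LINT_split[OF elim(5) cn[of n]] by simp
    ultimately have lQ: "(\<lambda>n. K * (LINT r:{c n..T}|lborel. (\<xi> r \<omega>)\<^sup>2)) \<longlonglongrightarrow> 0" by simp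
    have l1: "(\<lambda>n. 1/2 * A (c n) \<omega> * (X (c n) \<omega>)\<^sup>2) \<longlonglongrightarrow> 0"
      by (rule Lim_null_comparison[OF _ lQ]) (use elim(1) in auto)
    have "(\<lambda>n. K * \<bar>X (c n) \<omega>\<bar> * \<bar>Y (c n) \<omega>\<bar>) \<longlonglongrightarrow> K * \<bar>0\<bar> * \<bar>?YT\<bar>" by (intro tendsto_intros lX lY)
    then have lXY: "(\<lambda>n. K * \<bar>X (c n) \<omega>\<bar> * \<bar>Y (c n) \<omega>\<bar>) \<longlonglongrightarrow> 0" by simp
    have l2: "(\<lambda>n. B (c n) \<omega> * X (c n) \<omega> * Y (c n) \<omega>) \<longlonglongrightarrow> 0"
    proof (rule Lim_null_comparison[OF _ lXY], rule always_eventually, rule allI)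
      fix n
      have "\<bar>B (c n) \<omega>\<bar> \<le> K" using elim(4) c0(1) by blast
      then show "norm (B (c n) \<omega> * X (c n) \<omega> * Y (c n) \<omega>) \<le> K * \<bar>X (c n) \<omega>\<bar> * \<bar>Y (c n) \<omega>\<bar>"
        by (auto simp: abs_mult intro!: mult_right_mono)
    qed
    have "(\<lambda>n. 1/2 * C (c n) \<omega> * (Y (c n) \<omega>)\<^sup>2) \<longlonglongrightarrow> 1/2 * 0 * ?YT\<^sup>2" by (intro tendsto_intros lY elim(7))
    then have l3: "(\<lambda>n. 1/2 * C (c n) \<omega> * (Y (c n) \<omega>)\<^sup>2) \<longlonglongrightarrow> 0" by simp
    from tendsto_add[OF tendsto_add[OF l1 l2] l3] show ?case by (simp add: value_form_def)
  qed
  have Vdom: "AE \<omega> in M. \<bar>value_form X Y (c n) \<omega>\<bar> \<le> K * ?Q \<omega> + 3 * K * ?D \<omega>" for n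
    using Abound K(2) state_process_dominated[OF tT(1,2) order_refl st \<xi>]
  proof eventually_elim
    case (elim \<omega>)
    have d: "(X (c n) \<omega>)\<^sup>2 \<le> ?D \<omega>" "(Y (c n) \<omega>)\<^sup>2 \<le> ?D \<omega>" using elim(3) c0[of n] by auto
    have D0: "0 \<le> ?D \<omega>" using d(1) zero_le_power2[of "X (c n) \<omega>"] by linarith
    have bc: "\<bar>B (c n) \<omega>\<bar> \<le> K" "\<bar>C (c n) \<omega>\<bar> \<le> K" using elim(2) c0(1) by blast+
    have 1: "\<bar>1/2 * A (c n) \<omega> * (X (c n) \<omega>)\<^sup>2\<bar> \<le> K * ?Q \<omega>" using elim(1) order_trans by blast
    have "\<bar>X (c n) \<omega> * Y (c n) \<omega>\<bar> \<le> 2 * ?D \<omega>" using abs_mult_le_squares[of "X (c n) \<omega>" "Y (c n) \<omega>"] d by linarith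
    then have "\<bar>B (c n) \<omega>\<bar> * \<bar>X (c n) \<omega> * Y (c n) \<omega>\<bar> \<le> K * (2 * ?D \<omega>)" by (rule mult_mono[OF bc(1)]) (use K(1) in auto)
    then have 2: "\<bar>B (c n) \<omega> * X (c n) \<omega> * Y (c n) \<omega>\<bar> \<le> 2 * (K * ?D \<omega>)" by (simp add: abs_mult mult.assoc)
    have "\<bar>C (c n) \<omega>\<bar> * (Y (c n) \<omega>)\<^sup>2 \<le> K * ?D \<omega>" by (rule mult_mono[OF bc(2) d(2)]) (use K(1) in auto)
    moreover have "\<bar>1/2 * C (c n) \<omega> * (Y (c n) \<omega>)\<^sup>2\<bar> = 1/2 * (\<bar>C (c n) \<omega>\<bar> * (Y (c n) \<omega>)\<^sup>2)" by (simp add: abs_mult)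
    moreover have "0 \<le> K * ?D \<omega>" using K(1) D0 by simp
    ultimately have 3: "\<bar>1/2 * C (c n) \<omega> * (Y (c n) \<omega>)\<^sup>2\<bar> \<le> K * ?D \<omega>" by linarith
    have "\<bar>value_form X Y (c n) \<omega>\<bar> \<le> \<bar>1/2 * A (c n) \<omega> * (X (c n) \<omega>)\<^sup>2\<bar> + \<bar>B (c n) \<omega> * X (c n) \<omega> * Y (c n) \<omega>\<bar>
        + \<bar>1/2 * C (c n) \<omega> * (Y (c n) \<omega>)\<^sup>2\<bar>" unfolding value_form_def by (rule order_trans[OF abs_triangle_ineq add_right_mono[OF abs_triangle_ineq]])
    also have "\<dots> \<le> K * ?Q \<omega> + 2 * (K * ?D \<omega>) + K * ?D \<omega>" by (intro add_mono 1 2 3)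
    finally show ?case by simp
  qed
  have idom: "integrable M (\<lambda>\<omega>. K * ?Q \<omega> + 3 * K * ?D \<omega>)"
    using time_integrableD(2)[OF L2_progD(2)[OF order_refl \<xi>]] dominant_integrable[OF order_refl \<xi>, of x y] by simp
  have conv: "(\<lambda>n. expectation (\<lambda>\<omega>. indicat_real H \<omega> * value_form X Y (c n) \<omega>)
        + expectation (\<lambda>\<omega>. indicat_real H \<omega> * (LINT r:{t..c n}|lborel. running_cost \<xi> X Y r \<omega>)))
      \<longlonglongrightarrow> expectation (\<lambda>\<omega>. indicat_real H \<omega> * (LINT r:{t..T}|lborel. running_cost \<xi> X Y r \<omega>))"
    if H: "H \<in> sets (F t)" for H
  proof -
    have HM: "H \<in> sets M" using F_subset_M[of t] H tT by auto
    then have mh: "indicat_real H \<in> borel_measurable M" by simp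
    have l1: "(\<lambda>n. expectation (\<lambda>\<omega>. indicat_real H \<omega> * value_form X Y (c n) \<omega>)) \<longlonglongrightarrow> expectation (\<lambda>\<omega>. 0)"
    proof (rule integral_dominated_convergence[OF _ _ idom])
      show "(\<lambda>\<omega>. indicat_real H \<omega> * value_form X Y (c n) \<omega>) \<in> borel_measurable M" for n
        using energy_identity(3)[OF tT(1) c0(2,3) stn \<xi>n] mh by (intro borel_measurable_times) auto
      show "AE \<omega> in M. (\<lambda>n. indicat_real H \<omega> * value_form X Y (c n) \<omega>) \<longlonglongrightarrow> 0"
        using Vlim by eventually_elim (rule tendsto_mult_right_zero)
      show "AE \<omega> in M. norm (indicat_real H \<omega> * value_form X Y (c n) \<omega>) \<le> K * ?Q \<omega> + 3 * K * ?D \<omega>" for n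
        using Vdom[of n] by eventually_elim (auto simp: indicator_def)
    qed simp
    have l2: "(\<lambda>n. expectation (\<lambda>\<omega>. indicat_real H \<omega> * (LINT r:{t..c n}|lborel. running_cost \<xi> X Y r \<omega>)))
        \<longlonglongrightarrow> expectation (\<lambda>\<omega>. indicat_real H \<omega> * (LINT r:{t..T}|lborel. running_cost \<xi> X Y r \<omega>))"
    proof (rule integral_dominated_convergence[OF _ _ time_integrableD(2)[OF time_integrable_abs[OF rc]]])
      show "(\<lambda>\<omega>. indicat_real H \<omega> * (LINT r:{t..T}|lborel. running_cost \<xi> X Y r \<omega>)) \<in> borel_measurable M"
        using time_integrableD(2)[OF rc] mh by (intro borel_measurable_times) auto
      show "(\<lambda>\<omega>. indicat_real H \<omega> * (LINT r:{t..c n}|lborel. running_cost \<xi> X Y r \<omega>)) \<in> borel_measurable M" for n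
        using time_integrableD(2)[OF running_cost_bound(1)[OF tT(1) c0(2,4) stn \<xi>n]] mh by (intro borel_measurable_times) auto
      show "AE \<omega> in M. (\<lambda>n. indicat_real H \<omega> * (LINT r:{t..c n}|lborel. running_cost \<xi> X Y r \<omega>))
          \<longlonglongrightarrow> indicat_real H \<omega> * (LINT r:{t..T}|lborel. running_cost \<xi> X Y r \<omega>)"
        using time_integrableD(1)[OF rc] by eventually_elim (intro tendsto_intros along)
      show "AE \<omega> in M. norm (indicat_real H \<omega> * (LINT r:{t..c n}|lborel. running_cost \<xi> X Y r \<omega>))
          \<le> (LINT r:{t..T}|lborel. \<bar>running_cost \<xi> X Y r \<omega>\<bar>)" for n
        using time_integrableD(1)[OF rc]
      proof eventually_elim
        case (elim \<omega>)
        have cn: "c n \<in> {t..T}" using c0[of n] by auto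
        have i: "set_integrable lborel {t..c n} (\<lambda>r. running_cost \<xi> X Y r \<omega>)" by (rule set_integrable_subset[OF elim]) (use cn in auto)
        have "\<bar>LINT r:{t..c n}|lborel. running_cost \<xi> X Y r \<omega>\<bar> \<le> (LINT r:{t..c n}|lborel. \<bar>running_cost \<xi> X Y r \<omega>\<bar>)"
          using set_integral_norm_bound[OF i] by simp
        also have "\<dots> \<le> (LINT r:{t..T}|lborel. \<bar>running_cost \<xi> X Y r \<omega>\<bar>)"
        proof -
          have "0 \<le> (LINT r:{c n..T}|lborel. \<bar>running_cost \<xi> X Y r \<omega>\<bar>)"
            unfolding set_lebesgue_integral_def by (rule Bochner_Integration.integral_nonneg) simp
          then show ?thesis using LINT_split[OF set_integrable_abs[OF elim] cn] by simp
        qed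
        finally have k: "\<bar>LINT r:{t..c n}|lborel. running_cost \<xi> X Y r \<omega>\<bar> \<le> (LINT r:{t..T}|lborel. \<bar>running_cost \<xi> X Y r \<omega>\<bar>)" .
        have "norm (indicat_real H \<omega> * (LINT r:{t..c n}|lborel. running_cost \<xi> X Y r \<omega>)) \<le> \<bar>LINT r:{t..c n}|lborel. running_cost \<xi> X Y r \<omega>\<bar>"
          by (auto simp: indicator_def)
        with k show ?case by linarith
      qed
    qed
    from tendsto_add[OF l1 l2] show ?thesis by simp
  qed
  show "expectation (\<lambda>\<omega>. indicat_real H \<omega> * value_form X Y t \<omega>)
       \<le> expectation (\<lambda>\<omega>. indicat_real H \<omega> * (LINT r:{t..T}|lborel. running_cost \<xi> X Y r \<omega>))" if H: "H \<in> sets (F t)"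
  proof (rule LIMSEQ_le_const[OF conv[OF H]], intro exI allI impI)
    fix n
    have "0 \<le> expectation (\<lambda>\<omega>. indicat_real H \<omega> * (LINT r:{t..c n}|lborel. excess \<xi> X Y r \<omega>))"
      unfolding set_lebesgue_integral_def excess_def
      by (intro Bochner_Integration.integral_nonneg mult_nonneg_nonneg) (use eta in auto)
    then show "expectation (\<lambda>\<omega>. indicat_real H \<omega> * value_form X Y t \<omega>)
      \<le> expectation (\<lambda>\<omega>. indicat_real H \<omega> * value_form X Y (c n) \<omega>)
        + expectation (\<lambda>\<omega>. indicat_real H \<omega> * (LINT r:{t..c n}|lborel. running_cost \<xi> X Y r \<omega>))"
      using energy_identity(4)[OF tT(1) c0(2,3) stn \<xi>n H, of n] by linarith
  qed
  show "expectation (\<lambda>\<omega>. indicat_real H \<omega> * value_form X Y t \<omega>)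
       = expectation (\<lambda>\<omega>. indicat_real H \<omega> * (LINT r:{t..T}|lborel. running_cost \<xi> X Y r \<omega>))"
    if H: "H \<in> sets (F t)" and ex: "AE \<omega> in M. \<forall>r\<in>{t..<T}. excess \<xi> X Y r \<omega> = 0"
  proof -
    have z: "expectation (\<lambda>\<omega>. indicat_real H \<omega> * (LINT r:{t..c n}|lborel. excess \<xi> X Y r \<omega>)) = 0" for n
    proof (rule integral_eq_zero_AE)
      show "AE \<omega> in M. indicat_real H \<omega> * (LINT r:{t..c n}|lborel. excess \<xi> X Y r \<omega>) = 0"
        using ex
      proof eventually_elim
        case (elim \<omega>)
        have "(LINT r:{t..c n}|lborel. excess \<xi> X Y r \<omega>) = (LINT r:{t..c n}|lborel. 0)"
          by (rule set_lebesgue_integral_cong) (use elim c0(3)[of n] in auto)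
        then show ?case by simp
      qed
    qed
    have "expectation (\<lambda>\<omega>. indicat_real H \<omega> * value_form X Y (c n) \<omega>)
        + expectation (\<lambda>\<omega>. indicat_real H \<omega> * (LINT r:{t..c n}|lborel. running_cost \<xi> X Y r \<omega>))
       = expectation (\<lambda>\<omega>. indicat_real H \<omega> * value_form X Y t \<omega>)" for n
      using energy_identity(4)[OF tT(1) c0(2,3) stn \<xi>n H, of n] z[of n] by linarith
    then show ?thesis using conv[OF H] by (simp add: LIMSEQ_const_iff)
  qed
qed

definition initial_value :: "real \<Rightarrow> real \<Rightarrow> real \<Rightarrow> 'a \<Rightarrow> real" where
  "initial_value t x y \<omega> = 1/2 * A t \<omega> * x\<^sup>2 + B t \<omega> * x * y + 1/2 * C t \<omega> * y\<^sup>2"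

lemma initial_value_facts:
  assumes t: "t \<in> {0..<T}"
  shows "initial_value t x y \<in> borel_measurable (F t)" "integrable M (initial_value t x y)"
proof -
  have "0 \<le> t" "t < T" "t \<in> {0..t}" using t by auto
  note m = progressive_at_time[OF coefficients_progressive(1)[OF order_refl this(2)] this(3)]
    progressive_at_time[OF coefficients_progressive(2)[OF order_refl this(2)] this(3)]
    progressive_at_time[OF coefficients_progressive(3)[OF order_refl this(2)] this(3)]
  note m' = m[THEN borel_measurable_F_M, OF less_imp_le[OF \<open>t < T\<close>]]
  show "initial_value t x y \<in> borel_measurable (F t)"
    unfolding initial_value_def[abs_def] by (intro borel_measurable_add borel_measurable_times m) auto
  obtain K where K: "AE \<omega> in M. \<forall>s\<in>{0..t}. \<bar>A s \<omega>\<bar> \<le> K \<and> \<bar>B s \<omega>\<bar> \<le> K \<and> \<bar>C s \<omega>\<bar> \<le> K"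
    using coefficients_bounded[OF \<open>t < T\<close>] by blast
  have iABC: "integrable M (A t)" "integrable M (B t)" "integrable M (C t)"
  proof -
    have bd: "AE \<omega> in M. norm (A t \<omega>) \<le> K" "AE \<omega> in M. norm (B t \<omega>) \<le> K" "AE \<omega> in M. norm (C t \<omega>) \<le> K"
      using K by (eventually_elim, use t in auto)+
    show "integrable M (A t)" "integrable M (B t)" "integrable M (C t)"
      by (rule integrable_const_bound[OF bd(1) m'(1)] integrable_const_bound[OF bd(2) m'(2)] integrable_const_bound[OF bd(3) m'(3)])+
  qed
  have "initial_value t x y \<omega> = (1/2 * x\<^sup>2) * A t \<omega> + (x * y) * B t \<omega> + (1/2 * y\<^sup>2) * C t \<omega>" for \<omega>
    by (simp add: initial_value_def mult.commute)
  then show "integrable M (initial_value t x y)"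
    using iABC by (simp cong: Bochner_Integration.integrable_cong)
qed

lemma value_form_initial:
  assumes t: "t \<in> {0..<T}" and st: "state_process M F \<gamma> \<rho> t T x y \<xi> X Y"
  shows "AE \<omega> in M. value_form X Y t \<omega> = initial_value t x y \<omega>"
proof -
  have X: "AE \<omega> in M. \<forall>s\<in>{t..T}. set_integrable lborel {t..s} (\<lambda>r. \<xi> r \<omega>) \<and> X s \<omega> = x - (LINT r:{t..s}|lborel. \<xi> r \<omega>)"
    and Y: "AE \<omega> in M. \<forall>s\<in>{t..T}. set_integrable lborel {t..s} (\<lambda>r. - \<rho> r \<omega> * Y r \<omega> + \<gamma> * \<xi> r \<omega>) \<and>
        Y s \<omega> = y + (LINT r:{t..s}|lborel. - \<rho> r \<omega> * Y r \<omega> + \<gamma> * \<xi> r \<omega>)"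
    using st unfolding state_process_def position_process_def by auto
  have tt: "t \<in> {t..T}" using t by auto
  show ?thesis using X Y
  proof eventually_elim
    case (elim \<omega>)
    have "X t \<omega> = x - (LINT r:{t..t}|lborel. \<xi> r \<omega>)" "Y t \<omega> = y + (LINT r:{t..t}|lborel. - \<rho> r \<omega> * Y r \<omega> + \<gamma> * \<xi> r \<omega>)"
      using elim tt by blast+
    then have "X t \<omega> = x" "Y t \<omega> = y" unfolding atLeastAtMost_singleton LINT_at_point by simp_all
    then show ?case by (simp add: value_form_def initial_value_def)
  qed
qed

lemma expectation_initial:
  assumes t: "t \<in> {0..<T}" and st: "state_process M F \<gamma> \<rho> t T x y \<xi> X Y" and H: "H \<in> sets (F t)"
  shows "expectation (\<lambda>\<omega>. indicat_real H \<omega> * value_form X Y t \<omega>) = expectation (\<lambda>\<omega>. indicat_real H \<omega> * initial_value t x y \<omega>)"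
proof (rule integral_cong_AE)
  have t0: "0 \<le> t" "t < T" "t \<le> T" "t \<in> {t..t}" using t by auto
  have HM: "H \<in> sets M" using F_subset_M[OF t0(3)] H by auto
  have p: "progressive F t t X" "progressive F t t Y"
    using st t0 by (auto simp: state_process_def position_process_def intro: progressive_subinterval)
  have mX: "X t \<in> borel_measurable M" "Y t \<in> borel_measurable M"
    by (fact progressive_time_M[OF p(1) t0(4,3)] progressive_time_M[OF p(2) t0(4,3)])+
  note mc = progressive_time_M[OF coefficients_progressive(1)[OF t0(1,2)] t0(4,3)]
    progressive_time_M[OF coefficients_progressive(2)[OF t0(1,2)] t0(4,3)]
    progressive_time_M[OF coefficients_progressive(3)[OF t0(1,2)] t0(4,3)]
  show "(\<lambda>\<omega>. indicat_real H \<omega> * value_form X Y t \<omega>) \<in> borel_measurable M"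
    unfolding value_form_def using HM
    by (intro borel_measurable_times borel_measurable_add borel_measurable_power mX mc) auto
  show "(\<lambda>\<omega>. indicat_real H \<omega> * initial_value t x y \<omega>) \<in> borel_measurable M"
    using initial_value_facts(2)[OF t] HM by (intro borel_measurable_times) auto
  show "AE \<omega> in M. indicat_real H \<omega> * value_form X Y t \<omega> = indicat_real H \<omega> * initial_value t x y \<omega>"
    using value_form_initial[OF t st] by eventually_elim simp
qed

lemma conditional_cost_eq:
  "conditional_cost M F T \<eta> lam t \<xi> X Y = real_cond_exp M (F t) (\<lambda>\<omega>. LINT r:{t..T}|lborel. running_cost \<xi> X Y r \<omega>)"
  unfolding conditional_cost_def running_cost_def ..

text \<open>Expectations over all events of \<open>F t\<close> determine the conditional expectation.\<close>

lemma conditional_cost_lower_bound: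
  assumes t: "t \<in> {0..<T}" and adm: "admissible M F T t x \<xi>" and st: "state_process M F \<gamma> \<rho> t T x y \<xi> X Y"
  shows "AE \<omega> in M. initial_value t x y \<omega> \<le> conditional_cost M F T \<eta> lam t \<xi> X Y \<omega>"
proof -
  have tT: "t \<le> T" using t by simp
  let ?J = "\<lambda>\<omega>. LINT r:{t..T}|lborel. running_cost \<xi> X Y r \<omega>"
  note v = verification[OF t adm st]
  interpret ce: sigma_finite_subalgebra M "F t" by (rule cond_exp_F[OF tT])
  show ?thesis
    unfolding conditional_cost_eq
  proof (rule AE_le_of_integral_le[OF tT initial_value_facts(2,1)[OF t]])
    show "integrable M (real_cond_exp M (F t) ?J)" by (rule ce.real_cond_exp_int(1)[OF v(1)])
    show "real_cond_exp M (F t) ?J \<in> borel_measurable (F t)" by (rule borel_measurable_cond_exp)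
    fix H assume H: "H \<in> sets (F t)"
    have "expectation (\<lambda>\<omega>. indicat_real H \<omega> * initial_value t x y \<omega>) \<le> expectation (\<lambda>\<omega>. indicat_real H \<omega> * ?J \<omega>)"
      using v(2)[OF H] expectation_initial[OF t st H] by simp
    also have "\<dots> = expectation (\<lambda>\<omega>. indicat_real H \<omega> * real_cond_exp M (F t) ?J \<omega>)"
      using ce.real_cond_exp_intA[OF v(1) H] by (simp add: set_lebesgue_integral_def)
    finally show "expectation (\<lambda>\<omega>. indicat_real H \<omega> * initial_value t x y \<omega>) \<le> expectation (\<lambda>\<omega>. indicat_real H \<omega> * real_cond_exp M (F t) ?J \<omega>)" .
  qed
qed

section \<open>The feedback control is admissible and optimal\<close>

definition feedback_from :: "real \<Rightarrow> (real \<Rightarrow> 'a \<Rightarrow> real) \<Rightarrow> (real \<Rightarrow> 'a \<Rightarrow> real) \<Rightarrow> (real \<Rightarrow> 'a \<Rightarrow> real) \<Rightarrow> bool" where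
  "feedback_from t \<xi> X Y \<longleftrightarrow> (AE \<omega> in M. \<forall>s\<in>{t..<T}. \<xi> s \<omega> = feedback \<eta> \<gamma> A B C s \<omega> (X s \<omega>) (Y s \<omega>))"

text \<open>Before \<open>T\<close> the feedback is a linear function of the state with bounded coefficients, so Gronwall's
  inequality applies to \<open>\<bar>X\<bar> + \<bar>Y\<bar>\<close>.\<close>

lemma closed_loop_bounded:
  assumes tb: "0 \<le> t" "t \<le> b" "b < T" and st: "state_process M F \<gamma> \<rho> t b x y \<xi> X Y" and fb: "feedback_from t \<xi> X Y"
  shows "\<exists>R\<ge>0. AE \<omega> in M. \<forall>s\<in>{t..b}. \<bar>X s \<omega>\<bar> \<le> R \<and> \<bar>Y s \<omega>\<bar> \<le> R \<and> \<bar>\<xi> s \<omega>\<bar> \<le> R"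
proof -
  obtain K where K: "K \<ge> 0" "AE \<omega> in M. \<forall>s\<in>{0..b}. \<bar>A s \<omega>\<bar> \<le> K \<and> \<bar>B s \<omega>\<bar> \<le> K \<and> \<bar>C s \<omega>\<bar> \<le> K"
    using coefficients_bounded[OF tb(3)] by blast
  define k where "k = inverse \<eta> * (1 + 2 * K + 2 * \<gamma> * K)"
  have k0: "k \<ge> 0" using K(1) gamma eta by (auto simp: k_def intro!: mult_nonneg_nonneg add_nonneg_nonneg)
  define l where "l = (1 + \<gamma>) * k + rho_max + 1"
  have l0: "l > 0" using k0 gamma rho_max(1) by (auto simp: l_def intro!: add_nonneg_pos add_nonneg_nonneg)
  define R where "R = 2 * (\<bar>x\<bar> + \<bar>y\<bar>) * exp (2 * l * (b - t))"
  have R0: "R \<ge> 0" by (simp add: R_def)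
  have X: "AE \<omega> in M. \<forall>s\<in>{t..b}. set_integrable lborel {t..s} (\<lambda>r. \<xi> r \<omega>) \<and> X s \<omega> = x - (LINT r:{t..s}|lborel. \<xi> r \<omega>)"
    and Y: "AE \<omega> in M. \<forall>s\<in>{t..b}. set_integrable lborel {t..s} (\<lambda>r. - \<rho> r \<omega> * Y r \<omega> + \<gamma> * \<xi> r \<omega>) \<and>
        Y s \<omega> = y + (LINT r:{t..s}|lborel. - \<rho> r \<omega> * Y r \<omega> + \<gamma> * \<xi> r \<omega>)"
    using st unfolding state_process_def position_process_def by auto
  have "AE \<omega> in M. \<forall>s\<in>{t..b}. \<bar>X s \<omega>\<bar> + \<bar>Y s \<omega>\<bar> \<le> R \<and> \<bar>\<xi> s \<omega>\<bar> \<le> k * (\<bar>X s \<omega>\<bar> + \<bar>Y s \<omega>\<bar>)"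
    using X Y K(2) fb[unfolded feedback_from_def] AE_swap_time[OF rho_max(2)]
  proof eventually_elim
    case (elim \<omega>)
    have \<xi>: "\<bar>\<xi> s \<omega>\<bar> \<le> k * (\<bar>X s \<omega>\<bar> + \<bar>Y s \<omega>\<bar>)" if s: "s \<in> {t..b}" for s
    proof -
      have "\<xi> s \<omega> = feedback \<eta> \<gamma> A B C s \<omega> (X s \<omega>) (Y s \<omega>)" using elim(4) s tb by auto
      moreover have "\<bar>A s \<omega>\<bar> \<le> K" "\<bar>B s \<omega>\<bar> \<le> K" "\<bar>C s \<omega>\<bar> \<le> K" using elim(3) s tb by auto
      ultimately show ?thesis using feedback_linear_growth[of A s \<omega> K B C] by (simp add: k_def)
    qed
    have b: "b \<in> {t..b}" using tb by simp
    have iX: "set_integrable lborel {t..b} (\<lambda>r. \<xi> r \<omega>)" and iY: "set_integrable lborel {t..b} (\<lambda>r. - \<rho> r \<omega> * Y r \<omega> + \<gamma> * \<xi> r \<omega>)"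
      using elim(1,2) b by blast+
    have "continuous_on {t..b} (\<lambda>s. x - (LINT r:{t..s}|lborel. \<xi> r \<omega>))" "continuous_on {t..b} (\<lambda>s. y + (LINT r:{t..s}|lborel. - \<rho> r \<omega> * Y r \<omega> + \<gamma> * \<xi> r \<omega>))"
      by (intro continuous_intros continuous_on_indefinite_LINT iX iY)+
    then have cX: "continuous_on {t..b} (\<lambda>s. X s \<omega>)" and cY: "continuous_on {t..b} (\<lambda>s. Y s \<omega>)"
      using elim(1,2) by (blast intro: continuous_on_eq[OF _ sym])+
    have "\<bar>X s \<omega>\<bar> + \<bar>Y s \<omega>\<bar> \<le> R" if s: "s \<in> {t..b}" for s
      unfolding R_def
    proof (rule gronwall_bound[where \<phi>="\<lambda>s. \<bar>X s \<omega>\<bar> + \<bar>Y s \<omega>\<bar>", OF _ _ l0 _ _ s])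
      show c: "continuous_on {t..b} (\<lambda>s. \<bar>X s \<omega>\<bar> + \<bar>Y s \<omega>\<bar>)" by (intro continuous_intros cX cY)
      fix q assume q: "q \<in> {t..b}"
      have i: "set_integrable lborel {t..q} (\<lambda>r. \<bar>X r \<omega>\<bar> + \<bar>Y r \<omega>\<bar>)"
        by (rule borel_integrable_atLeastAtMost', rule continuous_on_subset[OF c]) (use q in auto)
      have i1: "set_integrable lborel {t..q} (\<lambda>r. \<xi> r \<omega>)" and i2: "set_integrable lborel {t..q} (\<lambda>r. - \<rho> r \<omega> * Y r \<omega> + \<gamma> * \<xi> r \<omega>)"
        using elim(1,2) q by blast+
      have "\<bar>X q \<omega>\<bar> + \<bar>Y q \<omega>\<bar> \<le> (\<bar>x\<bar> + \<bar>y\<bar>) + (\<bar>LINT r:{t..q}|lborel. \<xi> r \<omega>\<bar> + \<bar>LINT r:{t..q}|lborel. - \<rho> r \<omega> * Y r \<omega> + \<gamma> * \<xi> r \<omega>\<bar>)"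
        using elim(1,2) q by auto
      also have "\<dots> \<le> (\<bar>x\<bar> + \<bar>y\<bar>) + ((LINT r:{t..q}|lborel. \<bar>\<xi> r \<omega>\<bar>) + (LINT r:{t..q}|lborel. \<bar>- \<rho> r \<omega> * Y r \<omega> + \<gamma> * \<xi> r \<omega>\<bar>))"
        using set_integral_norm_bound[OF i1] set_integral_norm_bound[OF i2] by (intro add_left_mono add_mono) simp_all
      also have "(LINT r:{t..q}|lborel. \<bar>\<xi> r \<omega>\<bar>) + (LINT r:{t..q}|lborel. \<bar>- \<rho> r \<omega> * Y r \<omega> + \<gamma> * \<xi> r \<omega>\<bar>)
          = (LINT r:{t..q}|lborel. \<bar>\<xi> r \<omega>\<bar> + \<bar>- \<rho> r \<omega> * Y r \<omega> + \<gamma> * \<xi> r \<omega>\<bar>)"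
        by (rule set_integral_add(2)[OF set_integrable_abs[OF i1] set_integrable_abs[OF i2], symmetric])
      also have "\<dots> \<le> (LINT r:{t..q}|lborel. l * (\<bar>X r \<omega>\<bar> + \<bar>Y r \<omega>\<bar>))"
      proof (rule set_integral_mono_AE)
        show "set_integrable lborel {t..q} (\<lambda>r. \<bar>\<xi> r \<omega>\<bar> + \<bar>- \<rho> r \<omega> * Y r \<omega> + \<gamma> * \<xi> r \<omega>\<bar>)"
          by (rule set_integral_add(1)[OF set_integrable_abs[OF i1] set_integrable_abs[OF i2]])
        show "set_integrable lborel {t..q} (\<lambda>r. l * (\<bar>X r \<omega>\<bar> + \<bar>Y r \<omega>\<bar>))" using i by simp
        show "AE r\<in>{t..q} in lborel. \<bar>\<xi> r \<omega>\<bar> + \<bar>- \<rho> r \<omega> * Y r \<omega> + \<gamma> * \<xi> r \<omega>\<bar> \<le> l * (\<bar>X r \<omega>\<bar> + \<bar>Y r \<omega>\<bar>)"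
          using elim(5)
        proof eventually_elim
          case (elim r)
          show ?case
          proof
            assume r: "r \<in> {t..q}"
            let ?\<phi> = "\<bar>X r \<omega>\<bar> + \<bar>Y r \<omega>\<bar>"
            have 1: "\<bar>\<xi> r \<omega>\<bar> \<le> k * ?\<phi>" using \<xi>[of r] r q by auto
            have "\<bar>\<rho> r \<omega>\<bar> \<le> rho_max" using elim r q tb by auto
            then have "\<bar>\<rho> r \<omega>\<bar> * \<bar>Y r \<omega>\<bar> \<le> rho_max * ?\<phi>" using rho_max(1) by (intro mult_mono) auto
            moreover have "\<gamma> * \<bar>\<xi> r \<omega>\<bar> \<le> \<gamma> * (k * ?\<phi>)" using 1 gamma by (intro mult_left_mono) auto
            moreover have "\<bar>- \<rho> r \<omega> * Y r \<omega> + \<gamma> * \<xi> r \<omega>\<bar> \<le> \<bar>\<rho> r \<omega>\<bar> * \<bar>Y r \<omega>\<bar> + \<gamma> * \<bar>\<xi> r \<omega>\<bar>"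
              using abs_triangle_ineq[of "- \<rho> r \<omega> * Y r \<omega>" "\<gamma> * \<xi> r \<omega>"] gamma by (simp add: abs_mult)
            moreover have "l * ?\<phi> = k * ?\<phi> + \<gamma> * (k * ?\<phi>) + rho_max * ?\<phi> + ?\<phi>" unfolding l_def by (simp only: algebra_simps)
            ultimately show "\<bar>\<xi> r \<omega>\<bar> + \<bar>- \<rho> r \<omega> * Y r \<omega> + \<gamma> * \<xi> r \<omega>\<bar> \<le> l * ?\<phi>" using 1 by linarith
          qed
        qed
      qed
      also have "\<dots> = l * (LINT r:{t..q}|lborel. \<bar>X r \<omega>\<bar> + \<bar>Y r \<omega>\<bar>)" by (rule set_integral_mult_right)
      finally show "\<bar>X q \<omega>\<bar> + \<bar>Y q \<omega>\<bar> \<le> (\<bar>x\<bar> + \<bar>y\<bar>) + l * (LINT r:{t..q}|lborel. \<bar>X r \<omega>\<bar> + \<bar>Y r \<omega>\<bar>)" by simp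
    qed auto
    then show ?case using \<xi> by blast
  qed
  then have "AE \<omega> in M. \<forall>s\<in>{t..b}. \<bar>X s \<omega>\<bar> \<le> R + k * R \<and> \<bar>Y s \<omega>\<bar> \<le> R + k * R \<and> \<bar>\<xi> s \<omega>\<bar> \<le> R + k * R"
  proof eventually_elim
    case (elim \<omega>)
    show ?case
    proof
      fix s assume s: "s \<in> {t..b}"
      have 1: "\<bar>X s \<omega>\<bar> + \<bar>Y s \<omega>\<bar> \<le> R" "\<bar>\<xi> s \<omega>\<bar> \<le> k * (\<bar>X s \<omega>\<bar> + \<bar>Y s \<omega>\<bar>)" using elim s by blast+
      have "k * (\<bar>X s \<omega>\<bar> + \<bar>Y s \<omega>\<bar>) \<le> k * R" by (rule mult_left_mono[OF 1(1) k0])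
      moreover have "0 \<le> k * R" using k0 R0 by simp
      ultimately show "\<bar>X s \<omega>\<bar> \<le> R + k * R \<and> \<bar>Y s \<omega>\<bar> \<le> R + k * R \<and> \<bar>\<xi> s \<omega>\<bar> \<le> R + k * R" using 1 R0 by auto
    qed
  qed
  moreover have "0 \<le> R + k * R" using k0 R0 by simp
  ultimately show ?thesis by blast
qed

text \<open>For the feedback control the square in the energy identity is absent.\<close>

lemma closed_loop_energy:
  assumes tb: "0 \<le> t" "t \<le> b" "b < T" and st: "state_process M F \<gamma> \<rho> t b x y \<xi> X Y" and fb: "feedback_from t \<xi> X Y"
    and p: "progressive F t b \<xi>"
  shows "L2_prog M F t b \<xi>"
    and "expectation (value_form X Y b) + expectation (\<lambda>\<omega>. LINT r:{t..b}|lborel. running_cost \<xi> X Y r \<omega>) = expectation (value_form X Y t)"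
proof -
  have bT: "b \<le> T" using tb by simp
  obtain R where R: "R \<ge> 0" "AE \<omega> in M. \<forall>s\<in>{t..b}. \<bar>X s \<omega>\<bar> \<le> R \<and> \<bar>Y s \<omega>\<bar> \<le> R \<and> \<bar>\<xi> s \<omega>\<bar> \<le> R"
    using closed_loop_bounded[OF tb st fb] by blast
  have "time_integrable t b (\<lambda>s \<omega>. (norm (\<xi> s \<omega>))\<^sup>2)"
  proof (rule time_integrable_bound[OF time_integrable_const[of t b "R\<^sup>2"] _ bT])
    show "progressive F t b (\<lambda>s \<omega>. (norm (\<xi> s \<omega>))\<^sup>2)" by (rule progressive_compose[OF p]) simp
    show "AE (s, \<omega>) in lborel \<Otimes>\<^sub>M M. s \<in> {t..b} \<longrightarrow> \<bar>(norm (\<xi> s \<omega>))\<^sup>2\<bar> \<le> R\<^sup>2"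
      using AE_lift_time[OF R(2)]
    proof eventually_elim
      case (elim p)
      have "\<bar>(norm (\<xi> s \<omega>))\<^sup>2\<bar> \<le> R\<^sup>2" if "p = (s, \<omega>)" "s \<in> {t..b}" for s \<omega>
      proof -
        have "\<bar>\<xi> s \<omega>\<bar> \<le> R" using elim that by auto
        then show ?thesis using power_mono[of "\<bar>\<xi> s \<omega>\<bar>" R 2] by simp
      qed
      then show ?case by (cases p) auto
    qed
  qed
  then show \<xi>: "L2_prog M F t b \<xi>" using L2_prog_iff[OF bT] p by blast
  have S: "space M \<in> sets (F t)" using sets.top[of "F t"] by simp
  have one: "expectation (\<lambda>\<omega>. indicat_real (space M) \<omega> * f \<omega>) = expectation f" for f :: "'a \<Rightarrow> real"
    by (rule Bochner_Integration.integral_cong) auto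
  have z: "expectation (\<lambda>\<omega>. LINT r:{t..b}|lborel. excess \<xi> X Y r \<omega>) = 0"
  proof (rule integral_eq_zero_AE)
    show "AE \<omega> in M. (LINT r:{t..b}|lborel. excess \<xi> X Y r \<omega>) = 0"
      using fb[unfolded feedback_from_def]
    proof eventually_elim
      case (elim \<omega>)
      have "(LINT r:{t..b}|lborel. excess \<xi> X Y r \<omega>) = (LINT r:{t..b}|lborel. 0)"
        by (rule set_lebesgue_integral_cong) (use elim tb in \<open>auto simp: excess_def\<close>)
      then show ?case by simp
    qed
  qed
  show "expectation (value_form X Y b) + expectation (\<lambda>\<omega>. LINT r:{t..b}|lborel. running_cost \<xi> X Y r \<omega>) = expectation (value_form X Y t)"
    using energy_identity(4)[OF tb st \<xi> S] z unfolding one by simp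
qed

text \<open>By \<open>closed_loop_energy\<close>, the expectation of \<open>V b\<close> plus the cost from \<open>s0\<close> to \<open>b\<close> is the same for all
  \<open>b\<close>. In this sum \<open>A b * (X b)\<^sup>2\<close> is nonnegative near \<open>T\<close>, and all terms of indefinite sign are
  bounded by a constant plus a multiple of \<open>J\<^sup>2\<close>, where \<open>J\<close> is the integral of \<open>\<bar>\<xi>\<bar>\<close> over \<open>{s0..b}\<close>. As
  \<open>J\<^sup>2\<close> is at most \<open>b - s0\<close> times the integral of \<open>\<xi>\<^sup>2\<close>, a short horizon lets the cost \<open>1/2 \<eta> \<xi>\<^sup>2\<close> absorb
  it. This bounds the expectation of the integral of \<open>\<xi>\<^sup>2\<close> uniformly in \<open>b\<close>.\<close>

lemma closed_loop_square_integrable: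
  assumes t: "t \<in> {0..<T}" and p: "progressive F t T \<xi>" and st: "\<And>b. b \<in> {t..<T} \<Longrightarrow> state_process M F \<gamma> \<rho> t b x y \<xi> X Y"
    and fb: "feedback_from t \<xi> X Y"
  shows "L2_prog M F t T \<xi>"
proof -
  have t0: "0 \<le> t" "t < T" using t by auto
  have pb: "progressive F t b \<xi>" if "b \<le> T" for b by (rule progressive_subinterval[OF p]) (use that in auto)
  note ce = closed_loop_energy[OF t0(1) _ _ st fb pb]
  define g where "g = state_gain"
  have g: "g \<ge> 1" unfolding g_def by (rule state_gain_ge_1)
  obtain K where K: "K \<ge> 1" "AE \<omega> in M. \<forall>s\<in>{0..<T}. \<bar>A s \<omega>\<bar> \<le> K / (T - s) \<and> \<bar>B s \<omega>\<bar> \<le> K \<and> \<bar>C s \<omega>\<bar> \<le> K"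
    using coefficient_bounds by blast
  obtain b1 where b1: "b1 \<in> {0..<T}" "AE \<omega> in M. \<forall>s\<in>{b1..<T}. 1 \<le> A s \<omega>"
    using terminal unfolding singular_terminal_condition_def by (meson zero_less_one)
  \<comment> \<open>\<open>N\<close> collects the factors of \<open>J\<^sup>2\<close> below: \<open>8 * K * g\<^sup>2\<close> from the quadratic form and \<open>1 + g\<close> from
    the cost. A horizon of \<open>\<eta> / (4 * N)\<close> makes \<open>N * J\<^sup>2\<close> at most half of \<open>1/2 * \<eta>\<close> times the integral
    of \<open>\<xi>\<^sup>2\<close>.\<close>
  define N where "N = 8 * K * g\<^sup>2 + 1 + g"
  have N: "N > 0" using K(1) g by (auto simp: N_def intro!: add_nonneg_pos add_pos_pos)
  define s0 where "s0 = max (max t b1) (T - \<eta> / (4 * N))"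
  have s0: "t \<le> s0" "b1 \<le> s0" "s0 < T" "T - s0 \<le> \<eta> / (4 * N)" "s0 \<in> {t..<T}"
    using t0 b1(1) eta N by (auto simp: s0_def)
  obtain R0 where R0: "R0 \<ge> 0" "AE \<omega> in M. \<forall>s\<in>{t..s0}. \<bar>X s \<omega>\<bar> \<le> R0 \<and> \<bar>Y s \<omega>\<bar> \<le> R0 \<and> \<bar>\<xi> s \<omega>\<bar> \<le> R0"
    using closed_loop_bounded[OF t0(1) s0(1,3) st[OF s0(5)] fb] by blast
  \<comment> \<open>\<open>m + g * J\<close> bounds the state on \<open>{t..b}\<close>; \<open>m\<close> contains the part of the control before \<open>s0\<close>, where
    it is bounded.\<close>
  define m where "m = g * (\<bar>x\<bar> + \<bar>y\<bar> + R0 * T)"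
  have m0: "m \<ge> 0" using g R0(1) T_pos by (simp add: m_def)
  define c where "c = (8 * K + 1) * m\<^sup>2"
  let ?q = "\<lambda>b \<omega>. LINT r:{s0..b}|lborel. (\<xi> r \<omega>)\<^sup>2"
  have key: "\<eta> / 4 * expectation (?q b) \<le> expectation (value_form X Y s0) + c" if b: "b \<in> {s0..<T}" for b
  proof -
    have tb: "t \<le> b" "b < T" "b \<le> T" "b \<in> {t..<T}" "s0 \<in> {t..b}" using b s0 by auto
    note \<xi>b = ce(1)[OF tb(1,2,4,3)]
    note t\<xi>2 = L2_progD(2)[OF tb(3) \<xi>b]
    note rc = running_cost_bound(1)[OF t0(1) tb(1,3) st[OF tb(4)] \<xi>b]
    have tq: "time_integrable s0 b (\<lambda>s \<omega>. (\<xi> s \<omega>)\<^sup>2)" by (rule time_integrable_subinterval[OF t\<xi>2]) (use s0 in auto)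
    have trc: "time_integrable s0 b (running_cost \<xi> X Y)" by (rule time_integrable_subinterval[OF rc]) (use s0 in auto)
    have trc0: "time_integrable t s0 (running_cost \<xi> X Y)" by (rule time_integrable_subinterval[OF rc]) (use b in auto)
    obtain L where L: "AE (s, \<omega>) in lborel \<Otimes>\<^sub>M M. s \<in> {0..T} \<longrightarrow> 0 \<le> lam s \<omega> \<and> \<bar>lam s \<omega>\<bar> \<le> L"
      using lam_bound by blast
    have X: "AE \<omega> in M. \<forall>s\<in>{t..b}. set_integrable lborel {t..s} (\<lambda>r. \<xi> r \<omega>) \<and> X s \<omega> = x - (LINT r:{t..s}|lborel. \<xi> r \<omega>)"
      using st[OF tb(4)] unfolding state_process_def position_process_def by auto
    have iV: "integrable M (value_form X Y b)" by (rule energy_identity(3)[OF t0(1) tb(1,2) st[OF tb(4)] \<xi>b])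
    have "AE \<omega> in M. \<eta> / 4 * ?q b \<omega> - c \<le> value_form X Y b \<omega> + (LINT r:{s0..b}|lborel. running_cost \<xi> X Y r \<omega>)"
      using X state_process_bound[OF t0(1) tb(1,3) st[OF tb(4)]] time_integrableD(1)[OF tq] time_integrableD(1)[OF trc]
        AE_swap_time[OF L] K(2) b1(2) R0(2)
    proof eventually_elim
      case (elim \<omega>)
      have i: "set_integrable lborel {t..b} (\<lambda>r. \<xi> r \<omega>)" using elim(1) tb by auto
      have i0: "set_integrable lborel {s0..b} (\<lambda>r. \<xi> r \<omega>)" "set_integrable lborel {t..s0} (\<lambda>r. \<xi> r \<omega>)"
        by (rule set_integrable_subset[OF i]; use s0 b in auto)+
      define J where "J = (LINT r:{s0..b}|lborel. \<bar>\<xi> r \<omega>\<bar>)"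
      have J0: "J \<ge> 0" unfolding J_def set_lebesgue_integral_def by (rule Bochner_Integration.integral_nonneg) simp
      have "(LINT r:{t..s0}|lborel. \<bar>\<xi> r \<omega>\<bar>) \<le> (LINT r:{t..s0}|lborel. R0)"
        by (rule set_integral_mono[OF set_integrable_abs[OF i0(2)]])
          (use elim(8) integrable_indicator_Icc[of t s0] in \<open>auto simp: set_integrable_def\<close>)
      also have "\<dots> = R0 * (s0 - t)" using s0(1) by (simp add: set_lebesgue_integral_def)
      also have "\<dots> \<le> R0 * T" using R0(1) s0 t0 by (intro mult_left_mono) auto
      finally have "(LINT r:{t..b}|lborel. \<bar>\<xi> r \<omega>\<bar>) \<le> R0 * T + J"
        using LINT_split[OF set_integrable_abs[OF i] tb(5)] by (simp add: J_def)
      then have "g * (\<bar>x\<bar> + \<bar>y\<bar> + (LINT r:{t..b}|lborel. \<bar>\<xi> r \<omega>\<bar>)) \<le> g * (\<bar>x\<bar> + \<bar>y\<bar> + (R0 * T + J))"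
        using g by (intro mult_left_mono) auto
      also have "\<dots> = m + g * J" by (simp add: m_def algebra_simps)
      finally have XY: "\<bar>X s \<omega>\<bar> \<le> m + g * J" "\<bar>Y s \<omega>\<bar> \<le> m + g * J" if "s \<in> {t..b}" for s
        using elim(2) that unfolding g_def by force+
      have J2: "J\<^sup>2 \<le> (b - s0) * ?q b \<omega>"
        unfolding J_def using square_of_integral_le[OF set_integrable_abs[OF i0(1)]] elim(3) b by simp
      have q0: "0 \<le> ?q b \<omega>" unfolding set_lebesgue_integral_def by (rule Bochner_Integration.integral_nonneg) simp
      have "N * J\<^sup>2 \<le> N * ((\<eta> / (4 * N)) * ?q b \<omega>)"
        using J2 s0(4) b q0 N by (intro mult_left_mono order_trans[OF J2] mult_right_mono) auto
      then have NJ: "N * J\<^sup>2 \<le> \<eta> / 4 * ?q b \<omega>" using N by simp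
      have cost: "\<eta> / 2 * ?q b \<omega> - (m + g * J) * J \<le> (LINT r:{s0..b}|lborel. running_cost \<xi> X Y r \<omega>)"
      proof -
        have "\<eta> / 2 * ?q b \<omega> - (m + g * J) * J = (LINT r:{s0..b}|lborel. \<eta> / 2 * (\<xi> r \<omega>)\<^sup>2 - (m + g * J) * \<bar>\<xi> r \<omega>\<bar>)"
          unfolding J_def using elim(3) set_integrable_abs[OF i0(1)] by (simp add: set_integral_diff)
        also have "\<dots> \<le> (LINT r:{s0..b}|lborel. running_cost \<xi> X Y r \<omega>)"
        proof (rule set_integral_mono_AE[OF _ elim(4)])
          show "set_integrable lborel {s0..b} (\<lambda>r. \<eta> / 2 * (\<xi> r \<omega>)\<^sup>2 - (m + g * J) * \<bar>\<xi> r \<omega>\<bar>)"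
            using elim(3) set_integrable_abs[OF i0(1)] by (intro set_integral_diff) auto
          show "AE r\<in>{s0..b} in lborel. \<eta> / 2 * (\<xi> r \<omega>)\<^sup>2 - (m + g * J) * \<bar>\<xi> r \<omega>\<bar> \<le> running_cost \<xi> X Y r \<omega>"
            using elim(5)
          proof eventually_elim
            case (elim r)
            show ?case
            proof
              assume r: "r \<in> {s0..b}"
              then have "0 \<le> lam r \<omega> * (X r \<omega>)\<^sup>2" using elim s0 t0 tb by auto
              moreover have "\<bar>\<xi> r \<omega>\<bar> * \<bar>Y r \<omega>\<bar> \<le> \<bar>\<xi> r \<omega>\<bar> * (m + g * J)" by (rule mult_left_mono[OF XY(2)]) (use r s0 in auto)
              moreover have "- (\<bar>\<xi> r \<omega>\<bar> * \<bar>Y r \<omega>\<bar>) \<le> \<xi> r \<omega> * Y r \<omega>" unfolding abs_mult[symmetric] by linarith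
              ultimately show "\<eta> / 2 * (\<xi> r \<omega>)\<^sup>2 - (m + g * J) * \<bar>\<xi> r \<omega>\<bar> \<le> running_cost \<xi> X Y r \<omega>"
                unfolding running_cost_def by (simp add: mult.commute[of "m + g * J"] mult.assoc)
            qed
          qed
        qed
        finally show ?thesis .
      qed
      have val: "- (8 * K * (m\<^sup>2 + g\<^sup>2 * J\<^sup>2)) \<le> value_form X Y b \<omega>"
      proof -
        have "b \<in> {0..<T}" "b \<in> {b1..<T}" using b s0(1,2) t0(1) by auto
        then have "\<bar>B b \<omega>\<bar> \<le> K" "\<bar>C b \<omega>\<bar> \<le> K" "1 \<le> A b \<omega>" using elim(6,7) by blast+
        then have bc: "\<bar>B b \<omega>\<bar> \<le> K" "\<bar>C b \<omega>\<bar> \<le> K" "0 \<le> A b \<omega>" by auto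
        have bb: "b \<in> {t..b}" using tb by simp
        have sq: "(X b \<omega>)\<^sup>2 \<le> (m + g * J)\<^sup>2" "(Y b \<omega>)\<^sup>2 \<le> (m + g * J)\<^sup>2"
          using power_mono[OF XY(1)[OF bb], of 2] power_mono[OF XY(2)[OF bb], of 2] by auto
        have e: "(m + g * J)\<^sup>2 \<le> 2 * (m\<^sup>2 + g\<^sup>2 * J\<^sup>2)"
          using zero_le_power2[of "m - g * J"] by (simp add: power2_sum power2_diff power_mult_distrib mult.commute)
        have "\<bar>X b \<omega> * Y b \<omega>\<bar> \<le> 4 * (m\<^sup>2 + g\<^sup>2 * J\<^sup>2)" using abs_mult_le_squares[of "X b \<omega>" "Y b \<omega>"] sq e by linarith
        then have "\<bar>B b \<omega>\<bar> * \<bar>X b \<omega> * Y b \<omega>\<bar> \<le> K * (4 * (m\<^sup>2 + g\<^sup>2 * J\<^sup>2))" by (rule mult_mono[OF bc(1)]) (use K(1) in auto)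
        then have 1: "- (K * (4 * (m\<^sup>2 + g\<^sup>2 * J\<^sup>2))) \<le> B b \<omega> * X b \<omega> * Y b \<omega>"
          unfolding abs_mult[symmetric] mult.assoc[symmetric] by (simp add: abs_le_iff)
        have "(Y b \<omega>)\<^sup>2 \<le> 2 * (m\<^sup>2 + g\<^sup>2 * J\<^sup>2)" using sq e by linarith
        then have "\<bar>C b \<omega>\<bar> * (Y b \<omega>)\<^sup>2 \<le> K * (2 * (m\<^sup>2 + g\<^sup>2 * J\<^sup>2))" by (rule mult_mono[OF bc(2)]) (use K(1) in auto)
        moreover have "- (\<bar>C b \<omega>\<bar> * (Y b \<omega>)\<^sup>2) \<le> C b \<omega> * (Y b \<omega>)\<^sup>2"
          using mult_right_mono[of "- \<bar>C b \<omega>\<bar>" "C b \<omega>" "(Y b \<omega>)\<^sup>2"] by simp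
        ultimately have 2: "- (K * (2 * (m\<^sup>2 + g\<^sup>2 * J\<^sup>2))) \<le> C b \<omega> * (Y b \<omega>)\<^sup>2" by linarith
        have 3: "0 \<le> A b \<omega> * (X b \<omega>)\<^sup>2" using bc(3) by simp
        have 4: "0 \<le> K * (m\<^sup>2 + g\<^sup>2 * J\<^sup>2)" using K(1) by simp
        define S where "S = m\<^sup>2 + g\<^sup>2 * J\<^sup>2"
        have KS: "K * (4 * S) = 4 * (K * S)" "K * (2 * S) = 2 * (K * S)" "8 * K * S = 8 * (K * S)" by simp_all
        have half: "1/2 * A b \<omega> * (X b \<omega>)\<^sup>2 = (A b \<omega> * (X b \<omega>)\<^sup>2) / 2" "1/2 * C b \<omega> * (Y b \<omega>)\<^sup>2 = (C b \<omega> * (Y b \<omega>)\<^sup>2) / 2"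
          by simp_all
        show ?thesis
          using 1 2 3 4 unfolding S_def[symmetric] KS value_form_def half by linarith
      qed
      have "(m + g * J) * J \<le> m\<^sup>2 + J\<^sup>2 + g * J\<^sup>2"
        using abs_mult_le_squares[of m J] by (simp add: power2_eq_square algebra_simps)
      moreover have "8 * K * (m\<^sup>2 + g\<^sup>2 * J\<^sup>2) + (m\<^sup>2 + J\<^sup>2 + g * J\<^sup>2) = c + N * J\<^sup>2"
        by (simp add: c_def N_def algebra_simps)
      ultimately show ?case using cost val NJ by linarith
    qed
    then have "expectation (\<lambda>\<omega>. \<eta> / 4 * ?q b \<omega> - c) \<le> expectation (\<lambda>\<omega>. value_form X Y b \<omega> + (LINT r:{s0..b}|lborel. running_cost \<xi> X Y r \<omega>))"
      using time_integrableD(2)[OF tq] iV time_integrableD(2)[OF trc] by (intro integral_mono_AE) auto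
    also have "\<dots> = expectation (value_form X Y b) + expectation (\<lambda>\<omega>. LINT r:{s0..b}|lborel. running_cost \<xi> X Y r \<omega>)"
      using iV time_integrableD(2)[OF trc] by simp
    also have "\<dots> = expectation (value_form X Y s0)"
    proof -
      have "expectation (\<lambda>\<omega>. LINT r:{t..b}|lborel. running_cost \<xi> X Y r \<omega>)
        = expectation (\<lambda>\<omega>. (LINT r:{t..s0}|lborel. running_cost \<xi> X Y r \<omega>) + (LINT r:{s0..b}|lborel. running_cost \<xi> X Y r \<omega>))"
      proof (rule integral_cong_AE)
        show "AE \<omega> in M. (LINT r:{t..b}|lborel. running_cost \<xi> X Y r \<omega>)
            = (LINT r:{t..s0}|lborel. running_cost \<xi> X Y r \<omega>) + (LINT r:{s0..b}|lborel. running_cost \<xi> X Y r \<omega>)"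
          using time_integrableD(1)[OF rc] by eventually_elim (rule LINT_split[OF _ tb(5)])
      qed (use time_integrableD(2)[OF rc] time_integrableD(2)[OF trc] time_integrableD(2)[OF trc0] in auto)
      also have "\<dots> = expectation (\<lambda>\<omega>. LINT r:{t..s0}|lborel. running_cost \<xi> X Y r \<omega>) + expectation (\<lambda>\<omega>. LINT r:{s0..b}|lborel. running_cost \<xi> X Y r \<omega>)"
        using time_integrableD(2)[OF trc] time_integrableD(2)[OF trc0] by simp
      finally show ?thesis
        using ce(2)[OF tb(1,2,4,3)] ce(2)[OF s0(1,3,5)] s0(3) by simp
    qed
    finally show ?thesis using time_integrableD(2)[OF tq] by (simp add: prob_space)
  qed
  have sT: "s0 \<le> T" using s0 by simp
  note \<xi>0 = ce(1)[OF s0(1,3,5) sT]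
  define Q0 where "Q0 = expectation (\<lambda>\<omega>. LINT r:{t..s0}|lborel. (\<xi> r \<omega>)\<^sup>2)"
  define Q1 where "Q1 = 4 / \<eta> * (expectation (value_form X Y s0) + c)"
  have Q1: "expectation (?q b) \<le> Q1" if "b \<in> {s0..<T}" for b
    using key[OF that] eta by (simp add: Q1_def field_simps)
  have i\<xi>: "time_integrable t b (\<lambda>s \<omega>. (\<xi> s \<omega>)\<^sup>2)" if "b \<in> {t..<T}" for b
    by (rule L2_progD(2)[OF _ ce(1)]) (use that in auto)
  have "expectation (\<lambda>\<omega>. LINT r:{t..b}|lborel. (\<xi> r \<omega>)\<^sup>2) \<le> Q0 + \<bar>Q1\<bar>" if b: "b \<in> {t..<T}" for b
  proof (cases "b \<le> s0")
    case True
    have "expectation (\<lambda>\<omega>. LINT r:{t..b}|lborel. (\<xi> r \<omega>)\<^sup>2) \<le> Q0"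
      unfolding Q0_def
    proof (rule integral_mono_AE[OF time_integrableD(2)[OF i\<xi>[OF b]] time_integrableD(2)[OF i\<xi>[OF s0(5)]]])
      show "AE \<omega> in M. (LINT r:{t..b}|lborel. (\<xi> r \<omega>)\<^sup>2) \<le> (LINT r:{t..s0}|lborel. (\<xi> r \<omega>)\<^sup>2)"
        using time_integrableD(1)[OF i\<xi>[OF s0(5)]] by eventually_elim (rule LINT_mono_interval, use True b in auto)
    qed
    then show ?thesis by linarith
  next
    case False
    then have b': "b \<in> {s0..<T}" "s0 \<in> {t..b}" using b s0 by auto
    have tq: "time_integrable s0 b (\<lambda>s \<omega>. (\<xi> s \<omega>)\<^sup>2)" by (rule time_integrable_subinterval[OF i\<xi>[OF b]]) (use s0 in auto)
    have "expectation (\<lambda>\<omega>. LINT r:{t..b}|lborel. (\<xi> r \<omega>)\<^sup>2) = expectation (\<lambda>\<omega>. (LINT r:{t..s0}|lborel. (\<xi> r \<omega>)\<^sup>2) + ?q b \<omega>)"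
    proof (rule integral_cong_AE)
      show "AE \<omega> in M. (LINT r:{t..b}|lborel. (\<xi> r \<omega>)\<^sup>2) = (LINT r:{t..s0}|lborel. (\<xi> r \<omega>)\<^sup>2) + ?q b \<omega>"
        using time_integrableD(1)[OF i\<xi>[OF b]] by eventually_elim (rule LINT_split[OF _ b'(2)])
    qed (use time_integrableD(2)[OF i\<xi>[OF b]] time_integrableD(2)[OF i\<xi>[OF s0(5)]] time_integrableD(2)[OF tq] in auto)
    also have "\<dots> = Q0 + expectation (?q b)"
      unfolding Q0_def using time_integrableD(2)[OF i\<xi>[OF s0(5)]] time_integrableD(2)[OF tq] by simp
    finally show ?thesis using Q1[OF b'(1)] by linarith
  qed
  note bnd = this
  have "time_integrable t T (\<lambda>s \<omega>. (\<xi> s \<omega>)\<^sup>2)"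
    by (rule time_integrable_up_to[OF progressive_power[OF p] t0(2) order_refl _ i\<xi> bnd]) simp
  then show ?thesis using L2_prog_iff[OF order_refl, of t \<xi>] p by simp
qed

text \<open>A closed loop only provides a state process before \<open>T\<close>. Once \<open>\<xi>\<close> is integrable up to \<open>T\<close>, the integral
  equations define the missing values at \<open>T\<close>.\<close>

lemma state_process_extend:
  assumes t: "t \<in> {0..<T}" and \<xi>: "L2_prog M F t T \<xi>"
    and st: "\<And>b. b \<in> {t..<T} \<Longrightarrow> state_process M F \<gamma> \<rho> t b x y \<xi> X Y"
  obtains X' Y' where "state_process M F \<gamma> \<rho> t T x y \<xi> X' Y'"
    "AE \<omega> in M. \<forall>s\<in>{t..<T}. X' s \<omega> = X s \<omega> \<and> Y' s \<omega> = Y s \<omega>"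
proof -
  have t0: "0 \<le> t" "t < T" "t \<le> T" using t by auto
  note p\<xi> = L2_progD(1)[OF order_refl \<xi>]
  have t\<xi>: "time_integrable t T \<xi>" by (rule time_integrable_of_square[OF p\<xi> L2_progD(2)[OF order_refl \<xi>] order_refl])
  obtain c :: "nat \<Rightarrow> real" where c: "\<And>n. c n \<in> {t..<T}" "c \<longlonglongrightarrow> T"
    using sequence_from_below[OF t0(2)] by blast
  have c_above: "\<exists>n. s < c n" if "s < T" for s
    using order_tendstoD(1)[OF c(2) that] by (auto simp: eventually_sequentially)
  have X: "AE \<omega> in M. \<forall>n. \<forall>s\<in>{t..c n}. X s \<omega> = x - (LINT r:{t..s}|lborel. \<xi> r \<omega>)"
    and Y: "AE \<omega> in M. \<forall>n. \<forall>s\<in>{t..c n}. Y s \<omega> = y + (LINT r:{t..s}|lborel. - \<rho> r \<omega> * Y r \<omega> + \<gamma> * \<xi> r \<omega>)"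
    unfolding AE_all_countable using st[OF c(1)] unfolding state_process_def position_process_def
    by (blast intro: eventually_mono)+
  \<comment> \<open>The value of the integrand at the single time \<open>T\<close> does not affect the integral, but it must be
    measurable.\<close>
  define Yh where "Yh s \<omega> = (if s < T then Y s \<omega> else 0)" for s \<omega>
  have pYh: "progressive F t T Yh" unfolding Yh_def[abs_def]
    by (rule progressive_before_terminal) (use st in \<open>auto simp: state_process_def\<close>)
  define J where "J \<omega> = (LINT r:{t..T}|lborel. \<bar>\<xi> r \<omega>\<bar>)" for \<omega>
  have iJ: "integrable M J" unfolding J_def[abs_def] by (rule time_integrableD(2)[OF time_integrable_abs[OF t\<xi>]])
  define D where "D \<omega> = state_gain * (\<bar>x\<bar> + \<bar>y\<bar> + J \<omega>)" for \<omega>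
  have iD: "integrable M D" unfolding D_def[abs_def] using iJ by simp
  have "AE \<omega> in M. \<forall>n. \<forall>s\<in>{t..c n}. \<bar>Y s \<omega>\<bar> \<le> state_gain * (\<bar>x\<bar> + \<bar>y\<bar> + (LINT r:{t..c n}|lborel. \<bar>\<xi> r \<omega>\<bar>))"
    unfolding AE_all_countable
  proof
    fix n
    have "t \<le> c n" "c n \<le> T" using c(1)[of n] by auto
    from state_process_bound[OF t0(1) this st[OF c(1)]]
    show "AE \<omega> in M. \<forall>s\<in>{t..c n}. \<bar>Y s \<omega>\<bar> \<le> state_gain * (\<bar>x\<bar> + \<bar>y\<bar> + (LINT r:{t..c n}|lborel. \<bar>\<xi> r \<omega>\<bar>))"
      by eventually_elim blast
  qed
  then have YD: "AE \<omega> in M. \<forall>s\<in>{t..<T}. \<bar>Y s \<omega>\<bar> \<le> D \<omega>"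
    using time_integrableD(1)[OF time_integrable_abs[OF t\<xi>]]
  proof eventually_elim
    case (elim \<omega>)
    show ?case
    proof
      fix s assume s: "s \<in> {t..<T}"
      then obtain n where n: "s < c n" using c_above by auto
      then have "\<bar>Y s \<omega>\<bar> \<le> state_gain * (\<bar>x\<bar> + \<bar>y\<bar> + (LINT r:{t..c n}|lborel. \<bar>\<xi> r \<omega>\<bar>))" using elim(1) s by auto
      also have "\<dots> \<le> D \<omega>"
        unfolding D_def J_def
        by (intro mult_left_mono add_left_mono LINT_mono_interval[OF elim(2)]) (use c(1)[of n] state_gain_ge_1 in auto)
      finally show "\<bar>Y s \<omega>\<bar> \<le> D \<omega>" .
    qed
  qed
  define h where "h r \<omega> = - \<rho> r \<omega> * Yh r \<omega> + \<gamma> * \<xi> r \<omega>" for r \<omega>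
  have ph: "progressive F t T h" unfolding h_def[abs_def]
    by (intro progressive_intros rho_progressive pYh p\<xi> t0(1) order_refl)
  have th: "time_integrable t T h"
  proof (rule time_integrable_bound[OF time_integrable_add[OF time_integrable_cmult[OF time_integrable_random[OF iD], where c=rho_max]
      time_integrable_cmult[OF time_integrable_abs[OF t\<xi>], where c=\<gamma>]] ph order_refl])
    have "AE \<omega> in M. 0 \<le> D \<omega>"
      using YD by eventually_elim (use t0 in \<open>force intro: order_trans[OF abs_ge_zero]\<close>)
    from AE_lift_time[OF this] rho_max(2) AE_lift_time[OF YD]
    show "AE (r, \<omega>) in lborel \<Otimes>\<^sub>M M. r \<in> {t..T} \<longrightarrow> \<bar>h r \<omega>\<bar> \<le> rho_max * D \<omega> + \<gamma> * \<bar>\<xi> r \<omega>\<bar>"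
    proof eventually_elim
      case (elim p)
      have "\<bar>h r \<omega>\<bar> \<le> rho_max * D \<omega> + \<gamma> * \<bar>\<xi> r \<omega>\<bar>" if p: "p = (r, \<omega>)" and r: "r \<in> {t..T}" for r \<omega>
      proof -
        have "\<bar>Yh r \<omega>\<bar> \<le> D \<omega>" using elim(1,3) r unfolding p Yh_def by auto
        moreover have "\<bar>\<rho> r \<omega>\<bar> \<le> rho_max" using elim(2) r t0 unfolding p by auto
        ultimately have "\<bar>\<rho> r \<omega>\<bar> * \<bar>Yh r \<omega>\<bar> \<le> rho_max * D \<omega>" using rho_max(1) by (intro mult_mono) auto
        moreover have "\<bar>h r \<omega>\<bar> \<le> \<bar>\<rho> r \<omega>\<bar> * \<bar>Yh r \<omega>\<bar> + \<gamma> * \<bar>\<xi> r \<omega>\<bar>"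
          using abs_triangle_ineq[of "- \<rho> r \<omega> * Yh r \<omega>" "\<gamma> * \<xi> r \<omega>"] gamma by (simp add: h_def abs_mult)
        ultimately show ?thesis by linarith
      qed
      then show ?case by (cases p) auto
    qed
  qed
  define X' where "X' s \<omega> = x - (LINT r:{t..s}|lborel. \<xi> r \<omega>)" for s \<omega>
  define Y' where "Y' s \<omega> = y + (LINT r:{t..s}|lborel. h r \<omega>)" for s \<omega>
  have pX': "progressive F t T X'" "progressive F t T Y'"
    unfolding X'_def[abs_def] Y'_def[abs_def] by (intro progressive_intros progressive_integral p\<xi> ph)+
  have eq: "AE \<omega> in M. \<forall>s\<in>{t..<T}. X' s \<omega> = X s \<omega> \<and> Y' s \<omega> = Y s \<omega>"
    using X Y
  proof eventually_elim
    case (elim \<omega>)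
    show ?case
    proof
      fix s assume s: "s \<in> {t..<T}"
      then obtain n where n: "s < c n" using c_above by auto
      then have sn: "s \<in> {t..c n}" using s by auto
      have "X s \<omega> = x - (LINT r:{t..s}|lborel. \<xi> r \<omega>)" using elim(1) sn by blast
      moreover have "Y s \<omega> = y + (LINT r:{t..s}|lborel. - \<rho> r \<omega> * Y r \<omega> + \<gamma> * \<xi> r \<omega>)" using elim(2) sn by blast
      moreover have "(LINT r:{t..s}|lborel. - \<rho> r \<omega> * Y r \<omega> + \<gamma> * \<xi> r \<omega>) = (LINT r:{t..s}|lborel. h r \<omega>)"
        by (rule set_lebesgue_integral_cong) (use s in \<open>auto simp: h_def Yh_def\<close>)
      ultimately show "X' s \<omega> = X s \<omega> \<and> Y' s \<omega> = Y s \<omega>" by (simp add: X'_def Y'_def)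
    qed
  qed
  have st': "state_process M F \<gamma> \<rho> t T x y \<xi> X' Y'"
    unfolding state_process_def position_process_def
  proof (intro conjI pX')
    show "AE \<omega> in M. \<forall>s\<in>{t..T}. set_integrable lborel {t..s} (\<lambda>r. \<xi> r \<omega>) \<and> X' s \<omega> = x - (LINT r:{t..s}|lborel. \<xi> r \<omega>)"
      using time_integrableD(1)[OF t\<xi>]
    proof eventually_elim
      case (elim \<omega>)
      show ?case
      proof
        fix s assume "s \<in> {t..T}"
        then have "set_integrable lborel {t..s} (\<lambda>r. \<xi> r \<omega>)" by (intro set_integrable_subset[OF elim]) auto
        then show "set_integrable lborel {t..s} (\<lambda>r. \<xi> r \<omega>) \<and> X' s \<omega> = x - (LINT r:{t..s}|lborel. \<xi> r \<omega>)" by (simp add: X'_def)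
      qed
    qed
    show "AE \<omega> in M. \<forall>s\<in>{t..T}. set_integrable lborel {t..s} (\<lambda>r. - \<rho> r \<omega> * Y' r \<omega> + \<gamma> * \<xi> r \<omega>) \<and>
        Y' s \<omega> = y + (LINT r:{t..s}|lborel. - \<rho> r \<omega> * Y' r \<omega> + \<gamma> * \<xi> r \<omega>)"
      using time_integrableD(1)[OF th] eq
    proof eventually_elim
      case (elim \<omega>)
      show ?case
      proof
        fix s assume s: "s \<in> {t..T}"
        have i: "set_integrable lborel {t..s} (\<lambda>r. h r \<omega>)" by (rule set_integrable_subset[OF elim(1)]) (use s in auto)
        have e: "indicat_real {t..s} r *\<^sub>R h r \<omega> = indicat_real {t..s} r *\<^sub>R (- \<rho> r \<omega> * Y' r \<omega> + \<gamma> * \<xi> r \<omega>)" if "r \<notin> {T}" for r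
          using elim(2) that s by (cases "r \<in> {t..s}") (auto simp: h_def Yh_def)
        have 1: "set_integrable lborel {t..s} (\<lambda>r. - \<rho> r \<omega> * Y' r \<omega> + \<gamma> * \<xi> r \<omega>)"
          using i unfolding set_integrable_def
          by (subst (asm) integrable_discrete_difference[where X="{T}", OF _ _ _ e]) auto
        have 2: "(LINT r:{t..s}|lborel. h r \<omega>) = (LINT r:{t..s}|lborel. - \<rho> r \<omega> * Y' r \<omega> + \<gamma> * \<xi> r \<omega>)"
          unfolding set_lebesgue_integral_def
          by (rule integral_discrete_difference[where X="{T}", OF _ _ _ e]) auto
        show "set_integrable lborel {t..s} (\<lambda>r. - \<rho> r \<omega> * Y' r \<omega> + \<gamma> * \<xi> r \<omega>) \<and>
            Y' s \<omega> = y + (LINT r:{t..s}|lborel. - \<rho> r \<omega> * Y' r \<omega> + \<gamma> * \<xi> r \<omega>)"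
          using 1 2 by (simp add: Y'_def)
      qed
    qed
  qed
  from that[OF st' eq] show thesis .
qed

text \<open>The expectation of \<open>V\<close> is bounded along \<open>c n\<close> by the energy identity, and eventually \<open>A \<ge> k\<close>. Hence
  \<open>k * E[(X T)\<^sup>2]\<close> is bounded uniformly in \<open>k\<close>.\<close>

lemma closed_loop_liquidates:
  assumes t: "t \<in> {0..<T}" and \<xi>: "L2_prog M F t T \<xi>"
    and st: "state_process M F \<gamma> \<rho> t T x y \<xi> X Y" and fb: "feedback_from t \<xi> X Y"
  shows "AE \<omega> in M. X T \<omega> = 0"
proof -
  have t0: "0 \<le> t" "t < T" "t \<le> T" using t by auto
  obtain c :: "nat \<Rightarrow> real" where c: "\<And>n. c n \<in> {t..<T}" "c \<longlonglongrightarrow> T"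
    using sequence_from_below[OF t0(2)] by blast
  have c0: "c n \<in> {0..<T}" "t \<le> c n" "c n < T" "c n \<le> T" "c n \<in> {t..T}" for n using c(1)[of n] t0 by auto
  have stn: "state_process M F \<gamma> \<rho> t (c n) x y \<xi> X Y" for n by (rule state_process_restrict[OF st c0(4)])
  have pn: "progressive F t (c n) \<xi>" for n by (rule progressive_subinterval[OF L2_progD(1)[OF order_refl \<xi>]]) (use c0 in auto)
  note ce = closed_loop_energy[OF t0(1) c0(2,3) stn fb pn]
  note rc = running_cost_bound(1)[OF t0(1,3) order_refl st \<xi>]
  let ?D = "dominant t T x y \<xi>"
  note iD = dominant_integrable[OF order_refl \<xi>, of x y]
  obtain K where K: "K \<ge> 1" "AE \<omega> in M. \<forall>s\<in>{0..<T}. \<bar>A s \<omega>\<bar> \<le> K / (T - s) \<and> \<bar>B s \<omega>\<bar> \<le> K \<and> \<bar>C s \<omega>\<bar> \<le> K"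
    using coefficient_bounds by blast
  define C1 where "C1 = expectation (value_form X Y t) + expectation (\<lambda>\<omega>. LINT r:{t..T}|lborel. \<bar>running_cost \<xi> X Y r \<omega>\<bar>)"
  define C2 where "C2 = C1 + 3 * K * expectation ?D"
  have V: "expectation (value_form X Y (c n)) \<le> C1" for n
  proof -
    note rcn = running_cost_bound(1)[OF t0(1) c0(2,4) stn ce(1)]
    have "expectation (\<lambda>\<omega>. - (LINT r:{t..c n}|lborel. running_cost \<xi> X Y r \<omega>)) \<le> expectation (\<lambda>\<omega>. LINT r:{t..T}|lborel. \<bar>running_cost \<xi> X Y r \<omega>\<bar>)"
    proof (rule integral_mono_AE)
      show "integrable M (\<lambda>\<omega>. - (LINT r:{t..c n}|lborel. running_cost \<xi> X Y r \<omega>))" using time_integrableD(2)[OF rcn] by simp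
      show "integrable M (\<lambda>\<omega>. LINT r:{t..T}|lborel. \<bar>running_cost \<xi> X Y r \<omega>\<bar>)" by (rule time_integrableD(2)[OF time_integrable_abs[OF rc]])
      show "AE \<omega> in M. - (LINT r:{t..c n}|lborel. running_cost \<xi> X Y r \<omega>) \<le> (LINT r:{t..T}|lborel. \<bar>running_cost \<xi> X Y r \<omega>\<bar>)"
        using time_integrableD(1)[OF rc]
      proof eventually_elim
        case (elim \<omega>)
        have i: "set_integrable lborel {t..c n} (\<lambda>r. running_cost \<xi> X Y r \<omega>)" by (rule set_integrable_subset[OF elim]) (use c0 in auto)
        have "\<bar>LINT r:{t..c n}|lborel. running_cost \<xi> X Y r \<omega>\<bar> \<le> (LINT r:{t..c n}|lborel. \<bar>running_cost \<xi> X Y r \<omega>\<bar>)"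
          using set_integral_norm_bound[OF i] by simp
        also have "\<dots> \<le> (LINT r:{t..T}|lborel. \<bar>running_cost \<xi> X Y r \<omega>\<bar>)"
          by (rule LINT_mono_interval[OF set_integrable_abs[OF elim] c0(5)]) simp
        finally show ?case by linarith
      qed
    qed
    moreover have "expectation (\<lambda>\<omega>. - (LINT r:{t..c n}|lborel. running_cost \<xi> X Y r \<omega>)) = - expectation (\<lambda>\<omega>. LINT r:{t..c n}|lborel. running_cost \<xi> X Y r \<omega>)"
      by simp
    ultimately show ?thesis using ce(2)[of n] unfolding C1_def by linarith
  qed
  note dom = state_process_dominated[OF t0(1,3) order_refl st \<xi>]
  have pX: "progressive F t T X" using st by (auto simp: state_process_def position_process_def)
  have mX: "X s \<in> borel_measurable M" if "s \<in> {t..T}" for s by (rule progressive_time_M[OF pX that order_refl])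
  have iX2: "integrable M (\<lambda>\<omega>. (X s \<omega>)\<^sup>2)" if s: "s \<in> {t..T}" for s
  proof (rule Bochner_Integration.integrable_bound[OF iD])
    show "(\<lambda>\<omega>. (X s \<omega>)\<^sup>2) \<in> borel_measurable M" using mX[OF s] by simp
    show "AE \<omega> in M. norm ((X s \<omega>)\<^sup>2) \<le> norm (?D \<omega>)" using dom
    proof eventually_elim
      case (elim \<omega>)
      then have "(X s \<omega>)\<^sup>2 \<le> ?D \<omega>" using s by blast
      then show ?case by simp
    qed
  qed
  have lim: "(\<lambda>n. expectation (\<lambda>\<omega>. (X (c n) \<omega>)\<^sup>2)) \<longlonglongrightarrow> expectation (\<lambda>\<omega>. (X T \<omega>)\<^sup>2)"
  proof (rule integral_dominated_convergence[OF _ _ iD])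
    show "(\<lambda>\<omega>. (X T \<omega>)\<^sup>2) \<in> borel_measurable M" using iX2[of T] t0 by auto
    show "(\<lambda>\<omega>. (X (c n) \<omega>)\<^sup>2) \<in> borel_measurable M" for n using iX2[OF c0(5)] by blast
    show "AE \<omega> in M. norm ((X (c n) \<omega>)\<^sup>2) \<le> ?D \<omega>" for n using dom by eventually_elim (use c0(5) in auto)
    have X: "AE \<omega> in M. \<forall>s\<in>{t..T}. set_integrable lborel {t..s} (\<lambda>r. \<xi> r \<omega>) \<and> X s \<omega> = x - (LINT r:{t..s}|lborel. \<xi> r \<omega>)"
      using st unfolding state_process_def position_process_def by auto
    show "AE \<omega> in M. (\<lambda>n. (X (c n) \<omega>)\<^sup>2) \<longlonglongrightarrow> (X T \<omega>)\<^sup>2"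
      using X
    proof eventually_elim
      case (elim \<omega>)
      have "T \<in> {t..T}" using t0 by simp
      then have i: "set_integrable lborel {t..T} (\<lambda>r. \<xi> r \<omega>)" using elim by blast
      have "continuous_on {t..T} (\<lambda>s. x - (LINT r:{t..s}|lborel. \<xi> r \<omega>))"
        by (intro continuous_intros continuous_on_indefinite_LINT i)
      then have "continuous_on {t..T} (\<lambda>s. X s \<omega>)" by (rule continuous_on_eq) (use elim in auto)
      then have "(\<lambda>n. X (c n) \<omega>) \<longlonglongrightarrow> X T \<omega>"
        by (rule continuous_on_tendsto_compose[OF _ c(2)]) (use t0 c0(5) in auto)
      then show ?case by (intro tendsto_intros)
    qed
  qed
  have small: "1/2 * k * expectation (\<lambda>\<omega>. (X T \<omega>)\<^sup>2) \<le> C2" if k: "k > 0" for k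
  proof -
    obtain b where b: "b \<in> {0..<T}" "AE \<omega> in M. \<forall>s\<in>{b..<T}. k \<le> A s \<omega>"
      using terminal k unfolding singular_terminal_condition_def by meson
    obtain N where N: "\<And>n. n \<ge> N \<Longrightarrow> b < c n"
      using order_tendstoD(1)[OF c(2), of b] b(1) by (auto simp: eventually_sequentially)
    have "1/2 * k * expectation (\<lambda>\<omega>. (X (c n) \<omega>)\<^sup>2) \<le> C2" if n: "n \<ge> N" for n
    proof -
      have iV: "integrable M (value_form X Y (c n))" by (rule energy_identity(3)[OF t0(1) c0(2,3) stn ce(1)])
      have "expectation (\<lambda>\<omega>. 1/2 * k * (X (c n) \<omega>)\<^sup>2) \<le> expectation (\<lambda>\<omega>. value_form X Y (c n) \<omega> + 3 * K * ?D \<omega>)"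
      proof (rule integral_mono_AE)
        show "integrable M (\<lambda>\<omega>. 1/2 * k * (X (c n) \<omega>)\<^sup>2)" using iX2[OF c0(5)] by simp
        show "integrable M (\<lambda>\<omega>. value_form X Y (c n) \<omega> + 3 * K * ?D \<omega>)" using iV iD by simp
        show "AE \<omega> in M. 1/2 * k * (X (c n) \<omega>)\<^sup>2 \<le> value_form X Y (c n) \<omega> + 3 * K * ?D \<omega>"
          using b(2) K(2) dom
        proof eventually_elim
          case (elim \<omega>)
          have d: "(X (c n) \<omega>)\<^sup>2 \<le> ?D \<omega>" "(Y (c n) \<omega>)\<^sup>2 \<le> ?D \<omega>" using elim(3) c0(5)[of n] by auto
          have D0: "0 \<le> ?D \<omega>" using d(1) zero_le_power2[of "X (c n) \<omega>"] by linarith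
          have bc: "\<bar>B (c n) \<omega>\<bar> \<le> K" "\<bar>C (c n) \<omega>\<bar> \<le> K" using elim(2) c0(1) by blast+
          have a: "k \<le> A (c n) \<omega>" using elim(1) N[OF n] c0(3)[of n] by auto
          have 1: "1/2 * k * (X (c n) \<omega>)\<^sup>2 \<le> 1/2 * A (c n) \<omega> * (X (c n) \<omega>)\<^sup>2" using a by (intro mult_right_mono) auto
          have "\<bar>X (c n) \<omega> * Y (c n) \<omega>\<bar> \<le> 2 * ?D \<omega>" using abs_mult_le_squares[of "X (c n) \<omega>" "Y (c n) \<omega>"] d by linarith
          then have "\<bar>B (c n) \<omega>\<bar> * \<bar>X (c n) \<omega> * Y (c n) \<omega>\<bar> \<le> K * (2 * ?D \<omega>)" by (rule mult_mono[OF bc(1)]) (use K(1) in auto)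
          then have 2: "\<bar>B (c n) \<omega> * X (c n) \<omega> * Y (c n) \<omega>\<bar> \<le> 2 * (K * ?D \<omega>)" by (simp add: abs_mult mult.assoc)
          have "\<bar>C (c n) \<omega>\<bar> * (Y (c n) \<omega>)\<^sup>2 \<le> K * ?D \<omega>" by (rule mult_mono[OF bc(2) d(2)]) (use K(1) in auto)
          moreover have "\<bar>1/2 * C (c n) \<omega> * (Y (c n) \<omega>)\<^sup>2\<bar> = 1/2 * (\<bar>C (c n) \<omega>\<bar> * (Y (c n) \<omega>)\<^sup>2)" by (simp add: abs_mult)
          moreover have "0 \<le> K * ?D \<omega>" using K(1) D0 by simp
          ultimately have 3: "\<bar>1/2 * C (c n) \<omega> * (Y (c n) \<omega>)\<^sup>2\<bar> \<le> K * ?D \<omega>" by linarith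
          have "3 * K * ?D \<omega> = 2 * (K * ?D \<omega>) + K * ?D \<omega>" by simp
          then show ?case using 1 2 3 unfolding value_form_def by linarith
        qed
      qed
      then show ?thesis using V[of n] iV iD by (simp add: C2_def)
    qed
    then show ?thesis
      by (intro LIMSEQ_le_const2[OF tendsto_mult[OF tendsto_const lim]]) blast
  qed
  have "expectation (\<lambda>\<omega>. (X T \<omega>)\<^sup>2) \<le> 0"
  proof (rule ccontr)
    assume "\<not> ?thesis"
    then have e: "expectation (\<lambda>\<omega>. (X T \<omega>)\<^sup>2) > 0" by simp
    \<comment> \<open>This \<open>k\<close> makes the left side equal to \<open>\<bar>C2\<bar> + 1\<close>.\<close>
    have "1/2 * ((2 * \<bar>C2\<bar> + 2) / expectation (\<lambda>\<omega>. (X T \<omega>)\<^sup>2)) * expectation (\<lambda>\<omega>. (X T \<omega>)\<^sup>2) \<le> C2"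
      by (rule small) (use e in auto)
    then have "\<bar>C2\<bar> + 1 \<le> C2" using e by simp
    then show False by linarith
  qed
  moreover have "0 \<le> expectation (\<lambda>\<omega>. (X T \<omega>)\<^sup>2)" by (rule Bochner_Integration.integral_nonneg) simp
  ultimately have "expectation (\<lambda>\<omega>. (X T \<omega>)\<^sup>2) = 0" by simp
  then have "AE \<omega> in M. (X T \<omega>)\<^sup>2 = 0"
    using integral_nonneg_eq_0_iff_AE[of M "\<lambda>\<omega>. (X T \<omega>)\<^sup>2"] iX2[of T] t0 by auto
  then show ?thesis by eventually_elim simp
qed

text \<open>The excess vanishes, so that the lower bound for the cost is an equality over every event of \<open>F t\<close>.\<close>

lemma closed_loop_attains:
  assumes t: "t \<in> {0..<T}" and cl: "closed_loop M F T \<eta> \<gamma> \<rho> A B C t x y \<xi> X Y"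
  shows "admissible M F T t x \<xi>"
    and "\<exists>X Y. state_process M F \<gamma> \<rho> t T x y \<xi> X Y \<and>
      (AE \<omega> in M. conditional_cost M F T \<eta> lam t \<xi> X Y \<omega> = initial_value t x y \<omega>)"
proof -
  have tT: "t \<le> T" using t by simp
  have p: "progressive F t T \<xi>" and st: "\<And>b. b \<in> {t..<T} \<Longrightarrow> state_process M F \<gamma> \<rho> t b x y \<xi> X Y" and fb: "feedback_from t \<xi> X Y"
    using cl unfolding closed_loop_def feedback_from_def by blast+
  have \<xi>: "L2_prog M F t T \<xi>" by (rule closed_loop_square_integrable[OF t p st fb])
  obtain X' Y' where st': "state_process M F \<gamma> \<rho> t T x y \<xi> X' Y'"
    and eq: "AE \<omega> in M. \<forall>s\<in>{t..<T}. X' s \<omega> = X s \<omega> \<and> Y' s \<omega> = Y s \<omega>"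
    using state_process_extend[OF t \<xi> st] by blast
  have fb': "feedback_from t \<xi> X' Y'"
    unfolding feedback_from_def using fb[unfolded feedback_from_def] eq
  proof eventually_elim
    case (elim \<omega>)
    show ?case
    proof
      fix s assume "s \<in> {t..<T}"
      then have "\<xi> s \<omega> = feedback \<eta> \<gamma> A B C s \<omega> (X s \<omega>) (Y s \<omega>)" "X' s \<omega> = X s \<omega>" "Y' s \<omega> = Y s \<omega>" using elim by blast+
      then show "\<xi> s \<omega> = feedback \<eta> \<gamma> A B C s \<omega> (X' s \<omega>) (Y' s \<omega>)" by simp
    qed
  qed
  have "AE \<omega> in M. X' T \<omega> = 0" by (rule closed_loop_liquidates[OF t \<xi> st' fb'])
  then show adm: "admissible M F T t x \<xi>"
    unfolding admissible_def using \<xi> st' unfolding state_process_def by blast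
  note v = verification[OF t adm st']
  let ?J = "\<lambda>\<omega>. LINT r:{t..T}|lborel. running_cost \<xi> X' Y' r \<omega>"
  have ex: "AE \<omega> in M. \<forall>r\<in>{t..<T}. excess \<xi> X' Y' r \<omega> = 0"
    using fb'[unfolded feedback_from_def] by eventually_elim (simp add: excess_def)
  interpret ce: sigma_finite_subalgebra M "F t" by (rule cond_exp_F[OF tT])
  have "AE \<omega> in M. real_cond_exp M (F t) ?J \<omega> = initial_value t x y \<omega>"
  proof (rule ce.real_cond_exp_charact)
    show "(\<integral>\<omega>\<in>H. ?J \<omega> \<partial>M) = (\<integral>\<omega>\<in>H. initial_value t x y \<omega> \<partial>M)" if H: "H \<in> sets (F t)" for H
      using v(3)[OF H ex] expectation_initial[OF t st' H] by (simp add: set_lebesgue_integral_def)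
  qed (use v(1) initial_value_facts[OF t] in auto)
  with st' show "\<exists>X Y. state_process M F \<gamma> \<rho> t T x y \<xi> X Y \<and>
      (AE \<omega> in M. conditional_cost M F T \<eta> lam t \<xi> X Y \<omega> = initial_value t x y \<omega>)"
    unfolding conditional_cost_eq by blast
qed

text \<open>A lower bound that is attained is an essential infimum, and \<open>ess_inf\<close> agrees with it almost surely.\<close>

lemma value_function_of_closed_loop:
  assumes t: "t \<in> {0..<T}" and cl: "closed_loop M F T \<eta> \<gamma> \<rho> A B C t x y \<xi> X Y"
  shows "AE \<omega> in M. value_function M F T \<eta> \<gamma> \<rho> lam t x y \<omega> = ereal (initial_value t x y \<omega>)"
    and "optimal_control M F T \<eta> \<gamma> \<rho> lam t x y \<xi>"
proof -
  let ?S = "{(\<lambda>\<omega>. ereal (conditional_cost M F T \<eta> lam t \<xi> X Y \<omega>)) | \<xi> X Y.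
       admissible M F T t x \<xi> \<and> state_process M F \<gamma> \<rho> t T x y \<xi> X Y}"
  obtain X' Y' where st': "state_process M F \<gamma> \<rho> t T x y \<xi> X' Y'"
    and c: "AE \<omega> in M. conditional_cost M F T \<eta> lam t \<xi> X' Y' \<omega> = initial_value t x y \<omega>"
    using closed_loop_attains(2)[OF t cl] by blast
  note adm = closed_loop_attains(1)[OF t cl]
  have "is_ess_inf M ?S (\<lambda>\<omega>. ereal (initial_value t x y \<omega>))"
    unfolding is_ess_inf_def
  proof (intro conjI ballI impI)
    show "(\<lambda>\<omega>. ereal (initial_value t x y \<omega>)) \<in> borel_measurable M"
      using initial_value_facts(2)[OF t] by (intro borel_measurable_ereal) auto
    show "AE \<omega> in M. ereal (initial_value t x y \<omega>) \<le> f \<omega>" if "f \<in> ?S" for f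
    proof -
      obtain \<xi>1 X1 Y1 where f: "f = (\<lambda>\<omega>. ereal (conditional_cost M F T \<eta> lam t \<xi>1 X1 Y1 \<omega>))"
        and 1: "admissible M F T t x \<xi>1" "state_process M F \<gamma> \<rho> t T x y \<xi>1 X1 Y1"
        using \<open>f \<in> ?S\<close> by blast
      show ?thesis using conditional_cost_lower_bound[OF t 1] by eventually_elim (simp add: f)
    qed
    fix w assume w: "\<forall>f\<in>?S. AE \<omega> in M. w \<omega> \<le> f \<omega>"
    have "(\<lambda>\<omega>. ereal (conditional_cost M F T \<eta> lam t \<xi> X' Y' \<omega>)) \<in> ?S" using adm st' by blast
    with w have "AE \<omega> in M. w \<omega> \<le> ereal (conditional_cost M F T \<eta> lam t \<xi> X' Y' \<omega>)" by (rule bspec)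
    with c show "AE \<omega> in M. w \<omega> \<le> ereal (initial_value t x y \<omega>)" by eventually_elim simp
  qed
  then show vf: "AE \<omega> in M. value_function M F T \<eta> \<gamma> \<rho> lam t x y \<omega> = ereal (initial_value t x y \<omega>)"
    unfolding value_function_def by (rule ess_inf_AE_eq)
  have "AE \<omega> in M. ereal (conditional_cost M F T \<eta> lam t \<xi> X' Y' \<omega>) = value_function M F T \<eta> \<gamma> \<rho> lam t x y \<omega>"
    using vf c by eventually_elim simp
  then show "optimal_control M F T \<eta> \<gamma> \<rho> lam t x y \<xi>"
    unfolding optimal_control_def using adm st' by blast
qed

end

section \<open>Existence of the closed loop\<close>

definition clip :: "real \<Rightarrow> real \<Rightarrow> real" where
  "clip k z = max (- k) (min k z)"

lemma clip_bound: "0 \<le> k \<Longrightarrow> \<bar>clip k z\<bar> \<le> k"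
  by (auto simp: clip_def)

lemma clip_eq: "\<bar>z\<bar> \<le> k \<Longrightarrow> clip k z = z"
  by (auto simp: clip_def)

lemma clip_measurable: "(\<lambda>(k, z). clip k z) \<in> borel_measurable borel"
proof -
  have "(\<lambda>p :: real \<times> real. max (- fst p) (min (fst p) (snd p))) \<in> borel_measurable borel"
    by (intro borel_measurable_continuous_onI continuous_intros)
  then show ?thesis by (simp add: clip_def split_beta')
qed

context riccati_solution
begin

text \<open>The closed loop is a linear equation \<open>dU = G U ds\<close> for \<open>U = (X, Y)\<close>. Its coefficients are clipped at
  their almost sure bounds, which changes nothing almost surely but makes the bounds valid for every
  \<open>\<omega>\<close>. Picard iteration then converges everywhere, and its limit is progressively measurable.\<close>

theorem closed_loop_exists:
  assumes t: "t \<in> {0..<T}"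
  shows "\<exists>\<xi> X Y. closed_loop M F T \<eta> \<gamma> \<rho> A B C t x y \<xi> X Y"
proof -
  have t0: "0 \<le> t" "t < T" using t by auto
  obtain K where K: "K \<ge> 1" "AE \<omega> in M. \<forall>s\<in>{0..<T}. \<bar>A s \<omega>\<bar> \<le> K / (T - s) \<and> \<bar>B s \<omega>\<bar> \<le> K \<and> \<bar>C s \<omega>\<bar> \<le> K"
    using coefficient_bounds by blast
  define a where "a s \<omega> = (if s < T then clip (K / (T - s)) (A s \<omega>) else 0)" for s \<omega>
  define b where "b s \<omega> = (if s < T then clip K (B s \<omega>) else 0)" for s \<omega>
  define c where "c s \<omega> = (if s < T then clip K (C s \<omega>) else 0)" for s \<omega>
  define r where "r s \<omega> = clip rho_max (\<rho> s \<omega>)" for s \<omega>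
  have pabc: "progressive F t T a" "progressive F t T b" "progressive F t T c"
    unfolding a_def[abs_def] b_def[abs_def] c_def[abs_def]
  proof (safe intro!: progressive_before_terminal)
    fix b' assume b': "b' \<in> {t..<T}"
    then have bT: "b' < T" by simp
    note pc = coefficients_progressive[OF t0(1) bT]
    have d: "(\<lambda>s. K / (T - s)) \<in> borel_measurable borel" by simp
    show "progressive F t b' (\<lambda>s \<omega>. clip (K / (T - s)) (A s \<omega>))"
      by (rule progressive_compose2[OF progressive_deterministic[OF d] pc(1) clip_measurable])
    show "progressive F t b' (\<lambda>s \<omega>. clip K (B s \<omega>))" "progressive F t b' (\<lambda>s \<omega>. clip K (C s \<omega>))"
      by (rule progressive_compose2[OF progressive_const pc(2) clip_measurable], rule progressive_compose2[OF progressive_const pc(3) clip_measurable])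
  qed
  have pr: "progressive F t T r" unfolding r_def[abs_def]
    by (rule progressive_compose2[OF progressive_const rho_progressive[OF t0(1) order_refl] clip_measurable])
  let ?f = "feedback \<eta> \<gamma> a b c"
  define G where "G s \<omega> p = (- ?f s \<omega> (fst p) (snd p), - r s \<omega> * snd p + \<gamma> * ?f s \<omega> (fst p) (snd p))" for s \<omega> p
  have pf: "progressive F t q (\<lambda>s \<omega>. ?f s \<omega> (u s \<omega>) (v s \<omega>))"
    if "progressive F t q u" "progressive F t q v" "q \<le> T" for q u v
    unfolding feedback_def
    by (intro progressive_intros that(1,2) progressive_subinterval[OF pabc(1) order_refl that(3)]
      progressive_subinterval[OF pabc(2) order_refl that(3)] progressive_subinterval[OF pabc(3) order_refl that(3)])
  have pG: "progressive F t T (\<lambda>s \<omega>. G s \<omega> (u s \<omega>))" if u: "progressive F t T u" for u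
  proof -
    have "progressive F t T (\<lambda>s \<omega>. fst (u s \<omega>))" "progressive F t T (\<lambda>s \<omega>. snd (u s \<omega>))"
      using progressive_compose[OF u, of fst] progressive_compose[OF u, of snd]
      by (simp_all add: borel_measurable_continuous_onI continuous_intros)
    note uv = this and fuv = pf[OF this order_refl]
    show ?thesis unfolding G_def
      by (rule progressive_compose2[where h=Pair, OF progressive_uminus[OF fuv] progressive_add[OF progressive_mult[OF progressive_uminus[OF pr] uv(2)]
            progressive_mult[OF progressive_const fuv]]]) simp
  qed
  define pic where "pic n s \<omega> = picard t (x, y) (\<lambda>s. G s \<omega>) n s" for n s \<omega>
  have ppic: "progressive F t T (pic n)" for n
  proof (induction n)
    case 0
    then show ?case by (simp add: pic_def[abs_def] progressive_const)
  next
    case (Suc n)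
    have "pic (Suc n) = (\<lambda>s \<omega>. (x, y) + (LINT r:{t..s}|lborel. G r \<omega> (pic n r \<omega>)))"
      by (simp add: pic_def[abs_def])
    then show ?case using progressive_add[OF progressive_const progressive_integral[OF pG[OF Suc]]] by simp
  qed
  define U where "U s \<omega> = lim (\<lambda>n. pic n s \<omega>)" for s \<omega>
  have solves: "(\<lambda>n. pic n s \<omega>) \<longlonglongrightarrow> U s \<omega>" "set_integrable lborel {t..s} (\<lambda>q. G q \<omega> (U q \<omega>))"
      "U s \<omega> = (x, y) + (LINT q:{t..s}|lborel. G q \<omega> (U q \<omega>))"
    if \<omega>: "\<omega> \<in> space M" and s: "s \<in> {t..<T}" for s \<omega>
  proof -
    \<comment> \<open>On \<open>{t..s}\<close> all clipped coefficients are bounded by \<open>K'\<close>, since \<open>K / (T - q)\<close> is increasing in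
      \<open>q\<close>.\<close>
    define K' where "K' = K / (T - s) + K"
    have Ks: "0 \<le> K / (T - s)" using K(1) s by simp
    then have K'0: "0 \<le> K'" using K(1) by (simp add: K'_def)
    define m where "m = inverse \<eta> * (1 + 2 * K' + 2 * \<gamma> * K')"
    have m0: "0 \<le> m" using K'0 eta gamma by (auto simp: m_def intro!: mult_nonneg_nonneg add_nonneg_nonneg)
    define k where "k = (m + (rho_max + \<gamma> * m)) * 2 + 1"
    have k: "k > 0" using m0 gamma rho_max(1) by (auto simp: k_def intro!: add_nonneg_pos add_nonneg_nonneg)
    have lin: "G q \<omega> u - G q \<omega> v = G q \<omega> (u - v)" for q u v by (simp add: G_def feedback_def algebra_simps)
    have growth: "norm (G q \<omega> u) \<le> k * norm u" if q: "q \<in> {t..s}" for q u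
    proof -
      have "K / (T - q) \<le> K / (T - s)" using K(1) q s by (intro divide_left_mono) auto
      moreover have "0 \<le> K / (T - q)" using K(1) q s by auto
      ultimately have "\<bar>a q \<omega>\<bar> \<le> K'" "\<bar>b q \<omega>\<bar> \<le> K'" "\<bar>c q \<omega>\<bar> \<le> K'"
        using clip_bound[of "K / (T - q)" "A q \<omega>"] clip_bound[of K "B q \<omega>"] clip_bound[of K "C q \<omega>"] K(1) K'0 Ks
        by (auto simp: a_def b_def c_def K'_def)
      then have f: "\<bar>?f q \<omega> (fst u) (snd u)\<bar> \<le> m * (\<bar>fst u\<bar> + \<bar>snd u\<bar>)" unfolding m_def by (rule feedback_linear_growth)
      have "norm (G q \<omega> u) \<le> \<bar>?f q \<omega> (fst u) (snd u)\<bar> + \<bar>- r q \<omega> * snd u + \<gamma> * ?f q \<omega> (fst u) (snd u)\<bar>"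
        unfolding G_def using norm_Pair_le[of "- ?f q \<omega> (fst u) (snd u)" "- r q \<omega> * snd u + \<gamma> * ?f q \<omega> (fst u) (snd u)"] by simp
      also have "\<dots> \<le> \<bar>?f q \<omega> (fst u) (snd u)\<bar> + (\<bar>r q \<omega>\<bar> * \<bar>snd u\<bar> + \<gamma> * \<bar>?f q \<omega> (fst u) (snd u)\<bar>)"
        using abs_triangle_ineq[of "- r q \<omega> * snd u" "\<gamma> * ?f q \<omega> (fst u) (snd u)"] gamma by (simp add: abs_mult)
      also have "\<dots> \<le> m * (\<bar>fst u\<bar> + \<bar>snd u\<bar>) + (rho_max * (\<bar>fst u\<bar> + \<bar>snd u\<bar>) + \<gamma> * (m * (\<bar>fst u\<bar> + \<bar>snd u\<bar>)))"
        unfolding r_def using rho_max(1) gamma by (intro add_mono f mult_mono mult_left_mono clip_bound) auto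
      also have "\<dots> = (m + (rho_max + \<gamma> * m)) * (\<bar>fst u\<bar> + \<bar>snd u\<bar>)" by (simp only: distrib_right mult.assoc)
      also have "\<dots> \<le> (m + (rho_max + \<gamma> * m)) * (2 * norm u)"
        using norm_fst_le[of "fst u" "snd u"] norm_snd_le[of "snd u" "fst u"] m0 gamma rho_max(1) by (intro mult_left_mono) auto
      also have "\<dots> \<le> k * norm u" unfolding k_def by (simp add: distrib_right)
      finally show ?thesis .
    qed
    have meas: "set_borel_measurable lborel {t..s} (\<lambda>q. G q \<omega> (picard t (x, y) (\<lambda>s. G s \<omega>) n q))" for n
      using set_borel_measurable_subset[OF progressive_section_measurable[OF pG[OF ppic[of n]] order_refl \<omega>], of "{t..s}"] s
      by (simp add: pic_def)
    have G0: "G q \<omega> 0 = 0" for q by (simp add: G_def feedback_def zero_prod_def)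
    have ss: "s \<in> {t..s}" using s by simp
    note sol = picard_solves[where g="\<lambda>s. G s \<omega>", OF k _ G0 meas ss, folded pic_def U_def]
    show "(\<lambda>n. pic n s \<omega>) \<longlonglongrightarrow> U s \<omega>" "set_integrable lborel {t..s} (\<lambda>q. G q \<omega> (U q \<omega>))"
      "U s \<omega> = (x, y) + (LINT q:{t..s}|lborel. G q \<omega> (U q \<omega>))"
      using sol growth lin by auto
  qed
  have pU: "progressive F t q U" if q: "q < T" for q
    unfolding progressive_def
  proof
    fix u assume u: "u \<in> {t..q}"
    show "(\<lambda>(s, \<omega>). U s \<omega>) \<in> borel_measurable (restrict_space borel {t..u} \<Otimes>\<^sub>M F u)"
    proof (rule borel_measurable_LIMSEQ_metric)
      fix n show "(\<lambda>(s, \<omega>). pic n s \<omega>) \<in> borel_measurable (restrict_space borel {t..u} \<Otimes>\<^sub>M F u)"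
        using ppic[of n] u q unfolding progressive_def by auto
    next
      fix p assume "p \<in> space (restrict_space borel {t..u} \<Otimes>\<^sub>M F u)"
      then show "(\<lambda>n. case p of (s, \<omega>) \<Rightarrow> pic n s \<omega>) \<longlonglongrightarrow> (case p of (s, \<omega>) \<Rightarrow> U s \<omega>)"
        using solves(1) u q by (auto simp: space_pair_measure space_restrict_space)
    qed
  qed
  define X where "X s \<omega> = fst (U s \<omega>)" for s \<omega>
  define Y where "Y s \<omega> = snd (U s \<omega>)" for s \<omega>
  define \<xi> where "\<xi> s \<omega> = (if s < T then ?f s \<omega> (X s \<omega>) (Y s \<omega>) else 0)" for s \<omega>
  have pXY: "progressive F t q X" "progressive F t q Y" if "q < T" for q
    unfolding X_def[abs_def] Y_def[abs_def]
    using progressive_compose[OF pU[OF that], of fst] progressive_compose[OF pU[OF that], of snd]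
    by (simp_all add: borel_measurable_continuous_onI continuous_intros)
  have p\<xi>: "progressive F t T \<xi>" unfolding \<xi>_def[abs_def]
    by (rule progressive_before_terminal, rule pf) (auto intro: pXY)
  have state: "state_process M F \<gamma> \<rho> t q x y \<xi> X Y" if q: "q \<in> {t..<T}" for q
  proof -
    have qT: "q < T" "q \<le> T" using q by auto
    have int: "set_integrable lborel {t..s} (\<lambda>u. \<xi> u \<omega>)" "X s \<omega> = x - (LINT u:{t..s}|lborel. \<xi> u \<omega>)"
      "set_integrable lborel {t..s} (\<lambda>u. - r u \<omega> * Y u \<omega> + \<gamma> * \<xi> u \<omega>)" "Y s \<omega> = y + (LINT u:{t..s}|lborel. - r u \<omega> * Y u \<omega> + \<gamma> * \<xi> u \<omega>)"
      if \<omega>: "\<omega> \<in> space M" and s: "s \<in> {t..q}" for s \<omega>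
    proof -
      have sT: "s \<in> {t..<T}" using s qT by auto
      note sol = solves[OF \<omega> sT]
      have e: "fst (G u \<omega> (U u \<omega>)) = - \<xi> u \<omega>" "snd (G u \<omega> (U u \<omega>)) = - r u \<omega> * Y u \<omega> + \<gamma> * \<xi> u \<omega>" if "u \<in> {t..s}" for u
        using that sT by (simp_all add: G_def \<xi>_def X_def Y_def)
      note 1 = LINT_bounded_linear[OF bounded_linear_fst sol(2)] and 2 = LINT_bounded_linear[OF bounded_linear_snd sol(2)]
      have i1: "set_integrable lborel {t..s} (\<lambda>u. - \<xi> u \<omega>)"
        using 1(1) e(1) by (subst set_integrable_cong[OF refl refl, of "{t..s}" _ "\<lambda>u. fst (G u \<omega> (U u \<omega>))"]) auto
      then have "set_integrable lborel {t..s} (\<lambda>u. (-1) * (- \<xi> u \<omega>))" by (intro set_integrable_mult_right) auto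
      then show i\<xi>: "set_integrable lborel {t..s} (\<lambda>u. \<xi> u \<omega>)" by simp
      have "(LINT u:{t..s}|lborel. fst (G u \<omega> (U u \<omega>))) = (LINT u:{t..s}|lborel. - \<xi> u \<omega>)"
        by (rule set_lebesgue_integral_cong) (use e(1) in auto)
      also have "\<dots> = - (LINT u:{t..s}|lborel. \<xi> u \<omega>)" by (rule set_integral_uminus[OF i\<xi>])
      finally show "X s \<omega> = x - (LINT u:{t..s}|lborel. \<xi> u \<omega>)"
        using arg_cong[OF sol(3), of fst] 1(2) by (simp add: X_def)
      show "set_integrable lborel {t..s} (\<lambda>u. - r u \<omega> * Y u \<omega> + \<gamma> * \<xi> u \<omega>)"
        using 2(1) e(2) by (subst set_integrable_cong[OF refl refl, of "{t..s}" _ "\<lambda>u. snd (G u \<omega> (U u \<omega>))"]) auto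
      have "(LINT u:{t..s}|lborel. snd (G u \<omega> (U u \<omega>))) = (LINT u:{t..s}|lborel. - r u \<omega> * Y u \<omega> + \<gamma> * \<xi> u \<omega>)"
        by (rule set_lebesgue_integral_cong) (use e(2) in auto)
      then show "Y s \<omega> = y + (LINT u:{t..s}|lborel. - r u \<omega> * Y u \<omega> + \<gamma> * \<xi> u \<omega>)"
        using arg_cong[OF sol(3), of snd] 2(2) by (simp add: Y_def)
    qed
    have p\<xi>q: "progressive F t q \<xi>" by (rule progressive_subinterval[OF p\<xi> order_refl qT(2)])
    have p1: "progressive F t q (\<lambda>u \<omega>. - \<rho> u \<omega> * Y u \<omega> + \<gamma> * \<xi> u \<omega>)"
      by (intro progressive_intros pXY qT p\<xi>q rho_progressive t0(1))
    show ?thesis unfolding state_process_def position_process_def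
    proof (intro conjI pXY qT(1))
      show "AE \<omega> in M. \<forall>s\<in>{t..q}. set_integrable lborel {t..s} (\<lambda>r. \<xi> r \<omega>) \<and> X s \<omega> = x - (LINT r:{t..s}|lborel. \<xi> r \<omega>)"
        using int(1,2) by (intro AE_I2) blast
      show "AE \<omega> in M. \<forall>s\<in>{t..q}. set_integrable lborel {t..s} (\<lambda>r. - \<rho> r \<omega> * Y r \<omega> + \<gamma> * \<xi> r \<omega>) \<and>
          Y s \<omega> = y + (LINT r:{t..s}|lborel. - \<rho> r \<omega> * Y r \<omega> + \<gamma> * \<xi> r \<omega>)"
        using AE_swap_time[OF rho_max(2)] AE_space
      proof eventually_elim
        case (elim \<omega>)
        show ?case
        proof
          fix s assume s: "s \<in> {t..q}"
          note I = int(3,4)[OF elim(2) s]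
          have m1: "(\<lambda>u. indicat_real {t..s} u *\<^sub>R (- \<rho> u \<omega> * Y u \<omega> + \<gamma> * \<xi> u \<omega>)) \<in> borel_measurable lborel"
            using set_borel_measurable_subset[OF progressive_section_measurable[OF p1 qT(2) elim(2)], of "{t..s}"] s
            by (simp add: set_borel_measurable_def)
          have m2: "(\<lambda>u. indicat_real {t..s} u *\<^sub>R (- r u \<omega> * Y u \<omega> + \<gamma> * \<xi> u \<omega>)) \<in> borel_measurable lborel"
            using I(1) unfolding set_integrable_def by blast
          have ae: "AE u in lborel. indicat_real {t..s} u *\<^sub>R (- \<rho> u \<omega> * Y u \<omega> + \<gamma> * \<xi> u \<omega>)
              = indicat_real {t..s} u *\<^sub>R (- r u \<omega> * Y u \<omega> + \<gamma> * \<xi> u \<omega>)"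
            using elim(1)
          proof eventually_elim
            case (elim u)
            show ?case
            proof (cases "u \<in> {t..s}")
              case True
              then have "u \<in> {0..T}" using s qT t0 by auto
              then have "r u \<omega> = \<rho> u \<omega>" using elim by (simp add: r_def clip_eq)
              then show ?thesis by simp
            qed simp
          qed
          show "set_integrable lborel {t..s} (\<lambda>r. - \<rho> r \<omega> * Y r \<omega> + \<gamma> * \<xi> r \<omega>) \<and>
              Y s \<omega> = y + (LINT r:{t..s}|lborel. - \<rho> r \<omega> * Y r \<omega> + \<gamma> * \<xi> r \<omega>)"
            using I Bochner_Integration.integrable_cong_AE[OF m1 m2 ae] integral_cong_AE[OF m1 m2 ae]
            unfolding set_integrable_def set_lebesgue_integral_def by simp
        qed
      qed
    qed
  qed
  have "AE \<omega> in M. \<forall>s\<in>{t..<T}. \<xi> s \<omega> = feedback \<eta> \<gamma> A B C s \<omega> (X s \<omega>) (Y s \<omega>)"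
    using K(2)
  proof eventually_elim
    case (elim \<omega>)
    show ?case
    proof
      fix s assume s: "s \<in> {t..<T}"
      then have "s \<in> {0..<T}" using t0 by auto
      then have "\<bar>A s \<omega>\<bar> \<le> K / (T - s)" "\<bar>B s \<omega>\<bar> \<le> K" "\<bar>C s \<omega>\<bar> \<le> K" using elim by blast+
      then have "a s \<omega> = A s \<omega>" "b s \<omega> = B s \<omega>" "c s \<omega> = C s \<omega>" using s by (simp_all add: a_def b_def c_def clip_eq)
      then show "\<xi> s \<omega> = feedback \<eta> \<gamma> A B C s \<omega> (X s \<omega>) (Y s \<omega>)" using s by (simp add: \<xi>_def feedback_def)
    qed
  qed
  then have "closed_loop M F T \<eta> \<gamma> \<rho> A B C t x y \<xi> X Y"
    unfolding closed_loop_def using p\<xi> state by blast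
  then show ?thesis by blast
qed

section \<open>Uniqueness and the main result\<close>

lemma ito_integral_of_increment:
  assumes b: "b \<in> {0..<T}"
  shows ito_A: "has_ito_integral M F W 0 b ZA (\<lambda>\<omega>. A b \<omega> - A 0 \<omega> + (LINT r:{0..b}|lborel. drift_A r \<omega>))"
    and ito_B: "has_ito_integral M F W 0 b ZB (\<lambda>\<omega>. B b \<omega> - B 0 \<omega> + (LINT r:{0..b}|lborel. drift_B r \<omega>))"
    and ito_C: "has_ito_integral M F W 0 b ZC (\<lambda>\<omega>. C b \<omega> - C 0 \<omega> + (LINT r:{0..b}|lborel. drift_C r \<omega>))"
  using solution b
  unfolding bsde_solution_def bsde_between_def drift_A_def drift_B_def drift_C_def by auto

text \<open>Both solutions describe the same value function, so the quadratic forms agree at each fixed time,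
  and by continuity at all times. Then the Ito integrals of the two integrands agree, too.\<close>

theorem riccati_solution_unique:
  assumes other: "riccati_solution M F W T \<eta> \<gamma> \<rho> lam A' B' C' ZA' ZB' ZC'"
  shows "AE \<omega> in M. \<forall>t\<in>{0..<T}. A' t \<omega> = A t \<omega> \<and> B' t \<omega> = B t \<omega> \<and> C' t \<omega> = C t \<omega>"
    and "AE (t, \<omega>) in lborel \<Otimes>\<^sub>M M. t \<in> {0..<T} \<longrightarrow> ZA' t \<omega> = ZA t \<omega> \<and> ZB' t \<omega> = ZB t \<omega> \<and> ZC' t \<omega> = ZC t \<omega>"
proof -
  interpret R': riccati_solution M F W T \<eta> \<gamma> \<rho> lam A' B' C' ZA' ZB' ZC' by (rule other)
  have same_value: "AE \<omega> in M. R'.initial_value t x y \<omega> = initial_value t x y \<omega>" if t: "t \<in> {0..<T}" for t x y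
  proof -
    obtain \<xi> X Y \<xi>' X' Y' where "closed_loop M F T \<eta> \<gamma> \<rho> A B C t x y \<xi> X Y" "closed_loop M F T \<eta> \<gamma> \<rho> A' B' C' t x y \<xi>' X' Y'"
      using closed_loop_exists[OF t] R'.closed_loop_exists[OF t] by blast
    from value_function_of_closed_loop(1)[OF t this(1)] R'.value_function_of_closed_loop(1)[OF t this(2)]
    show ?thesis by eventually_elim simp
  qed
  have at_time: "AE \<omega> in M. A' t \<omega> = A t \<omega> \<and> B' t \<omega> = B t \<omega> \<and> C' t \<omega> = C t \<omega>" if t: "t \<in> {0..<T}" for t
    using same_value[OF t, of 1 0] same_value[OF t, of 0 1] same_value[OF t, of 1 1]
    by eventually_elim (simp add: initial_value_def R'.initial_value_def)
  have "AE \<omega> in M. \<forall>q\<in>\<rat> \<inter> {0..<T}. A' q \<omega> = A q \<omega> \<and> B' q \<omega> = B q \<omega> \<and> C' q \<omega> = C q \<omega>"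
    by (rule AE_ball_countable') (use at_time countable_rat in auto)
  then show same: "AE \<omega> in M. \<forall>t\<in>{0..<T}. A' t \<omega> = A t \<omega> \<and> B' t \<omega> = B t \<omega> \<and> C' t \<omega> = C t \<omega>"
    using coefficients_continuous R'.coefficients_continuous
  proof eventually_elim
    case (elim \<omega>)
    show ?case
    proof
      fix t assume t: "t \<in> {0..<T}"
      define c where "c = (t + T) / 2"
      have c: "c \<in> {0..<T}" "t \<in> {0..<c}" using t by (auto simp: c_def)
      have eq: "f t = g t" if f: "continuous_on {0..c} f" and g: "continuous_on {0..c} g"
        and q: "\<And>q. q \<in> \<rat> \<inter> {0..<T} \<Longrightarrow> f q = g q" for f g :: "real \<Rightarrow> real"
      proof -
        have "f t - g t \<le> 0"
          by (rule continuous_le_from_rationals[OF continuous_on_diff[OF f g] c(2)]) (use q c in auto)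
        moreover have "g t - f t \<le> 0"
          by (rule continuous_le_from_rationals[OF continuous_on_diff[OF g f] c(2)]) (use q c in auto)
        ultimately show ?thesis by simp
      qed
      show "A' t \<omega> = A t \<omega> \<and> B' t \<omega> = B t \<omega> \<and> C' t \<omega> = C t \<omega>"
        using elim(1)[rule_format] elim(2)[rule_format, OF c(1)] elim(3)[rule_format, OF c(1)]
          eq[of "\<lambda>s. A' s \<omega>" "\<lambda>s. A s \<omega>"] eq[of "\<lambda>s. B' s \<omega>" "\<lambda>s. B s \<omega>"] eq[of "\<lambda>s. C' s \<omega>" "\<lambda>s. C s \<omega>"]
        by blast
    qed
  qed
  have zero: "0 \<in> {0..<T}" using T_pos by simp
  have drift_eq: "AE \<omega> in M. (LINT r:{0..b}|lborel. drift_A r \<omega>) = (LINT r:{0..b}|lborel. R'.drift_A r \<omega>)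
      \<and> (LINT r:{0..b}|lborel. drift_B r \<omega>) = (LINT r:{0..b}|lborel. R'.drift_B r \<omega>)
      \<and> (LINT r:{0..b}|lborel. drift_C r \<omega>) = (LINT r:{0..b}|lborel. R'.drift_C r \<omega>)" if b: "b \<in> {0..<T}" for b
    using same
  proof eventually_elim
    case (elim \<omega>)
    have "drift_A r \<omega> = R'.drift_A r \<omega>" "drift_B r \<omega> = R'.drift_B r \<omega>" "drift_C r \<omega> = R'.drift_C r \<omega>" if "r \<in> {0..b}" for r
    proof -
      have "r \<in> {0..<T}" using that b by auto
      then have "A' r \<omega> = A r \<omega>" "B' r \<omega> = B r \<omega>" "C' r \<omega> = C r \<omega>" using elim by blast+
      then show "drift_A r \<omega> = R'.drift_A r \<omega>" "drift_B r \<omega> = R'.drift_B r \<omega>" "drift_C r \<omega> = R'.drift_C r \<omega>"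
        unfolding drift_A_def R'.drift_A_def drift_B_def R'.drift_B_def drift_C_def R'.drift_C_def by simp_all
    qed
    then show ?case by (auto intro!: set_lebesgue_integral_cong)
  qed
  have ZA: "AE (s, \<omega>) in lborel \<Otimes>\<^sub>M M. s \<in> {0..<T} \<longrightarrow> ZA' s \<omega> = ZA s \<omega>"
  proof (rule ito_integrand_unique_before_terminal)
    fix b assume b: "b \<in> {0..<T}"
    have "has_ito_integral M F W 0 b ZA (\<lambda>\<omega>. A b \<omega> - A 0 \<omega> + (LINT r:{0..b}|lborel. drift_A r \<omega>))"
      "has_ito_integral M F W 0 b ZA' (\<lambda>\<omega>. A' b \<omega> - A' 0 \<omega> + (LINT r:{0..b}|lborel. R'.drift_A r \<omega>))"
      by (rule ito_A[OF b] R'.ito_A[OF b])+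
    moreover have "AE \<omega> in M. A' b \<omega> - A' 0 \<omega> + (LINT r:{0..b}|lborel. R'.drift_A r \<omega>) = A b \<omega> - A 0 \<omega> + (LINT r:{0..b}|lborel. drift_A r \<omega>)"
      using same drift_eq[OF b] by eventually_elim (use b zero in simp)
    ultimately show "\<exists>I I'. has_ito_integral M F W 0 b ZA' I \<and> has_ito_integral M F W 0 b ZA I' \<and> (AE \<omega> in M. I \<omega> = I' \<omega>)" by blast
  qed
  have ZB: "AE (s, \<omega>) in lborel \<Otimes>\<^sub>M M. s \<in> {0..<T} \<longrightarrow> ZB' s \<omega> = ZB s \<omega>"
  proof (rule ito_integrand_unique_before_terminal)
    fix b assume b: "b \<in> {0..<T}"
    have "has_ito_integral M F W 0 b ZB (\<lambda>\<omega>. B b \<omega> - B 0 \<omega> + (LINT r:{0..b}|lborel. drift_B r \<omega>))"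
      "has_ito_integral M F W 0 b ZB' (\<lambda>\<omega>. B' b \<omega> - B' 0 \<omega> + (LINT r:{0..b}|lborel. R'.drift_B r \<omega>))"
      by (rule ito_B[OF b] R'.ito_B[OF b])+
    moreover have "AE \<omega> in M. B' b \<omega> - B' 0 \<omega> + (LINT r:{0..b}|lborel. R'.drift_B r \<omega>) = B b \<omega> - B 0 \<omega> + (LINT r:{0..b}|lborel. drift_B r \<omega>)"
      using same drift_eq[OF b] by eventually_elim (use b zero in simp)
    ultimately show "\<exists>I I'. has_ito_integral M F W 0 b ZB' I \<and> has_ito_integral M F W 0 b ZB I' \<and> (AE \<omega> in M. I \<omega> = I' \<omega>)" by blast
  qed
  have ZC: "AE (s, \<omega>) in lborel \<Otimes>\<^sub>M M. s \<in> {0..<T} \<longrightarrow> ZC' s \<omega> = ZC s \<omega>"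
  proof (rule ito_integrand_unique_before_terminal)
    fix b assume b: "b \<in> {0..<T}"
    have "has_ito_integral M F W 0 b ZC (\<lambda>\<omega>. C b \<omega> - C 0 \<omega> + (LINT r:{0..b}|lborel. drift_C r \<omega>))"
      "has_ito_integral M F W 0 b ZC' (\<lambda>\<omega>. C' b \<omega> - C' 0 \<omega> + (LINT r:{0..b}|lborel. R'.drift_C r \<omega>))"
      by (rule ito_C[OF b] R'.ito_C[OF b])+
    moreover have "AE \<omega> in M. C' b \<omega> - C' 0 \<omega> + (LINT r:{0..b}|lborel. R'.drift_C r \<omega>) = C b \<omega> - C 0 \<omega> + (LINT r:{0..b}|lborel. drift_C r \<omega>)"
      using same drift_eq[OF b] by eventually_elim (use b zero in simp)
    ultimately show "\<exists>I I'. has_ito_integral M F W 0 b ZC' I \<and> has_ito_integral M F W 0 b ZC I' \<and> (AE \<omega> in M. I \<omega> = I' \<omega>)" by blast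
  qed
  show "AE (t, \<omega>) in lborel \<Otimes>\<^sub>M M. t \<in> {0..<T} \<longrightarrow> ZA' t \<omega> = ZA t \<omega> \<and> ZB' t \<omega> = ZB t \<omega> \<and> ZC' t \<omega> = ZC t \<omega>"
    using ZA ZB ZC by eventually_elim auto
qed

end

theorem theorem2p6:
  fixes M :: "'a measure"
    and F :: "real \<Rightarrow> 'a measure"
    and W :: "real \<Rightarrow> 'a \<Rightarrow> real ^ 'm"
    and T \<eta> \<gamma> :: real
    and \<rho> lam A B C :: "real \<Rightarrow> 'a \<Rightarrow> real"
    and ZA ZB ZC :: "real \<Rightarrow> 'a \<Rightarrow> real ^ 'm"
  assumes "T > 0"
    and "prob_space M" and "complete_measure M"
    and "standard_brownian_motion M T W"
    and "F = augmented_filtration M W" and "sets M = sets (F T)"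
    and "\<eta> > 0" and "\<gamma> \<ge> 0"
    and "Linf_prog M F 0 T {0..} \<rho>" and "Linf_prog M F 0 T {0..} lam"
    and "bsde_solution M F W T \<eta> \<gamma> \<rho> lam A B C ZA ZB ZC"
    and "singular_terminal_condition M T A B C"
  shows
    "(\<forall>t\<in>{0..<T}. \<forall>x y. AE \<omega> in M.
        value_function M F T \<eta> \<gamma> \<rho> lam t x y \<omega>
          = ereal (1/2 * A t \<omega> * x\<^sup>2 + B t \<omega> * x * y + 1/2 * C t \<omega> * y\<^sup>2))
     \<and> (\<forall>t\<in>{0..<T}. \<forall>x y.
        (\<exists>\<xi> X Y. closed_loop M F T \<eta> \<gamma> \<rho> A B C t x y \<xi> X Y) \<and>
        (\<forall>\<xi> X Y. closed_loop M F T \<eta> \<gamma> \<rho> A B C t x y \<xi> X Y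
           \<longrightarrow> optimal_control M F T \<eta> \<gamma> \<rho> lam t x y \<xi>))
     \<and> (\<forall>A' B' C' ZA' ZB' ZC'.
        bsde_solution M F W T \<eta> \<gamma> \<rho> lam A' B' C' ZA' ZB' ZC' \<and>
        singular_terminal_condition M T A' B' C' \<longrightarrow>
        (AE \<omega> in M. \<forall>t\<in>{0..<T}. A' t \<omega> = A t \<omega> \<and> B' t \<omega> = B t \<omega> \<and> C' t \<omega> = C t \<omega>) \<and>
        (AE (t, \<omega>) in lborel \<Otimes>\<^sub>M M. t \<in> {0..<T} \<longrightarrow>
           ZA' t \<omega> = ZA t \<omega> \<and> ZB' t \<omega> = ZB t \<omega> \<and> ZC' t \<omega> = ZC t \<omega>))"
proof -
  interpret prob_space M by fact
  interpret riccati_solution M F W T \<eta> \<gamma> \<rho> lam A B C ZA ZB ZC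
    using assms by unfold_locales auto
  have V: "1/2 * A t \<omega> * x\<^sup>2 + B t \<omega> * x * y + 1/2 * C t \<omega> * y\<^sup>2 = initial_value t x y \<omega>" for t x y \<omega>
    by (simp add: initial_value_def)
  show ?thesis
    unfolding V
  proof (intro conjI ballI allI impI; (elim conjE)?)
    fix t x y assume t: "t \<in> {0..<T}"
    obtain \<xi> X Y where cl: "closed_loop M F T \<eta> \<gamma> \<rho> A B C t x y \<xi> X Y"
      using closed_loop_exists[OF t] by blast
    then show "\<exists>\<xi> X Y. closed_loop M F T \<eta> \<gamma> \<rho> A B C t x y \<xi> X Y" by blast
    show "AE \<omega> in M. value_function M F T \<eta> \<gamma> \<rho> lam t x y \<omega> = ereal (initial_value t x y \<omega>)"
      by (rule value_function_of_closed_loop(1)[OF t cl])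
  next
    fix t x y \<xi> X Y assume "t \<in> {0..<T}" "closed_loop M F T \<eta> \<gamma> \<rho> A B C t x y \<xi> X Y"
    then show "optimal_control M F T \<eta> \<gamma> \<rho> lam t x y \<xi>" by (rule value_function_of_closed_loop(2))
  next
    fix A' B' C' ZA' ZB' ZC'
    assume "bsde_solution M F W T \<eta> \<gamma> \<rho> lam A' B' C' ZA' ZB' ZC'" "singular_terminal_condition M T A' B' C'"
    then have "riccati_solution M F W T \<eta> \<gamma> \<rho> lam A' B' C' ZA' ZB' ZC'"
      by unfold_locales
    note u = riccati_solution_unique[OF this]
    show "AE \<omega> in M. \<forall>t\<in>{0..<T}. A' t \<omega> = A t \<omega> \<and> B' t \<omega> = B t \<omega> \<and> C' t \<omega> = C t \<omega>" by (rule u(1))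
    show "AE (t, \<omega>) in lborel \<Otimes>\<^sub>M M. t \<in> {0..<T} \<longrightarrow>
        ZA' t \<omega> = ZA t \<omega> \<and> ZB' t \<omega> = ZB t \<omega> \<and> ZC' t \<omega> = ZC t \<omega>" by (rule u(2))
  qed
qed

end
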